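(* Suppose that $\tilde{\mathfrak g}$ is basic classical and $\ell\ge1$. Let $\tilde{\mathfrak b}$ be a Borel subalgebra of $\tilde{\mathfrak g}$ with Cartan subalgebra $\mathfrak h$, and let $L\in\tilde{\mathcal O}_\ell$ be a simple $\tilde{\mathfrak g}_\ell$-module with $\tilde{\mathfrak b}_\ell$-highest weight vector $v_\lambda\in L$ of $\tilde{\mathfrak b}_\ell$-highest weight $\lambda=(\lambda^{(0)},\lambda^{(1)},\dots,\lambda^{(\ell)})\in\mathfrak h_\ell^*$. Let $\alpha$ be an isotropic odd simple root (of the positive system of $\tilde{\mathfrak b}$). Then: (i) Suppose that $\langle\lambda^{(k)},\alpha\rangle\neq0$ and $\langle\lambda^{(k+1)},\alpha\rangle=\cdots=\langle\lambda^{(\ell)},\alpha\rangle=0$ for some $0\le k\le\ell$. Then $f_\alpha^{(0)}f_\alpha^{(1)}\cdots f_\alpha^{(k)}v_\lambda$ is a $\tilde{\mathfrak b}(\alpha)_\ell$-highest weight vector of $L$. (ii) Suppose that $\langle\lambda^{(k)},\alpha\rangle=0$ for all $0\le k\le\ell$. Then $v_\lambda$ is a $\tilde{\mathfrak b}(\alpha)_\ell$-highest weight vector of $L$.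
   Context: Everything is over $\mathbb C$. Basic classical means one of $\mathfrak{gl}(m|n)$, $\mathfrak{sl}(m|n)$, $\mathfrak{osp}(m|2n)$, $D(2,1;\alpha)$, $G(3)$, $F(4)$, with a fixed even non-degenerate invariant supersymmetric bilinear form, inducing a non-degenerate form $\langle\cdot,\cdot\rangle$ on $\mathfrak h^*$, $\mathfrak h$ a Cartan subalgebra of $\tilde{\mathfrak g}_{\bar0}$. $\tilde{\mathfrak g}_\ell=\tilde{\mathfrak g}\otimes\mathbb C[\theta]/(\theta^{\ell+1})$, $\theta$ even, $[x\otimes\theta^i,y\otimes\theta^j]=[x,y]\otimes\theta^{i+j}$; $x^{(i)}:=x\otimes\theta^i$; for a subspace $\mathfrak s$, $\mathfrak s_\ell=\mathfrak s\otimes\mathbb C[\theta]/(\theta^{\ell+1})$. A Borel subalgebra $\tilde{\mathfrak b}=\mathfrak h\oplus\tilde{\mathfrak n}$ comes from a triangular decomposition: there is $H\in\mathfrak h$ with $\mathrm{Re}\,\beta(H)\ne0$ for all roots $\beta$, and $\tilde{\mathfrak n}$ is the sum of root spaces with $\mathrm{Re}\,\beta(H)>0$; its roots form the positive system $\Phi^+$. For an isotropic odd simple root $\alpha\in\Phi^+$, $\tilde{\mathfrak b}(\alpha)$ is the Borel subalgebra (containing $\mathfrak h$) with positive system $(\Phi^+\setminus\{\alpha\})\cup\{-\alpha\}$. Choose non-zero root vectors $e_\alpha\in\tilde{\mathfrak g}^\alpha$, $f_\alpha\in\tilde{\mathfrak g}^{-\alpha}$ such that $h_\alpha:=[e_\alpha,f_\alpha]$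 satisfies $\nu(h_\alpha)=\langle\nu,\alpha\rangle$ for $\nu\in\mathfrak h^*$. $\tilde{\mathcal O}_\ell$ is the category of finitely generated $\tilde{\mathfrak g}_\ell$-modules on which $\mathfrak h$ acts semisimply and $\tilde{\mathfrak b}_\ell$ acts locally finitely. A $\tilde{\mathfrak b}_\ell$-highest weight vector of weight $\lambda\in\mathfrak h_\ell^*$ is a non-zero vector $v$ with $\tilde{\mathfrak n}_\ell v=0$ and $hv=\lambda(h)v$ for $h\in\mathfrak h_\ell$; similarly for $\tilde{\mathfrak b}(\alpha)_\ell$. $\lambda^{(i)}\in\mathfrak h^*$ is given by $\lambda^{(i)}(h)=\lambda(h\otimes\theta^i)$. *)

theory Defs
  imports "HOL-Analysis.Analysis" "HOL-Library.Function_Algebras"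
begin

section \<open>Complex superspaces, Lie superalgebras, modules\<close>

text \<open>Parities are booleans, \<open>True\<close> being odd, so that addition of parities is \<open>\<noteq>\<close>.
  A superspace is the sum of its two homogeneous parts, which are subspaces of an ambient
  complex vector space on the whole type.\<close>

record 'a superspace =
  sscale :: "complex \<Rightarrow> 'a \<Rightarrow> 'a"
  part :: "bool \<Rightarrow> 'a set"

record 'a superalgebra = "'a superspace" +
  brk :: "'a \<Rightarrow> 'a \<Rightarrow> 'a"

record ('a, 'b) supermodule = "'b superspace" +
  act :: "'a \<Rightarrow> 'b \<Rightarrow> 'b"

definition space_of :: "('a::ab_group_add, 'z) superspace_scheme \<Rightarrow> 'a set" where
  "space_of V = {x + y | x y. x \<in> part V False \<and> y \<in> part V True}"

definition subspace_in :: "('a::ab_group_add, 'z) superspace_scheme \<Rightarrow> 'a set \<Rightarrow> bool" where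
  "subspace_in V W \<longleftrightarrow> module.subspace (sscale V) W \<and> W \<subseteq> space_of V"

definition span_in :: "('a::ab_group_add, 'z) superspace_scheme \<Rightarrow> 'a set \<Rightarrow> 'a set" where
  "span_in V X = module.span (sscale V) X"

definition is_superspace :: "('a::ab_group_add, 'z) superspace_scheme \<Rightarrow> bool" where
  "is_superspace V \<longleftrightarrow> vector_space (sscale V) \<and>
     (\<forall>p. module.subspace (sscale V) (part V p)) \<and> part V False \<inter> part V True = {0}"

text \<open>The Koszul sign.\<close>

definition ksign :: "bool \<Rightarrow> bool \<Rightarrow> complex" where
  "ksign p q = (if p \<and> q then - 1 else 1)"

definition lie_superalgebra :: "('a::ab_group_add) superalgebra \<Rightarrow> bool" where
  "lie_superalgebra G \<longleftrightarrow> is_superspace G \<and>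
     (\<forall>x\<in>space_of G. \<forall>y\<in>space_of G. \<forall>z\<in>space_of G.
        brk G (x + y) z = brk G x z + brk G y z \<and> brk G z (x + y) = brk G z x + brk G z y) \<and>
     (\<forall>c. \<forall>x\<in>space_of G. \<forall>y\<in>space_of G.
        brk G (sscale G c x) y = sscale G c (brk G x y) \<and>
        brk G x (sscale G c y) = sscale G c (brk G x y)) \<and>
     (\<forall>p q. \<forall>x\<in>part G p. \<forall>y\<in>part G q. brk G x y \<in> part G (p \<noteq> q)) \<and>
     (\<forall>p q. \<forall>x\<in>part G p. \<forall>y\<in>part G q. brk G x y = sscale G (- ksign p q) (brk G y x)) \<and>
     (\<forall>p q. \<forall>x\<in>part G p. \<forall>y\<in>part G q. \<forall>z\<in>space_of G.
        brk G x (brk G y z) = brk G (brk G x y) z + sscale G (ksign p q) (brk G y (brk G x z)))"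

definition is_module :: "('a::ab_group_add) superalgebra \<Rightarrow> ('a, 'b::ab_group_add) supermodule \<Rightarrow> bool" where
  "is_module G M \<longleftrightarrow> is_superspace M \<and>
     (\<forall>x\<in>space_of G. \<forall>y\<in>space_of G. \<forall>v\<in>space_of M. act M (x + y) v = act M x v + act M y v) \<and>
     (\<forall>x\<in>space_of G. \<forall>v\<in>space_of M. \<forall>w\<in>space_of M. act M x (v + w) = act M x v + act M x w) \<and>
     (\<forall>c. \<forall>x\<in>space_of G. \<forall>v\<in>space_of M.
        act M (sscale G c x) v = sscale M c (act M x v) \<and>
        act M x (sscale M c v) = sscale M c (act M x v)) \<and>
     (\<forall>p q. \<forall>x\<in>part G p. \<forall>v\<in>part M q. act M x v \<in> part M (p \<noteq> q)) \<and>
     (\<forall>p q. \<forall>x\<in>part G p. \<forall>y\<in>part G q. \<forall>v\<in>space_of M.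
        act M (brk G x y) v = act M x (act M y v) - sscale M (ksign p q) (act M y (act M x v)))"

definition submodule_of ::
  "('a::ab_group_add) superalgebra \<Rightarrow> ('a, 'b::ab_group_add) supermodule \<Rightarrow> 'b set \<Rightarrow> bool" where
  "submodule_of G M W \<longleftrightarrow> subspace_in M W \<and>
     (\<forall>v\<in>part M False. \<forall>w\<in>part M True. v + w \<in> W \<longrightarrow> v \<in> W \<and> w \<in> W) \<and>
     (\<forall>x\<in>space_of G. \<forall>w\<in>W. act M x w \<in> W)"

definition simple_module ::
  "('a::ab_group_add) superalgebra \<Rightarrow> ('a, 'b::ab_group_add) supermodule \<Rightarrow> bool" where
  "simple_module G M \<longleftrightarrow> is_module G M \<and> space_of M \<noteq> {0} \<and>
     (\<forall>W. submodule_of G M W \<longrightarrow> W = {0} \<or> W = space_of M)"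

definition finitely_generated ::
  "('a::ab_group_add) superalgebra \<Rightarrow> ('a, 'b::ab_group_add) supermodule \<Rightarrow> bool" where
  "finitely_generated G M \<longleftrightarrow> (\<exists>X. finite X \<and> X \<subseteq> space_of M \<and>
     (\<forall>W. submodule_of G M W \<and> X \<subseteq> W \<longrightarrow> W = space_of M))"

definition superalgebra_iso ::
  "('a::ab_group_add) superalgebra \<Rightarrow> ('b::ab_group_add) superalgebra \<Rightarrow> bool" where
  "superalgebra_iso G K \<longleftrightarrow> (\<exists>\<phi>. bij_betw \<phi> (space_of G) (space_of K) \<and>
     (\<forall>x\<in>space_of G. \<forall>y\<in>space_of G. \<phi> (x + y) = \<phi> x + \<phi> y \<and> \<phi> (brk G x y) = brk K (\<phi> x) (\<phi> y)) \<and>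
     (\<forall>c. \<forall>x\<in>space_of G. \<phi> (sscale G c x) = sscale K c (\<phi> x)) \<and>
     (\<forall>p. \<phi> ` part G p = part K p))"


section \<open>The matrix families\<close>

text \<open>Square matrices of size \<open>N\<close> are functions of two indices vanishing outside \<open>{..<N}\<close>.
  In \<open>gl(m|n)\<close>, indices below \<open>m\<close> are even and the remaining ones odd; the matrix unit at
  \<open>(i, j)\<close> has parity \<open>|i| + |j|\<close>, and the bracket is the supercommutator, extended
  bilinearly to inhomogeneous matrices.\<close>

definition gl :: "nat \<Rightarrow> nat \<Rightarrow> (nat \<Rightarrow> nat \<Rightarrow> complex) superalgebra" where
  "gl m n = \<lparr>
     sscale = (\<lambda>c X i j. c * X i j),
     part = (\<lambda>p. {X. \<forall>i j. X i j \<noteq> 0 \<longrightarrow> i < m + n \<and> j < m + n \<and> ((i \<ge> m) \<noteq> (j \<ge> m)) = p}),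
     brk = (\<lambda>X Y i j. \<Sum>k<m+n. X i k * Y k j
              - ksign ((i \<ge> m) \<noteq> (k \<ge> m)) ((k \<ge> m) \<noteq> (j \<ge> m)) * (Y i k * X k j)) \<rparr>"

definition supertrace :: "nat \<Rightarrow> nat \<Rightarrow> (nat \<Rightarrow> nat \<Rightarrow> complex) \<Rightarrow> complex" where
  "supertrace m n X = (\<Sum>i<m. X i i) - (\<Sum>i=m..<m+n. X i i)"

definition sl :: "nat \<Rightarrow> nat \<Rightarrow> (nat \<Rightarrow> nat \<Rightarrow> complex) superalgebra" where
  "sl m n = (gl m n)\<lparr>part := (\<lambda>p. {X \<in> part (gl m n) p. supertrace m n X = 0})\<rparr>"

text \<open>Gram matrix of an even supersymmetric form on the superspace of dimension \<open>m|2n\<close>: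
  the identity on the even part and the standard symplectic matrix on the odd part.\<close>

definition osp_gram :: "nat \<Rightarrow> nat \<Rightarrow> nat \<Rightarrow> nat \<Rightarrow> complex" where
  "osp_gram m n i j =
     (if i < m \<and> j < m then (if i = j then 1 else 0)
      else if i \<ge> m \<and> j = i + n then 1
      else if j \<ge> m \<and> i = j + n then - 1
      else 0)"

text \<open>\<open>osp m n\<close> is \<open>osp(m|2n)\<close>: for the form \<open>b\<close> above, a matrix \<open>X\<close> of parity \<open>p\<close>
  satisfies \<open>b (X u) v + (-1) ^ (p |u|) * b u (X v) = 0\<close>, written out on basis vectors.\<close>

definition osp :: "nat \<Rightarrow> nat \<Rightarrow> (nat \<Rightarrow> nat \<Rightarrow> complex) superalgebra" where
  "osp m n = (gl m (2 * n))\<lparr>part := (\<lambda>p. {X \<in> part (gl m (2 * n)) p.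
     \<forall>i<m+2*n. \<forall>j<m+2*n.
       (\<Sum>k<m+2*n. X k i * osp_gram m n k j)
       + ksign p (i \<ge> m) * (\<Sum>k<m+2*n. osp_gram m n i k * X k j) = 0})\<rparr>"


section \<open>The exceptional families\<close>

definition mscale :: "complex \<Rightarrow> complex^'n^'m \<Rightarrow> complex^'n^'m" where
  "mscale c A = (\<chi> i j. c * A $ i $ j)"

definition comm :: "complex^'n^'n \<Rightarrow> complex^'n^'n \<Rightarrow> complex^'n^'n" where
  "comm A B = A ** B - B ** A"

definition sl2 :: "(complex^2^2) set" where
  "sl2 = {A. trace A = 0}"

text \<open>The invariant symplectic form \<open>\<psi>\<close> on the natural \<open>sl2\<close>-module, and the symmetric
  invariant pairing with values in \<open>sl2\<close>,
  \<open>sl2_pair x y z = \<psi> y z \<cdot> x + \<psi> x z \<cdot> y\<close>, as a matrix acting on \<open>z\<close>.\<close>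

definition eps :: "2 \<Rightarrow> 2 \<Rightarrow> complex" where
  "eps i j = (if i = 0 \<and> j = 1 then 1 else if i = 1 \<and> j = 0 then - 1 else 0)"

definition sl2_pair :: "complex^2 \<Rightarrow> complex^2 \<Rightarrow> complex^2^2" where
  "sl2_pair x y = (\<chi> a b. \<Sum>c\<in>UNIV. (x $ a * y $ c + y $ a * x $ c) * eps c b)"

subsection \<open>\<open>D(2,1;\<alpha>)\<close>\<close>

text \<open>The even part is \<open>sl2 \<times> sl2 \<times> sl2\<close> and the odd part is the tensor product of the three
  natural modules (an element is given by its coordinates \<open>T $ i $ j $ k\<close>).  The bracket of two odd
  elements is determined by
  \<open>[u1\<otimes>u2\<otimes>u3, w1\<otimes>w2\<otimes>w3] = (s1 \<psi>(u2,w2) \<psi>(u3,w3) sl2_pair u1 w1, s2 \<dots>, s3 \<dots>)\<close>;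
  the Jacobi identity amounts to \<open>s1 + s2 + s3 = 0\<close>, and
  \<open>D(2,1;\<alpha>)\<close> is the case \<open>(s1, s2, s3) = (1, \<alpha>, - 1 - \<alpha>)\<close>.\<close>

type_synonym d21 = "(complex^2^2) \<times> (complex^2^2) \<times> (complex^2^2) \<times> (complex^2^2^2)"

definition tensor_act ::
  "complex^2^2 \<Rightarrow> complex^2^2 \<Rightarrow> complex^2^2 \<Rightarrow> complex^2^2^2 \<Rightarrow> complex^2^2^2" where
  "tensor_act A B C T = (\<chi> i j k. \<Sum>a\<in>UNIV.
     A $ i $ a * T $ a $ j $ k + B $ j $ a * T $ i $ a $ k + C $ k $ a * T $ i $ j $ a)"

definition tensor_pair :: "(2 \<Rightarrow> 2 \<Rightarrow> 2 \<Rightarrow> complex) \<Rightarrow> (2 \<Rightarrow> 2 \<Rightarrow> 2 \<Rightarrow> complex) \<Rightarrow> complex^2^2" where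
  "tensor_pair S T = (\<chi> a b. \<Sum>c\<in>UNIV. \<Sum>j\<in>UNIV. \<Sum>j'\<in>UNIV. \<Sum>k\<in>UNIV. \<Sum>k'\<in>UNIV.
     (S a j k * T c j' k' + T a j' k' * S c j k) * eps c b * eps j j' * eps k k')"

definition D21 :: "complex \<Rightarrow> d21 superalgebra" where
  "D21 \<alpha> = \<lparr>
     sscale = (\<lambda>c (A, B, C, T). (mscale c A, mscale c B, mscale c C, \<chi> i j k. c * T $ i $ j $ k)),
     part = (\<lambda>p. if p then {(A, B, C, T). A = 0 \<and> B = 0 \<and> C = 0}
                  else {(A, B, C, T). A \<in> sl2 \<and> B \<in> sl2 \<and> C \<in> sl2 \<and> T = 0}),
     brk = (\<lambda>(A, B, C, S) (A', B', C', T).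
       (comm A A' + tensor_pair (\<lambda>i j k. S $ i $ j $ k) (\<lambda>i j k. T $ i $ j $ k),
        comm B B' + mscale \<alpha> (tensor_pair (\<lambda>i j k. S $ j $ i $ k) (\<lambda>i j k. T $ j $ i $ k)),
        comm C C' + mscale (- 1 - \<alpha>) (tensor_pair (\<lambda>i j k. S $ j $ k $ i) (\<lambda>i j k. T $ j $ k $ i)),
        tensor_act A B C T - tensor_act A' B' C' S)) \<rparr>"

subsection \<open>\<open>G(3)\<close> and \<open>F(4)\<close>\<close>

text \<open>The cross product on the imaginary octonions, with basis indexed by the integers
  modulo 7 and \<open>e_i \<times> e_(i+d) = e_(i+3d)\<close> for the non-zero squares \<open>d = 1, 2, 4\<close>.\<close>

definition oct_cross :: "complex^7 \<Rightarrow> complex^7 \<Rightarrow> complex^7" where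
  "oct_cross x y = (\<chi> k. \<Sum>d\<in>{1, 2, 4}.
     x $ (k - 3 * d) * y $ (k - 2 * d) - y $ (k - 3 * d) * x $ (k - 2 * d))"

definition g2 :: "(complex^7^7) set" where
  "g2 = {M. \<forall>x y. M *v oct_cross x y = oct_cross (M *v x) y + oct_cross x (M *v y)}"

text \<open>The derivation \<open>w \<mapsto> 3 ((u \<cdot> w) v - (v \<cdot> w) u) - (u \<times> v) \<times> w\<close>, with \<open>\<cdot>\<close> the
  bilinear dot product: up to a scalar this is the unique \<open>g2\<close>-equivariant skew pairing of two
  imaginary octonions with values in \<open>g2\<close>.\<close>

definition g2_pair :: "complex^7 \<Rightarrow> complex^7 \<Rightarrow> complex^7^7" where
  "g2_pair u v = (\<chi> i j. 3 * (u $ j * v $ i - v $ j * u $ i)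
                        - oct_cross (oct_cross u v) (axis j 1) $ i)"

text \<open>In both algebras below the odd part is \<open>W \<otimes> C^2\<close>, an element being given by its
  coordinates \<open>S $ i $ a\<close>, with the even part acting by \<open>X\<close> on \<open>W\<close> and by \<open>A\<close> on \<open>C^2\<close>.
  The relative coefficients of the two components of the bracket of odd elements are forced, up to
  a common rescaling, by the Jacobi identity.\<close>

definition bi_act :: "complex^'n^'n \<Rightarrow> complex^2^2 \<Rightarrow> complex^2^'n \<Rightarrow> complex^2^'n" where
  "bi_act X A S = X ** S + S ** transpose A"

definition G3 :: "((complex^7^7) \<times> (complex^2^2) \<times> (complex^2^7)) superalgebra" where
  "G3 = \<lparr>
     sscale = (\<lambda>c (M, A, S). (mscale c M, mscale c A, mscale c S)),
     part = (\<lambda>p. if p then {(M, A, S). M = 0 \<and> A = 0}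
                  else {(M, A, S). M \<in> g2 \<and> A \<in> sl2 \<and> S = 0}),
     brk = (\<lambda>(M, A, S) (N, B, T).
       (comm M N + (\<Sum>a\<in>UNIV. \<Sum>b\<in>UNIV. mscale (eps a b) (g2_pair (column a S) (column b T))),
        comm A B + mscale (- 2) (\<Sum>i\<in>UNIV. sl2_pair (S $ i) (T $ i)),
        bi_act M A T - bi_act N B S)) \<rparr>"

definition so7 :: "(complex^7^7) set" where
  "so7 = {M. transpose M = - M}"

text \<open>Left multiplication by the \<open>i\<close>-th imaginary unit on the octonions; the index \<open>None\<close>
  stands for the unit octonion.  These matrices square to \<open>- 1\<close> and anticommute, and so
  make the octonions the spin module of \<open>so7\<close>.\<close>

definition oct_left :: "7 \<Rightarrow> complex^(7 option)^(7 option)" where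
  "oct_left i = (\<chi> p q. case q of
       None \<Rightarrow> (if p = Some i then 1 else 0)
     | Some j \<Rightarrow> (case p of None \<Rightarrow> (if i = j then - 1 else 0)
                 | Some k \<Rightarrow> oct_cross (axis i 1) (axis j 1) $ k))"

definition spin :: "complex^7^7 \<Rightarrow> complex^(7 option)^(7 option)" where
  "spin M = (\<Sum>i\<in>UNIV. \<Sum>j\<in>UNIV. mscale (- (M $ i $ j) / 4) (oct_left i ** oct_left j))"

definition spin_pair :: "complex^(7 option) \<Rightarrow> complex^(7 option) \<Rightarrow> complex^7^7" where
  "spin_pair s t = (\<chi> i j. if i = j then 0
                           else \<Sum>p\<in>UNIV. s $ p * ((oct_left i ** oct_left j) *v t) $ p)"

definition F4 :: "((complex^7^7) \<times> (complex^2^2) \<times> (complex^2^(7 option))) superalgebra" where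
  "F4 = \<lparr>
     sscale = (\<lambda>c (M, A, S). (mscale c M, mscale c A, mscale c S)),
     part = (\<lambda>p. if p then {(M, A, S). M = 0 \<and> A = 0}
                  else {(M, A, S). M \<in> so7 \<and> A \<in> sl2 \<and> S = 0}),
     brk = (\<lambda>(M, A, S) (N, B, T).
       (comm M N + mscale 2 (\<Sum>a\<in>UNIV. \<Sum>b\<in>UNIV.
           mscale (eps a b) (spin_pair (column a S) (column b T))),
        comm A B + mscale (- 3) (\<Sum>p\<in>UNIV. sl2_pair (S $ p) (T $ p)),
        bi_act (spin M) A T - bi_act (spin N) B S)) \<rparr>"

text \<open>\<open>sl(n|n)\<close> is not excluded here: it carries no non-degenerate invariant form.\<close>

definition basic_classical :: "('a::ab_group_add) superalgebra \<Rightarrow> bool" where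
  "basic_classical G \<longleftrightarrow>
     (\<exists>m n. superalgebra_iso G (gl m n)) \<or>
     (\<exists>m n. superalgebra_iso G (sl m n)) \<or>
     (\<exists>m n. superalgebra_iso G (osp m n)) \<or>
     (\<exists>\<alpha>. \<alpha> \<noteq> 0 \<and> \<alpha> \<noteq> - 1 \<and> superalgebra_iso G (D21 \<alpha>)) \<or>
     superalgebra_iso G G3 \<or>
     superalgebra_iso G F4"


section \<open>Invariant forms, Cartan subalgebras, roots\<close>

definition invariant_form ::
  "('a::ab_group_add) superalgebra \<Rightarrow> ('a \<Rightarrow> 'a \<Rightarrow> complex) \<Rightarrow> bool" where
  "invariant_form G B \<longleftrightarrow>
     (\<forall>x\<in>space_of G. \<forall>y\<in>space_of G. \<forall>z\<in>space_of G.
        B (x + y) z = B x z + B y z \<and> B z (x + y) = B z x + B z y) \<and>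
     (\<forall>c. \<forall>x\<in>space_of G. \<forall>y\<in>space_of G.
        B (sscale G c x) y = c * B x y \<and> B x (sscale G c y) = c * B x y) \<and>
     (\<forall>x\<in>part G False. \<forall>y\<in>part G True. B x y = 0) \<and>
     (\<forall>p q. \<forall>x\<in>part G p. \<forall>y\<in>part G q. B x y = ksign p q * B y x) \<and>
     (\<forall>x\<in>space_of G. \<forall>y\<in>space_of G. \<forall>z\<in>space_of G. B (brk G x y) z = B x (brk G y z))"

definition nondegenerate_form ::
  "('a::ab_group_add) superalgebra \<Rightarrow> ('a \<Rightarrow> 'a \<Rightarrow> complex) \<Rightarrow> bool" where
  "nondegenerate_form G B \<longleftrightarrow>
     (\<forall>x\<in>space_of G. (\<forall>y\<in>space_of G. B x y = 0) \<longrightarrow> x = 0)"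

fun lower_central :: "('a::ab_group_add) superalgebra \<Rightarrow> 'a set \<Rightarrow> nat \<Rightarrow> 'a set" where
  "lower_central G \<hh> 0 = \<hh>"
| "lower_central G \<hh> (Suc n) = span_in G {brk G x y | x y. x \<in> \<hh> \<and> y \<in> lower_central G \<hh> n}"

text \<open>A Cartan subalgebra of the even part: a nilpotent, self-normalizing subalgebra.\<close>

definition cartan_subalgebra :: "('a::ab_group_add) superalgebra \<Rightarrow> 'a set \<Rightarrow> bool" where
  "cartan_subalgebra G \<hh> \<longleftrightarrow>
     subspace_in G \<hh> \<and> \<hh> \<subseteq> part G False \<and> (\<forall>x\<in>\<hh>. \<forall>y\<in>\<hh>. brk G x y \<in> \<hh>) \<and>
     (\<exists>n. lower_central G \<hh> n = {0}) \<and>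
     (\<forall>x\<in>part G False. (\<forall>y\<in>\<hh>. brk G x y \<in> \<hh>) \<longrightarrow> x \<in> \<hh>)"

text \<open>The dual of a subspace \<open>W\<close>.  Functionals are represented by functions vanishing outside
  \<open>W\<close>, so that equality, sums and negatives of functionals are those of functions.\<close>

definition dual :: "('a::ab_group_add, 'z) superspace_scheme \<Rightarrow> 'a set \<Rightarrow> ('a \<Rightarrow> complex) set" where
  "dual V W = {\<beta>. (\<forall>x\<in>W. \<forall>y\<in>W. \<beta> (x + y) = \<beta> x + \<beta> y) \<and>
                  (\<forall>c. \<forall>x\<in>W. \<beta> (sscale V c x) = c * \<beta> x) \<and> (\<forall>x. x \<notin> W \<longrightarrow> \<beta> x = 0)}"

text \<open>The form on the dual of \<open>\<hh>\<close> induced by the restriction of \<open>B\<close> to \<open>\<hh>\<close>.\<close>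

definition dual_vec :: "('a \<Rightarrow> 'a \<Rightarrow> complex) \<Rightarrow> 'a set \<Rightarrow> ('a \<Rightarrow> complex) \<Rightarrow> 'a" where
  "dual_vec B \<hh> \<mu> = (THE t. t \<in> \<hh> \<and> (\<forall>x\<in>\<hh>. B t x = \<mu> x))"

definition dual_form ::
  "('a \<Rightarrow> 'a \<Rightarrow> complex) \<Rightarrow> 'a set \<Rightarrow> ('a \<Rightarrow> complex) \<Rightarrow> ('a \<Rightarrow> complex) \<Rightarrow> complex" where
  "dual_form B \<hh> \<mu> \<nu> = B (dual_vec B \<hh> \<mu>) (dual_vec B \<hh> \<nu>)"

definition root_space ::
  "('a::ab_group_add) superalgebra \<Rightarrow> 'a set \<Rightarrow> ('a \<Rightarrow> complex) \<Rightarrow> 'a set" where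
  "root_space G \<hh> \<beta> = {x \<in> space_of G. \<forall>h\<in>\<hh>. brk G h x = sscale G (\<beta> h) x}"

definition roots :: "('a::ab_group_add) superalgebra \<Rightarrow> 'a set \<Rightarrow> ('a \<Rightarrow> complex) set" where
  "roots G \<hh> = {\<beta> \<in> dual G \<hh>. \<beta> \<noteq> 0 \<and> root_space G \<hh> \<beta> \<noteq> {0}}"

definition odd_root :: "('a::ab_group_add) superalgebra \<Rightarrow> 'a set \<Rightarrow> ('a \<Rightarrow> complex) \<Rightarrow> bool" where
  "odd_root G \<hh> \<beta> \<longleftrightarrow> \<beta> \<in> roots G \<hh> \<and> root_space G \<hh> \<beta> \<inter> part G True \<noteq> {0}"

definition positive_system ::
  "('a::ab_group_add) superalgebra \<Rightarrow> 'a set \<Rightarrow> ('a \<Rightarrow> complex) set \<Rightarrow> bool" where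
  "positive_system G \<hh> P \<longleftrightarrow> (\<exists>H\<in>\<hh>. (\<forall>\<beta>\<in>roots G \<hh>. Re (\<beta> H) \<noteq> 0) \<and>
     P = {\<beta> \<in> roots G \<hh>. Re (\<beta> H) > 0})"

definition simple_root :: "('a \<Rightarrow> complex) set \<Rightarrow> ('a \<Rightarrow> complex) \<Rightarrow> bool" where
  "simple_root P \<alpha> \<longleftrightarrow> \<alpha> \<in> P \<and> (\<forall>\<beta>\<in>P. \<forall>\<gamma>\<in>P. \<alpha> \<noteq> \<beta> + \<gamma>)"

definition nilradical ::
  "('a::ab_group_add) superalgebra \<Rightarrow> 'a set \<Rightarrow> ('a \<Rightarrow> complex) set \<Rightarrow> 'a set" where
  "nilradical G \<hh> P = span_in G (\<Union>\<beta>\<in>P. root_space G \<hh> \<beta>)"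

definition borel ::
  "('a::ab_group_add) superalgebra \<Rightarrow> 'a set \<Rightarrow> ('a \<Rightarrow> complex) set \<Rightarrow> 'a set" where
  "borel G \<hh> P = {x + y | x y. x \<in> \<hh> \<and> y \<in> nilradical G \<hh> P}"

text \<open>The positive system of the Borel subalgebra obtained by the odd reflection at \<open>\<alpha>\<close>.\<close>

definition odd_reflection :: "('a \<Rightarrow> complex) set \<Rightarrow> ('a \<Rightarrow> complex) \<Rightarrow> ('a \<Rightarrow> complex) set" where
  "odd_reflection P \<alpha> = (P - {\<alpha>}) \<union> {- \<alpha>}"


section \<open>Truncated current superalgebras and their highest weight vectors\<close>

text \<open>An element of \<open>G \<otimes> C[\<theta>]/(\<theta>^(l+1))\<close> is its sequence of coefficients.\<close>

definition current_set :: "nat \<Rightarrow> ('a::ab_group_add) set \<Rightarrow> (nat \<Rightarrow> 'a) set" where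
  "current_set l W = {x. (\<forall>i\<le>l. x i \<in> W) \<and> (\<forall>i>l. x i = 0)}"

definition current :: "nat \<Rightarrow> ('a::ab_group_add) superalgebra \<Rightarrow> (nat \<Rightarrow> 'a) superalgebra" where
  "current l G = \<lparr>
     sscale = (\<lambda>c x i. sscale G c (x i)),
     part = (\<lambda>p. current_set l (part G p)),
     brk = (\<lambda>x y n. if n \<le> l then (\<Sum>i\<le>n. brk G (x i) (y (n - i))) else 0) \<rparr>"

text \<open>The element \<open>x \<otimes> \<theta>^i\<close>.\<close>

definition cur :: "nat \<Rightarrow> 'a::ab_group_add \<Rightarrow> nat \<Rightarrow> (nat \<Rightarrow> 'a)" where
  "cur l x i = (\<lambda>j. if j = i \<and> i \<le> l then x else 0)"

definition weight_component ::
  "nat \<Rightarrow> 'a::ab_group_add set \<Rightarrow> ((nat \<Rightarrow> 'a) \<Rightarrow> complex) \<Rightarrow> nat \<Rightarrow> ('a \<Rightarrow> complex)" where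
  "weight_component l \<hh> \<Lambda> i = (\<lambda>h. if h \<in> \<hh> then \<Lambda> (cur l h i) else 0)"

definition category_O ::
  "('a::ab_group_add) superalgebra \<Rightarrow> 'a set \<Rightarrow> ('a \<Rightarrow> complex) set \<Rightarrow> nat \<Rightarrow>
   (nat \<Rightarrow> 'a, 'b::ab_group_add) supermodule \<Rightarrow> bool" where
  "category_O G \<hh> P l M \<longleftrightarrow>
     is_module (current l G) M \<and> finitely_generated (current l G) M \<and>
     space_of M = span_in M {v \<in> space_of M.
        \<exists>\<mu>\<in>dual G \<hh>. \<forall>h\<in>\<hh>. act M (cur l h 0) v = sscale M (\<mu> h) v} \<and>
     (\<forall>v\<in>space_of M. \<exists>X. finite X \<and> X \<subseteq> space_of M \<and> v \<in> span_in M X \<and>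
        (\<forall>x\<in>current_set l (borel G \<hh> P). \<forall>w\<in>span_in M X. act M x w \<in> span_in M X))"

definition highest_weight_vector ::
  "('a::ab_group_add) superalgebra \<Rightarrow> 'a set \<Rightarrow> ('a \<Rightarrow> complex) set \<Rightarrow> nat \<Rightarrow>
   (nat \<Rightarrow> 'a, 'b::ab_group_add) supermodule \<Rightarrow> ((nat \<Rightarrow> 'a) \<Rightarrow> complex) \<Rightarrow> 'b \<Rightarrow> bool" where
  "highest_weight_vector G \<hh> P l M \<Lambda> v \<longleftrightarrow>
     \<Lambda> \<in> dual (current l G) (current_set l \<hh>) \<and> v \<in> space_of M \<and> v \<noteq> 0 \<and>
     (\<forall>x\<in>current_set l (nilradical G \<hh> P). act M x v = 0) \<and>
     (\<forall>h\<in>current_set l \<hh>. act M h v = sscale M (\<Lambda> h) v)"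

end

theory Submission
  imports Defs "HOL-Computational_Algebra.Fundamental_Theorem_Algebra"
begin

text \<open>On a highest weight vector of weight \<open>\<Lambda>\<close> the odd operators \<open>f\<^sub>\<alpha> \<otimes> \<theta>^i\<close> anticommute, while
  their anticommutator with \<open>e\<^sub>\<alpha> \<otimes> \<theta>^j\<close> is the scalar \<open>\<Lambda>(h\<^sub>\<alpha> \<otimes> \<theta>^(i + j))\<close>; so applying the
  \<open>e\<^sub>\<alpha> \<otimes> \<theta>^j\<close> to the product in the first case recovers a non-zero multiple of the highest weight
  vector, and all further \<open>f\<^sub>\<alpha> \<otimes> \<theta>^i\<close> produce singular vectors of lower weight, which vanish in a
  simple module.  The properties of the root system that this uses are collected in the predicate
  \<open>admissible\<close> and are verified without a classification of the Cartan subalgebras: they follow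
  from the explicit brackets of the matrix and exceptional families.\<close>

section \<open>Diagonalization of operators\<close>

text \<open>\<open>cartan_subalgebra\<close> only says nilpotent and self-normalizing, so the
  diagonalizability of its adjoint action has to be produced before root spaces are of any use. It
  is taken from the module: \<open>\<hh>\<close> acts semisimply on \<open>L\<close>, hence its
  commutators and the Jordan blocks of its adjoint action annihilate \<open>L\<close> in degree 0.
  Apart from the situation of gl(1|1), the annihilator of \<open>L\<close> in degree 0, a graded
  ideal, is either central, and then the adjoint action is diagonalizable, or it contains the odd
  part. In the latter case all root vectors act by zero in every degree, all pairings with \<alpha>
  vanish, and the highest weight vector stays one after the reflection. The Jacobi identity of the
  models is never computed: it is carried over from \<open>G\<close> along the isomorphism, and
  closure properties of the models are read off from it. The orthosymplectic and exceptional
  families share one argument, because their odd part has a symplectic factor \<open>U\<close>: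
  quadratic expressions in weight vectors of \<open>U\<close> supply elements of any toral
  subalgebra by which the weights of \<open>U\<close> can be told apart.\<close>

locale complex_vs = vector_space scale for scale :: "complex \<Rightarrow> 'a::ab_group_add \<Rightarrow> 'a" (infixr \<open>*c\<close> 75)
begin

definition shift :: "('a \<Rightarrow> 'a) \<Rightarrow> complex \<Rightarrow> 'a \<Rightarrow> 'a" where
  "shift T c v = T v - c *c v"

definition shifts :: "('a \<Rightarrow> 'a) \<Rightarrow> complex list \<Rightarrow> 'a \<Rightarrow> 'a" where
  "shifts T cs = foldr (shift T) cs"

text \<open>Linearity is asked on \<open>E\<close> only, because brackets and module actions are
  constrained on \<open>space_of\<close> and arbitrary elsewhere on the type.\<close>

definition linear_op :: "'a set \<Rightarrow> ('a \<Rightarrow> 'a) \<Rightarrow> bool" where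
  "linear_op E T \<longleftrightarrow> subspace E \<and> (\<forall>x\<in>E. T x \<in> E) \<and> (\<forall>x\<in>E. \<forall>y\<in>E. T (x + y) = T x + T y) \<and>
     (\<forall>c. \<forall>x\<in>E. T (c *c x) = c *c T x)"

lemma shifts_Nil [simp]: "shifts T [] v = v"
  and shifts_Cons [simp]: "shifts T (c # cs) v = shift T c (shifts T cs v)"
  by (simp_all add: shifts_def)

lemma shifts_append: "shifts T (cs @ ds) v = shifts T cs (shifts T ds v)"
  by (induction cs) auto

lemma linear_op_0: "linear_op E T \<Longrightarrow> T 0 = 0"
  unfolding linear_op_def by (metis scale_zero_left subspace_0)

lemma linear_op_diff:
  assumes "linear_op E T" "x \<in> E" "y \<in> E" shows "T (x - y) = T x - T y"
proof -
  have "T x = T ((x - y) + y)" by simp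
  also have "\<dots> = T (x - y) + T y"
    using assms unfolding linear_op_def by (metis subspace_diff)
  finally show ?thesis by simp
qed

lemma linear_op_shift: "linear_op E T \<Longrightarrow> linear_op E (shift T c)"
  unfolding linear_op_def shift_def
  by (auto simp: algebra_simps subspace_add subspace_scale intro!: subspace_diff)

lemma linear_op_shifts: "linear_op E T \<Longrightarrow> linear_op E (shifts T cs)"
proof (induction cs)
  case Nil
  then show ?case by (simp add: linear_op_def)
next
  case (Cons c cs)
  from linear_op_shift [OF Cons.prems, of c] Cons.IH [OF Cons.prems]
  show ?case unfolding linear_op_def by simp
qed

lemma shift_commute:
  assumes "linear_op E T" "v \<in> E"
  shows "shift T c (shift T d v) = shift T d (shift T c v)"
proof -
  have *: "T v \<in> E" "\<And>c. c *c v \<in> E" "\<And>c. T (c *c v) = c *c T v"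
    using assms by (auto simp: linear_op_def subspace_scale)
  show ?thesis
    unfolding shift_def linear_op_diff [OF assms(1) *(1,2)] *(3) by (simp add: algebra_simps)
qed

lemma shift_shifts_commute:
  assumes "linear_op E T" "v \<in> E"
  shows "shift T c (shifts T cs v) = shifts T cs (shift T c v)"
  using assms(2)
proof (induction cs arbitrary: v)
  case (Cons d cs)
  have "shifts T cs v \<in> E" using linear_op_shifts [OF assms(1)] Cons.prems by (simp add: linear_op_def)
  then have "shift T c (shift T d (shifts T cs v)) = shift T d (shift T c (shifts T cs v))"
    using shift_commute [OF assms(1)] by blast
  then show ?case using Cons by simp
qed simp

lemma shifts_commute:
  assumes "linear_op E T" "v \<in> E"
  shows "shifts T cs (shifts T ds v) = shifts T ds (shifts T cs v)"
  using assms(2)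
proof (induction cs arbitrary: v)
  case (Cons d cs)
  have "shifts T cs v \<in> E" using linear_op_shifts [OF assms(1)] Cons.prems by (simp add: linear_op_def)
  then show ?case using Cons shift_shifts_commute [OF assms(1)] by simp
qed simp

lemma shifts_eigen:
  assumes T: "linear_op E T" and v: "v \<in> E" and ev: "T v = d *c v"
  shows "shifts T cs v = (\<Prod>c\<leftarrow>cs. d - c) *c v"
proof (induction cs)
  case (Cons c cs)
  have "shift T c (k *c v) = ((d - c) * k) *c v" for k
    using T v ev by (simp add: shift_def linear_op_def algebra_simps)
  then show ?case using Cons by simp
qed simp

section \<open>Polynomials in an operator\<close>

definition peval :: "('a \<Rightarrow> 'a) \<Rightarrow> complex poly \<Rightarrow> 'a \<Rightarrow> 'a" where
  "peval T p v = (\<Sum>i\<le>degree p. coeff p i *c (T ^^ i) v)"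

text \<open>The sum may run beyond the degree, so polynomials of different degrees can be compared
  over one common range.\<close>

lemma peval_ge: "degree p \<le> N \<Longrightarrow> peval T p v = (\<Sum>i\<le>N. coeff p i *c (T ^^ i) v)"
  unfolding peval_def by (rule sum.mono_neutral_left) (auto simp: coeff_eq_0)

lemma peval_add: "peval T (p + q) v = peval T p v + peval T q v"
proof -
  let ?N = "max (degree p) (degree q)"
  show ?thesis
    using degree_add_le_max [of p q]
    by (simp add: peval_ge [of "p + q" ?N] peval_ge [of p ?N] peval_ge [of q ?N] scale_left_distrib sum.distrib)
qed

lemma peval_smult: "peval T (smult c p) v = c *c peval T p v"
  by (simp add: peval_ge [of "smult c p" "degree p"] peval_def degree_smult_le scale_sum_right)

lemma peval_0 [simp]: "peval T 0 v = 0"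
  by (simp add: peval_def)

lemma peval_diff: "peval T (p - q) v = peval T p v - peval T q v"
  using peval_add [of T p "smult (-1) q" v] peval_smult [of T "-1" q v] by simp

lemma peval_monom: "peval T (monom 1 k) v = (T ^^ k) v"
proof -
  have "peval T (monom 1 k) v = (\<Sum>i\<le>k. (if i = k then (T ^^ i) v else 0))"
    by (subst peval_ge [of _ k]) (auto simp: degree_monom_le if_distrib if_distribR cong: if_cong intro!: sum.cong)
  then show ?thesis by simp
qed

lemma peval_pCons_0: "peval T (pCons 0 q) v = peval T q (T v)"
proof -
  have "peval T (pCons 0 q) v = (\<Sum>i\<le>Suc (degree q). coeff (pCons 0 q) i *c (T ^^ i) v)"
    by (rule peval_ge) (rule degree_pCons_le)
  also have "\<dots> = (\<Sum>i\<le>degree q. coeff q i *c (T ^^ Suc i) v)"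
    by (subst sum.atMost_Suc_shift) simp
  finally show ?thesis by (simp add: peval_def funpow_swap1)
qed

lemma linear_op_funpow: "linear_op E T \<Longrightarrow> linear_op E (T ^^ i)"
  by (induction i) (auto simp: linear_op_def)

text \<open>Applying \<open>T - c\<close> to the vector first amounts to multiplying the polynomial
  by \<open>X - c\<close>; this is the step by which one linear factor is split off.\<close>

lemma peval_shift:
  assumes "linear_op E T" "v \<in> E"
  shows "peval T q (shift T c v) = peval T ([:- c, 1:] * q) v"
proof -
  have "(T ^^ i) (T v - c *c v) = (T ^^ i) (T v) - c *c (T ^^ i) v" for i
    using linear_op_funpow [OF assms(1), of i] assms linear_op_diff [OF linear_op_funpow [OF assms(1), of i]]
    by (simp add: linear_op_def subspace_scale)
  then have "peval T q (T v - c *c v) = peval T q (T v) - c *c peval T q v"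
    by (simp add: peval_def scale_right_diff_distrib sum_subtractf scale_sum_right mult.commute)
  also have "\<dots> = peval T (pCons 0 q - smult c q) v"
    by (simp add: peval_diff peval_pCons_0 peval_smult)
  also have "pCons 0 q - smult c q = [:- c, 1:] * q" by (simp add: algebra_simps)
  finally show ?thesis by (simp add: shift_def)
qed

text \<open>Over the complex numbers a non-constant polynomial has a root \<open>c\<close>.
  Splitting off \<open>X - c\<close> lowers the degree and replaces \<open>v\<close> by
  \<open>shift T c v\<close>, so induction on the degree turns an annihilating polynomial into an
  annihilating product of linear factors.\<close>

lemma peval_zero_imp_shifts_zero:
  assumes T: "linear_op E T"
  shows "p \<noteq> 0 \<Longrightarrow> v \<in> E \<Longrightarrow> peval T p v = 0 \<Longrightarrow> \<exists>cs. shifts T cs v = 0"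
proof (induction "degree p" arbitrary: p v)
  case 0
  have "coeff p 0 \<noteq> 0" using 0(1,2) by (metis leading_coeff_0_iff)
  moreover have "coeff p 0 *c v = 0" using 0 by (simp add: peval_def)
  ultimately show ?case by (intro exI [of _ "[]"]) simp
next
  case (Suc n)
  from Suc(2) have "\<not> constant (poly p)" by (simp add: constant_degree)
  then obtain c where "poly p c = 0" using fundamental_theorem_of_algebra by blast
  then obtain q where q: "p = [:- c, 1:] * q" by (auto simp: poly_eq_0_iff_dvd dvd_def)
  have "q \<noteq> 0" using Suc(3) q by auto
  then have "degree q = n" using Suc(2) degree_mult_eq [of "[:- c, 1:]" q] q by simp
  moreover have "shift T c v \<in> E" using linear_op_shift [OF T] Suc(4) by (simp add: linear_op_def)
  moreover have "peval T q (shift T c v) = 0" using peval_shift [OF T Suc(4)] q Suc(5) by simp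
  ultimately obtain cs where "shifts T cs (shift T c v) = 0"
    using Suc(1) \<open>q \<noteq> 0\<close> by metis
  then show ?case by (intro exI [of _ "cs @ [c]"]) (simp add: shifts_append)
qed

text \<open>The iterates of \<open>v\<close> lie in the finitely generated space
  \<open>span X\<close>, so some \<open>(T ^^ k) v\<close> depends on the earlier ones. This is a
  polynomial relation for the single vector \<open>v\<close>, which is all that a decomposition of
  \<open>v\<close> requires.\<close>

lemma annihilating_shifts:
  assumes T: "linear_op E T" and fin: "finite X" "E \<subseteq> span X" and v: "v \<in> E"
  shows "\<exists>cs. shifts T cs v = 0"
proof -
  define S where "S k = (\<lambda>i. (T ^^ i) v) ` {..<k}" for k :: nat
  have inE: "(T ^^ i) v \<in> E" for i using linear_op_funpow [OF T] v by (simp add: linear_op_def)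
  have "\<exists>k. (T ^^ k) v \<in> span (S k)"
  proof (rule ccontr)
    assume *: "\<nexists>k. (T ^^ k) v \<in> span (S k)"
    have "independent (S k) \<and> card (S k) = k" for k
    proof (induction k)
      case 0
      show ?case by (simp add: S_def independent_empty)
    next
      case (Suc k)
      have "S (Suc k) = insert ((T ^^ k) v) (S k)" by (auto simp: S_def lessThan_Suc)
      moreover have "(T ^^ k) v \<notin> span (S k)" using * by blast
      moreover have "(T ^^ k) v \<notin> S k" using * span_base by blast
      moreover have "finite (S k)" by (simp add: S_def)
      ultimately show ?case using Suc by (simp add: independent_insert)
    qed
    then have "independent (S (Suc (card X)))" "card (S (Suc (card X))) = Suc (card X)" by auto
    moreover have "S (Suc (card X)) \<subseteq> span X" using inE fin by (auto simp: S_def)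
    ultimately show False using independent_span_bound [OF fin(1)] by fastforce
  qed
  then obtain k where k: "(T ^^ k) v \<in> span (S k)" by blast
  \<comment> \<open>Values at \<open>v\<close> of polynomials of degree below \<open>k\<close>. They
    form a subspace containing the earlier iterates, so membership in the span of these becomes
    membership here.\<close>
  define A where "A = {peval T q v | q. \<forall>i\<ge>k. coeff q i = 0}"
  have "subspace A"
  proof (unfold subspace_def, intro conjI ballI allI)
    show "0 \<in> A" unfolding A_def by (force intro: exI [of _ 0])
  next
    fix x y assume "x \<in> A" "y \<in> A"
    then obtain p q where "x = peval T p v" "y = peval T q v" "\<forall>i\<ge>k. coeff p i = 0" "\<forall>i\<ge>k. coeff q i = 0"
      unfolding A_def by blast
    then show "x + y \<in> A" unfolding A_def by (auto simp: peval_add intro!: exI [of _ "p + q"])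
  next
    fix c x assume "x \<in> A"
    then obtain p where "x = peval T p v" "\<forall>i\<ge>k. coeff p i = 0" unfolding A_def by blast
    then show "c *c x \<in> A" unfolding A_def by (auto simp: peval_smult intro!: exI [of _ "smult c p"])
  qed
  moreover have "S k \<subseteq> A"
    unfolding S_def A_def by (auto simp: peval_monom intro!: exI [of _ "monom 1 _"])
  ultimately have "span (S k) \<subseteq> A" by (rule span_minimal [rotated])
  then obtain q where q: "(T ^^ k) v = peval T q v" "\<forall>i\<ge>k. coeff q i = 0" using k unfolding A_def by blast
  \<comment> \<open>The coefficient at \<open>k\<close> shows that the relation is not the zero
    polynomial.\<close>
  have "coeff (monom 1 k - q) k = 1" using q(2) by simp
  then have "monom 1 k - q \<noteq> 0" by auto
  moreover have "peval T (monom 1 k - q) v = 0" by (simp add: peval_diff peval_monom q(1))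
  ultimately show ?thesis using peval_zero_imp_shifts_zero [OF T _ v] by blast
qed

text \<open>If no operator \<open>T - c\<close> has a Jordan block of size two, repeated factors may be dropped.\<close>

lemma distinct_annihilating_shifts:
  assumes T: "linear_op E T" and v: "v \<in> E" and z: "shifts T cs v = 0"
    and semisimple: "\<And>c u. u \<in> E \<Longrightarrow> shift T c (shift T c u) = 0 \<Longrightarrow> shift T c u = 0"
  shows "\<exists>ds. distinct ds \<and> shifts T ds v = 0"
proof -
  have "v \<in> E \<Longrightarrow> shifts T cs v = 0 \<Longrightarrow> shifts T (remdups cs) v = 0" for v
  proof (induction cs arbitrary: v)
    case (Cons c cs)
    have cv: "shift T c v \<in> E" using linear_op_shift [OF T] Cons.prems by (simp add: linear_op_def)
    have "shifts T cs (shift T c v) = 0"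
      using Cons.prems shift_shifts_commute [OF T] by simp
    then have *: "shifts T (remdups cs) (shift T c v) = 0" using Cons.IH cv by blast
    show ?case
    proof (cases "c \<in> set cs")
      case False
      then show ?thesis using * shift_shifts_commute [OF T Cons.prems(1)] by simp
    next
      case True
      \<comment> \<open>A factor that occurs already is taken out of the deduplicated product:
        \<open>u\<close> is killed by the square of \<open>shift T c\<close>, hence by
        \<open>shift T c\<close> itself.\<close>
      define u where "u = shifts T (remove1 c (remdups cs)) v"
      have uE: "u \<in> E" unfolding u_def using linear_op_shifts [OF T] Cons.prems by (simp add: linear_op_def)
      obtain xs ys where xy: "remdups cs = xs @ c # ys" "c \<notin> set xs"
        using True by (metis set_remdups split_list_first)
      have eq: "shifts T (remdups cs) w = shift T c (shifts T (remove1 c (remdups cs)) w)" if "w \<in> E" for w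
      proof -
        have "shifts T ys w \<in> E" using linear_op_shifts [OF T] that by (simp add: linear_op_def)
        then show ?thesis using xy shift_shifts_commute [OF T, of "shifts T ys w" c xs]
          by (simp add: shifts_append remove1_append)
      qed
      have "shift T c (shift T c u) = 0"
        using * eq [OF cv] shift_shifts_commute [OF T Cons.prems(1)] by (simp add: u_def)
      then have "shift T c u = 0" using semisimple uE by blast
      then show ?thesis using True eq [OF Cons.prems(1)] by (simp add: u_def)
    qed
  qed simp
  then show ?thesis using v z by (metis distinct_remdups)
qed

text \<open>One eigenvalue is peeled off at a time. The remaining factors applied to
  \<open>v\<close> give a \<open>c\<close>-eigenvector \<open>u\<close>, which they scale by the
  number \<open>k\<close>, non-zero because the list is distinct. Hence the shorter product kills
  \<open>v - u / k\<close>.\<close>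

lemma eigenvector_decomposition:
  assumes T: "linear_op E T"
  shows "v \<in> E \<Longrightarrow> distinct cs \<Longrightarrow> shifts T cs v = 0 \<Longrightarrow> v \<in> span {w \<in> E. \<exists>c. T w = c *c w}"
proof (induction cs arbitrary: v)
  case Nil
  then show ?case by (simp add: span_zero)
next
  case (Cons c cs)
  define u where "u = shifts T cs v"
  define k where "k = (\<Prod>d\<leftarrow>cs. c - d)"
  have uE: "u \<in> E" unfolding u_def using linear_op_shifts [OF T] Cons.prems by (simp add: linear_op_def)
  have Tu: "T u = c *c u" using Cons.prems by (simp add: u_def shift_def)
  have k: "k \<noteq> 0" using Cons.prems by (auto simp: k_def prod_list_zero_iff)
  have E: "subspace E" using T by (simp add: linear_op_def)
  have kuE: "inverse k *c u \<in> E" using E uE by (simp add: subspace_scale)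
  have "shifts T cs (v - inverse k *c u) = u - inverse k *c shifts T cs u"
    using linear_op_diff [OF linear_op_shifts [OF T]] Cons.prems kuE linear_op_shifts [OF T, of cs] uE
    by (simp add: u_def linear_op_def)
  also have "\<dots> = 0"
    using shifts_eigen [OF T uE Tu, of cs] k by (simp add: k_def)
  finally have "v - inverse k *c u \<in> span {w \<in> E. \<exists>c. T w = c *c w}"
    using Cons kuE E by (simp add: subspace_diff)
  moreover have "inverse k *c u \<in> span {w \<in> E. \<exists>c. T w = c *c w}"
    using uE Tu by (intro span_scale span_base) auto
  ultimately have "(v - inverse k *c u) + inverse k *c u \<in> span {w \<in> E. \<exists>c. T w = c *c w}"
    by (rule span_add)
  then show ?case by simp
qed

lemma linear_op_subset:
  "linear_op E T \<Longrightarrow> subspace F \<Longrightarrow> F \<subseteq> E \<Longrightarrow> (\<And>x. x \<in> F \<Longrightarrow> T x \<in> F) \<Longrightarrow> linear_op F T"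
  unfolding linear_op_def by blast

text \<open>Induction on \<open>J\<close>: a joint eigenspace for \<open>J\<close> is stable under
  the next operator by commutativity, and this operator is again diagonalizable on it.\<close>

lemma simultaneous_eigenvectors:
  assumes fin: "finite X" "E \<subseteq> span X"
    and T: "\<And>i. i \<in> I \<Longrightarrow> linear_op E (T i)"
    and comm: "\<And>i j x. i \<in> I \<Longrightarrow> j \<in> I \<Longrightarrow> x \<in> E \<Longrightarrow> T i (T j x) = T j (T i x)"
    and semisimple: "\<And>i c u. i \<in> I \<Longrightarrow> u \<in> E \<Longrightarrow> shift (T i) c (shift (T i) c u) = 0 \<Longrightarrow> shift (T i) c u = 0"
    and "finite J" "J \<subseteq> I" "subspace E"
  shows "E \<subseteq> span {w \<in> E. \<forall>i\<in>J. \<exists>c. T i w = c *c w}"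
  using \<open>finite J\<close> \<open>J \<subseteq> I\<close>
proof (induction J)
  case empty
  then show ?case by (auto intro: span_base)
next
  case (insert j J)
  let ?S = "span {w \<in> E. \<forall>i\<in>insert j J. \<exists>c. T i w = c *c w}"
  have "w \<in> ?S" if w: "w \<in> E" "\<forall>i\<in>J. \<exists>c. T i w = c *c w" for w
  proof -
    obtain c where c: "\<And>i. i \<in> J \<Longrightarrow> T i w = c i *c w" using w(2) by metis
    define F where "F = {u \<in> E. \<forall>i\<in>J. T i u = c i *c u}"
    have lin: "T i (x + y) = T i x + T i y" "T i (k *c x) = k *c T i x" "T i x \<in> E"
      if "i \<in> I" "x \<in> E" "y \<in> E" for i x y k using T [OF that(1)] that by (auto simp: linear_op_def)
    have lin0: "T i 0 = 0" if "i \<in> I" for i using T [OF that] by (rule linear_op_0)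
    have sub: "subspace F"
      unfolding F_def subspace_def using \<open>subspace E\<close> insert.prems
      by (auto simp: lin lin0 subset_iff subspace_0 subspace_add subspace_scale algebra_simps)
    have F: "linear_op F (T j)"
    proof (rule linear_op_subset [OF T [of j] sub])
      show "j \<in> I" "F \<subseteq> E" using insert.prems by (auto simp: F_def)
      show "T j x \<in> F" if "x \<in> F" for x
        using that insert.prems lin [of j x] comm [of _ j x] by (auto simp: F_def subset_iff lin)
    qed
    have wF: "w \<in> F" using w c by (simp add: F_def)
    obtain cs where cs: "shifts (T j) cs w = 0"
      using annihilating_shifts [OF F fin(1) _ wF] fin(2) by (auto simp: F_def)
    obtain ds where "distinct ds" "shifts (T j) ds w = 0"
      using distinct_annihilating_shifts [OF F wF cs] semisimple [of j] insert.prems by (auto simp: F_def)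
    then have "w \<in> span {u \<in> F. \<exists>c. T j u = c *c u}"
      using eigenvector_decomposition [OF F wF] by blast
    also have "\<dots> \<subseteq> ?S" by (rule span_mono) (auto simp: F_def)
    finally show ?thesis .
  qed
  then have "span {w \<in> E. \<forall>i\<in>J. \<exists>c. T i w = c *c w} \<subseteq> ?S"
    by (intro span_minimal) auto
  then show ?case using insert by blast
qed

text \<open>The product of \<open>T - c\<close> over the eigenvalues that occur kills a sum of eigenvectors,
  but not an eigenvector with another eigenvalue.\<close>

lemma eigenvector_notin_span:
  assumes T: "linear_op E T" and X: "X \<subseteq> E" "\<And>x. x \<in> X \<Longrightarrow> \<exists>c. T x = c *c x \<and> c \<noteq> d"
    and v: "v \<in> E" "T v = d *c v" "v \<in> span X"
  shows "v = 0"
proof -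
  have E: "subspace E" using T by (simp add: linear_op_def)
  \<comment> \<open>The annihilating product may depend on \<open>x\<close>. For a sum the two lists
    are concatenated, and since the factors commute either list can be applied first.\<close>
  define A where "A = {x \<in> E. \<exists>cs. d \<notin> set cs \<and> shifts T cs x = 0}"
  have lin: "shifts T cs (x + y) = shifts T cs x + shifts T cs y" "shifts T cs (k *c x) = k *c shifts T cs x"
    if "x \<in> E" "y \<in> E" for cs x y k using linear_op_shifts [OF T, of cs] that by (auto simp: linear_op_def)
  have z: "shifts T cs 0 = 0" for cs using linear_op_shifts [OF T] linear_op_0 by blast
  have "subspace A"
    unfolding subspace_def
  proof (intro conjI ballI allI)
    show "0 \<in> A" using E z by (auto simp: A_def subspace_0 intro: exI [of _ "[]"])
  next
    fix x y assume "x \<in> A" "y \<in> A"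
    then obtain cs ds where *: "x \<in> E" "y \<in> E" "d \<notin> set cs" "d \<notin> set ds" "shifts T cs x = 0" "shifts T ds y = 0"
      by (auto simp: A_def)
    then have "shifts T (cs @ ds) (x + y) = 0"
      by (simp add: shifts_append lin [OF *(1,2)])
        (metis * T add.right_neutral lin(1) linear_op_def linear_op_shifts shifts_commute z)
    then show "x + y \<in> A" unfolding A_def using * E by (auto simp: subspace_add intro!: exI [of _ "cs @ ds"])
  next
    fix c x assume "x \<in> A"
    then show "c *c x \<in> A" using E by (auto simp: A_def lin subspace_scale)
  qed
  moreover have "X \<subseteq> A"
  proof
    fix x assume "x \<in> X"
    then obtain c where "T x = c *c x" "c \<noteq> d" "x \<in> E" using X by blast
    then show "x \<in> A" by (auto simp: A_def shift_def intro!: exI [of _ "[c]"])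
  qed
  ultimately have "v \<in> A" using v(3) span_minimal by blast
  then obtain cs where "d \<notin> set cs" "shifts T cs v = 0" by (auto simp: A_def)
  moreover have "(\<Prod>c\<leftarrow>cs. d - c) \<noteq> 0" using \<open>d \<notin> set cs\<close> by (auto simp: prod_list_zero_iff)
  ultimately show ?thesis using shifts_eigen [OF T v(1,2), of cs] by simp
qed

end

section \<open>Superspaces, Lie superalgebras and modules over current algebras\<close>

lemma sum_fun_apply: "(\<Sum>i\<in>I. f i) n = (\<Sum>i\<in>I. f i n)"
  by (induction I rule: infinite_finite_induct) auto

locale superspace =
  fixes V :: "('a::ab_group_add, 'z) superspace_scheme"
  assumes superspace: "is_superspace V"

sublocale superspace \<subseteq> complex_vs "sscale V"
  using superspace by (simp add: is_superspace_def complex_vs_def)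

context superspace
begin

lemma part_subspace: "subspace (part V p)"
  using superspace by (simp add: is_superspace_def)

lemma part_inter: "x \<in> part V False \<Longrightarrow> x \<in> part V True \<Longrightarrow> x = 0"
  using superspace by (auto simp: is_superspace_def)

lemma part_inter': "x \<in> part V p \<Longrightarrow> x \<in> part V (\<not> p) \<Longrightarrow> x = 0"
  using part_inter by (cases p) auto

lemma part_zero [simp]: "0 \<in> part V p"
  and part_add: "x \<in> part V p \<Longrightarrow> y \<in> part V p \<Longrightarrow> x + y \<in> part V p"
  and part_diff: "x \<in> part V p \<Longrightarrow> y \<in> part V p \<Longrightarrow> x - y \<in> part V p"
  and part_minus: "x \<in> part V p \<Longrightarrow> - x \<in> part V p"
  and part_scale: "x \<in> part V p \<Longrightarrow> sscale V c x \<in> part V p"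
  by (simp_all add: part_subspace subspace_0 subspace_add subspace_diff subspace_neg subspace_scale)

lemma part_space: "x \<in> part V p \<Longrightarrow> x \<in> space_of V"
proof -
  assume x: "x \<in> part V p"
  show ?thesis
  proof (cases p)
    case True
    then have "x \<in> part V True" using x by simp
    then have "0 + x \<in> space_of V" using part_zero [of False] unfolding space_of_def by blast
    then show ?thesis by simp
  next
    case False
    then have "x \<in> part V False" using x by simp
    then have "x + 0 \<in> space_of V" using part_zero [of True] unfolding space_of_def by blast
    then show ?thesis by simp
  qed
qed

lemma space_sum: "x \<in> part V False \<Longrightarrow> y \<in> part V True \<Longrightarrow> x + y \<in> space_of V"
  by (auto simp: space_of_def)

lemma space_cases:
  assumes "x \<in> space_of V"
  obtains a b where "a \<in> part V False" "b \<in> part V True" "x = a + b"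
  using assms by (auto simp: space_of_def)

lemma space_subspace: "subspace (space_of V)"
  using subspace_sums [OF part_subspace part_subspace, of False True] by (simp add: space_of_def)

lemma space_zero [simp]: "0 \<in> space_of V"
  and space_add: "x \<in> space_of V \<Longrightarrow> y \<in> space_of V \<Longrightarrow> x + y \<in> space_of V"
  and space_diff: "x \<in> space_of V \<Longrightarrow> y \<in> space_of V \<Longrightarrow> x - y \<in> space_of V"
  and space_minus: "x \<in> space_of V \<Longrightarrow> - x \<in> space_of V"
  and space_scale: "x \<in> space_of V \<Longrightarrow> sscale V c x \<in> space_of V"
  by (simp_all add: space_subspace subspace_0 subspace_add subspace_diff subspace_neg subspace_scale)

lemma part_sum_unique:
  assumes "a \<in> part V False" "b \<in> part V True" "c \<in> part V False" "d \<in> part V True" "a + b = c + d"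
  shows "a = c" "b = d"
proof -
  have "a - c = d - b" using assms(5) by (simp add: algebra_simps)
  then have "a - c = 0" using assms part_inter [of "a - c"] part_diff by metis
  then show "a = c" "b = d" using assms(5) by auto
qed

lemma part_sum_zero:
  assumes "a \<in> part V p" "b \<in> part V (\<not> p)" "a + b = 0" shows "a = 0" "b = 0"
proof -
  have "a = - b" using assms(3) by (simp add: eq_neg_iff_add_eq_0)
  then show "a = 0" "b = 0" using part_inter' [of a p] part_minus [of b "\<not> p"] assms by auto
qed

lemma span_in_eq: "span_in V X = span X" by (simp add: span_in_def)

text \<open>The sums of homogeneous elements of the span form a subspace containing
  \<open>X\<close>. This makes a subspace generated by homogeneous vectors graded, as submodules
  have to be.\<close>

lemma span_homogeneous:
  assumes X: "\<And>x. x \<in> X \<Longrightarrow> x \<in> part V False \<or> x \<in> part V True" and x: "x \<in> span X"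
  shows "\<exists>a b. a \<in> part V False \<and> b \<in> part V True \<and> a \<in> span X \<and> b \<in> span X \<and> x = a + b"
proof -
  let ?A = "{x + y | x y. x \<in> part V False \<inter> span X \<and> y \<in> part V True \<inter> span X}"
  have "subspace ?A"
    by (intro subspace_sums subspace_inter part_subspace subspace_span)
  moreover have "X \<subseteq> ?A"
  proof
    fix x assume x: "x \<in> X"
    have "x = x + 0" "x = 0 + x" by simp_all
    then show "x \<in> ?A" using X [OF x] span_base [OF x] span_zero part_zero by blast
  qed
  ultimately have "span X \<subseteq> ?A" by (rule span_minimal [rotated])
  then show ?thesis using x by blast
qed

end

locale lie_superalg =
  fixes G :: "('a::ab_group_add) superalgebra"
  assumes lie: "lie_superalgebra G"

sublocale lie_superalg \<subseteq> superspace G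
  using lie by unfold_locales (simp add: lie_superalgebra_def)

context lie_superalg
begin

lemma br_add_left: "x \<in> space_of G \<Longrightarrow> y \<in> space_of G \<Longrightarrow> z \<in> space_of G \<Longrightarrow> brk G (x + y) z = brk G x z + brk G y z"
  and br_add_right: "x \<in> space_of G \<Longrightarrow> y \<in> space_of G \<Longrightarrow> z \<in> space_of G \<Longrightarrow> brk G z (x + y) = brk G z x + brk G z y"
  and br_scale_left: "x \<in> space_of G \<Longrightarrow> y \<in> space_of G \<Longrightarrow> brk G (sscale G c x) y = sscale G c (brk G x y)"
  and br_scale_right: "x \<in> space_of G \<Longrightarrow> y \<in> space_of G \<Longrightarrow> brk G x (sscale G c y) = sscale G c (brk G x y)"
  and br_part: "x \<in> part G p \<Longrightarrow> y \<in> part G q \<Longrightarrow> brk G x y \<in> part G (p \<noteq> q)"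
  and br_skew: "x \<in> part G p \<Longrightarrow> y \<in> part G q \<Longrightarrow> brk G x y = sscale G (- ksign p q) (brk G y x)"
  and jacobi: "x \<in> part G p \<Longrightarrow> y \<in> part G q \<Longrightarrow> z \<in> space_of G \<Longrightarrow>
    brk G x (brk G y z) = brk G (brk G x y) z + sscale G (ksign p q) (brk G y (brk G x z))"
  using lie unfolding lie_superalgebra_def by blast+

lemma br_space: "x \<in> space_of G \<Longrightarrow> y \<in> space_of G \<Longrightarrow> brk G x y \<in> space_of G"
proof -
  assume x: "x \<in> space_of G" and y: "y \<in> space_of G"
  obtain a b where "a \<in> part G False" "b \<in> part G True" "x = a + b" using x by (rule space_cases)
  moreover obtain c d where "c \<in> part G False" "d \<in> part G True" "y = c + d" using y by (rule space_cases)
  ultimately show ?thesis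
    by (simp add: br_add_left br_add_right part_space space_add part_space [OF br_part])
qed

lemma br_zero_left [simp]: "y \<in> space_of G \<Longrightarrow> brk G 0 y = 0"
  using br_scale_left [of 0 y 0] by simp

lemma br_zero_right [simp]: "y \<in> space_of G \<Longrightarrow> brk G y 0 = 0"
  using br_scale_right [of y 0 0] by simp

lemma br_diff_left: "x \<in> space_of G \<Longrightarrow> y \<in> space_of G \<Longrightarrow> z \<in> space_of G \<Longrightarrow> brk G (x - y) z = brk G x z - brk G y z"
  using br_add_left [of "x - y" y z] by (simp add: space_diff)

lemma br_diff_right: "x \<in> space_of G \<Longrightarrow> y \<in> space_of G \<Longrightarrow> z \<in> space_of G \<Longrightarrow> brk G z (x - y) = brk G z x - brk G z y"
  using br_add_right [of "x - y" y z] by (simp add: space_diff)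

lemma br_skew_even:
  assumes "x \<in> part G False" "y \<in> space_of G" shows "brk G x y = - brk G y x"
proof -
  obtain a b where ab: "a \<in> part G False" "b \<in> part G True" "y = a + b" using assms(2) by (rule space_cases)
  have "brk G x a = - brk G a x" "brk G x b = - brk G b x"
    using br_skew [OF assms(1) ab(1)] br_skew [OF assms(1) ab(2)] by (auto simp: ksign_def)
  then show ?thesis using assms ab by (simp add: br_add_left br_add_right part_space)
qed

lemma br_sym_odd: "x \<in> part G True \<Longrightarrow> y \<in> part G True \<Longrightarrow> brk G x y = brk G y x"
  using br_skew [of x True y True] by (simp add: ksign_def)

lemma jacobi_even:
  assumes "x \<in> part G False" "y \<in> space_of G" "z \<in> space_of G"
  shows "brk G x (brk G y z) = brk G (brk G x y) z + brk G y (brk G x z)"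
proof -
  obtain a b where ab: "a \<in> part G False" "b \<in> part G True" "y = a + b" using assms(2) by (rule space_cases)
  show ?thesis
    using jacobi [OF assms(1) ab(1) assms(3)] jacobi [OF assms(1) ab(2) assms(3)] assms ab
    by (simp add: ksign_def br_add_left br_add_right br_space part_space algebra_simps)
qed

end

locale current_module = lie_superalg G for G :: "('a::ab_group_add) superalgebra" +
  fixes l :: nat and L :: "(nat \<Rightarrow> 'a, 'b::ab_group_add) supermodule"
  assumes mod: "is_module (current l G) L"

sublocale current_module \<subseteq> L: superspace L
  using mod by unfold_locales (simp add: is_module_def)

context current_module
begin

text \<open>The action of \<open>x\<close> tensor theta^i. As \<open>cur\<close> is zero in degrees
  beyond \<open>l\<close>, the bracket rules below hold for all \<open>i\<close> and
  \<open>j\<close> without a bound on \<open>i + j\<close>.\<close>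

definition A :: "nat \<Rightarrow> 'a \<Rightarrow> 'b \<Rightarrow> 'b" where
  "A i x u = act L (cur l x i) u"

lemma cur_part: "x \<in> part G p \<Longrightarrow> cur l x i \<in> part (current l G) p"
  by (auto simp: current_def current_set_def cur_def)

lemma space_current: "space_of (current l G) = current_set l (space_of G)"
proof
  show "space_of (current l G) \<subseteq> current_set l (space_of G)"
  proof
    fix x assume "x \<in> space_of (current l G)"
    then obtain a b where "x = a + b" "a \<in> current_set l (part G False)" "b \<in> current_set l (part G True)"
      by (auto simp: space_of_def current_def)
    then show "x \<in> current_set l (space_of G)" by (auto simp: current_set_def space_sum)
  qed
  show "current_set l (space_of G) \<subseteq> space_of (current l G)"
  proof
    fix x assume x: "x \<in> current_set l (space_of G)"
    define a where "a i = (SOME a. \<exists>b. a \<in> part G False \<and> b \<in> part G True \<and> x i = a + b)" for i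
    have a: "\<exists>b. a i \<in> part G False \<and> b \<in> part G True \<and> x i = a i + b" for i
      unfolding a_def
    proof (rule someI_ex)
      have "x i \<in> space_of G" using x by (cases "i \<le> l") (auto simp: current_set_def)
      then show "\<exists>a b. a \<in> part G False \<and> b \<in> part G True \<and> x i = a + b" by (blast elim: space_cases)
    qed
    define u where "u = (\<lambda>i. if i \<le> l then a i else 0)"
    have "u \<in> part (current l G) False" using a by (auto simp: current_def current_set_def u_def)
    moreover have "x - u \<in> part (current l G) True"
    proof -
      have "x i - a i \<in> part G True" for i using a [of i] by (metis add_diff_cancel_left')
      then show ?thesis using x by (auto simp: current_def current_set_def u_def)
    qed
    moreover have "x = u + (x - u)" by simp
    ultimately show "x \<in> space_of (current l G)" unfolding space_of_def by blast
  qed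
qed

lemma cur_space: "x \<in> space_of G \<Longrightarrow> cur l x i \<in> space_of (current l G)"
  by (auto simp: space_current current_set_def cur_def)

lemma cur_add: "cur l (x + y) i = cur l x i + cur l y i"
  and cur_scale: "cur l (sscale G c x) i = sscale (current l G) c (cur l x i)"
  by (auto simp: cur_def current_def fun_eq_iff)

text \<open>Only the term \<open>k = i\<close> of the convolution survives, and beyond the
  truncation degree both sides are zero.\<close>

lemma cur_br:
  assumes "x \<in> space_of G" "y \<in> space_of G"
  shows "brk (current l G) (cur l x i) (cur l y j) = cur l (brk G x y) (i + j)"
proof
  fix n
  have "(\<Sum>k\<le>n. brk G (cur l x i k) (cur l y j (n - k))) =
      (\<Sum>k\<le>n. if k = i then brk G (cur l x i i) (cur l y j (n - i)) else 0)"
    using assms by (intro sum.cong) (auto simp: cur_def)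
  also have "\<dots> = (if i \<le> n then brk G (cur l x i i) (cur l y j (n - i)) else 0)" by simp
  finally show "brk (current l G) (cur l x i) (cur l y j) n = cur l (brk G x y) (i + j) n"
    using assms by (auto simp: current_def cur_def)
qed

lemma A_add: "x \<in> space_of G \<Longrightarrow> y \<in> space_of G \<Longrightarrow> u \<in> space_of L \<Longrightarrow> A i (x + y) u = A i x u + A i y u"
  and A_scale: "x \<in> space_of G \<Longrightarrow> u \<in> space_of L \<Longrightarrow> A i (sscale G c x) u = sscale L c (A i x u)"
  and A_add_right: "x \<in> space_of G \<Longrightarrow> u \<in> space_of L \<Longrightarrow> w \<in> space_of L \<Longrightarrow> A i x (u + w) = A i x u + A i x w"
  and A_scale_right: "x \<in> space_of G \<Longrightarrow> u \<in> space_of L \<Longrightarrow> A i x (sscale L c u) = sscale L c (A i x u)"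
  using mod cur_space unfolding is_module_def A_def cur_add cur_scale by blast+

lemma A_part: "x \<in> part G p \<Longrightarrow> u \<in> part L q \<Longrightarrow> A i x u \<in> part L (p \<noteq> q)"
  using mod cur_part unfolding is_module_def A_def by blast

lemma A_br: "x \<in> part G p \<Longrightarrow> y \<in> part G q \<Longrightarrow> u \<in> space_of L \<Longrightarrow>
    A (i + j) (brk G x y) u = A i x (A j y u) - sscale L (ksign p q) (A j y (A i x u))"
  using mod cur_part [of x p i] cur_part [of y q j] part_space [of x p] part_space [of y q]
  unfolding is_module_def A_def by (metis cur_br)

lemma A_space: "x \<in> space_of G \<Longrightarrow> u \<in> space_of L \<Longrightarrow> A i x u \<in> space_of L"
proof -
  assume x: "x \<in> space_of G" and u: "u \<in> space_of L"
  obtain a b where "a \<in> part G False" "b \<in> part G True" "x = a + b" using x by (rule space_cases)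
  moreover obtain c d where "c \<in> part L False" "d \<in> part L True" "u = c + d" using u by (rule L.space_cases)
  ultimately show ?thesis
    by (simp add: A_add A_add_right part_space L.part_space L.space_add L.part_space [OF A_part])
qed

lemma A_zero_left [simp]: "u \<in> space_of L \<Longrightarrow> A i 0 u = 0"
  using A_scale [of 0 u i 0] by simp

lemma A_zero_right [simp]: "x \<in> space_of G \<Longrightarrow> A i x 0 = 0"
  using A_scale_right [of x 0 i 0] by simp

lemma A_diff_right: "x \<in> space_of G \<Longrightarrow> u \<in> space_of L \<Longrightarrow> w \<in> space_of L \<Longrightarrow> A i x (u - w) = A i x u - A i x w"
  using A_add_right [of x "u - w" w i] by (simp add: L.space_diff)

lemma A_big: "l < i \<Longrightarrow> x \<in> space_of G \<Longrightarrow> u \<in> space_of L \<Longrightarrow> A i x u = 0"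
proof -
  assume "l < i" "x \<in> space_of G" "u \<in> space_of L"
  moreover from this have "cur l x i = cur l 0 i" by (auto simp: cur_def)
  ultimately show ?thesis using A_zero_left [of u i] by (simp add: A_def)
qed

lemma A_br_even:
  assumes "x \<in> part G False" "y \<in> space_of G" "u \<in> space_of L"
  shows "A (i + j) (brk G x y) u = A i x (A j y u) - A j y (A i x u)"
proof -
  obtain a b where ab: "a \<in> part G False" "b \<in> part G True" "y = a + b" using assms(2) by (rule space_cases)
  show ?thesis
    using A_br [OF assms(1) ab(1) assms(3), of i j] A_br [OF assms(1) ab(2) assms(3), of i j] assms ab
    by (simp add: ksign_def br_add_right br_space part_space algebra_simps A_add A_add_right A_space)
qed

lemma linear_op_A: "x \<in> space_of G \<Longrightarrow> L.linear_op (space_of L) (A i x)"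
  unfolding L.linear_op_def by (auto simp: L.space_subspace A_space A_add_right A_scale_right)

lemma A_kernel_subspace: "subspace {x \<in> space_of G. A i x u \<in> W}" if "u \<in> space_of L" "L.subspace W"
  unfolding subspace_def using that
  by (auto simp: space_add space_scale A_add A_scale L.subspace_0 L.subspace_add L.subspace_scale)

text \<open>Questions about the current algebra reduce to single theta-degrees by this expansion.
  The action is additive on \<open>space_of (current l G)\<close> only, so the induction carries the
  membership of the partial sums along.\<close>

lemma act_sum_cur:
  assumes "x \<in> current_set l (space_of G)" "u \<in> space_of L"
  shows "act L x u = (\<Sum>i\<le>l. A i (x i) u)"
proof -
  have *: "(\<Sum>i\<in>N. cur l (x i) i) \<in> space_of (current l G) \<and>
      act L (\<Sum>i\<in>N. cur l (x i) i) u = (\<Sum>i\<in>N. A i (x i) u)" if "N \<subseteq> {..l}" for N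
    using finite_subset [OF that finite_atMost] that
  proof (induction N rule: finite_induct)
    case empty
    have "cur l (0::'a) 0 = (\<lambda>a. 0)" by (auto simp: cur_def)
    then show ?case using A_zero_left [OF assms(2), of 0] cur_space [of 0 0] by (simp add: A_def)
  next
    case (insert i N)
    then have xi: "cur l (x i) i \<in> space_of (current l G)"
      using assms(1) cur_space by (auto simp: current_set_def)
    have IH: "(\<Sum>i\<in>N. cur l (x i) i) \<in> space_of (current l G)" using insert by auto
    have add: "act L (a + b) u = act L a u + act L b u"
      if "a \<in> space_of (current l G)" "b \<in> space_of (current l G)" for a b
      using mod assms(2) that unfolding is_module_def by blast
    have clo: "a + b \<in> space_of (current l G)"
      if "a \<in> space_of (current l G)" "b \<in> space_of (current l G)" for a b
      using that unfolding space_current current_set_def by (auto simp: space_add)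
    have IH': "act L (\<Sum>i\<in>N. cur l (x i) i) u = (\<Sum>i\<in>N. A i (x i) u)" using insert by auto
    show ?case
      unfolding sum.insert [OF insert(1,2)] add [OF xi IH] IH' using clo [OF xi IH] by (simp only: A_def)
  qed
  have "x = (\<Sum>i\<le>l. cur l (x i) i)"
  proof
    fix n
    have "(\<Sum>i\<le>l. cur l (x i) i) n = (\<Sum>i\<le>l. cur l (x i) i n)"
      by (rule sum_fun_apply)
    also have "\<dots> = (\<Sum>i\<le>l. if n = i then x i else 0)" by (intro sum.cong) (auto simp: cur_def)
    also have "\<dots> = x n" using assms(1) by (auto simp: current_set_def not_le)
    finally show "x n = (\<Sum>i\<le>l. cur l (x i) i) n" by simp
  qed
  with * [of "{..l}"] show ?thesis by simp
qed

end

section \<open>Root spaces and singular vectors\<close>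

text \<open>The properties by which a Cartan subalgebra is used: commutative, its own centralizer in
  the even part, and diagonalizable on the whole of \<open>G\<close>, odd part included. The last
  clause asks for an eigenvalue for each \<open>k\<close> separately; that it depends linearly on
  \<open>k\<close> is derived.\<close>

definition toral :: "('a::ab_group_add) superalgebra \<Rightarrow> 'a set \<Rightarrow> bool" where
  "toral G \<hh> \<longleftrightarrow> module.subspace (sscale G) \<hh> \<and> \<hh> \<subseteq> part G False \<and>
     (\<forall>x\<in>\<hh>. \<forall>y\<in>\<hh>. brk G x y = 0) \<and>
     (\<forall>x\<in>part G False. (\<forall>y\<in>\<hh>. brk G y x = 0) \<longrightarrow> x \<in> \<hh>) \<and>
     space_of G \<subseteq> span_in G {x \<in> space_of G. \<forall>k\<in>\<hh>. \<exists>c. brk G k x = sscale G c x}"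

context lie_superalg
begin

lemma root_space_subspace:
  assumes "\<hh> \<subseteq> space_of G" shows "subspace (root_space G \<hh> \<beta>)"
  using assms unfolding subspace_def root_space_def
  by (auto simp: subset_iff space_add space_scale br_add_right br_scale_right scale_right_distrib mult.commute)

lemma root_space_space: "x \<in> root_space G \<hh> \<beta> \<Longrightarrow> x \<in> space_of G"
  by (simp add: root_space_def)

lemma root_space_parts:
  assumes h: "\<hh> \<subseteq> part G False" and x: "a + b \<in> root_space G \<hh> \<beta>" "a \<in> part G False" "b \<in> part G True"
  shows "a \<in> root_space G \<hh> \<beta>" "b \<in> root_space G \<hh> \<beta>"
proof -
  have "brk G k a = sscale G (\<beta> k) a \<and> brk G k b = sscale G (\<beta> k) b" if k: "k \<in> \<hh>" for k
  proof -
    have kp: "k \<in> part G False" using h k by blast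
    have "brk G k a + brk G k b = sscale G (\<beta> k) a + sscale G (\<beta> k) b"
      using x(1) k br_add_right [OF part_space [OF x(2)] part_space [OF x(3)] part_space [OF kp]]
      by (simp add: root_space_def scale_right_distrib)
    moreover have "brk G k a \<in> part G False" "brk G k b \<in> part G True"
      using br_part [OF kp x(2)] br_part [OF kp x(3)] by simp_all
    ultimately show ?thesis using part_sum_unique x part_scale by metis
  qed
  then show "a \<in> root_space G \<hh> \<beta>" "b \<in> root_space G \<hh> \<beta>"
    using x by (auto simp: root_space_def part_space)
qed

lemma root_space_cases:
  assumes h: "\<hh> \<subseteq> part G False" and x: "x \<in> root_space G \<hh> \<beta>"
  obtains a b where "a \<in> part G False" "b \<in> part G True" "x = a + b"
    "a \<in> root_space G \<hh> \<beta>" "b \<in> root_space G \<hh> \<beta>"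
proof -
  obtain a b where "a \<in> part G False" "b \<in> part G True" "x = a + b"
    using root_space_space [OF x] by (rule space_cases)
  then show ?thesis using that root_space_parts [OF h] x by blast
qed

lemma root_space_br:
  assumes h: "\<hh> \<subseteq> part G False" and x: "x \<in> root_space G \<hh> \<beta>" and y: "y \<in> root_space G \<hh> \<gamma>"
  shows "brk G x y \<in> root_space G \<hh> (\<beta> + \<gamma>)"
proof -
  have xy: "x \<in> space_of G" "y \<in> space_of G" using x y by (simp_all add: root_space_def)
  have "brk G k (brk G x y) = sscale G ((\<beta> + \<gamma>) k) (brk G x y)" if k: "k \<in> \<hh>" for k
    using jacobi_even [of k x y] k h xy x y
    by (auto simp: root_space_def br_scale_left br_scale_right scale_left_distrib subset_iff)
  then show ?thesis using br_space [OF xy] by (simp add: root_space_def)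
qed

lemma root_space_cong:
  "(\<And>k. k \<in> \<hh> \<Longrightarrow> \<beta> k = \<gamma> k) \<Longrightarrow> root_space G \<hh> \<beta> = root_space G \<hh> \<gamma>"
  by (auto simp: root_space_def)

text \<open>For a non-zero vector the eigenvalue is determined by \<open>k\<close>, hence linear in
  \<open>k\<close>; it is set to 0 outside \<open>\<hh>\<close> to fit the representation of
  functionals.\<close>

lemma eigenvector_root_space:
  assumes h: "\<hh> \<subseteq> space_of G" "subspace \<hh>" and x: "x \<in> space_of G" "\<forall>k\<in>\<hh>. \<exists>c. brk G k x = sscale G c x"
  shows "\<exists>\<beta>\<in>dual G \<hh>. x \<in> root_space G \<hh> \<beta>"
proof (cases "x = 0")
  case True
  have "(\<lambda>_. 0) \<in> dual G \<hh>" by (simp add: dual_def)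
  moreover have "x \<in> root_space G \<hh> (\<lambda>_. 0)" using h True by (auto simp: root_space_def)
  ultimately show ?thesis by blast
next
  case False
  obtain b where b: "\<And>k. k \<in> \<hh> \<Longrightarrow> brk G k x = sscale G (b k) x" using x(2) by metis
  define \<beta> where "\<beta> k = (if k \<in> \<hh> then b k else 0)" for k
  have 1: "b (k + k') = b k + b k'" if "k \<in> \<hh>" "k' \<in> \<hh>" for k k'
  proof -
    have "sscale G (b (k + k')) x = sscale G (b k + b k') x"
      using that b [of k] b [of k'] b [of "k + k'"] h x subspace_add [OF h(2) that]
      by (simp add: subset_iff br_add_left scale_left_distrib)
    then show ?thesis using False scale_right_imp_eq by blast
  qed
  have 2: "b (sscale G c k) = c * b k" if "k \<in> \<hh>" for k c
  proof -
    have "sscale G (b (sscale G c k)) x = sscale G (c * b k) x"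
      using b [OF that] b [OF subspace_scale [OF h(2) that], of c] br_scale_left [of k x c] h x that
      by (auto simp del: scale_cancel_right)
    then show ?thesis using False scale_right_imp_eq by blast
  qed
  have "\<beta> \<in> dual G \<hh>"
    using 1 2 subspace_add [OF h(2)] subspace_scale [OF h(2)] by (auto simp: dual_def \<beta>_def)
  moreover have "x \<in> root_space G \<hh> \<beta>" using b x by (simp add: root_space_def \<beta>_def)
  ultimately show ?thesis by blast
qed

lemma toral_span:
  assumes "toral G \<hh>"
  shows "space_of G \<subseteq> span (\<Union>\<beta>\<in>dual G \<hh>. root_space G \<hh> \<beta>)"
proof -
  have h: "\<hh> \<subseteq> space_of G" "subspace \<hh>" using assms part_space by (auto simp: toral_def)
  have "{x \<in> space_of G. \<forall>k\<in>\<hh>. \<exists>c. brk G k x = sscale G c x} \<subseteq> (\<Union>\<beta>\<in>dual G \<hh>. root_space G \<hh> \<beta>)"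
    using eigenvector_root_space [OF h] by blast
  then show ?thesis using assms span_mono unfolding toral_def span_in_eq by blast
qed

text \<open>Homogeneous root vectors span everything. Weight 0 is included in
  \<open>dual G \<hh>\<close>, so \<open>\<hh>\<close> itself needs no separate case.\<close>

lemma toral_induct [consumes 2, case_names subspace even odd]:
  assumes tor: "toral G \<hh>" and "x \<in> space_of G"
    and sub: "subspace {x. Q x}"
    and even: "\<And>\<beta> x. \<beta> \<in> dual G \<hh> \<Longrightarrow> x \<in> root_space G \<hh> \<beta> \<Longrightarrow> x \<in> part G False \<Longrightarrow> Q x"
    and odd: "\<And>\<beta> x. \<beta> \<in> dual G \<hh> \<Longrightarrow> x \<in> root_space G \<hh> \<beta> \<Longrightarrow> x \<in> part G True \<Longrightarrow> Q x"
  shows "Q x"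
proof -
  have h: "\<hh> \<subseteq> part G False" using tor by (simp add: toral_def)
  have "Q x" if \<beta>: "\<beta> \<in> dual G \<hh>" and x: "x \<in> root_space G \<hh> \<beta>" for x \<beta>
  proof -
    obtain a b where "a \<in> part G False" "b \<in> part G True" "x = a + b"
      "a \<in> root_space G \<hh> \<beta>" "b \<in> root_space G \<hh> \<beta>"
      using root_space_cases [OF h x] by blast
    then show ?thesis using even odd \<beta> subspace_add [OF sub] by auto
  qed
  then have "(\<Union>\<beta>\<in>dual G \<hh>. root_space G \<hh> \<beta>) \<subseteq> {x. Q x}" by blast
  then show ?thesis using span_minimal [OF _ sub] toral_span [OF tor] assms(2) by blast
qed

end

context current_module
begin

inductive_set orbit :: "'a set \<Rightarrow> 'b \<Rightarrow> 'b set" for X w where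
  orbit_base: "w \<in> orbit X w"
| orbit_step: "u \<in> orbit X w \<Longrightarrow> x \<in> X \<Longrightarrow> A i x u \<in> orbit X w"

text \<open>The submodule generated by a singular vector lives in the \<open>H\<close>-eigenspaces below that of
  the vector, so in a simple module a singular vector below a non-zero weight vector vanishes.\<close>

lemma singular_vector_zero:
  assumes tor: "toral G \<hh>" and simple: "simple_module (current l G) L" and H: "H \<in> \<hh>"
    and w: "w \<in> part L p" "A 0 H w = sscale L c w"
    and sing: "\<And>\<beta> x i. \<beta> \<in> dual G \<hh> \<Longrightarrow> 0 < Re (\<beta> H) \<Longrightarrow> x \<in> root_space G \<hh> \<beta> \<Longrightarrow> A i x w = 0"
    and v: "v \<in> space_of L" "v \<noteq> 0" "A 0 H v = sscale L d v" and cd: "Re c < Re d"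
  shows "w = 0"
proof -
  \<comment> \<open>Weights whose value at \<open>H\<close> has real part 0 are included, so
    \<open>\<hh>\<close> is among the operators that generate the orbit.\<close>
  define low where "low = {x. (x \<in> part G False \<or> x \<in> part G True) \<and>
    (\<exists>\<beta>\<in>dual G \<hh>. Re (\<beta> H) \<le> 0 \<and> x \<in> root_space G \<hh> \<beta>)}"
  let ?gen = "orbit low w"
  have Hp: "H \<in> part G False" "H \<in> space_of G" using tor H part_space by (auto simp: toral_def)
  have gen: "(u \<in> part L False \<or> u \<in> part L True) \<and> (\<exists>c'. A 0 H u = sscale L c' u \<and> Re c' \<le> Re c)"
    if "u \<in> ?gen" for u
    using that
  proof induction
    case orbit_base
    then show ?case using w by (cases p) auto
  next
    case (orbit_step u' x i)
    then obtain \<beta> c' where x: "Re (\<beta> H) \<le> 0" "x \<in> root_space G \<hh> \<beta>" "x \<in> part G False \<or> x \<in> part G True"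
      and c': "A 0 H u' = sscale L c' u'" "Re c' \<le> Re c" by (auto simp: low_def)
    have xs: "x \<in> space_of G" "u' \<in> space_of L" using orbit_step x part_space L.part_space by blast+
    have "A 0 H (A i x u') = A i x (A 0 H u') + A i (brk G H x) u'"
      using A_br_even [OF Hp(1) xs, of 0 i] by simp
    also have "\<dots> = sscale L (c' + \<beta> H) (A i x u')"
      using x H xs c' by (simp add: A_scale A_scale_right root_space_def L.scale_left_distrib)
    finally have "A 0 H (A i x u') = sscale L (c' + \<beta> H) (A i x u')" .
    moreover have "Re (c' + \<beta> H) \<le> Re c" using c' x by simp
    moreover have "A i x u' \<in> part L False \<or> A i x u' \<in> part L True"
      using orbit_step(3) x(3) A_part [of x False u' False i] A_part [of x False u' True i]
        A_part [of x True u' False i] A_part [of x True u' True i] by auto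
    ultimately show ?case by blast
  qed
  let ?W = "L.span ?gen"
  have gen_space: "?gen \<subseteq> space_of L" using gen L.part_space by blast
  then have W_space: "?W \<subseteq> space_of L" using L.span_minimal L.space_subspace by blast
  have low_W: "A i x u \<in> ?W" if "u \<in> ?W" "x \<in> low" for i x u
  proof -
    have xs: "x \<in> space_of G" using that part_space by (auto simp: low_def)
    have "L.subspace {u \<in> space_of L. A i x u \<in> ?W}"
      using xs unfolding L.subspace_def
      by (auto simp: L.space_add L.space_scale A_add_right A_scale_right L.span_add L.span_scale L.span_zero)
    moreover have "?gen \<subseteq> {u \<in> space_of L. A i x u \<in> ?W}"
      using gen_space orbit_step [OF _ that(2)] L.span_base by blast
    ultimately have "?W \<subseteq> {u \<in> space_of L. A i x u \<in> ?W}" using L.span_minimal by blast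
    then show ?thesis using that by blast
  qed
  have extend: "\<forall>i. \<forall>x\<in>space_of G. A i x u \<in> ?W" if us: "u \<in> space_of L"
    and hom: "\<And>i x q \<beta>. \<beta> \<in> dual G \<hh> \<Longrightarrow> x \<in> root_space G \<hh> \<beta> \<Longrightarrow> x \<in> part G q \<Longrightarrow> A i x u \<in> ?W" for u
  proof (intro allI ballI)
    fix i x assume "x \<in> space_of G"
    have "x \<in> space_of G \<and> A i x u \<in> ?W"
      using tor \<open>x \<in> space_of G\<close>
    proof (induction rule: toral_induct)
      case subspace
      then show ?case using A_kernel_subspace [OF us L.subspace_span] by simp
    qed (use hom root_space_space in blast)+
    then show "A i x u \<in> ?W" ..
  qed
  have cases_low: "x \<in> low \<or> 0 < Re (\<beta> H)"
    if "\<beta> \<in> dual G \<hh>" "x \<in> root_space G \<hh> \<beta>" "x \<in> part G q" for x \<beta> q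
    using that unfolding low_def by (cases q) force+
  \<comment> \<open>Induction on the length of the word: moving \<open>x\<close> past the outermost
    letter leaves their bracket acting on the shorter word, and the induction hypothesis covers all
    of \<open>space_of G\<close>. So the letters need no ordering.\<close>
  have A_gen: "\<forall>i. \<forall>x\<in>space_of G. A i x u \<in> ?W" if "u \<in> ?gen" for u
    using that
  proof induction
    case orbit_base
    have ws: "w \<in> space_of L" using w(1) by (rule L.part_space)
    show ?case
    proof (rule extend [OF ws])
      fix i x q \<beta> assume x: "\<beta> \<in> dual G \<hh>" "x \<in> root_space G \<hh> \<beta>" "x \<in> part G q"
      show "A i x w \<in> ?W"
        using cases_low [OF x] sing [OF x(1) _ x(2), of i] L.span_base [OF orbit.orbit_step [OF orbit.orbit_base, of x low i w]]
        by (auto simp: L.span_zero)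
    qed
  next
    case (orbit_step u' y j)
    obtain r where y: "y \<in> part G r" using orbit_step(2) by (auto simp: low_def)
    have u: "A j y u' \<in> ?gen" by (rule orbit.orbit_step [OF orbit_step(1,2)])
    have u': "u' \<in> space_of L" using orbit_step gen_space by blast
    have us: "A j y u' \<in> space_of L" using u gen_space by blast
    show ?case
    proof (rule extend [OF us])
      fix i x q \<beta> assume x: "\<beta> \<in> dual G \<hh>" "x \<in> root_space G \<hh> \<beta>" "x \<in> part G q"
      have "A i x (A j y u') = A (i + j) (brk G x y) u' + sscale L (ksign q r) (A j y (A i x u'))"
        using A_br [OF x(3) y u', of i j] by simp
      moreover have "A (i + j) (brk G x y) u' \<in> ?W"
        using orbit_step(3) br_space part_space x(3) y by blast
      moreover have "A j y (A i x u') \<in> ?W" using low_W orbit_step(2,3) part_space x(3) by blast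
      ultimately show "A i x (A j y u') \<in> ?W" by (simp add: L.span_add L.span_scale)
    qed
  qed
  have A_W: "A i x u \<in> ?W" if "u \<in> ?W" "x \<in> space_of G" for i x u
  proof -
    have "L.subspace {u \<in> space_of L. A i x u \<in> ?W}"
      using that unfolding L.subspace_def
      by (auto simp: L.space_add L.space_scale A_add_right A_scale_right L.span_add L.span_scale L.span_zero)
    moreover have "?gen \<subseteq> {u \<in> space_of L. A i x u \<in> ?W}" using gen_space A_gen that by blast
    ultimately have "?W \<subseteq> {u \<in> space_of L. A i x u \<in> ?W}" using L.span_minimal by blast
    then show ?thesis using that by blast
  qed
  have "submodule_of (current l G) L ?W"
    unfolding submodule_of_def subspace_in_def
  proof (intro conjI ballI impI)
    show "L.subspace ?W" "?W \<subseteq> space_of L" using W_space by auto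
    fix a b assume ab: "a \<in> part L False" "b \<in> part L True" "a + b \<in> ?W"
    obtain a' b' where "a' \<in> part L False" "b' \<in> part L True" "a' \<in> ?W" "b' \<in> ?W" "a + b = a' + b'"
      using L.span_homogeneous [OF _ ab(3)] gen by blast
    then show "a \<in> ?W" "b \<in> ?W" using L.part_sum_unique [OF ab(1,2)] by metis+
  next
    fix x u assume x: "x \<in> space_of (current l G)" and u: "u \<in> ?W"
    have "x i \<in> space_of G" if "i \<le> l" for i using x that by (simp add: space_current current_set_def)
    then have "(\<Sum>i\<le>l. A i (x i) u) \<in> ?W" using A_W [OF u] by (intro L.span_sum) simp
    then show "act L x u \<in> ?W" using act_sum_cur [of x u] x u W_space by (simp add: space_current subset_iff)
  qed
  then have "?W = {0} \<or> ?W = space_of L" using simple by (simp add: simple_module_def)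
  \<comment> \<open>All generators have \<open>H\<close>-eigenvalues with real part at most
    \<open>Re c\<close>, whereas that of \<open>v\<close> has the larger real part
    \<open>Re d\<close>.\<close>
  moreover have "?W \<noteq> space_of L"
  proof
    assume "?W = space_of L"
    then have "v \<in> ?W" using v by simp
    have "v = 0"
    proof (rule L.eigenvector_notin_span [OF linear_op_A [OF Hp(2), of 0] gen_space _ v(1) v(3) \<open>v \<in> ?W\<close>])
      show "\<exists>c. A 0 H x = sscale L c x \<and> c \<noteq> d" if "x \<in> ?gen" for x
        using gen [OF that] cd by force
    qed
    then show False using v by simp
  qed
  ultimately show ?thesis using orbit_base [of w low] L.span_base by blast
qed

text \<open>It suffices to test root vectors and elements of \<open>\<hh>\<close> in each
  theta-degree: the scalars are linear in the element because \<open>w\<close> is non-zero, and the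
  weight on the current algebra is their sum over the degrees.\<close>

lemma highest_weight_vectorI:
  assumes h: "subspace \<hh>" "\<hh> \<subseteq> part G False" and w: "w \<in> space_of L" "w \<noteq> 0"
    and kill: "\<And>\<beta> x i. \<beta> \<in> P \<Longrightarrow> x \<in> root_space G \<hh> \<beta> \<Longrightarrow> A i x w = 0"
    and scal: "\<And>k i. k \<in> \<hh> \<Longrightarrow> \<exists>c. A i k w = sscale L c w"
  shows "\<exists>\<mu>. highest_weight_vector G \<hh> P l L \<mu> w"
proof -
  have "\<forall>i. \<forall>k\<in>\<hh>. \<exists>c. A i k w = sscale L c w" using scal by blast
  then obtain m where m: "\<And>i k. k \<in> \<hh> \<Longrightarrow> A i k w = sscale L (m i k) w" by metis
  have hs: "k \<in> space_of G" if "k \<in> \<hh>" for k using h that part_space by blast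
  have m_add: "m i (a + b) = m i a + m i b" if "a \<in> \<hh>" "b \<in> \<hh>" for i a b
  proof -
    have "sscale L (m i (a + b)) w = sscale L (m i a + m i b) w"
      using A_add [OF hs [OF that(1)] hs [OF that(2)] w(1)] that subspace_add [OF h(1) that]
      by (simp add: m L.scale_left_distrib)
    then show ?thesis using w(2) L.scale_right_imp_eq by blast
  qed
  have m_scale: "m i (sscale G c a) = c * m i a" if "a \<in> \<hh>" for i a c
  proof -
    have "sscale L (m i (sscale G c a)) w = sscale L (c * m i a) w"
      using A_scale [OF hs [OF that(1)] w(1)] that subspace_scale [OF h(1) that]
      by (simp add: m)
    then show ?thesis using w(2) L.scale_right_imp_eq by blast
  qed
  define \<mu> where "\<mu> x = (if x \<in> current_set l \<hh> then \<Sum>i\<le>l. m i (x i) else 0)" for x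
  have in_h: "x i \<in> \<hh>" if "x \<in> current_set l \<hh>" "i \<le> l" for x i
    using that by (simp add: current_set_def)
  have "\<mu> \<in> dual (current l G) (current_set l \<hh>)"
    unfolding dual_def
  proof (intro CollectI conjI ballI allI impI)
    fix x y assume xy: "x \<in> current_set l \<hh>" "y \<in> current_set l \<hh>"
    then have "x + y \<in> current_set l \<hh>" using subspace_add [OF h(1)] by (auto simp: current_set_def)
    then show "\<mu> (x + y) = \<mu> x + \<mu> y"
      using xy in_h by (simp add: \<mu>_def m_add sum.distrib)
  next
    fix c x assume x: "x \<in> current_set l \<hh>"
    then have "sscale (current l G) c x \<in> current_set l \<hh>"
      using subspace_scale [OF h(1)] by (auto simp: current_set_def current_def)
    then show "\<mu> (sscale (current l G) c x) = c * \<mu> x"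
      using x in_h by (simp add: \<mu>_def m_scale sum_distrib_left current_def)
  qed (simp add: \<mu>_def)
  moreover have "act L x w = 0" if "x \<in> current_set l (nilradical G \<hh> P)" for x
  proof -
    have "nilradical G \<hh> P \<subseteq> {y \<in> space_of G. A i y w \<in> {0}}" for i
      unfolding nilradical_def span_in_eq
      by (rule span_minimal) (use kill root_space_space A_kernel_subspace [OF w(1), of "{0}"] in auto)
    then have x: "y \<in> space_of G \<and> A i y w = 0" if "y \<in> nilradical G \<hh> P" for i y using that by blast
    then have "x \<in> current_set l (space_of G)" using that by (auto simp: current_set_def)
    then show ?thesis using act_sum_cur [OF _ w(1)] x that by (simp add: current_set_def)
  qed
  moreover have "act L x w = sscale L (\<mu> x) w" if "x \<in> current_set l \<hh>" for x
  proof -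
    have "x \<in> current_set l (space_of G)" using that hs by (auto simp: current_set_def)
    then have "act L x w = (\<Sum>i\<le>l. A i (x i) w)" by (rule act_sum_cur [OF _ w(1)])
    also have "\<dots> = (\<Sum>i\<le>l. sscale L (m i (x i)) w)" using m in_h [OF that] by (intro sum.cong) auto
    finally show ?thesis using that by (simp add: \<mu>_def L.scale_sum_left)
  qed
  ultimately show ?thesis unfolding highest_weight_vector_def using w by blast
qed

lemma highest_weight_vectorD:
  assumes hw: "highest_weight_vector G \<hh> P l L \<Lambda> v" and h: "subspace \<hh>"
  shows "v \<in> space_of L" "v \<noteq> 0" "\<beta> \<in> P \<Longrightarrow> x \<in> root_space G \<hh> \<beta> \<Longrightarrow> A i x v = 0"
    "k \<in> \<hh> \<Longrightarrow> A i k v = sscale L (\<Lambda> (cur l k i)) v"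
proof -
  show "v \<in> space_of L" "v \<noteq> 0" using hw by (simp_all add: highest_weight_vector_def)
  show "A i x v = 0" if "\<beta> \<in> P" "x \<in> root_space G \<hh> \<beta>"
  proof -
    have "x \<in> nilradical G \<hh> P" unfolding nilradical_def span_in_eq using that by (blast intro: span_base)
    then have "cur l x i \<in> current_set l (nilradical G \<hh> P)"
      by (auto simp: current_set_def cur_def nilradical_def span_in_eq span_zero)
    then show ?thesis using hw by (simp add: highest_weight_vector_def A_def)
  qed
  show "A i k v = sscale L (\<Lambda> (cur l k i)) v" if "k \<in> \<hh>"
  proof -
    have "cur l k i \<in> current_set l \<hh>" using that subspace_0 [OF h] by (auto simp: current_set_def cur_def)
    then show ?thesis using hw by (simp add: highest_weight_vector_def A_def)
  qed
qed

end

section \<open>The odd reflection of a highest weight vector\<close>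

text \<open>What the computation needs from an isotropic simple root: both root spaces are lines,
  the negative root vector squares to zero, \<alpha> vanishes on its coroot, and twice \<alpha> is
  not a root. The element \<open>H\<close> defines the positive system and serves to compare
  weights.\<close>

locale odd_reflection_setting = current_module G l L
  for G :: "('a::ab_group_add) superalgebra" and l :: nat
    and L :: "(nat \<Rightarrow> 'a, 'b::ab_group_add) supermodule" +
  fixes \<hh> :: "'a set" and P :: "('a \<Rightarrow> complex) set" and H :: 'a
    and \<Lambda> :: "(nat \<Rightarrow> 'a) \<Rightarrow> complex" and v :: 'b and \<alpha> :: "'a \<Rightarrow> complex" and e f :: 'a
  assumes tor: "toral G \<hh>"
    and simple: "simple_module (current l G) L"
    and H: "H \<in> \<hh>" "\<And>\<beta>. \<beta> \<in> roots G \<hh> \<Longrightarrow> Re (\<beta> H) \<noteq> 0"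
    and P: "P = {\<beta> \<in> roots G \<hh>. Re (\<beta> H) > 0}"
    and roots_sym: "\<And>\<beta>. \<beta> \<in> roots G \<hh> \<Longrightarrow> - \<beta> \<in> roots G \<hh>"
    and hw: "highest_weight_vector G \<hh> P l L \<Lambda> v"
    and \<alpha>: "simple_root P \<alpha>"
    and e: "e \<in> part G True" "e \<in> root_space G \<hh> \<alpha>" "\<And>x. x \<in> root_space G \<hh> \<alpha> \<Longrightarrow> \<exists>c. x = sscale G c e"
    and f: "f \<in> part G True" "f \<in> root_space G \<hh> (- \<alpha>)" "\<And>x. x \<in> root_space G \<hh> (- \<alpha>) \<Longrightarrow> \<exists>c. x = sscale G c f"
    and ff: "brk G f f = 0"
    and t: "brk G e f \<in> \<hh>" "\<alpha> (brk G e f) = 0"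
    and double: "root_space G \<hh> (\<alpha> + \<alpha>) = {0}"
begin

abbreviation "t \<equiv> brk G e f"

lemma h_sub: "subspace \<hh>" "\<hh> \<subseteq> part G False" "\<hh> \<subseteq> space_of G"
  using tor part_space by (auto simp: toral_def)

lemma h_part: "k \<in> \<hh> \<Longrightarrow> k \<in> part G False" "k \<in> \<hh> \<Longrightarrow> k \<in> space_of G"
  using h_sub by auto

lemma ef_space: "e \<in> space_of G" "f \<in> space_of G"
  using e f part_space by auto

lemma \<alpha>_P: "\<alpha> \<in> P" "\<alpha> \<in> dual G \<hh>" "0 < Re (\<alpha> H)"
  using \<alpha> by (auto simp: simple_root_def P roots_def)

lemma positive_root:
  "\<beta> \<in> dual G \<hh> \<Longrightarrow> x \<in> root_space G \<hh> \<beta> \<Longrightarrow> x \<noteq> 0 \<Longrightarrow> 0 < Re (\<beta> H) \<Longrightarrow> \<beta> \<in> P"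
  unfolding P roots_def by auto

lemma dual_diff: "\<beta> \<in> dual G \<hh> \<Longrightarrow> \<gamma> \<in> dual G \<hh> \<Longrightarrow> \<beta> + - \<gamma> \<in> dual G \<hh>"
  by (auto simp: dual_def algebra_simps)

text \<open>Simplicity of \<open>\<alpha>\<close>: if \<open>\<beta> - \<alpha>\<close> were a negative root, \<open>\<alpha> = \<beta> + (\<alpha> - \<beta>)\<close>.\<close>

lemma bracket_f:
  assumes \<beta>: "\<beta> \<in> P" "\<beta> \<noteq> \<alpha>" and x: "x \<in> root_space G \<hh> \<beta>"
  shows "brk G x f = 0 \<or> \<beta> + - \<alpha> \<in> P" "brk G x f \<in> root_space G \<hh> (\<beta> + - \<alpha>)"
proof -
  show y: "brk G x f \<in> root_space G \<hh> (\<beta> + - \<alpha>)" by (rule root_space_br [OF h_sub(2) x f(2)])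
  have "\<beta> + - \<alpha> \<in> P" if "brk G x f \<noteq> 0"
  proof -
    have \<beta>d: "\<beta> \<in> dual G \<hh>" using \<beta> by (simp add: P roots_def)
    have d: "\<beta> + - \<alpha> \<in> dual G \<hh>" by (rule dual_diff [OF \<beta>d \<alpha>_P(2)])
    have "\<beta> + - \<alpha> \<noteq> 0" using \<beta>(2) by (auto simp: fun_eq_iff)
    then have r: "\<beta> + - \<alpha> \<in> roots G \<hh>" using d y that by (auto simp: roots_def)
    show ?thesis
    proof (cases "Re ((\<beta> + - \<alpha>) H) > 0")
      case True
      then show ?thesis using r by (simp add: P)
    next
      case False
      then have "Re ((- (\<beta> + - \<alpha>)) H) > 0" using H(2) [OF r] by simp
      then have "- (\<beta> + - \<alpha>) \<in> P" using roots_sym [OF r] by (simp add: P)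
      moreover have "\<alpha> = \<beta> + - (\<beta> + - \<alpha>)" by (simp add: fun_eq_iff)
      ultimately show ?thesis using \<alpha> \<beta>(1) unfolding simple_root_def by blast
    qed
  qed
  then show "brk G x f = 0 \<or> \<beta> + - \<alpha> \<in> P" by blast
qed

definition singular :: "'b \<Rightarrow> bool" where
  "singular u \<longleftrightarrow> u \<in> space_of L \<and> (\<forall>\<beta>\<in>P. \<forall>x\<in>root_space G \<hh> \<beta>. \<forall>i. A i x u = 0) \<and>
     (\<forall>k\<in>\<hh>. \<forall>i. A i k u = sscale L (\<Lambda> (cur l k i)) u)"

lemma v_space: "v \<in> space_of L" and v_nz: "v \<noteq> 0" and v_singular: "singular v"
  using highest_weight_vectorD [OF hw h_sub(1)] by (auto simp: singular_def)

text \<open>\<open>v\<close> is not assumed homogeneous, while the sign in the bracket rule depends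
  on parities. Root spaces and \<open>\<hh>\<close> respect the grading, so the two components can
  be treated separately.\<close>

lemma singular_parts:
  assumes "singular (a + b)" and a: "a \<in> part L False" and b: "b \<in> part L True"
  shows "singular a" "singular b"
proof -
  have ab: "a \<in> space_of L" "b \<in> space_of L" using a b L.part_space by auto
  have hom: "A i x a = 0 \<and> A i x b = 0"
    if "x \<in> part G q" "\<beta> \<in> P" "x \<in> root_space G \<hh> \<beta>" for i x q \<beta>
  proof -
    have "A i x a + A i x b = 0"
      using assms(1) that ab part_space by (auto simp: singular_def A_add_right [symmetric])
    then show ?thesis
      using L.part_sum_zero [of "A i x a" q "A i x b"] A_part [OF that(1) a] A_part [OF that(1) b] by auto
  qed
  have "A i x a = 0 \<and> A i x b = 0" if \<beta>: "\<beta> \<in> P" and x: "x \<in> root_space G \<hh> \<beta>" for i x \<beta>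
  proof -
    obtain c d where cd: "c \<in> part G False" "d \<in> part G True" "x = c + d"
      "c \<in> root_space G \<hh> \<beta>" "d \<in> root_space G \<hh> \<beta>"
      using root_space_cases [OF h_sub(2) x] by blast
    then show ?thesis using hom [OF cd(1) \<beta>] hom [OF cd(2) \<beta>] ab by (simp add: A_add part_space)
  qed
  moreover have "A i k a = sscale L (\<Lambda> (cur l k i)) a \<and> A i k b = sscale L (\<Lambda> (cur l k i)) b"
    if k: "k \<in> \<hh>" for k i
  proof -
    have "A i k a + A i k b = sscale L (\<Lambda> (cur l k i)) a + sscale L (\<Lambda> (cur l k i)) b"
      using assms(1) k ab h_part by (simp add: singular_def A_add_right [symmetric] L.scale_right_distrib)
    then show ?thesis
      using L.part_sum_unique [of "A i k a" "A i k b" "sscale L (\<Lambda> (cur l k i)) a" "sscale L (\<Lambda> (cur l k i)) b"]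
        A_part [OF h_part(1) [OF k] a] A_part [OF h_part(1) [OF k] b] L.part_scale a b by simp
  qed
  ultimately show "singular a" "singular b" using ab by (auto simp: singular_def)
qed

lemma A_h_f: "k \<in> \<hh> \<Longrightarrow> u \<in> space_of L \<Longrightarrow>
    A i k (A j f u) = A j f (A i k u) - sscale L (\<alpha> k) (A (i + j) f u)"
  using A_br_even [of k f u i j] h_part ef_space f(2) A_scale [of f u "i + j" "- \<alpha> k"]
  by (simp add: root_space_def algebra_simps)

lemma A_x_f:
  assumes "x \<in> part G p" "u \<in> space_of L"
  shows "A i x (A j f u) = A (i + j) (brk G x f) u + sscale L (ksign p True) (A j f (A i x u))"
  using A_br [OF assms(1) f(1) assms(2), of i j] by simp

lemma A_f_anticommute: "u \<in> space_of L \<Longrightarrow> A i f (A j f u) = - A j f (A i f u)"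
  using A_x_f [OF f(1), of u i j] ff by (simp add: ksign_def)

lemma A_f_square: "u \<in> space_of L \<Longrightarrow> A i f (A i f u) = 0"
proof -
  assume u: "u \<in> space_of L"
  have "A i f (A i f u) + A i f (A i f u) = 0"
    using A_f_anticommute [OF u, of i i] by (simp add: eq_neg_iff_add_eq_0)
  then have "sscale L 2 (A i f (A i f u)) = 0"
    using L.scale_left_distrib [of 1 1 "A i f (A i f u)"] by simp
  then show ?thesis by simp
qed

lemma A_e_f: "u \<in> space_of L \<Longrightarrow> A i e (A j f u) = A (i + j) t u - A j f (A i e u)"
  using A_x_f [OF e(1), of u i j] by (simp add: ksign_def)

text \<open>The vector \<open>A j f u\<close> is killed by all positive root vectors: for a positive
  root other than \<alpha> the bracket with \<open>f\<close> is zero or again a positive root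
  vector, and for \<alpha> it is a multiple of \<open>t\<close> in degree at least \<open>j\<close>,
  which acts by zero. Its \<open>H\<close>-eigenvalue lies below that of \<open>v\<close>, so
  simplicity makes it vanish.\<close>

lemma singular_f_zero:
  assumes u: "singular u" "u \<in> part L p"
    and zero: "\<And>i. j \<le> i \<Longrightarrow> i \<le> l \<Longrightarrow> \<Lambda> (cur l t i) = 0"
  shows "A j f u = 0"
proof -
  have us: "u \<in> space_of L" using u by (simp add: singular_def)
  have hom: "A i x (A j f u) = 0"
    if \<beta>: "\<beta> \<in> P" and x: "x \<in> root_space G \<hh> \<beta>" "x \<in> part G q" for i x q \<beta>
  proof -
    have "A i x u = 0" using u \<beta> x by (simp add: singular_def)
    moreover have "A (i + j) (brk G x f) u = 0"
    proof (cases "\<beta> = \<alpha>")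
      case True
      then obtain c where "x = sscale G c e" using e(3) x by blast
      then have "A (i + j) (brk G x f) u = sscale L c (A (i + j) t u)"
        using ef_space us h_part(2) [OF t(1)] by (simp add: br_scale_left A_scale)
      moreover have "A (i + j) t u = 0"
        using zero [of "i + j"] A_big [of "i + j" t u] h_part(2) [OF t(1)] us u t(1)
        by (cases "i + j \<le> l") (auto simp: singular_def)
      ultimately show ?thesis by simp
    next
      case False
      then show ?thesis using bracket_f [OF \<beta> False x(1)] u us by (auto simp: singular_def)
    qed
    ultimately show ?thesis using A_x_f [OF x(2) us, of i j] ef_space by simp
  qed
  show ?thesis
  proof (rule singular_vector_zero [OF tor simple H(1)])
    show "A j f u \<in> part L (True \<noteq> p)" using A_part [OF f(1) u(2)] .
    show "A 0 H (A j f u) = sscale L (\<Lambda> (cur l H 0) - \<alpha> H) (A j f u)"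
      using A_h_f [OF H(1) us, of 0 j] u H(1) ef_space us
      by (simp add: singular_def A_scale_right L.scale_left_diff_distrib)
    show "v \<in> space_of L" "v \<noteq> 0" by (fact v_space v_nz)+
    show "A 0 H v = sscale L (\<Lambda> (cur l H 0)) v" using v_singular H(1) by (simp add: singular_def)
    show "Re (\<Lambda> (cur l H 0) - \<alpha> H) < Re (\<Lambda> (cur l H 0))" using \<alpha>_P by simp
    fix \<beta> x i assume \<beta>: "\<beta> \<in> dual G \<hh>" "0 < Re (\<beta> H)" and x: "x \<in> root_space G \<hh> \<beta>"
    have Af: "A j f u \<in> space_of L" using A_space ef_space us by blast
    obtain a b where ab: "a \<in> part G False" "b \<in> part G True" "x = a + b"
      "a \<in> root_space G \<hh> \<beta>" "b \<in> root_space G \<hh> \<beta>"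
      using root_space_cases [OF h_sub(2) x] by blast
    show "A i x (A j f u) = 0"
    proof (cases "x = 0")
      case False
      then have "\<beta> \<in> P" using positive_root \<beta> x by blast
      then show ?thesis using hom ab Af by (simp add: A_add part_space)
    qed (simp add: Af)
  qed
qed

lemma v_f_zero:
  assumes zero: "\<And>i. j \<le> i \<Longrightarrow> i \<le> l \<Longrightarrow> \<Lambda> (cur l t i) = 0"
  shows "A j f v = 0"
proof -
  obtain a b where ab: "a \<in> part L False" "b \<in> part L True" "v = a + b"
    using v_space by (rule L.space_cases)
  have "singular a" "singular b" using singular_parts [OF _ ab(1,2)] v_singular ab(3) by simp_all
  then have "A j f a = 0" "A j f b = 0"
    using singular_f_zero [OF _ ab(1) zero] singular_f_zero [OF _ ab(2) zero] by blast+
  then show ?thesis using ab ef_space by (simp add: A_add_right L.part_space)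
qed

lemma f_word_space: "foldr (\<lambda>i. A i f) js v \<in> space_of L"
  by (induction js) (auto simp: v_space A_space ef_space)

text \<open>Bracketing with \<open>f\<close> moves \<open>\<beta>\<close> to
  \<open>\<beta> - \<alpha>\<close>, which is positive by simplicity of \<alpha>. It is not \<alpha>
  itself, as twice \<alpha> is not a root, so the induction hypothesis for shorter words
  applies.\<close>

lemma f_word_killed:
  "\<beta> \<in> P \<Longrightarrow> \<beta> \<noteq> \<alpha> \<Longrightarrow> x \<in> root_space G \<hh> \<beta> \<Longrightarrow> A i x (foldr (\<lambda>i. A i f) js v) = 0"
proof (induction js arbitrary: i x \<beta>)
  case Nil
  then show ?case using v_singular by (simp add: singular_def)
next
  case (Cons j js)
  let ?u = "foldr (\<lambda>i. A i f) js v"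
  have hom: "A i y (A j f ?u) = 0" if y: "y \<in> root_space G \<hh> \<beta>" "y \<in> part G q" for y q
  proof -
    have "A (i + j) (brk G y f) ?u = 0"
    proof (cases "brk G y f = 0")
      case True
      then show ?thesis using f_word_space by simp
    next
      case False
      then have "\<beta> + - \<alpha> \<in> P" using bracket_f [OF Cons.prems(1,2) y(1)] by blast
      moreover have "\<beta> + - \<alpha> \<noteq> \<alpha>"
      proof
        assume "\<beta> + - \<alpha> = \<alpha>"
        then have "\<beta> k = \<alpha> k + \<alpha> k" for k
          by (metis (no_types) ab_left_minus add.assoc add.commute add_0 plus_fun_apply uminus_apply)
        then have "\<beta> = \<alpha> + \<alpha>" by (simp add: fun_eq_iff)
        then have "y = 0" using y double by simp
        then show False using False ef_space by simp
      qed
      ultimately show ?thesis using Cons.IH bracket_f(2) [OF Cons.prems(1,2) y(1)] by blast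
    qed
    moreover have "A i y ?u = 0" using Cons.IH Cons.prems y by blast
    ultimately show ?thesis using A_x_f [OF y(2) f_word_space, of i j js] ef_space by simp
  qed
  obtain a b where ab: "a \<in> part G False" "b \<in> part G True" "x = a + b"
    "a \<in> root_space G \<hh> \<beta>" "b \<in> root_space G \<hh> \<beta>"
    using root_space_cases [OF h_sub(2) Cons.prems(3)] by blast
  have "A j f ?u \<in> space_of L" using f_word_space A_space ef_space by blast
  then show ?case using hom ab by (simp add: A_add part_space)
qed

text \<open>The new positive system has \<open>- \<alpha>\<close> in place of \<alpha>. Every word
  in \<open>f\<close> is killed by the common positive roots, so only the operators of
  \<open>f\<close> itself are left to check.\<close>

lemma reflected_highest_weight_vector:
  assumes w: "w = foldr (\<lambda>i. A i f) js v" "w \<noteq> 0" and kill: "\<And>j. A j f w = 0"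
    and scal: "\<And>k i. k \<in> \<hh> \<Longrightarrow> \<exists>c. A i k w = sscale L c w"
  shows "\<exists>\<mu>. highest_weight_vector G \<hh> (odd_reflection P \<alpha>) l L \<mu> w"
proof (rule highest_weight_vectorI [OF h_sub(1,2) _ w(2) _ scal])
  show ws: "w \<in> space_of L" using w f_word_space by simp
  fix \<beta> x i assume \<beta>: "\<beta> \<in> odd_reflection P \<alpha>" and x: "x \<in> root_space G \<hh> \<beta>"
  show "A i x w = 0"
  proof (cases "\<beta> = - \<alpha>")
    case True
    then obtain c where "x = sscale G c f" using f(3) x by blast
    then show ?thesis using kill ef_space ws by (simp add: A_scale)
  next
    case False
    then show ?thesis using \<beta> x f_word_killed w by (auto simp: odd_reflection_def)
  qed
qed

lemma reflected_zero:
  assumes "\<And>i. i \<le> l \<Longrightarrow> \<Lambda> (cur l t i) = 0"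
  shows "\<exists>\<mu>. highest_weight_vector G \<hh> (odd_reflection P \<alpha>) l L \<mu> v"
proof (rule reflected_highest_weight_vector [of v "[]"])
  show "A j f v = 0" for j using v_f_zero assms by blast
  show "\<exists>c. A i k v = sscale L c v" if "k \<in> \<hh>" for k i using v_singular that by (auto simp: singular_def)
qed (simp_all add: v_nz)

text \<open>With \<open>w a\<close> the product of the factors \<open>a\<close> to \<open>k\<close>
  applied to \<open>v\<close>, downward induction from \<open>w (Suc k) = v\<close> shows that
  \<open>f\<close> in any degree at least \<open>a\<close> kills \<open>w a\<close>. The operator
  \<open>e\<close> in degree \<open>k - a\<close> then maps \<open>w a\<close> to a non-zero
  multiple of \<open>w (Suc a)\<close>, so no \<open>w a\<close> vanishes.\<close>

lemma reflected_nonzero: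
  assumes k: "k \<le> l" "\<Lambda> (cur l t k) \<noteq> 0" "\<And>j. k < j \<Longrightarrow> j \<le> l \<Longrightarrow> \<Lambda> (cur l t j) = 0"
  shows "\<exists>\<mu>. highest_weight_vector G \<hh> (odd_reflection P \<alpha>) l L \<mu> (foldr (\<lambda>i. A i f) [0..<Suc k] v)"
proof -
  define w where "w a = foldr (\<lambda>i. A i f) [a..<Suc k] v" for a
  have w_space: "w a \<in> space_of L" for a unfolding w_def by (rule f_word_space)
  have w_last: "w (Suc k) = v" by (simp add: w_def)
  have w_step: "w a = A a f (w (Suc a))" if "a \<le> k" for a
    using that upt_conv_Cons [of a "Suc k"] by (simp add: w_def del: upt_Suc)
  \<comment> \<open>The weight changes in degree 0 only, where each factor subtracts
    \<alpha>.\<close>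
  have "(\<forall>j\<ge>a. A j f (w a) = 0) \<and> (\<forall>x\<in>\<hh>. \<forall>i>0. A i x (w a) = sscale L (\<Lambda> (cur l x i)) (w a)) \<and>
    (\<forall>x\<in>\<hh>. A 0 x (w a) = sscale L (\<Lambda> (cur l x 0) - of_nat (Suc k - a) * \<alpha> x) (w a))"
    if "a \<le> Suc k" for a
    using that
  proof (induction a rule: inc_induct)
    case base
    have "A j f v = 0" if "Suc k \<le> j" for j using v_f_zero k(3) that by simp
    then show ?case using v_singular by (simp add: w_last singular_def)
  next
    case (step a)
    then have wa: "w a = A a f (w (Suc a))" using w_step by simp
    have 1: "A j f (w (Suc a)) = 0" if "Suc a \<le> j" for j using step that by blast
    have "A j f (w a) = 0" if "a \<le> j" for j
    proof (cases "j = a")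
      case True
      then show ?thesis using A_f_square [OF w_space] wa by simp
    next
      case False
      then show ?thesis
        using A_f_anticommute [OF w_space, of j a "Suc a"] wa 1 [of j] that ef_space by simp
    qed
    \<comment> \<open>The correction term contains \<open>f\<close> in degree \<open>i + a\<close>,
      which exceeds \<open>a\<close> as \<open>i > 0\<close>, and this kills
      \<open>w (Suc a)\<close>.\<close>
    moreover have "A i x (w a) = sscale L (\<Lambda> (cur l x i)) (w a)" if "x \<in> \<hh>" "i > 0" for x i
      using A_h_f [OF that(1) w_space, of i a "Suc a"] wa 1 [of "i + a"] that step w_space ef_space
      by (simp add: A_scale_right)
    moreover have "A 0 x (w a) = sscale L (\<Lambda> (cur l x 0) - of_nat (Suc k - a) * \<alpha> x) (w a)" if "x \<in> \<hh>" for x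
    proof -
      define c where "c = \<Lambda> (cur l x 0) - of_nat (Suc k - Suc a) * \<alpha> x"
      have IH: "A 0 x (w (Suc a)) = sscale L c (w (Suc a))" using step that by (simp add: c_def)
      have "A 0 x (w a) = sscale L (c - \<alpha> x) (w a)"
        using A_h_f [OF that w_space, of 0 a "Suc a"] wa IH w_space ef_space
        by (simp add: A_scale_right L.scale_left_diff_distrib)
      moreover have "c - \<alpha> x = \<Lambda> (cur l x 0) - of_nat (Suc k - a) * \<alpha> x"
        using step.hyps by (simp add: c_def Suc_diff_le algebra_simps)
      ultimately show ?thesis by simp
    qed
    ultimately show ?case by blast
  qed
  note * = this
  \<comment> \<open>In degree 0 the correction is a multiple of \<open>\<alpha> t = 0\<close>, so
    \<open>t\<close> acts on every \<open>w a\<close> as it does on \<open>v\<close>.\<close>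
  have t_w: "A i t (w a) = sscale L (\<Lambda> (cur l t i)) (w a)" if "a \<le> Suc k" for a i
    using * [OF that] t by (cases "i = 0") auto
  have t_big: "A i t (w a) = 0" if "a \<le> Suc k" "k < i" for a i
    using t_w [OF that(1)] k(3) [of i] A_big [of i t "w a"] w_space h_part(2) [OF t(1)] that by (cases "i \<le> l") auto
  \<comment> \<open>Both summands of the anticommutator rule vanish: \<open>t\<close> occurs in
    degree \<open>i + a > k\<close>, and \<open>e\<close> in degree \<open>i\<close> meets
    \<open>w (Suc a)\<close>, where the induction hypothesis applies.\<close>
  have e_big: "\<forall>i. k < i + a \<longrightarrow> A i e (w a) = 0" if "a \<le> Suc k" for a
    using that
  proof (induction a rule: inc_induct)
    case base
    then show ?case using v_singular e(2) \<alpha>_P by (simp add: w_last singular_def)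
  next
    case (step a)
    show ?case
    proof (intro allI impI)
      fix i assume i: "k < i + a"
      have "A i e (w a) = A (i + a) t (w (Suc a)) - A a f (A i e (w (Suc a)))"
        using w_step step A_e_f [OF w_space] by simp
      then show "A i e (w a) = 0" using t_big step i ef_space by simp
    qed
  qed
  \<comment> \<open>The degree \<open>k - a\<close> is chosen so that \<open>t\<close> appears in
    degree exactly \<open>k\<close>, the last one in which it does not act by zero; the other
    summand vanishes since \<open>(k - a) + Suc a > k\<close>.\<close>
  have e_step: "A (k - a) e (w a) = sscale L (\<Lambda> (cur l t k)) (w (Suc a))" if "a \<le> k" for a
  proof -
    have "A (k - a) e (w a) = A k t (w (Suc a)) - A a f (A (k - a) e (w (Suc a)))"
      using w_step [OF that] A_e_f [OF w_space, of "k - a" a "Suc a"] that by simp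
    then show ?thesis using t_w [of "Suc a" k] e_big [of "Suc a"] that ef_space by simp
  qed
  have w_nz: "w a \<noteq> 0" if "a \<le> Suc k" for a
    using that
  proof (induction a rule: inc_induct)
    case base
    then show ?case by (simp add: w_last v_nz)
  next
    case (step a)
    then show ?case using e_step [of a] k(2) ef_space by auto
  qed
  show ?thesis
  proof (rule reflected_highest_weight_vector [OF refl])
    fix x i assume "x \<in> \<hh>"
    then show "\<exists>c. A i x (foldr (\<lambda>i. A i f) [0..<Suc k] v) = sscale L c (foldr (\<lambda>i. A i f) [0..<Suc k] v)"
      using * [of 0] unfolding w_def by (cases "i = 0") blast+
  qed (use * [of 0] w_nz [of 0] in \<open>simp_all add: w_def del: upt_Suc\<close>)
qed

end

section \<open>The structural input and the dichotomy for the Cartan subalgebra\<close>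

definition center :: "('a::ab_group_add) superalgebra \<Rightarrow> 'a set" where
  "center K = {z \<in> space_of K. \<forall>y\<in>space_of K. brk K z y = 0}"

definition graded_ideal :: "('a::ab_group_add) superalgebra \<Rightarrow> 'a set \<Rightarrow> bool" where
  "graded_ideal K I \<longleftrightarrow> subspace_in K I \<and>
     (\<forall>a\<in>part K False. \<forall>b\<in>part K True. a + b \<in> I \<longrightarrow> a \<in> I \<and> b \<in> I) \<and>
     (\<forall>x\<in>space_of K. \<forall>y\<in>I. brk K x y \<in> I)"

text \<open>The last clause, non-degeneracy of the bracket between opposite odd root vectors, makes
  the root spaces one-dimensional once an invariant form is available. In this form the property can
  be checked from the brackets of the models.\<close>

definition reflection_root ::
  "('a::ab_group_add) superalgebra \<Rightarrow> 'a set \<Rightarrow> ('a \<Rightarrow> complex) \<Rightarrow> 'a \<Rightarrow> bool" where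
  "reflection_root K \<hh> a e \<longleftrightarrow> brk K e e = 0 \<and>
     root_space K \<hh> a \<inter> part K False \<subseteq> {0} \<and> root_space K \<hh> (a + a) \<subseteq> {0} \<and>
     (\<forall>x\<in>root_space K \<hh> a \<inter> part K True. \<forall>y\<in>root_space K \<hh> (- a) \<inter> part K True.
        brk K x y = 0 \<longrightarrow> x = 0 \<or> y = 0)"

text \<open>What the classification contributes.  In \<open>gl(1|1)\<close> there are further ideals, but there the
  even part is itself the Cartan subalgebra; this is the first alternative in the fourth clause.\<close>

definition admissible :: "('a::ab_group_add) superalgebra \<Rightarrow> bool" where
  "admissible K \<longleftrightarrow>
     (\<exists>X. finite X \<and> space_of K \<subseteq> span_in K X) \<and>
     (\<forall>z\<in>part K False. (\<forall>y\<in>part K True. brk K z y = 0) \<longrightarrow> z \<in> center K) \<and>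
     (\<forall>x\<in>part K False. \<forall>y\<in>space_of K. brk K x y \<in> center K \<longrightarrow> brk K x y = 0) \<and>
     (toral K (part K False) \<or> (\<forall>I. graded_ideal K I \<longrightarrow> I \<subseteq> center K \<or> part K True \<subseteq> I)) \<and>
     (\<forall>\<hh>. toral K \<hh> \<longrightarrow> root_space K \<hh> (\<lambda>_. 0) \<inter> part K True \<subseteq> {0}) \<and>
     (\<forall>\<hh> B a e f. toral K \<hh> \<and> invariant_form K B \<and> e \<in> root_space K \<hh> a \<inter> part K True \<and>
        f \<in> root_space K \<hh> (- a) \<inter> part K True \<and> B e f \<noteq> 0 \<and> brk K (brk K e f) e = 0 \<longrightarrow>
        reflection_root K \<hh> a e)"

lemma (in vector_space) finite_spanning_subset:
  assumes "finite X" "V \<subseteq> span X"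
  obtains F where "finite F" "F \<subseteq> V" "V \<subseteq> span F"
proof -
  obtain F where F: "F \<subseteq> V" "independent F" "V \<subseteq> span F" by (rule maximal_independent_subset)
  then have "finite F" using independent_span_bound [OF assms(1) F(2)] assms(2) by blast
  then show ?thesis using F that by blast
qed

text \<open>The operator \<open>T - c\<close> kills \<open>c\<close>-eigenvectors and scales the
  others, so its image lies in the span of eigenvectors for other eigenvalues. A vector of the image
  that is itself a \<open>c\<close>-eigenvector is therefore zero.\<close>

lemma (in complex_vs) diagonalizable_no_jordan_block:
  assumes T: "linear_op E T" and E: "E \<subseteq> span {w \<in> E. \<exists>c. T w = c *c w}"
    and u: "u \<in> E" "shift T c (shift T c u) = 0"
  shows "shift T c u = 0"
proof (rule eigenvector_notin_span [OF T])
  let ?X = "{w \<in> E. \<exists>d. T w = d *c w \<and> d \<noteq> c}"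
  have E': "subspace E" using T by (simp add: linear_op_def)
  have lin: "shift T c (x + y) = shift T c x + shift T c y" "shift T c (k *c x) = k *c shift T c x"
    if "x \<in> E" "y \<in> E" for x y k using linear_op_shift [OF T] that by (auto simp: linear_op_def)
  show "?X \<subseteq> E" "\<And>x. x \<in> ?X \<Longrightarrow> \<exists>d. T x = d *c x \<and> d \<noteq> c" by auto
  show "shift T c u \<in> E" using linear_op_shift [OF T] u by (simp add: linear_op_def)
  show "T (shift T c u) = c *c shift T c u" using u(2) by (simp add: shift_def [of T c "shift T c u"])
  have "subspace {x \<in> E. shift T c x \<in> span ?X}"
    unfolding subspace_def using E' linear_op_0 [OF linear_op_shift [OF T]]
    by (auto simp: lin subspace_0 subspace_add subspace_scale span_add span_scale span_zero)
  moreover have "{w \<in> E. \<exists>c. T w = c *c w} \<subseteq> {x \<in> E. shift T c x \<in> span ?X}"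
  proof clarify
    fix w d assume w: "w \<in> E" "T w = d *c w"
    then have "shift T c w = (d - c) *c w" by (simp add: shift_def scale_left_diff_distrib)
    moreover have "d \<noteq> c \<Longrightarrow> w \<in> span ?X" using w by (intro span_base) blast
    then have "(d - c) *c w \<in> span ?X" by (cases "d = c") (simp_all add: span_zero span_scale)
    ultimately show "shift T c w \<in> span ?X" by simp
  qed
  ultimately have "span {w \<in> E. \<exists>c. T w = c *c w} \<subseteq> {x \<in> E. shift T c x \<in> span ?X}"
    by (rule span_minimal [rotated])
  then show "shift T c u \<in> span ?X" using E u(1) by blast
qed

context current_module
begin

text \<open>Only theta-degree 0 is tested: this is the degree in which \<open>\<hh>\<close> acts
  semisimply.\<close>

definition kernel :: "'a set" where
  "kernel = {x \<in> space_of G. \<forall>u\<in>space_of L. A 0 x u = 0}"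

lemma kernel_parts:
  assumes a: "a \<in> part G False" and b: "b \<in> part G True" and ab: "a + b \<in> kernel"
  shows "a \<in> kernel" "b \<in> kernel"
proof -
  have hom: "A 0 a u = 0 \<and> A 0 b u = 0" if u: "u \<in> part L q" for u q
  proof -
    have "A 0 a u + A 0 b u = 0"
      using a b ab u part_space L.part_space by (auto simp: kernel_def A_add [symmetric])
    then show ?thesis using L.part_sum_zero [of "A 0 a u" q "A 0 b u"] A_part [OF a u] A_part [OF b u] by auto
  qed
  have "A 0 a u = 0 \<and> A 0 b u = 0" if u: "u \<in> space_of L" for u
  proof -
    obtain c d where "c \<in> part L False" "d \<in> part L True" "u = c + d" using u by (rule L.space_cases)
    then show ?thesis using hom a b by (simp add: A_add_right part_space L.part_space)
  qed
  then show "a \<in> kernel" "b \<in> kernel" using a b by (auto simp: kernel_def part_space)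
qed

lemma kernel_ideal: "graded_ideal G kernel"
  unfolding graded_ideal_def subspace_in_def
proof (intro conjI ballI impI)
  show "subspace kernel"
    unfolding subspace_def kernel_def by (auto simp: space_add space_scale A_add A_scale)
  show "kernel \<subseteq> space_of G" by (auto simp: kernel_def)
next
  fix x y assume x: "x \<in> space_of G" and y: "y \<in> kernel"
  have hom: "A 0 (brk G a b) u = 0" if "a \<in> part G p" "b \<in> part G q" "b \<in> kernel" "u \<in> space_of L" for a b p q u
    using A_br [OF that(1,2,4), of 0 0] that A_space part_space by (auto simp: kernel_def)
  have ys: "y \<in> space_of G" using y by (simp add: kernel_def)
  obtain a b where ab: "a \<in> part G False" "b \<in> part G True" "x = a + b" using x by (rule space_cases)
  obtain c d where cd: "c \<in> part G False" "d \<in> part G True" "y = c + d" using ys by (rule space_cases)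
  have "c \<in> kernel" "d \<in> kernel" using kernel_parts [OF cd(1,2)] cd(3) y by auto
  then have "A 0 (brk G x y) u = 0" if "u \<in> space_of L" for u
    using ab cd that hom [OF ab(1) cd(1)] hom [OF ab(1) cd(2)] hom [OF ab(2) cd(1)] hom [OF ab(2) cd(2)]
    by (simp add: br_add_left br_add_right part_space space_add br_space A_add)
  then show "brk G x y \<in> kernel" using br_space x ys by (simp add: kernel_def)
qed (use kernel_parts in auto)

text \<open>The weight decomposition of \<open>L\<close> makes commutators in \<open>\<hh>\<close>
  and the non-semisimple parts of its adjoint action act by zero in degree 0, so they are central if
  \<open>kernel\<close> is; admissibility says that a bracket with an even element vanishes once it
  is central. The centralizer property comes from self-normalization.\<close>

lemma cartan_toral_or_odd_trivial:
  assumes cartan: "cartan_subalgebra G \<hh>" and adm: "admissible G"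
    and weights: "space_of L = L.span {v \<in> space_of L. \<exists>\<mu>\<in>dual G \<hh>. \<forall>h\<in>\<hh>. A 0 h v = sscale L (\<mu> h) v}"
  shows "toral G \<hh> \<or> part G True \<subseteq> kernel"
proof -
  have h: "subspace \<hh>" "\<hh> \<subseteq> part G False" "\<hh> \<subseteq> space_of G"
    and normal: "\<And>x. x \<in> part G False \<Longrightarrow> \<forall>y\<in>\<hh>. brk G x y \<in> \<hh> \<Longrightarrow> x \<in> \<hh>"
    using cartan by (auto simp: cartan_subalgebra_def subspace_in_def)
  have cent: "x \<in> \<hh>" if x: "x \<in> part G False" "\<forall>y\<in>\<hh>. brk G y x = 0" for x
  proof (rule normal [OF x(1)])
    show "\<forall>y\<in>\<hh>. brk G x y \<in> \<hh>"
      using x br_skew_even [OF x(1)] h(3) subspace_0 [OF h(1)] by auto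
  qed
  consider "toral G (part G False)" | "kernel \<subseteq> center G" | "part G True \<subseteq> kernel"
    using adm kernel_ideal by (auto simp: admissible_def)
  then show ?thesis
  proof cases
    case 1
    \<comment> \<open>Everything even commutes with \<open>\<hh>\<close> here, so
      \<open>\<hh>\<close>, being its own centralizer, is the whole even part.\<close>
    then have "\<hh> = part G False" using cent h(2) by (auto simp: toral_def)
    then show ?thesis using 1 by simp
  next
    case 3
    then show ?thesis by simp
  next
    case 2
    \<comment> \<open>On a weight vector both elements act by scalars, so their bracket acts by
      zero.\<close>
    have abelian: "brk G x y = 0" if xy: "x \<in> \<hh>" "y \<in> \<hh>" for x y
    proof -
      have xs: "x \<in> part G False" "x \<in> space_of G" "y \<in> space_of G" using xy h by auto
      have "L.subspace {u \<in> space_of L. A 0 (brk G x y) u = 0}"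
        unfolding L.subspace_def using br_space xs
        by (auto simp: L.space_add L.space_scale A_add_right A_scale_right)
      moreover have "A 0 (brk G x y) u = 0"
        if "u \<in> space_of L" "\<And>h. h \<in> \<hh> \<Longrightarrow> A 0 h u = sscale L (\<mu> h) u" for u \<mu>
        using A_br_even [OF xs(1,3) that(1), of 0 0] that xy xs
        by (simp add: A_scale_right mult.commute)
      ultimately have "L.span {v \<in> space_of L. \<exists>\<mu>\<in>dual G \<hh>. \<forall>h\<in>\<hh>. A 0 h v = sscale L (\<mu> h) v} \<subseteq> {u \<in> space_of L. A 0 (brk G x y) u = 0}"
        by (intro L.span_minimal) auto
      then have "brk G x y \<in> kernel" using weights br_space xs by (auto simp: kernel_def)
      then show ?thesis using 2 adm xs by (auto simp: admissible_def)
    qed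
    have L_eig: "space_of L \<subseteq> L.span {w \<in> space_of L. \<exists>c. A 0 k w = sscale L c w}" if "k \<in> \<hh>" for k
      using that by (subst weights) (rule L.span_mono; blast)
    have semisimple: "shift (brk G k) c u = 0"
      if k: "k \<in> \<hh>" and u: "u \<in> space_of G" and z: "shift (brk G k) c (shift (brk G k) c u) = 0" for k c u
    proof -
      have kp: "k \<in> part G False" "k \<in> space_of G" using k h by auto
      have sh: "shift (brk G k) c x \<in> space_of G" if "x \<in> space_of G" for x
        using that kp by (simp add: shift_def space_diff br_space space_scale)
      have "A 0 (shift (brk G k) c u) v = 0"
        if v: "v \<in> space_of L" "A 0 k v = sscale L m v" for v m
      proof -
        \<comment> \<open>On a vector \<open>v\<close> of \<open>k\<close>-eigenvalue
          \<open>m\<close>, the operator \<open>ad k - c\<close> applied to \<open>x\<close> turns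
          into \<open>k - (m + c)\<close> applied to \<open>A 0 x v\<close>. A Jordan block of
          \<open>ad k\<close> that acts non-trivially would thus give one of \<open>k\<close> on
          \<open>L\<close>.\<close>
        have *: "A 0 (shift (brk G k) c x) v = L.shift (A 0 k) (m + c) (A 0 x v)" if x: "x \<in> space_of G" for x
        proof -
          have "A 0 (shift (brk G k) c x) v + A 0 (sscale G c x) v = A 0 (brk G k x) v"
            using x kp v by (subst A_add [symmetric]) (auto simp: shift_def space_diff br_space space_scale)
          then have "A 0 (shift (brk G k) c x) v = A 0 (brk G k x) v - sscale L c (A 0 x v)"
            using x v by (simp add: eq_diff_eq A_scale)
          moreover have "A 0 (brk G k x) v = A 0 k (A 0 x v) - sscale L m (A 0 x v)"
            using A_br_even [OF kp(1) x v(1), of 0 0] x v by (simp add: A_scale_right)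
          ultimately show ?thesis by (simp add: L.shift_def L.scale_left_distrib)
        qed
        have "L.shift (A 0 k) (m + c) (L.shift (A 0 k) (m + c) (A 0 u v)) = 0"
          using * [OF u] * [OF sh [OF u]] z v by simp
        then have "L.shift (A 0 k) (m + c) (A 0 u v) = 0"
          using L.diagonalizable_no_jordan_block [OF linear_op_A [OF kp(2)] L_eig [OF k]] A_space u v by blast
        then show ?thesis using * [OF u] by simp
      qed
      note weight_zero = this
      let ?y = "shift (brk G k) c u"
      have "L.subspace {w \<in> space_of L. A 0 ?y w = 0}"
        unfolding L.subspace_def using sh [OF u]
        by (auto simp: L.space_add L.space_scale A_add_right A_scale_right)
      then have "L.span {v \<in> space_of L. \<exists>\<mu>\<in>dual G \<hh>. \<forall>h\<in>\<hh>. A 0 h v = sscale L (\<mu> h) v} \<subseteq> {w \<in> space_of L. A 0 ?y w = 0}"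
        using weight_zero k by (intro L.span_minimal) auto
      then have "?y \<in> kernel" using weights sh [OF u] by (auto simp: kernel_def)
      then have central: "?y \<in> center G" using 2 by blast
      \<comment> \<open>For \<open>c \<noteq> 0\<close> this forces \<open>?y = 0\<close>; for
        \<open>c = 0\<close> the central element \<open>?y\<close> is itself a bracket with
        \<open>k\<close> and vanishes by admissibility.\<close>
      then have "brk G k ?y = 0" using br_skew_even [OF kp(1) sh [OF u]] kp by (simp add: center_def)
      then have "sscale G c ?y = 0" using z by (simp add: shift_def [of "brk G k" c ?y])
      then show ?thesis
        using central adm kp u by (cases "c = 0") (auto simp: admissible_def shift_def)
    qed
    obtain X where X: "finite X" "space_of G \<subseteq> span X" using adm by (auto simp: admissible_def span_in_eq)
    have "\<hh> \<subseteq> span X" using X h by blast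
    \<comment> \<open>Simultaneous diagonalization handles finitely many operators; a finite
      spanning set of \<open>\<hh>\<close> is enough because being an eigenvector passes to linear
      combinations.\<close>
    then obtain J where J: "finite J" "J \<subseteq> \<hh>" "\<hh> \<subseteq> span J" using X(1) finite_spanning_subset by blast
    have "space_of G \<subseteq> span {w \<in> space_of G. \<forall>k\<in>J. \<exists>c. brk G k w = sscale G c w}"
    proof (rule simultaneous_eigenvectors [OF X _ _ _ J(1,2) space_subspace])
      show "linear_op (space_of G) (brk G k)" if "k \<in> \<hh>" for k
        using that h(3) unfolding linear_op_def
        by (auto simp: subset_iff space_subspace br_space br_add_right br_scale_right)
      show "brk G i (brk G j x) = brk G j (brk G i x)" if "i \<in> \<hh>" "j \<in> \<hh>" "x \<in> space_of G" for i j x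
        using jacobi_even [of i j x] that h abelian [of i j] by (auto simp: subset_iff)
    qed (use semisimple in auto)
    also have "\<dots> \<subseteq> span {w \<in> space_of G. \<forall>k\<in>\<hh>. \<exists>c. brk G k w = sscale G c w}"
    proof (rule span_mono, clarify)
      fix w k assume w: "w \<in> space_of G" "\<forall>k\<in>J. \<exists>c. brk G k w = sscale G c w" and k: "k \<in> \<hh>"
      have "\<exists>c. brk G (x + y) w = sscale G c w"
        if "x \<in> space_of G" "y \<in> space_of G" "brk G x w = sscale G a w" "brk G y w = sscale G b w" for x y a b
        using that w by (intro exI [of _ "a + b"]) (simp add: br_add_left scale_left_distrib)
      moreover have "\<exists>d. brk G (sscale G c x) w = sscale G d w"
        if "x \<in> space_of G" "brk G x w = sscale G a w" for x a c
        using that w by (intro exI [of _ "c * a"]) (simp add: br_scale_left)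
      moreover have "\<exists>c. brk G 0 w = sscale G c w" using w by (intro exI [of _ 0]) simp
      ultimately have "subspace {x \<in> space_of G. \<exists>c. brk G x w = sscale G c w}"
        unfolding subspace_def by (fastforce simp: space_add space_scale)
      then have "span J \<subseteq> {x \<in> space_of G. \<exists>c. brk G x w = sscale G c w}"
        using J(2) h(3) w by (intro span_minimal) auto
      then show "\<exists>c. brk G k w = sscale G c w" using J(3) k by blast
    qed
    finally show ?thesis
      unfolding toral_def span_in_eq using h abelian cent by blast
  qed
qed

end

section \<open>Invariant forms and the reduction to the structural input\<close>

locale lie_superalg_form = lie_superalg G for G :: "('a::ab_group_add) superalgebra" +
  fixes B :: "'a \<Rightarrow> 'a \<Rightarrow> complex"
  assumes form: "invariant_form G B" and nondeg: "nondegenerate_form G B"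
begin

lemma B_add_left: "x \<in> space_of G \<Longrightarrow> y \<in> space_of G \<Longrightarrow> z \<in> space_of G \<Longrightarrow> B (x + y) z = B x z + B y z"
  and B_add_right: "x \<in> space_of G \<Longrightarrow> y \<in> space_of G \<Longrightarrow> z \<in> space_of G \<Longrightarrow> B z (x + y) = B z x + B z y"
  and B_scale_left: "x \<in> space_of G \<Longrightarrow> y \<in> space_of G \<Longrightarrow> B (sscale G c x) y = c * B x y"
  and B_scale_right: "x \<in> space_of G \<Longrightarrow> y \<in> space_of G \<Longrightarrow> B x (sscale G c y) = c * B x y"
  and B_parts: "x \<in> part G False \<Longrightarrow> y \<in> part G True \<Longrightarrow> B x y = 0"
  and B_sym: "x \<in> part G p \<Longrightarrow> y \<in> part G q \<Longrightarrow> B x y = ksign p q * B y x"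
  and B_inv: "x \<in> space_of G \<Longrightarrow> y \<in> space_of G \<Longrightarrow> z \<in> space_of G \<Longrightarrow> B (brk G x y) z = B x (brk G y z)"
  using form unfolding invariant_form_def by blast+

lemma B_parts': "x \<in> part G True \<Longrightarrow> y \<in> part G False \<Longrightarrow> B x y = 0"
  using B_sym [of x True y False] B_parts [of y x] by simp

lemma B_zero_left: "y \<in> space_of G \<Longrightarrow> B 0 y = 0"
  using B_scale_left [of 0 y 0] by simp

lemma B_zero_right: "y \<in> space_of G \<Longrightarrow> B y 0 = 0"
  using B_scale_right [of y 0 0] by simp

lemma B_minus_left: "x \<in> space_of G \<Longrightarrow> y \<in> space_of G \<Longrightarrow> B (- x) y = - B x y"
  using B_scale_left [of x y "-1"] by simp

lemma B_minus_right: "x \<in> space_of G \<Longrightarrow> y \<in> space_of G \<Longrightarrow> B x (- y) = - B x y"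
  using B_scale_right [of x y "-1"] by simp

lemma B_diff_left: "x \<in> space_of G \<Longrightarrow> y \<in> space_of G \<Longrightarrow> z \<in> space_of G \<Longrightarrow> B (x - y) z = B x z - B y z"
  using B_add_left [of "x - y" y z] by (simp add: space_diff)

lemma B_diff_right: "x \<in> space_of G \<Longrightarrow> y \<in> space_of G \<Longrightarrow> z \<in> space_of G \<Longrightarrow> B z (x - y) = B z x - B z y"
  using B_add_right [of "x - y" y z] by (simp add: space_diff)

lemma B_nondeg: "x \<in> space_of G \<Longrightarrow> (\<And>y. y \<in> space_of G \<Longrightarrow> B x y = 0) \<Longrightarrow> x = 0"
  using nondeg by (auto simp: nondegenerate_form_def)

lemma B_nondeg_part:
  assumes x: "x \<in> part G p" "\<And>y. y \<in> part G p \<Longrightarrow> B x y = 0" shows "x = 0"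
proof (rule B_nondeg [OF part_space [OF x(1)]])
  fix y assume "y \<in> space_of G"
  then obtain a b where "a \<in> part G False" "b \<in> part G True" "y = a + b" by (rule space_cases)
  then show "B x y = 0"
    using x B_parts [of x b] B_parts' [of x a] by (cases p) (auto simp: B_add_right part_space)
qed

text \<open>Elimination replaces a dimension count. When \<open>d\<close> is new, some
  \<open>z'\<close> kills \<open>F\<close> but not \<open>d\<close>; correcting \<open>x\<close>
  along \<open>d\<close> and \<open>z\<close> along \<open>z'\<close> reduces the claim to
  \<open>F\<close>.\<close>

lemma orthogonal_vector:
  assumes "finite F" "F \<subseteq> part G False"
  shows "x \<in> part G False \<Longrightarrow> x \<notin> span F \<Longrightarrow> \<exists>z\<in>part G False. (\<forall>d\<in>F. B z d = 0) \<and> B z x \<noteq> 0"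
  using assms
proof (induction F arbitrary: x rule: finite_induct)
  case empty
  then have "x \<noteq> 0" by auto
  then obtain z where "z \<in> part G False" "B x z \<noteq> 0" using B_nondeg_part empty(1) by blast
  then show ?case using B_sym [of z False x False] empty(1) by (intro bexI [of _ z]) (simp_all add: ksign_def)
next
  case (insert d F)
  have d: "d \<in> part G False" "d \<in> space_of G" using insert part_space by auto
  show ?case
  proof (cases "d \<in> span F")
    case True
    have xs: "x \<notin> span F" using insert.prems(2) span_mono [of F "insert d F"] by blast
    then obtain z where z: "z \<in> part G False" "\<forall>d\<in>F. B z d = 0" "B z x \<noteq> 0"
      using insert.IH insert.prems by blast
    have "subspace {y \<in> space_of G. B z y = 0}"
      using part_space [OF z(1)] unfolding subspace_def
      by (auto simp: space_add space_scale B_add_right B_scale_right B_zero_right)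
    then have "span F \<subseteq> {y \<in> space_of G. B z y = 0}"
      using z(2) insert.prems part_space by (intro span_minimal) auto
    then show ?thesis using z True by blast
  next
    case False
    then obtain z' where z': "z' \<in> part G False" "\<forall>d\<in>F. B z' d = 0" "B z' d \<noteq> 0"
      using insert.IH [OF d(1)] insert.prems by auto
    have xs: "x \<in> space_of G" "z' \<in> space_of G" using insert.prems z' part_space by auto
    \<comment> \<open>The multiple of \<open>d\<close> is chosen so that \<open>B z' y = 0\<close>;
      then \<open>B w x\<close> below equals \<open>B z y\<close>.\<close>
    define y where "y = x - sscale G (B z' x / B z' d) d"
    have "y \<in> part G False" unfolding y_def using insert.prems d by (simp add: part_diff part_scale)
    moreover have "y \<notin> span F"
    proof
      assume "y \<in> span F"
      then have "y \<in> span (insert d F)" using span_mono [of F "insert d F"] by blast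
      moreover have "d \<in> span (insert d F)" by (rule span_base) simp
      ultimately have "y + sscale G (B z' x / B z' d) d \<in> span (insert d F)"
        by (intro span_add span_scale)
      then show False using insert.prems(2) by (simp add: y_def)
    qed
    ultimately obtain z where z: "z \<in> part G False" "\<forall>d\<in>F. B z d = 0" "B z y \<noteq> 0"
      using insert.IH insert.prems by blast
    have zs: "z \<in> space_of G" using z part_space by blast
    define w where "w = z - sscale G (B z d / B z' d) z'"
    have w: "w \<in> part G False" unfolding w_def using z z' by (simp add: part_diff part_scale)
    have Bw: "B w u = B z u - B z d / B z' d * B z' u" if "u \<in> space_of G" for u
      unfolding w_def using that zs xs by (simp add: B_diff_left space_scale B_scale_left)
    have "B z y = B z x - B z' x / B z' d * B z d"
      unfolding y_def using zs xs d by (simp add: B_diff_right space_scale B_scale_right)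
    then have "B w x \<noteq> 0" using z(3) Bw [OF xs(1)] by (simp add: mult.commute)
    moreover have "B w u = 0" if "u \<in> insert d F" for u
      using that Bw z z' insert.prems part_space d by auto
    ultimately show ?thesis using w by blast
  qed
qed

lemma B_root_spaces:
  assumes h: "\<hh> \<subseteq> part G False" and x: "x \<in> root_space G \<hh> \<beta>" and y: "y \<in> root_space G \<hh> \<gamma>"
    and k: "k \<in> \<hh>" "\<beta> k + \<gamma> k \<noteq> 0"
  shows "B x y = 0"
proof -
  have s: "x \<in> space_of G" "y \<in> space_of G" "k \<in> part G False" "k \<in> space_of G"
    using x y k h part_space by (auto simp: root_space_def)
  have "\<beta> k * B x y = B (brk G k x) y" using x k s by (simp add: root_space_def B_scale_left)
  also have "\<dots> = - B (brk G x k) y" using br_skew_even [of k x] s by (simp add: B_minus_left br_space)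
  also have "\<dots> = - B x (brk G k y)" using s by (simp add: B_inv)
  also have "\<dots> = - (\<gamma> k * B x y)" using y k s by (simp add: root_space_def B_scale_right)
  finally have "(\<beta> k + \<gamma> k) * B x y = 0" by (simp add: algebra_simps)
  then show ?thesis using k by simp
qed

text \<open>By invariance \<open>x\<close> is orthogonal to all root vectors whose weight is not
  \<open>- \<beta>\<close>, and to those of the other parity; non-degeneracy leaves a
  partner.\<close>

lemma dual_root_vector:
  assumes tor: "toral G \<hh>" and x: "x \<in> root_space G \<hh> \<beta>" "x \<in> part G p" "x \<noteq> 0"
  shows "\<exists>y\<in>root_space G \<hh> (- \<beta>) \<inter> part G p. B x y \<noteq> 0"
proof (rule ccontr)
  assume *: "\<not> ?thesis"
  have h: "\<hh> \<subseteq> part G False" using tor by (simp add: toral_def)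
  have xs: "x \<in> space_of G" using x by (simp add: root_space_def)
  have hom: "B x y = 0" if "y \<in> root_space G \<hh> \<gamma>" "y \<in> part G q" for y \<gamma> q
  proof (cases "q = p \<and> (\<forall>k\<in>\<hh>. \<beta> k + \<gamma> k = 0)")
    case True
    then have "\<gamma> k = (- \<beta>) k" if "k \<in> \<hh>" for k using that by (simp add: eq_neg_iff_add_eq_0 add.commute)
    then have "root_space G \<hh> \<gamma> = root_space G \<hh> (- \<beta>)" by (rule root_space_cong)
    then show ?thesis using * that True by blast
  next
    case False
    then show ?thesis
      using B_root_spaces [OF h x(1) that(1)] B_parts [of x y] B_parts' [of x y] x that by (cases p; cases q) auto
  qed
  have "y \<in> space_of G \<and> B x y = 0" if "y \<in> space_of G" for y
    using tor that
  proof (induction rule: toral_induct)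
    case subspace
    then show ?case unfolding subspace_def using xs
      by (auto simp: space_add space_scale B_add_right B_scale_right B_zero_right)
  qed (use hom part_space in blast)+
  then show False using B_nondeg [OF xs] x by blast
qed

lemma minus_dual: "\<beta> \<in> dual G \<hh> \<Longrightarrow> - \<beta> \<in> dual G \<hh>"
  by (auto simp: dual_def)

lemma roots_minus:
  assumes tor: "toral G \<hh>" and "\<beta> \<in> roots G \<hh>"
  shows "- \<beta> \<in> roots G \<hh>"
proof -
  have h: "\<hh> \<subseteq> part G False" using tor by (simp add: toral_def)
  have "\<hh> \<subseteq> space_of G" using h part_space by blast
  then have "0 \<in> root_space G \<hh> \<beta>" by (rule subspace_0 [OF root_space_subspace])
  then obtain x where x: "x \<in> root_space G \<hh> \<beta>" "x \<noteq> 0" using assms(2) by (auto simp: roots_def)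
  obtain a b where ab: "a \<in> part G False" "b \<in> part G True" "x = a + b"
    "a \<in> root_space G \<hh> \<beta>" "b \<in> root_space G \<hh> \<beta>"
    using root_space_cases [OF h x(1)] by blast
  then obtain c p where c: "c \<in> part G p" "c \<in> root_space G \<hh> \<beta>" "c \<noteq> 0"
  proof (cases "a = 0")
    case True
    then show ?thesis using that [of b True] ab x by simp
  next
    case False
    then show ?thesis using that [of a False] ab by simp
  qed
  obtain y where "y \<in> root_space G \<hh> (- \<beta>)" "B c y \<noteq> 0" using dual_root_vector [OF tor c(2,1,3)] by blast
  moreover from this have "y \<noteq> 0" using B_zero_right c part_space by blast
  moreover have "- \<beta> \<noteq> 0" using assms(2) by (auto simp: roots_def fun_eq_iff)
  ultimately show ?thesis using assms(2) minus_dual by (auto simp: roots_def)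
qed

end

text \<open>If the odd part of \<open>G \<otimes> 1\<close> acts trivially, so do all root vectors, because
  \<open>span [G\<^sub>1, G\<^sub>1]\<close> is the orthogonal complement of central elements.\<close>

lemma (in current_module) root_vectors_trivial:
  assumes adm: "admissible G" and form: "invariant_form G B" "nondegenerate_form G B"
    and ker: "part G True \<subseteq> kernel" and h: "\<hh> \<subseteq> part G False"
    and x: "x \<in> root_space G \<hh> \<beta>" and k: "k \<in> \<hh>" "\<beta> k \<noteq> 0" and u: "u \<in> space_of L"
  shows "A i x u = 0"
proof -
  interpret lie_superalg_form G B by unfold_locales (fact form)+
  \<comment> \<open>Odd elements act by zero in degree 0, so splitting the degree \<open>i\<close>
    of the bracket as \<open>0 + i\<close> kills it in every degree.\<close>
  have br_trivial: "A i (brk G z y) u = 0" if "z \<in> part G True" "y \<in> part G q" for z y q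
    using A_br [OF that u, of 0 i] that ker A_space [OF part_space [OF that(2)] u] u part_space that
    by (auto simp: kernel_def subset_iff)
  obtain a b where ab: "a \<in> part G False" "b \<in> part G True" "x = a + b"
    "a \<in> root_space G \<hh> \<beta>" "b \<in> root_space G \<hh> \<beta>"
    using root_space_cases [OF h x] by blast
  have kp: "k \<in> part G False" "k \<in> space_of G" using k h part_space by auto
  have s: "a \<in> space_of G" "b \<in> space_of G" using ab part_space by auto
  have "A i b u = 0"
  proof -
    \<comment> \<open>As \<open>\<beta> k \<noteq> 0\<close>, the odd root vector \<open>b\<close>
      is a multiple of its bracket with \<open>k\<close>.\<close>
    have "brk G b k = sscale G (- \<beta> k) b"
      using br_skew_even [OF kp(1) s(2)] ab(5) k by (simp add: root_space_def)
    then have "sscale L (- \<beta> k) (A i b u) = 0"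
      using br_trivial [OF ab(2) kp(1)] s u by (metis A_scale)
    then show ?thesis using k by simp
  qed
  moreover have "A i a u = 0"
  proof -
    let ?D = "{brk G y z | y z. y \<in> part G True \<and> z \<in> part G True}"
    have D: "?D \<subseteq> part G False" using br_part [of _ True _ True] by auto
    obtain X where X: "finite X" "space_of G \<subseteq> span X" using adm by (auto simp: admissible_def span_in_eq)
    have "?D \<subseteq> span X" using D X part_space by blast
    then obtain F where F: "finite F" "F \<subseteq> ?D" "?D \<subseteq> span F" using X(1) finite_spanning_subset by blast
    have Fs: "F \<subseteq> part G False" "F \<subseteq> space_of G" using F(2) D part_space by blast+
    have "a \<in> span F"
    proof (rule ccontr)
      \<comment> \<open>A witness \<open>z\<close> orthogonal to all brackets of odd elements
        commutes with the odd part by invariance, so it is central. Then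
        \<open>B z (brk G k a) = 0\<close>, although this is \<open>\<beta> k\<close> times
        \<open>B z a\<close>.\<close>
      assume "a \<notin> span F"
      then obtain z where z: "z \<in> part G False" "\<forall>d\<in>F. B z d = 0" "B z a \<noteq> 0"
        using orthogonal_vector [OF F(1) Fs(1) ab(1)] by blast
      have zs: "z \<in> space_of G" using z part_space by blast
      have "subspace {y \<in> space_of G. B z y = 0}"
        using zs unfolding subspace_def
        by (auto simp: space_add space_scale B_add_right B_scale_right B_zero_right)
      then have "span F \<subseteq> {y \<in> space_of G. B z y = 0}"
        using z(2) Fs(2) by (intro span_minimal) auto
      then have zD: "B z (brk G y w) = 0" if "y \<in> part G True" "w \<in> part G True" for y w
        using F(3) that by blast
      have "brk G z y = 0" if y: "y \<in> part G True" for y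
      proof (rule B_nondeg_part)
        show "brk G z y \<in> part G True" using br_part [OF z(1) y] by simp
        show "B (brk G z y) w = 0" if "w \<in> part G True" for w
          using zD [OF y that] B_inv zs y that part_space by simp
      qed
      then have "z \<in> center G" using adm z(1) by (auto simp: admissible_def)
      then have "brk G z k = 0" using kp by (simp add: center_def)
      then have "B z (brk G k a) = 0" using B_inv [OF zs kp(2) s(1)] B_zero_left s by simp
      then show False using z(3) k ab(4) s zs by (simp add: root_space_def B_scale_right)
    qed
    moreover have "span F \<subseteq> {y \<in> space_of G. A i y u \<in> {0}}"
      using F(2) br_trivial Fs(2) A_kernel_subspace [OF u L.subspace_single_0]
      by (intro span_minimal) auto
    ultimately show ?thesis by blast
  qed
  ultimately show ?thesis using ab s u by (simp add: A_add)
qed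

text \<open>Subtracting a multiple of \<open>x\<close> from \<open>b\<close> gives \<open>w\<close>
  orthogonal to \<open>y\<close>. Invariance makes \<open>brk G w y\<close> orthogonal to
  \<open>\<hh>\<close>, hence zero, and the last clause of \<open>reflection_root\<close> leaves
  only \<open>w = 0\<close>.\<close>

lemma (in lie_superalg_form) isotropic_root_line:
  assumes tor: "toral G \<hh>" and z0: "root_space G \<hh> (\<lambda>_. 0) \<subseteq> \<hh>"
    and good: "reflection_root G \<hh> \<alpha> x"
    and x: "x \<in> root_space G \<hh> \<alpha> \<inter> part G True" and y: "y \<in> root_space G \<hh> (- \<alpha>) \<inter> part G True"
    and xy: "B x y \<noteq> 0" and z: "z \<in> root_space G \<hh> \<alpha>"
  shows "\<exists>c. z = sscale G c x"
proof -
  have h: "\<hh> \<subseteq> part G False" "\<hh> \<subseteq> space_of G" using tor part_space by (auto simp: toral_def)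
  have s: "x \<in> space_of G" "y \<in> space_of G" using x y part_space by auto
  obtain a b where ab: "a \<in> part G False" "b \<in> part G True" "z = a + b"
    "a \<in> root_space G \<hh> \<alpha>" "b \<in> root_space G \<hh> \<alpha>"
    using root_space_cases [OF h(1) z] by blast
  have a0: "a = 0" using good ab by (auto simp: reflection_root_def)
  define w where "w = b - sscale G (B b y / B x y) x"
  have bs: "b \<in> space_of G" using ab part_space by blast
  have w: "w \<in> root_space G \<hh> \<alpha>" "w \<in> part G True"
    unfolding w_def using ab x subspace_diff [OF root_space_subspace [OF h(2)]] subspace_scale [OF root_space_subspace [OF h(2)]]
    by (auto simp: part_diff part_scale)
  then have ws: "w \<in> space_of G" using part_space by blast
  have "B w y = 0" unfolding w_def using s bs xy by (simp add: B_diff_left space_scale B_scale_left)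
  have "brk G w y \<in> root_space G \<hh> (\<alpha> + - \<alpha>)" using root_space_br [OF h(1) w(1)] y by blast
  then have wy: "brk G w y \<in> root_space G \<hh> (\<lambda>_. 0)" by (simp add: root_space_def)
  have "brk G w y = 0"
  proof (rule ccontr)
    assume nz: "brk G w y \<noteq> 0"
    have "brk G w y \<in> part G False" using br_part [OF w(2), of y True] y by auto
    then obtain k where k: "k \<in> root_space G \<hh> (- (\<lambda>_. 0))" "B (brk G w y) k \<noteq> 0"
      using dual_root_vector [OF tor wy _ nz] by blast
    have "root_space G \<hh> (- (\<lambda>_. 0)) = root_space G \<hh> (\<lambda>_. 0)" by (rule root_space_cong) simp
    then have kh: "k \<in> \<hh>" using k(1) z0 by blast
    then have "- brk G y k = - sscale G (\<alpha> k) y"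
      using y h br_skew_even [of k y] s by (auto simp: root_space_def subset_iff)
    then have "brk G y k = sscale G (\<alpha> k) y" by simp
    then have "B (brk G w y) k = \<alpha> k * B w y"
      using B_inv [OF ws s(2), of k] kh h ws s by (auto simp: B_scale_right)
    then show False using k \<open>B w y = 0\<close> by simp
  qed
  then have "w = 0 \<or> y = 0" using good w y by (auto simp: reflection_root_def)
  then have "w = 0" using xy B_zero_right s by auto
  then show ?thesis using ab a0 by (auto simp: w_def)
qed

text \<open>\<open>e\<close> and \<open>f\<close> come without parity and are normalized only
  through \<open>brk G e f\<close>. They are compared with an odd pair \<open>x\<close>,
  \<open>y\<close> with \<open>B x y \<noteq> 0\<close>: invariance identifies
  \<open>brk G x y / B x y\<close> with the vector of \<open>\<hh>\<close> dual to \<alpha>, and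
  this equals \<open>brk G e f\<close>. Isotropy then triggers the reflection clause of
  admissibility for \<alpha> and for \<open>- \<alpha>\<close>.\<close>

lemma (in lie_superalg_form) coroot:
  assumes tor: "toral G \<hh>" and adm: "admissible G"
    and \<alpha>: "odd_root G \<hh> \<alpha>" "dual_form B \<hh> \<alpha> \<alpha> = 0"
    and e: "e \<in> root_space G \<hh> \<alpha>" "e \<noteq> 0" and f: "f \<in> root_space G \<hh> (- \<alpha>)" "f \<noteq> 0"
    and t: "brk G e f \<in> \<hh>" "\<forall>\<nu>\<in>dual G \<hh>. \<nu> (brk G e f) = dual_form B \<hh> \<nu> \<alpha>"
  shows "e \<in> part G True" "f \<in> part G True"
    "z \<in> root_space G \<hh> \<alpha> \<Longrightarrow> \<exists>c. z = sscale G c e"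
    "z \<in> root_space G \<hh> (- \<alpha>) \<Longrightarrow> \<exists>c. z = sscale G c f"
    "brk G f f = 0" "\<alpha> (brk G e f) = 0" "root_space G \<hh> (\<alpha> + \<alpha>) = {0}"
proof -
  have h: "\<hh> \<subseteq> part G False" "\<hh> \<subseteq> space_of G" "subspace \<hh>"
    using tor part_space by (auto simp: toral_def)
  have \<alpha>d: "\<alpha> \<in> dual G \<hh>" using \<alpha> by (simp add: odd_root_def roots_def)
  \<comment> \<open>Weight 0 is exhausted by \<open>\<hh>\<close>: its odd part vanishes by
    admissibility, and its even part is the centralizer of \<open>\<hh>\<close>.\<close>
  have z0: "root_space G \<hh> (\<lambda>_. 0) \<subseteq> \<hh>"
  proof
    fix z assume z: "z \<in> root_space G \<hh> (\<lambda>_. 0)"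
    obtain a b where ab: "a \<in> part G False" "b \<in> part G True" "z = a + b"
      "a \<in> root_space G \<hh> (\<lambda>_. 0)" "b \<in> root_space G \<hh> (\<lambda>_. 0)"
      using root_space_cases [OF h(1) z] by blast
    then have "b = 0" using adm tor by (auto simp: admissible_def)
    moreover have "a \<in> \<hh>" using ab tor by (auto simp: toral_def root_space_def)
    ultimately show "z \<in> \<hh>" using ab by simp
  qed
  have h0: "k \<in> root_space G \<hh> (\<lambda>_. 0)" if "k \<in> \<hh>" for k
    using that h tor by (auto simp: root_space_def toral_def)
  \<comment> \<open>Weight 0 pairs with weight 0 only, so the form is non-degenerate on
    \<open>\<hh>\<close>.\<close>
  have B_h: "k = 0" if k: "k \<in> \<hh>" "\<And>k'. k' \<in> \<hh> \<Longrightarrow> B k k' = 0" for k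
  proof (rule ccontr)
    assume "k \<noteq> 0"
    then obtain y where "y \<in> root_space G \<hh> (- (\<lambda>_. 0))" "B k y \<noteq> 0"
      using dual_root_vector [OF tor h0 [OF k(1)], of False] k(1) h by blast
    moreover have "root_space G \<hh> (- (\<lambda>_. 0)) = root_space G \<hh> (\<lambda>_. 0)" by (rule root_space_cong) simp
    ultimately show False using z0 k by blast
  qed
  have "0 \<in> root_space G \<hh> \<alpha> \<inter> part G True"
    using subspace_0 [OF root_space_subspace [OF h(2)]] by simp
  then obtain x where x: "x \<in> root_space G \<hh> \<alpha>" "x \<in> part G True" "x \<noteq> 0"
    using \<alpha> by (auto simp: odd_root_def)
  obtain y where y: "y \<in> root_space G \<hh> (- \<alpha>)" "y \<in> part G True" "B x y \<noteq> 0"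
    using dual_root_vector [OF tor x] by blast
  have s: "x \<in> space_of G" "y \<in> space_of G" using x y part_space by auto
  have "brk G x y \<in> root_space G \<hh> (\<alpha> + - \<alpha>)" by (rule root_space_br [OF h(1) x(1) y(1)])
  then have sh: "brk G x y \<in> \<hh>" using z0 by (auto simp: root_space_def)
  have Bs: "B (brk G x y) k = \<alpha> k * B x y" if k: "k \<in> \<hh>" for k
  proof -
    have "- brk G y k = - sscale G (\<alpha> k) y"
      using y h br_skew_even [of k y] s k by (auto simp: root_space_def subset_iff)
    then have "brk G y k = sscale G (\<alpha> k) y" by simp
    then show ?thesis using B_inv [OF s, of k] k h s by (auto simp: B_scale_right)
  qed
  \<comment> \<open>This evaluates the definite description in \<open>dual_vec\<close>.\<close>
  have unique: "dual_vec B \<hh> \<nu> = k" if k: "k \<in> \<hh>" "\<And>k'. k' \<in> \<hh> \<Longrightarrow> B k k' = \<nu> k'" for \<nu> k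
    unfolding dual_vec_def
  proof (rule the_equality)
    show "k \<in> \<hh> \<and> (\<forall>x\<in>\<hh>. B k x = \<nu> x)" using k by blast
    fix k' assume k': "k' \<in> \<hh> \<and> (\<forall>x\<in>\<hh>. B k' x = \<nu> x)"
    have "k' - k = 0"
      using k k' h by (intro B_h) (auto simp: subspace_diff B_diff_left subset_iff)
    then show "k' = k" by simp
  qed
  define t\<alpha> where "t\<alpha> = sscale G (inverse (B x y)) (brk G x y)"
  have t\<alpha>: "t\<alpha> \<in> \<hh>" unfolding t\<alpha>_def using sh h(3) by (simp add: subspace_scale)
  have Bt\<alpha>: "B t\<alpha> k = \<alpha> k" if "k \<in> \<hh>" for k
    unfolding t\<alpha>_def using Bs [OF that] that h br_space [OF s] y(3) by (auto simp: B_scale_left)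
  \<comment> \<open>The two vectors are tested against the functionals \<open>B k\<close> restricted
    to \<open>\<hh>\<close>, whose dual vectors are the \<open>k\<close> themselves.\<close>
  have "brk G e f - t\<alpha> = 0"
  proof (rule B_h)
    show d: "brk G e f - t\<alpha> \<in> \<hh>" using t t\<alpha> h(3) by (simp add: subspace_diff)
    fix k assume k: "k \<in> \<hh>"
    define \<nu> where "\<nu> k' = (if k' \<in> \<hh> then B k k' else 0)" for k'
    have "\<nu> \<in> dual G \<hh>"
      using k h by (auto simp: dual_def \<nu>_def B_add_right B_scale_right subspace_add subspace_scale subset_iff)
    then have "\<nu> (brk G e f) = dual_form B \<hh> \<nu> \<alpha>" using t by blast
    then have "B k (brk G e f) = B k t\<alpha>"
      using unique [OF k, of \<nu>] unique [OF t\<alpha>, of \<alpha>] Bt\<alpha> t by (simp add: dual_form_def \<nu>_def)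
    then have "B k (brk G e f - t\<alpha>) = 0" using k t t\<alpha> h by (auto simp: B_diff_right subset_iff)
    then show "B (brk G e f - t\<alpha>) k = 0"
      using B_sym [of "brk G e f - t\<alpha>" False k False] d k h by (auto simp: ksign_def)
  qed
  then have tt: "brk G e f = t\<alpha>" by simp
  show at: "\<alpha> (brk G e f) = 0" using t \<alpha> \<alpha>d by simp
  then have as: "\<alpha> (brk G x y) = 0"
    using tt y(3) \<alpha>d sh by (simp add: t\<alpha>_def dual_def)
  have sx: "brk G (brk G x y) x = 0" using x(1) sh as by (simp add: root_space_def)
  have sy: "brk G (brk G y x) y = 0" using y(1) sh as br_sym_odd [OF x(2) y(2)] by (simp add: root_space_def)
  have mm: "- (- \<alpha>) = \<alpha>" by (simp add: fun_eq_iff)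
  have Byx: "B y x \<noteq> 0" using y(3) B_sym [OF x(2) y(2)] by simp
  have good: "reflection_root G \<hh> \<alpha> x" "reflection_root G \<hh> (- \<alpha>) y"
    using adm tor form x y sx sy Byx mm unfolding admissible_def by (metis IntI)+
  have line: "\<exists>c. z = sscale G c x" if "z \<in> root_space G \<hh> \<alpha>" for z
    using isotropic_root_line [OF tor z0 good(1) _ _ y(3) that] x y by blast
  have line': "\<exists>c. z = sscale G c y" if "z \<in> root_space G \<hh> (- \<alpha>)" for z
    using isotropic_root_line [OF tor z0 good(2) _ _ Byx that] x y mm by simp
  obtain c where c: "e = sscale G c x" "c \<noteq> 0" using line [OF e(1)] e(2) by auto
  obtain d where d: "f = sscale G d y" "d \<noteq> 0" using line' [OF f(1)] f(2) by auto
  show "e \<in> part G True" "f \<in> part G True" using c d x y by (auto simp: part_scale)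
  show "\<exists>c. z = sscale G c e" if z: "z \<in> root_space G \<hh> \<alpha>"
  proof -
    obtain a where "z = sscale G a x" using line [OF z] by blast
    then show ?thesis using c by (intro exI [of _ "a / c"]) simp
  qed
  show "\<exists>c. z = sscale G c f" if z: "z \<in> root_space G \<hh> (- \<alpha>)"
  proof -
    obtain a where "z = sscale G a y" using line' [OF z] by blast
    then show ?thesis using d by (intro exI [of _ "a / d"]) simp
  qed
  show "brk G f f = 0" using good(2) d s by (simp add: reflection_root_def br_scale_left br_scale_right space_scale)
  show "root_space G \<hh> (\<alpha> + \<alpha>) = {0}"
    using good(1) subspace_0 [OF root_space_subspace [OF h(2)]] by (auto simp: reflection_root_def)
qed

text \<open>For toral \<open>\<hh>\<close> this is the computation in
  \<open>odd_reflection_setting\<close>. If the odd part acts trivially in degree 0, all root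
  vectors act by zero in all degrees, hence so does \<open>brk G e f\<close>; then all pairings with
  \<alpha> are zero, and \<open>v\<close> is a highest weight vector for the reflected system as
  well.\<close>

theorem odd_reflection_of_admissible:
  assumes lie: "lie_superalgebra G" and adm: "admissible G"
    and inv: "invariant_form G B" and nd: "nondegenerate_form G B"
    and cartan: "cartan_subalgebra G \<hh>" and pos: "positive_system G \<hh> P"
    and O: "category_O G \<hh> P l L" and simple: "simple_module (current l G) L"
    and hw: "highest_weight_vector G \<hh> P l L \<Lambda> v"
    and \<alpha>: "simple_root P \<alpha>" "odd_root G \<hh> \<alpha>" "dual_form B \<hh> \<alpha> \<alpha> = 0"
    and e: "e \<in> root_space G \<hh> \<alpha>" "e \<noteq> 0" and f: "f \<in> root_space G \<hh> (- \<alpha>)" "f \<noteq> 0"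
    and t: "brk G e f \<in> \<hh>" "\<forall>\<nu>\<in>dual G \<hh>. \<nu> (brk G e f) = dual_form B \<hh> \<nu> \<alpha>"
  shows "(\<forall>k\<le>l. dual_form B \<hh> (weight_component l \<hh> \<Lambda> k) \<alpha> \<noteq> 0 \<and>
            (\<forall>j. k < j \<and> j \<le> l \<longrightarrow> dual_form B \<hh> (weight_component l \<hh> \<Lambda> j) \<alpha> = 0) \<longrightarrow>
            (\<exists>\<mu>. highest_weight_vector G \<hh> (odd_reflection P \<alpha>) l L \<mu>
                    (foldr (\<lambda>i. act L (cur l f i)) [0..<Suc k] v)))
       \<and> ((\<forall>k\<le>l. dual_form B \<hh> (weight_component l \<hh> \<Lambda> k) \<alpha> = 0) \<longrightarrow>
            (\<exists>\<mu>. highest_weight_vector G \<hh> (odd_reflection P \<alpha>) l L \<mu> v))"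
proof -
  interpret lie_superalg_form G B by unfold_locales (fact lie inv nd)+
  interpret current_module G l L
    using O by unfold_locales (simp add: category_O_def)
  have h: "subspace \<hh>" "\<hh> \<subseteq> part G False" "\<hh> \<subseteq> space_of G"
    using cartan part_space by (auto simp: cartan_subalgebra_def subspace_in_def)
  obtain H where H: "H \<in> \<hh>" "\<forall>\<beta>\<in>roots G \<hh>. Re (\<beta> H) \<noteq> 0" "P = {\<beta> \<in> roots G \<hh>. Re (\<beta> H) > 0}"
    using pos by (auto simp: positive_system_def)
  \<comment> \<open>The pairing of a weight component with \<alpha> is its value at the coroot, that
    is, the scalar by which the coroot acts in degree \<open>k\<close>.\<close>
  have component: "dual_form B \<hh> (weight_component l \<hh> \<Lambda> k) \<alpha> = \<Lambda> (cur l (brk G e f) k)" if "k \<le> l" for k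
  proof -
    have "cur l x k \<in> current_set l \<hh>" if "x \<in> \<hh>" for x
      using that subspace_0 [OF h(1)] by (auto simp: current_set_def cur_def)
    then have "weight_component l \<hh> \<Lambda> k \<in> dual G \<hh>"
      using hw unfolding highest_weight_vector_def
      by (auto simp: dual_def weight_component_def subspace_add [OF h(1)] subspace_scale [OF h(1)] cur_add cur_scale)
    then show ?thesis using t by (metis weight_component_def)
  qed
  have A_fold: "foldr (\<lambda>i. act L (cur l f i)) js v = foldr (\<lambda>i. A i f) js v" for js
    by (simp add: A_def [abs_def])
  have "toral G \<hh> \<or> part G True \<subseteq> kernel"
    using cartan_toral_or_odd_trivial [OF cartan adm] O by (auto simp: category_O_def A_def L.span_in_eq)
  then show ?thesis
  proof
    assume tor: "toral G \<hh>"
    interpret odd_reflection_setting G l L \<hh> P H \<Lambda> v \<alpha> e f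
      using tor simple H roots_minus [OF tor] hw \<alpha> e f t coroot [OF tor adm \<alpha>(2,3) e f t]
      by unfold_locales blast+
    show ?thesis
      using reflected_nonzero reflected_zero component by (auto simp: A_fold simp del: upt_Suc)
  next
    assume ker: "part G True \<subseteq> kernel"
    have \<alpha>P: "\<alpha> \<in> P" "\<alpha> \<noteq> 0" "\<alpha> \<in> dual G \<hh>" using \<alpha> H by (auto simp: simple_root_def roots_def)
    have nz: "\<exists>k\<in>\<hh>. \<beta> k \<noteq> 0" if "\<beta> \<in> dual G \<hh>" "\<beta> \<noteq> 0" for \<beta>
      using that by (auto simp: dual_def fun_eq_iff)
    have trivial: "A i x u = 0" if "\<beta> \<in> dual G \<hh>" "\<beta> \<noteq> 0" "x \<in> root_space G \<hh> \<beta>" "u \<in> space_of L" for i x u \<beta>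
      using nz [OF that(1,2)] root_vectors_trivial [OF adm inv nd ker h(2) that(3) _ _ that(4)] by blast
    note v = highest_weight_vectorD [OF hw h(1)]
    have m\<alpha>: "- \<alpha> \<in> dual G \<hh>" "- \<alpha> \<noteq> 0" using \<alpha>P minus_dual by (auto simp: fun_eq_iff)
    have es: "e \<in> space_of G" "f \<in> space_of G" using e f root_space_space by auto
    have "A i (brk G e f) v = 0" for i
    proof -
      obtain a b where ab: "a \<in> part G False" "b \<in> part G True" "e = a + b"
        "a \<in> root_space G \<hh> \<alpha>" "b \<in> root_space G \<hh> \<alpha>"
        using root_space_cases [OF h(2) e(1)] by blast
      obtain c d where cd: "c \<in> part G False" "d \<in> part G True" "f = c + d"
        "c \<in> root_space G \<hh> (- \<alpha>)" "d \<in> root_space G \<hh> (- \<alpha>)"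
        using root_space_cases [OF h(2) f(1)] by blast
      have "A i (brk G x y) v = 0"
        if "x \<in> part G p" "y \<in> part G q" "x \<in> root_space G \<hh> \<alpha>" "y \<in> root_space G \<hh> (- \<alpha>)" for x y p q
        using A_br [OF that(1,2) v(1), of 0 i] trivial [OF \<alpha>P(3,2) that(3)] trivial [OF m\<alpha> that(4)] v(1)
          A_space part_space that by simp
      then show ?thesis
        using ab cd v(1) by (simp add: br_add_left br_add_right br_space part_space space_add A_add)
    qed
    then have zero: "\<Lambda> (cur l (brk G e f) i) = 0" for i using v(4) [OF t(1), of i] v(2) by simp
    have "\<exists>\<mu>. highest_weight_vector G \<hh> (odd_reflection P \<alpha>) l L \<mu> v"
    proof (rule highest_weight_vectorI [OF h(1,2) v(1,2)])
      fix \<beta> x i assume "\<beta> \<in> odd_reflection P \<alpha>" and x: "x \<in> root_space G \<hh> \<beta>"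
      then consider "\<beta> = - \<alpha>" | "\<beta> \<in> P" by (auto simp: odd_reflection_def)
      then show "A i x v = 0"
        using v(3) [OF _ x] trivial [OF m\<alpha> _ v(1)] x by cases auto
    qed (use v(4) in blast)
    then show ?thesis using component zero by auto
  qed
qed

section \<open>Transport along isomorphisms\<close>

lemma admissible_central:
  "admissible K \<Longrightarrow> z \<in> part K False \<Longrightarrow> (\<And>y. y \<in> part K True \<Longrightarrow> brk K z y = 0) \<Longrightarrow> z \<in> center K"
  and admissible_bracket:
  "admissible K \<Longrightarrow> x \<in> part K False \<Longrightarrow> y \<in> space_of K \<Longrightarrow> brk K x y \<in> center K \<Longrightarrow> brk K x y = 0"
  and admissible_ideals:
  "admissible K \<Longrightarrow> toral K (part K False) \<or> (\<forall>I. graded_ideal K I \<longrightarrow> I \<subseteq> center K \<or> part K True \<subseteq> I)"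
  and admissible_zero_weight:
  "admissible K \<Longrightarrow> toral K \<hh> \<Longrightarrow> root_space K \<hh> (\<lambda>_. 0) \<inter> part K True \<subseteq> {0}"
  and admissible_reflection:
  "admissible K \<Longrightarrow> toral K \<hh> \<Longrightarrow> invariant_form K B \<Longrightarrow> e \<in> root_space K \<hh> a \<inter> part K True \<Longrightarrow>
   f \<in> root_space K \<hh> (- a) \<inter> part K True \<Longrightarrow> B e f \<noteq> 0 \<Longrightarrow> brk K (brk K e f) e = 0 \<Longrightarrow> reflection_root K \<hh> a e"
proof -
  assume adm: "admissible K"
  note D = adm [unfolded admissible_def]
  show "z \<in> part K False \<Longrightarrow> (\<And>y. y \<in> part K True \<Longrightarrow> brk K z y = 0) \<Longrightarrow> z \<in> center K"
    using D [THEN conjunct2, THEN conjunct1] by simp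
  show "x \<in> part K False \<Longrightarrow> y \<in> space_of K \<Longrightarrow> brk K x y \<in> center K \<Longrightarrow> brk K x y = 0"
    using D [THEN conjunct2, THEN conjunct2, THEN conjunct1] by simp
  show "toral K (part K False) \<or> (\<forall>I. graded_ideal K I \<longrightarrow> I \<subseteq> center K \<or> part K True \<subseteq> I)"
    using D [THEN conjunct2, THEN conjunct2, THEN conjunct2, THEN conjunct1] by simp
  show "toral K \<hh> \<Longrightarrow> root_space K \<hh> (\<lambda>_. 0) \<inter> part K True \<subseteq> {0}"
    using D [THEN conjunct2, THEN conjunct2, THEN conjunct2, THEN conjunct2, THEN conjunct1] by simp
  show "toral K \<hh> \<Longrightarrow> invariant_form K B \<Longrightarrow> e \<in> root_space K \<hh> a \<inter> part K True \<Longrightarrow>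
   f \<in> root_space K \<hh> (- a) \<inter> part K True \<Longrightarrow> B e f \<noteq> 0 \<Longrightarrow> brk K (brk K e f) e = 0 \<Longrightarrow> reflection_root K \<hh> a e"
    using D [THEN conjunct2, THEN conjunct2, THEN conjunct2, THEN conjunct2, THEN conjunct2] by metis
qed

text \<open>The target is given no Lie axioms, only a scalar multiplication; \<open>lie_K\<close>
  obtains them from \<open>G\<close>. So the Jacobi identities of the concrete models are available
  without computation.\<close>

locale superalg_iso = lie_superalg G + K: complex_vs "sscale K"
  for G :: "('a::ab_group_add) superalgebra" and K :: "('b::ab_group_add) superalgebra" +
  fixes \<phi> :: "'a \<Rightarrow> 'b"
  assumes bij: "bij_betw \<phi> (space_of G) (space_of K)"
    and \<phi>_add: "x \<in> space_of G \<Longrightarrow> y \<in> space_of G \<Longrightarrow> \<phi> (x + y) = \<phi> x + \<phi> y"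
    and \<phi>_br: "x \<in> space_of G \<Longrightarrow> y \<in> space_of G \<Longrightarrow> \<phi> (brk G x y) = brk K (\<phi> x) (\<phi> y)"
    and \<phi>_scale: "x \<in> space_of G \<Longrightarrow> \<phi> (sscale G c x) = sscale K c (\<phi> x)"
    and \<phi>_part: "\<phi> ` part G p = part K p"
begin

definition \<psi> :: "'b \<Rightarrow> 'a" where "\<psi> = inv_into (space_of G) \<phi>"

lemma \<psi>_space: "y \<in> space_of K \<Longrightarrow> \<psi> y \<in> space_of G"
  and \<phi>_\<psi>: "y \<in> space_of K \<Longrightarrow> \<phi> (\<psi> y) = y"
  and \<psi>_\<phi>: "x \<in> space_of G \<Longrightarrow> \<psi> (\<phi> x) = x"
  and \<phi>_space: "x \<in> space_of G \<Longrightarrow> \<phi> x \<in> space_of K"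
  using bij unfolding \<psi>_def bij_betw_def
  by (auto simp: inv_into_into f_inv_into_f inv_into_f_f)

lemma \<phi>_inj: "x \<in> space_of G \<Longrightarrow> y \<in> space_of G \<Longrightarrow> \<phi> x = \<phi> y \<Longrightarrow> x = y"
  using bij by (auto simp: bij_betw_def inj_on_def)

lemma \<phi>_zero [simp]: "\<phi> 0 = 0"
  using \<phi>_scale [of 0 0] by simp

lemma \<phi>_eq_zero: "x \<in> space_of G \<Longrightarrow> \<phi> x = 0 \<longleftrightarrow> x = 0"
  using \<phi>_inj [of x 0] by auto

lemma \<phi>_br_zero: "x \<in> space_of G \<Longrightarrow> y \<in> space_of G \<Longrightarrow> brk K (\<phi> x) (\<phi> y) = 0 \<longleftrightarrow> brk G x y = 0"
  using \<phi>_eq_zero [OF br_space] by (simp add: \<phi>_br)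

lemma space_K: "space_of K = \<phi> ` space_of G"
  using bij by (auto simp: bij_betw_def)

lemma part_K: "x \<in> space_of G \<Longrightarrow> \<phi> x \<in> part K p \<longleftrightarrow> x \<in> part G p"
  using \<phi>_part [of p] \<phi>_inj part_space by blast

lemma part_imageI: "x \<in> part G p \<Longrightarrow> \<phi> x \<in> part K p"
  using part_K part_space by simp

lemma part_imageE: "y \<in> part K p \<Longrightarrow> \<exists>x\<in>part G p. y = \<phi> x"
  using \<phi>_part [of p] by auto

lemma image_subspace: "subspace V \<Longrightarrow> V \<subseteq> space_of G \<Longrightarrow> K.subspace (\<phi> ` V)"
  unfolding K.subspace_def
proof (intro conjI ballI allI)
  assume V: "subspace V" "V \<subseteq> space_of G"
  show "0 \<in> \<phi> ` V" using subspace_0 [OF V(1)] \<phi>_zero by (metis imageI)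
  show "x + y \<in> \<phi> ` V" if "x \<in> \<phi> ` V" "y \<in> \<phi> ` V" for x y
    using that V \<phi>_add subspace_add [OF V(1)] by (smt (verit) imageE imageI subsetD)
  show "sscale K c x \<in> \<phi> ` V" if "x \<in> \<phi> ` V" for c x
    using that V \<phi>_scale subspace_scale [OF V(1)] by (smt (verit) imageE imageI subsetD)
qed

lemma lie_K: "lie_superalgebra K"
  unfolding lie_superalgebra_def
proof (intro conjI)
  show "is_superspace K"
    unfolding is_superspace_def
  proof (intro conjI allI)
    show "vector_space (sscale K)" by (rule K.vector_space_axioms)
    show "K.subspace (part K p)" for p
      unfolding \<phi>_part [symmetric] using part_subspace part_space by (intro image_subspace) auto
    show "part K False \<inter> part K True = {0}"
      unfolding \<phi>_part [symmetric] using \<phi>_inj part_space part_inter \<phi>_zero part_zero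
      by (auto simp: image_iff) (metis \<phi>_zero part_zero)+
  qed
  show "\<forall>x\<in>space_of K. \<forall>y\<in>space_of K. \<forall>z\<in>space_of K.
        brk K (x + y) z = brk K x z + brk K y z \<and> brk K z (x + y) = brk K z x + brk K z y"
    unfolding space_K by (auto simp: \<phi>_add [symmetric] \<phi>_br [symmetric] br_add_left br_add_right br_space space_add)
  show "\<forall>c. \<forall>x\<in>space_of K. \<forall>y\<in>space_of K. brk K (sscale K c x) y = sscale K c (brk K x y) \<and>
          brk K x (sscale K c y) = sscale K c (brk K x y)"
    unfolding space_K by (auto simp: \<phi>_scale [symmetric] \<phi>_br [symmetric] br_scale_left br_scale_right br_space space_scale)
  have pre: "\<exists>x'\<in>part G p. \<exists>y'\<in>part G q. x = \<phi> x' \<and> y = \<phi> y' \<and> x' \<in> space_of G \<and> y' \<in> space_of G"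
    if x: "x \<in> part K p" and y: "y \<in> part K q" for x y p q
  proof -
    have "x \<in> \<phi> ` part G p" "y \<in> \<phi> ` part G q" using x y by (simp_all add: \<phi>_part)
    then show ?thesis using part_space by blast
  qed
  show "\<forall>p q. \<forall>x\<in>part K p. \<forall>y\<in>part K q. brk K x y \<in> part K (p \<noteq> q)"
  proof (intro allI ballI)
    fix p q x y assume "x \<in> part K p" "y \<in> part K q"
    then obtain x' y' where "x' \<in> part G p" "y' \<in> part G q" "x' \<in> space_of G" "y' \<in> space_of G" "x = \<phi> x'" "y = \<phi> y'"
      using pre by blast
    then show "brk K x y \<in> part K (p \<noteq> q)"
      using imageI [OF br_part, of x' p y' q \<phi>] \<phi>_part [of "p \<noteq> q"] by (simp add: \<phi>_br)
  qed
  show "\<forall>p q. \<forall>x\<in>part K p. \<forall>y\<in>part K q. brk K x y = sscale K (- ksign p q) (brk K y x)"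
  proof (intro allI ballI)
    fix p q x y assume "x \<in> part K p" "y \<in> part K q"
    then obtain x' y' where *: "x' \<in> part G p" "y' \<in> part G q" "x' \<in> space_of G" "y' \<in> space_of G" "x = \<phi> x'" "y = \<phi> y'"
      using pre by blast
    then show "brk K x y = sscale K (- ksign p q) (brk K y x)"
      using br_skew [OF *(1,2)] \<phi>_scale [of "brk G y' x'" "- ksign p q"] by (simp add: \<phi>_br [symmetric] br_space)
  qed
  show "\<forall>p q. \<forall>x\<in>part K p. \<forall>y\<in>part K q. \<forall>z\<in>space_of K.
        brk K x (brk K y z) = brk K (brk K x y) z + sscale K (ksign p q) (brk K y (brk K x z))"
  proof (intro allI ballI)
    fix p q x y z assume "x \<in> part K p" "y \<in> part K q" "z \<in> space_of K"
    then obtain x' y' z' where *: "x' \<in> part G p" "y' \<in> part G q" "z' \<in> space_of G" "x = \<phi> x'" "y = \<phi> y'" "z = \<phi> z'"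
      using pre space_K by blast
    then have s: "x' \<in> space_of G" "y' \<in> space_of G" using part_space by auto
    show "brk K x (brk K y z) = brk K (brk K x y) z + sscale K (ksign p q) (brk K y (brk K x z))"
      using jacobi [OF *(1-3)] s *(3)
      by (simp add: * \<phi>_add [symmetric] \<phi>_br [symmetric] \<phi>_scale [symmetric] br_space space_scale)
  qed
qed

sublocale L: lie_superalg K by unfold_locales (rule lie_K)

lemma \<psi>_simps:
  "x \<in> space_of K \<Longrightarrow> y \<in> space_of K \<Longrightarrow> \<psi> (x + y) = \<psi> x + \<psi> y"
  "x \<in> space_of K \<Longrightarrow> \<psi> (sscale K c x) = sscale G c (\<psi> x)"
  "x \<in> space_of K \<Longrightarrow> y \<in> space_of K \<Longrightarrow> \<psi> (brk K x y) = brk G (\<psi> x) (\<psi> y)"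
  "x \<in> part K p \<Longrightarrow> \<psi> x \<in> part G p"
proof -
  show "\<psi> (x + y) = \<psi> x + \<psi> y" if "x \<in> space_of K" "y \<in> space_of K"
    using that \<psi>_\<phi> [of "\<psi> x + \<psi> y"] by (simp add: \<phi>_add \<psi>_space space_add \<phi>_\<psi>)
  show "\<psi> (sscale K c x) = sscale G c (\<psi> x)" if "x \<in> space_of K"
    using that \<psi>_\<phi> [of "sscale G c (\<psi> x)"] by (simp add: \<phi>_scale \<psi>_space space_scale \<phi>_\<psi>)
  show "\<psi> (brk K x y) = brk G (\<psi> x) (\<psi> y)" if "x \<in> space_of K" "y \<in> space_of K"
    using that \<psi>_\<phi> [of "brk G (\<psi> x) (\<psi> y)"] by (simp add: \<phi>_br \<psi>_space br_space \<phi>_\<psi>)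
  show "\<psi> x \<in> part G p" if "x \<in> part K p"
    using that part_K [of "\<psi> x" p] L.part_space [OF that] by (simp add: \<psi>_space \<phi>_\<psi>)
qed

lemma form_K: "invariant_form G B \<Longrightarrow> invariant_form K (\<lambda>x y. B (\<psi> x) (\<psi> y))"
  unfolding invariant_form_def
  using \<psi>_simps(4) \<psi>_space L.br_space
  by (simp add: \<psi>_simps(1-3)) 

lemma nondegenerate_K: "nondegenerate_form G B \<Longrightarrow> nondegenerate_form K (\<lambda>x y. B (\<psi> x) (\<psi> y))"
  unfolding nondegenerate_form_def space_K using \<psi>_\<phi> by auto

lemma root_space_K:
  assumes "\<hh> \<subseteq> space_of G" "x \<in> space_of G"
  shows "\<phi> x \<in> root_space K (\<phi> ` \<hh>) a \<longleftrightarrow> x \<in> root_space G \<hh> (\<lambda>k. a (\<phi> k))"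
proof -
  have "brk K (\<phi> k) (\<phi> x) = sscale K (a (\<phi> k)) (\<phi> x) \<longleftrightarrow> brk G k x = sscale G (a (\<phi> k)) x"
    if "k \<in> \<hh>" for k
  proof -
    have "k \<in> space_of G" using that assms by blast
    then show ?thesis
      using assms \<phi>_inj [of "brk G k x" "sscale G (a (\<phi> k)) x"]
      by (auto simp: \<phi>_br [symmetric] \<phi>_scale [symmetric] br_space space_scale)
  qed
  then show ?thesis using assms by (simp add: root_space_def \<phi>_space)
qed

lemma root_space_K':
  assumes "\<hh> \<subseteq> space_of G" "x \<in> space_of G"
  shows "\<phi> x \<in> root_space K (\<phi> ` \<hh>) (\<lambda>k. a (\<psi> k)) \<longleftrightarrow> x \<in> root_space G \<hh> a"
proof -
  have "root_space G \<hh> (\<lambda>k. a (\<psi> (\<phi> k))) = root_space G \<hh> a"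
    using assms by (intro root_space_cong) (auto simp: \<psi>_\<phi> subset_iff)
  then show ?thesis using root_space_K [OF assms] by simp
qed

lemma center_K: "z \<in> space_of G \<Longrightarrow> \<phi> z \<in> center K \<longleftrightarrow> z \<in> center G"
  unfolding center_def space_K
  by (auto simp: \<phi>_br [symmetric] \<phi>_eq_zero br_space)

lemma span_K:
  assumes "X \<subseteq> space_of G" shows "\<phi> ` span X \<subseteq> K.span (\<phi> ` X)"
proof -
  have "subspace {x \<in> space_of G. \<phi> x \<in> K.span (\<phi> ` X)}"
    unfolding subspace_def
    by (auto simp: space_add space_scale \<phi>_add \<phi>_scale K.span_add K.span_scale K.span_zero)
  moreover have "X \<subseteq> {x \<in> space_of G. \<phi> x \<in> K.span (\<phi> ` X)}" using assms K.span_base by blast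
  ultimately have "span X \<subseteq> {x \<in> space_of G. \<phi> x \<in> K.span (\<phi> ` X)}" by (rule span_minimal [rotated])
  then show ?thesis by blast
qed

lemma toral_K:
  assumes "toral G \<hh>" shows "toral K (\<phi> ` \<hh>)"
proof -
  have h: "subspace \<hh>" "\<hh> \<subseteq> part G False" "\<hh> \<subseteq> space_of G" "\<And>x y. x \<in> \<hh> \<Longrightarrow> y \<in> \<hh> \<Longrightarrow> brk G x y = 0"
    "\<And>x. x \<in> part G False \<Longrightarrow> (\<And>y. y \<in> \<hh> \<Longrightarrow> brk G y x = 0) \<Longrightarrow> x \<in> \<hh>"
    using assms part_space by (auto simp: toral_def)
  let ?E = "{x \<in> space_of G. \<forall>k\<in>\<hh>. \<exists>c. brk G k x = sscale G c x}"
  have "space_of K \<subseteq> K.span (\<phi> ` ?E)"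
  proof -
    have "space_of G \<subseteq> span ?E" using assms by (simp add: toral_def span_in_eq)
    then have "space_of K \<subseteq> \<phi> ` span ?E" unfolding space_K by blast
    also have "\<dots> \<subseteq> K.span (\<phi> ` ?E)" by (rule span_K) blast
    finally show ?thesis .
  qed
  also have "\<dots> \<subseteq> K.span {x \<in> space_of K. \<forall>k\<in>\<phi> ` \<hh>. \<exists>c. brk K k x = sscale K c x}"
  proof (rule K.span_mono, clarify)
    fix x assume x: "x \<in> space_of G" "\<forall>k\<in>\<hh>. \<exists>c. brk G k x = sscale G c x"
    have "\<exists>c. brk K (\<phi> k) (\<phi> x) = sscale K c (\<phi> x)" if "k \<in> \<hh>" for k
      using x that h(3) \<phi>_br [of k x] \<phi>_scale [OF x(1)] by (metis subsetD)
    then show "\<phi> x \<in> space_of K \<and> (\<forall>k\<in>\<phi> ` \<hh>. \<exists>c. brk K k (\<phi> x) = sscale K c (\<phi> x))"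
      using x \<phi>_space by blast
  qed
  finally have sp: "space_of K \<subseteq> K.span {x \<in> space_of K. \<forall>k\<in>\<phi> ` \<hh>. \<exists>c. brk K k x = sscale K c x}" .
  have 1: "\<phi> ` \<hh> \<subseteq> part K False" using h(2) by (auto intro: part_imageI)
  have 2: "brk K x y = 0" if "x \<in> \<phi> ` \<hh>" "y \<in> \<phi> ` \<hh>" for x y
    using that h(3,4) \<phi>_br [symmetric] by (auto simp: subset_iff)
  have 3: "x \<in> \<phi> ` \<hh>" if x: "x \<in> part K False" "\<forall>y\<in>\<phi> ` \<hh>. brk K y x = 0" for x
  proof -
    obtain z where z: "z \<in> part G False" "x = \<phi> z" using part_imageE [OF x(1)] by blast
    have "brk G y z = 0" if "y \<in> \<hh>" for y
      using x(2) z that h(3) \<phi>_br [of y z] \<phi>_eq_zero [of "brk G y z"] part_space br_space by (auto simp: subset_iff)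
    then show ?thesis using h(5) z by blast
  qed
  show ?thesis
    unfolding toral_def L.span_in_eq using image_subspace [OF h(1,3)] sp 1 2 3 by blast
qed

lemma graded_ideal_K:
  assumes I: "graded_ideal G I" shows "graded_ideal K (\<phi> ` I)"
proof -
  have s: "subspace I" "I \<subseteq> space_of G" using I by (auto simp: graded_ideal_def subspace_in_def)
  show ?thesis
    unfolding graded_ideal_def subspace_in_def
  proof (intro conjI ballI impI)
    show "K.subspace (\<phi> ` I)" by (rule image_subspace [OF s])
    show "\<phi> ` I \<subseteq> space_of K" using s \<phi>_space by blast
    fix a b assume "a \<in> part K False" "b \<in> part K True" and ab: "a + b \<in> \<phi> ` I"
    then obtain a' b' where *: "a' \<in> part G False" "b' \<in> part G True" "a = \<phi> a'" "b = \<phi> b'"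
      using part_imageE by blast
    have "\<phi> (a' + b') \<in> \<phi> ` I" using ab * by (simp add: \<phi>_add part_space)
    then have "a' + b' \<in> I" using \<phi>_inj s * space_sum by (metis imageE subsetD)
    then show "a \<in> \<phi> ` I" "b \<in> \<phi> ` I" using I * unfolding graded_ideal_def by blast+
  next
    fix x y assume "x \<in> space_of K" "y \<in> \<phi> ` I"
    then show "brk K x y \<in> \<phi> ` I"
      using I s unfolding space_K graded_ideal_def by (auto simp: \<phi>_br [symmetric] subset_iff)
  qed
qed

text \<open>Each clause is pushed to \<open>K\<close>, with toral subalgebras and ideals replaced by
  their images and with weights and forms composed with the inverse \<open>\<psi>\<close>. The
  finite spanning set has to be moved into \<open>space_of K\<close> before it can be pulled
  back.\<close>

lemma admissible_transport:
  assumes adm: "admissible K" shows "admissible G"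
  unfolding admissible_def
proof (intro conjI ballI allI impI)
  obtain X where X: "finite X" "space_of K \<subseteq> K.span X" using adm by (auto simp: admissible_def L.span_in_eq)
  obtain F where F: "finite F" "F \<subseteq> space_of K" "space_of K \<subseteq> K.span F"
    using K.finite_spanning_subset [OF X] by blast
  have "K.subspace {y \<in> space_of K. \<psi> y \<in> span (\<psi> ` F)}"
    unfolding K.subspace_def using \<psi>_\<phi> [of 0]
    by (auto simp: L.space_add L.space_scale \<psi>_simps span_add span_scale span_zero)
  then have "K.span F \<subseteq> {y \<in> space_of K. \<psi> y \<in> span (\<psi> ` F)}"
    using F(2) by (intro K.span_minimal) (auto intro: span_base)
  then have "space_of G \<subseteq> span (\<psi> ` F)" using F(3) \<phi>_space \<psi>_\<phi> by force
  then show "\<exists>X. finite X \<and> space_of G \<subseteq> span_in G X" using F(1) by (auto simp: span_in_eq)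
next
  fix z assume z: "z \<in> part G False" "\<forall>y\<in>part G True. brk G z y = 0"
  have zs: "z \<in> space_of G" using z part_space by blast
  have "\<forall>y\<in>part K True. brk K (\<phi> z) y = 0"
  proof
    fix y assume "y \<in> part K True"
    then obtain x where "x \<in> part G True" "y = \<phi> x" using part_imageE by blast
    then show "brk K (\<phi> z) y = 0" using z(2) part_space \<phi>_br [OF zs, symmetric] by simp
  qed
  then have "\<phi> z \<in> center K" using admissible_central [OF adm part_imageI [OF z(1)]] by blast
  then show "z \<in> center G" using center_K zs by blast
next
  fix x y assume x: "x \<in> part G False" and y: "y \<in> space_of G" and c: "brk G x y \<in> center G"
  have xs: "x \<in> space_of G" using x part_space by blast
  have "brk K (\<phi> x) (\<phi> y) \<in> center K" using c center_K [OF br_space [OF xs y]] \<phi>_br [OF xs y] by simp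
  then have "brk K (\<phi> x) (\<phi> y) = 0"
    using admissible_bracket [OF adm part_imageI [OF x] \<phi>_space [OF y]] by blast
  then show "brk G x y = 0" using \<phi>_br_zero [OF xs y] by blast
next
  consider "toral K (part K False)" | "\<forall>I. graded_ideal K I \<longrightarrow> I \<subseteq> center K \<or> part K True \<subseteq> I"
    using admissible_ideals [OF adm] by blast
  then show "toral G (part G False) \<or> (\<forall>I. graded_ideal G I \<longrightarrow> I \<subseteq> center G \<or> part G True \<subseteq> I)"
  proof cases
    case 1
    have ab: "brk G x y = 0" if "x \<in> part G False" "y \<in> part G False" for x y
    proof -
      have "\<phi> x \<in> part K False" "\<phi> y \<in> part K False" using that by (auto intro: part_imageI)
      then have "brk K (\<phi> x) (\<phi> y) = 0" using 1 by (auto simp: toral_def)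
      then show ?thesis using that part_space \<phi>_br_zero by blast
    qed
    let ?E = "{x \<in> space_of K. \<forall>k\<in>part K False. \<exists>c. brk K k x = sscale K c x}"
    let ?F = "{x \<in> space_of G. \<forall>k\<in>part G False. \<exists>c. brk G k x = sscale G c x}"
    have "K.subspace {y \<in> space_of K. \<psi> y \<in> span ?F}"
      unfolding K.subspace_def using \<psi>_\<phi> [of 0]
      by (auto simp: L.space_add L.space_scale \<psi>_simps span_add span_scale span_zero)
    moreover have "?E \<subseteq> {y \<in> space_of K. \<psi> y \<in> span ?F}"
    proof clarify
      fix y assume y: "y \<in> space_of K" "\<forall>k\<in>part K False. \<exists>c. brk K k y = sscale K c y"
      have "\<exists>c. brk G k (\<psi> y) = sscale G c (\<psi> y)" if "k \<in> part G False" for k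
      proof -
        have k: "\<phi> k \<in> part K False" "k \<in> space_of G" using that by (auto intro: part_imageI part_space)
        then obtain c where "brk K (\<phi> k) y = sscale K c y" using y by blast
        then have "\<psi> (brk K (\<phi> k) y) = \<psi> (sscale K c y)" by simp
        then show ?thesis using y k \<phi>_space by (auto simp: \<psi>_simps \<psi>_\<phi>)
      qed
      then show "\<psi> y \<in> span ?F" using y \<psi>_space by (intro span_base) blast
    qed
    ultimately have "K.span ?E \<subseteq> {y \<in> space_of K. \<psi> y \<in> span ?F}" by (rule K.span_minimal [rotated])
    then have "space_of K \<subseteq> {y \<in> space_of K. \<psi> y \<in> span ?F}"
      using 1 unfolding toral_def L.span_in_eq by blast
    then have "space_of G \<subseteq> span ?F" using \<phi>_space \<psi>_\<phi> by force
    then have "toral G (part G False)"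
      unfolding toral_def span_in_eq using part_subspace ab by blast
    then show ?thesis ..
  next
    case 2
    have "I \<subseteq> center G \<or> part G True \<subseteq> I" if I: "graded_ideal G I" for I
    proof -
      have s: "I \<subseteq> space_of G" using I by (auto simp: graded_ideal_def subspace_in_def)
      consider "\<phi> ` I \<subseteq> center K" | "part K True \<subseteq> \<phi> ` I" using 2 graded_ideal_K [OF I] by blast
      then show ?thesis
      proof cases
        case 1
        then show ?thesis using center_K s by blast
      next
        case 2
        have "x \<in> I" if x: "x \<in> part G True" for x
        proof -
          have "\<phi> x \<in> \<phi> ` I" using 2 part_imageI [OF x] by blast
          then show ?thesis using \<phi>_inj s part_space [OF x] by blast
        qed
        then show ?thesis by blast
      qed
    qed
    then show ?thesis by blast
  qed
next
  fix \<hh> assume tor: "toral G \<hh>"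
  have h: "\<hh> \<subseteq> space_of G" using tor part_space by (auto simp: toral_def)
  have *: "root_space K (\<phi> ` \<hh>) (\<lambda>_. 0) \<inter> part K True \<subseteq> {0}"
    by (rule admissible_zero_weight [OF adm toral_K [OF tor]])
  show "root_space G \<hh> (\<lambda>_. 0) \<inter> part G True \<subseteq> {0}"
  proof
    fix x assume x: "x \<in> root_space G \<hh> (\<lambda>_. 0) \<inter> part G True"
    then have xs: "x \<in> space_of G" using part_space by blast
    then have "\<phi> x \<in> root_space K (\<phi> ` \<hh>) (\<lambda>_. 0) \<inter> part K True"
      using root_space_K [OF h xs, of "\<lambda>_. 0"] part_K x by blast
    then show "x \<in> {0}" using * \<phi>_eq_zero xs by blast
  qed
next
  fix \<hh> B a e f
  assume *: "toral G \<hh> \<and> invariant_form G B \<and> e \<in> root_space G \<hh> a \<inter> part G True \<and>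
        f \<in> root_space G \<hh> (- a) \<inter> part G True \<and> B e f \<noteq> 0 \<and> brk G (brk G e f) e = 0"
  have h: "\<hh> \<subseteq> space_of G" using * part_space by (auto simp: toral_def)
  have s: "e \<in> space_of G" "f \<in> space_of G" using * part_space by blast+
  let ?a = "\<lambda>k. a (\<psi> k)" and ?B = "\<lambda>x y. B (\<psi> x) (\<psi> y)"
  have neg: "- ?a = (\<lambda>k. (- a) (\<psi> k))" "?a + ?a = (\<lambda>k. (a + a) (\<psi> k))" by (auto simp: fun_eq_iff)
  note rs = root_space_K' [OF h]
  have "reflection_root K (\<phi> ` \<hh>) ?a (\<phi> e)"
  proof -
    have "toral K (\<phi> ` \<hh>)" "invariant_form K ?B" using * toral_K form_K by auto
    moreover have "\<phi> e \<in> root_space K (\<phi> ` \<hh>) ?a \<inter> part K True"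
      "\<phi> f \<in> root_space K (\<phi> ` \<hh>) (- ?a) \<inter> part K True"
      unfolding neg using * s rs part_K by blast+
    moreover have "?B (\<phi> e) (\<phi> f) \<noteq> 0" using * s \<psi>_\<phi> by simp
    moreover have "brk K (brk K (\<phi> e) (\<phi> f)) (\<phi> e) = 0"
      using * s by (simp add: \<phi>_br [symmetric] br_space)
    ultimately show ?thesis by (rule admissible_reflection [OF adm])
  qed
  note r = this [unfolded reflection_root_def neg]
  note r1 = r [THEN conjunct1] and r2 = r [THEN conjunct2, THEN conjunct1]
    and r3 = r [THEN conjunct2, THEN conjunct2, THEN conjunct1]
    and r4 = r [THEN conjunct2, THEN conjunct2, THEN conjunct2, rule_format]
  show "reflection_root G \<hh> a e"
    unfolding reflection_root_def
  proof (intro conjI ballI impI subsetI)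
    show "brk G e e = 0" using r1 \<phi>_br_zero [OF s(1) s(1)] by simp
    show "x \<in> {0}" if x: "x \<in> root_space G \<hh> a \<inter> part G False" for x
    proof -
      have xs: "x \<in> space_of G" using x root_space_space by blast
      have "\<phi> x \<in> root_space K (\<phi> ` \<hh>) ?a \<inter> part K False" using x rs [OF xs] part_imageI by simp
      then show ?thesis using r2 \<phi>_eq_zero [OF xs] by auto
    qed
    show "x \<in> {0}" if x: "x \<in> root_space G \<hh> (a + a)" for x
    proof -
      have xs: "x \<in> space_of G" using x root_space_space by blast
      then show ?thesis using r3 \<phi>_eq_zero [OF xs] rs [OF xs, of "a + a"] x by auto
    qed
    fix x y assume x: "x \<in> root_space G \<hh> a \<inter> part G True" and y: "y \<in> root_space G \<hh> (- a) \<inter> part G True"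
      and xy: "brk G x y = 0"
    have xs: "x \<in> space_of G" "y \<in> space_of G" using x y part_space by blast+
    have "\<phi> x = 0 \<or> \<phi> y = 0"
    proof (rule r4)
      show "\<phi> x \<in> root_space K (\<phi> ` \<hh>) ?a \<inter> part K True" using x rs [OF xs(1)] part_imageI by simp
      show "\<phi> y \<in> root_space K (\<phi> ` \<hh>) (\<lambda>k. (- a) (\<psi> k)) \<inter> part K True"
        using y rs [OF xs(2), of "- a"] part_imageI by simp
      show "brk K (\<phi> x) (\<phi> y) = 0" using xy \<phi>_br_zero [OF xs] by simp
    qed
    then show "x = 0 \<or> y = 0" using \<phi>_eq_zero [OF xs(1)] \<phi>_eq_zero [OF xs(2)] by simp
  qed
qed

end

text \<open>The model may use that it is a Lie superalgebra with a non-degenerate invariant form and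
  non-zero odd part, all inherited from \<open>G\<close>; this is how sl(n|n) and the purely even
  members of the families are discarded.\<close>

lemma admissible_iso:
  assumes iso: "superalgebra_iso G K" and lie: "lie_superalgebra G" and vs: "vector_space (sscale K)"
    and form: "invariant_form G B" "nondegenerate_form G B" and odd: "part G True \<noteq> {0}"
    and adm: "\<And>B. lie_superalgebra K \<Longrightarrow> invariant_form K B \<Longrightarrow> nondegenerate_form K B \<Longrightarrow> part K True \<noteq> {0} \<Longrightarrow> admissible K"
  shows "admissible G"
proof -
  interpret G: lie_superalg G by unfold_locales (rule lie)
  obtain \<phi> where \<phi>: "bij_betw \<phi> (space_of G) (space_of K)"
     "\<forall>x\<in>space_of G. \<forall>y\<in>space_of G. \<phi> (x + y) = \<phi> x + \<phi> y \<and> \<phi> (brk G x y) = brk K (\<phi> x) (\<phi> y)"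
     "\<forall>c. \<forall>x\<in>space_of G. \<phi> (sscale G c x) = sscale K c (\<phi> x)"
     "\<forall>p. \<phi> ` part G p = part K p"
    using iso unfolding superalgebra_iso_def by (elim exE conjE)
  interpret superalg_iso G K \<phi>
    using \<phi> vs by (simp add: superalg_iso_def superalg_iso_axioms_def complex_vs_def G.lie_superalg_axioms)
  have "part K True \<noteq> {0}"
  proof
    assume "part K True = {0}"
    then have "x = 0" if "x \<in> part G True" for x
      using part_imageI [OF that] \<phi>_eq_zero [OF G.part_space [OF that]] by simp
    then have "part G True = {0}" using G.part_zero [of True] by auto
    then show False using odd by simp
  qed
  then show ?thesis
    by (rule admissible_transport [OF adm [OF lie_K form_K [OF form(1)] nondegenerate_K [OF form(2)]]])
qed

text \<open>Root vectors split into homogeneous ones, so the odd ones span modulo the even part;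
  uniqueness of the parity decomposition removes the even summand.\<close>

lemma (in lie_superalg) toral_odd_span:
  assumes tor: "toral G \<hh>"
  shows "part G True \<subseteq> span {x \<in> part G True. \<exists>\<beta>. x \<in> root_space G \<hh> \<beta>}"
proof
  let ?E = "{x \<in> part G True. \<exists>\<beta>. x \<in> root_space G \<hh> \<beta>}"
  have E: "span ?E \<subseteq> part G True" by (rule span_minimal) (auto simp: part_subspace)
  fix x assume x: "x \<in> part G True"
  have "x \<in> {a + b | a b. a \<in> part G False \<and> b \<in> span ?E}"
    using tor part_space [OF x]
  proof (induction rule: toral_induct)
    case subspace
    show ?case using subspace_sums [OF part_subspace [of False] subspace_span [of ?E]] by simp
  next
    case (even \<beta> x)
    have "x = x + 0" by simp
    then show ?case using even span_zero by blast
  next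
    case (odd \<beta> x)
    then have "x \<in> span ?E" by (intro span_base) blast
    moreover have "x = 0 + x" by simp
    ultimately show ?case using part_zero by blast
  qed
  then obtain a b where ab: "a \<in> part G False" "b \<in> span ?E" "x = a + b" by blast
  then have "0 + x = a + b" "b \<in> part G True" using E by auto
  then have "x = b" using part_sum_unique(2) [OF part_zero x ab(1)] by blast
  then show "x \<in> span ?E" using ab by simp
qed

section \<open>Lie superalgebras whose odd part is a tensor product with a symplectic space\<close>

text \<open>This covers \<open>osp(m|2n)\<close>, \<open>D(2,1;\<alpha>)\<close>, \<open>G(3)\<close> and \<open>F(4)\<close>: the even part is \<open>S \<oplus> Q\<close> with
  \<open>Q = sp(U)\<close>, spanned by the operators \<open>quad u u'\<close>, and the odd part is \<open>W \<otimes> U\<close>; \<open>cw\<close> and \<open>cu\<close>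
  are the contractions of the odd part with vectors of \<open>W\<close> and of \<open>U\<close>.  The families differ in
  the skew pairing \<open>p\<close>, about which only the last assumption is needed.\<close>

locale tensor_superalg = lie_superalg K + W: complex_vs sw + U: complex_vs su
  for K :: "('k::ab_group_add) superalgebra"
    and sw :: "complex \<Rightarrow> 'w::ab_group_add \<Rightarrow> 'w" and su :: "complex \<Rightarrow> 'u::ab_group_add \<Rightarrow> 'u" +
  fixes WS :: "'w set" and US :: "'u set" and S Q :: "'k set"
    and tens :: "'w \<Rightarrow> 'u \<Rightarrow> 'k" and cw :: "'k \<Rightarrow> 'w \<Rightarrow> 'u" and cu :: "'k \<Rightarrow> 'u \<Rightarrow> 'w"
    and sact :: "'k \<Rightarrow> 'w \<Rightarrow> 'w" and qact :: "'k \<Rightarrow> 'u \<Rightarrow> 'u"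
    and quad :: "'u \<Rightarrow> 'u \<Rightarrow> 'k" and p :: "'w \<Rightarrow> 'w \<Rightarrow> 'k"
    and sym :: "'w \<Rightarrow> 'w \<Rightarrow> complex" and psi :: "'u \<Rightarrow> 'u \<Rightarrow> complex"
  assumes fin: "\<exists>X. finite X \<and> space_of K \<subseteq> span X"
    and WS: "W.subspace WS" and US: "U.subspace US"
    and nontrivial: "part K True \<noteq> {0}"
    and tens_part: "w \<in> WS \<Longrightarrow> u \<in> US \<Longrightarrow> tens w u \<in> part K True"
    and tens_span: "part K True \<subseteq> span {tens w u | w u. w \<in> WS \<and> u \<in> US}"
    and cw_in: "x \<in> part K True \<Longrightarrow> w \<in> WS \<Longrightarrow> cw x w \<in> US"
    and cw_add: "x \<in> part K True \<Longrightarrow> y \<in> part K True \<Longrightarrow> w \<in> WS \<Longrightarrow> cw (x + y) w = cw x w + cw y w"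
    and cw_scale: "x \<in> part K True \<Longrightarrow> w \<in> WS \<Longrightarrow> cw (sscale K c x) w = su c (cw x w)"
    and cw_tens: "w \<in> WS \<Longrightarrow> w' \<in> WS \<Longrightarrow> u \<in> US \<Longrightarrow> cw (tens w u) w' = su (sym w w') u"
    and cw_inj: "x \<in> part K True \<Longrightarrow> (\<And>w. w \<in> WS \<Longrightarrow> cw x w = 0) \<Longrightarrow> x = 0"
    and cu_in: "x \<in> part K True \<Longrightarrow> u \<in> US \<Longrightarrow> cu x u \<in> WS"
    and cu_add: "x \<in> part K True \<Longrightarrow> y \<in> part K True \<Longrightarrow> u \<in> US \<Longrightarrow> cu (x + y) u = cu x u + cu y u"
    and cu_scale: "x \<in> part K True \<Longrightarrow> u \<in> US \<Longrightarrow> cu (sscale K c x) u = sw c (cu x u)"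
    and cu_tens: "w \<in> WS \<Longrightarrow> u \<in> US \<Longrightarrow> u' \<in> US \<Longrightarrow> cu (tens w u) u' = sw (psi u u') w"
    and sym_add: "w \<in> WS \<Longrightarrow> w' \<in> WS \<Longrightarrow> w'' \<in> WS \<Longrightarrow> sym (w + w') w'' = sym w w'' + sym w' w''"
    and sym_scale: "w \<in> WS \<Longrightarrow> w' \<in> WS \<Longrightarrow> sym (sw c w) w' = c * sym w w'"
    and sym_comm: "w \<in> WS \<Longrightarrow> w' \<in> WS \<Longrightarrow> sym w w' = sym w' w"
    and sym_nondeg: "w \<in> WS \<Longrightarrow> (\<And>w'. w' \<in> WS \<Longrightarrow> sym w w' = 0) \<Longrightarrow> w = 0"
    and psi_add: "u \<in> US \<Longrightarrow> u' \<in> US \<Longrightarrow> u'' \<in> US \<Longrightarrow> psi (u + u') u'' = psi u u'' + psi u' u''"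
    and psi_scale: "u \<in> US \<Longrightarrow> u' \<in> US \<Longrightarrow> psi (su c u) u' = c * psi u u'"
    and psi_skew: "u \<in> US \<Longrightarrow> u' \<in> US \<Longrightarrow> psi u u' = - psi u' u"
    and psi_nondeg: "u \<in> US \<Longrightarrow> (\<And>u'. u' \<in> US \<Longrightarrow> psi u u' = 0) \<Longrightarrow> u = 0"
    and SQ: "S \<subseteq> part K False" "Q \<subseteq> part K False" "subspace S" "subspace Q" "S \<inter> Q = {0}"
      "\<And>z. z \<in> part K False \<Longrightarrow> \<exists>s\<in>S. \<exists>q\<in>Q. z = s + q"
    and SQ_br: "s \<in> S \<Longrightarrow> q \<in> Q \<Longrightarrow> brk K s q = 0" "s \<in> S \<Longrightarrow> s' \<in> S \<Longrightarrow> brk K s s' \<in> S"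
      "q \<in> Q \<Longrightarrow> q' \<in> Q \<Longrightarrow> brk K q q' \<in> Q"
    and sact_in: "s \<in> S \<Longrightarrow> w \<in> WS \<Longrightarrow> sact s w \<in> WS"
    and sact_br: "s \<in> S \<Longrightarrow> w \<in> WS \<Longrightarrow> u \<in> US \<Longrightarrow> brk K s (tens w u) = tens (sact s w) u"
    and sact_faithful: "s \<in> S \<Longrightarrow> (\<And>w. w \<in> WS \<Longrightarrow> sact s w = 0) \<Longrightarrow> s = 0"
    and qact_in: "q \<in> Q \<Longrightarrow> u \<in> US \<Longrightarrow> qact q u \<in> US"
    and qact_add: "q \<in> Q \<Longrightarrow> u \<in> US \<Longrightarrow> u' \<in> US \<Longrightarrow> qact q (u + u') = qact q u + qact q u'"
    and qact_scale: "q \<in> Q \<Longrightarrow> u \<in> US \<Longrightarrow> qact q (su c u) = su c (qact q u)"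
    and qact_br: "q \<in> Q \<Longrightarrow> w \<in> WS \<Longrightarrow> u \<in> US \<Longrightarrow> brk K q (tens w u) = tens w (qact q u)"
    and qact_faithful: "q \<in> Q \<Longrightarrow> (\<And>u. u \<in> US \<Longrightarrow> qact q u = 0) \<Longrightarrow> q = 0"
    and qact_psi: "q \<in> Q \<Longrightarrow> u \<in> US \<Longrightarrow> u' \<in> US \<Longrightarrow> psi (qact q u) u' = - psi u (qact q u')"
    and quad_in: "u \<in> US \<Longrightarrow> u' \<in> US \<Longrightarrow> quad u u' \<in> Q"
    and quad_act: "u \<in> US \<Longrightarrow> u' \<in> US \<Longrightarrow> z \<in> US \<Longrightarrow> qact (quad u u') z = su (psi u' z) u + su (psi u z) u'"
    and p_in: "w \<in> WS \<Longrightarrow> w' \<in> WS \<Longrightarrow> p w w' \<in> S"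
    and tens_br: "w \<in> WS \<Longrightarrow> w' \<in> WS \<Longrightarrow> u \<in> US \<Longrightarrow> u' \<in> US \<Longrightarrow>
      brk K (tens w u) (tens w' u') = sscale K (psi u u') (p w w') + sscale K (sym w w') (quad u u')"
    and p_parallel: "w \<in> WS \<Longrightarrow> w' \<in> WS \<Longrightarrow> w \<noteq> 0 \<Longrightarrow> sym w w = 0 \<Longrightarrow> sym w' w' = 0 \<Longrightarrow> sym w w' = 0 \<Longrightarrow>
      p w w' = 0 \<Longrightarrow> \<exists>c. w' = sw c w"
begin

section \<open>Linear algebra of the two tensor factors\<close>

lemma WS_simps: "0 \<in> WS" "w \<in> WS \<Longrightarrow> w' \<in> WS \<Longrightarrow> w + w' \<in> WS" "w \<in> WS \<Longrightarrow> sw c w \<in> WS"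
  "w \<in> WS \<Longrightarrow> w' \<in> WS \<Longrightarrow> w - w' \<in> WS"
  using WS W.subspace_0 W.subspace_add W.subspace_scale W.subspace_diff by auto

lemma US_simps: "0 \<in> US" "u \<in> US \<Longrightarrow> u' \<in> US \<Longrightarrow> u + u' \<in> US" "u \<in> US \<Longrightarrow> su c u \<in> US"
  "u \<in> US \<Longrightarrow> u' \<in> US \<Longrightarrow> u - u' \<in> US"
  using US U.subspace_0 U.subspace_add U.subspace_scale U.subspace_diff by auto

lemma SQ_part: "s \<in> S \<Longrightarrow> s \<in> part K False" "s \<in> Q \<Longrightarrow> s \<in> part K False"
  "s \<in> S \<Longrightarrow> s \<in> space_of K" "s \<in> Q \<Longrightarrow> s \<in> space_of K"
  using SQ part_space by auto

lemma SQ_scale: "s \<in> S \<Longrightarrow> sscale K c s \<in> S" "s \<in> Q \<Longrightarrow> sscale K c s \<in> Q"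
  using SQ subspace_scale by auto

lemma SQ_unique: "s \<in> S \<Longrightarrow> q \<in> Q \<Longrightarrow> s + q = 0 \<Longrightarrow> s = 0 \<and> q = 0"
proof -
  assume sq: "s \<in> S" "q \<in> Q" "s + q = 0"
  have "s = - q" using sq(3) by (simp add: eq_neg_iff_add_eq_0)
  then have "s \<in> Q" using subspace_neg [OF SQ(4)] sq by simp
  then have "s = 0" using SQ(5) sq(1) by blast
  then show ?thesis using sq(3) by simp
qed

lemma QS_br: "q \<in> Q \<Longrightarrow> s \<in> S \<Longrightarrow> brk K q s = 0"
  using br_skew_even [of q s] SQ_br(1) [of s q] SQ_part by simp

lemma tens_space: "w \<in> WS \<Longrightarrow> u \<in> US \<Longrightarrow> tens w u \<in> space_of K"
  using tens_part part_space by blast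

lemma psi_self: "u \<in> US \<Longrightarrow> psi u u = 0"
  using psi_skew [of u u] by simp

lemma psi_zero: "u \<in> US \<Longrightarrow> psi 0 u = 0" "u \<in> US \<Longrightarrow> psi u 0 = 0"
  using psi_scale [of 0 u 0] psi_skew [of u 0] US_simps by auto

lemma psi_scale_right: "u \<in> US \<Longrightarrow> u' \<in> US \<Longrightarrow> psi u (su c u') = c * psi u u'"
  using psi_scale [of u' u c] psi_skew [of u "su c u'"] psi_skew [of u u'] US_simps by simp

lemma psi_minus: "u \<in> US \<Longrightarrow> u' \<in> US \<Longrightarrow> psi (- u) u' = - psi u u'"
  using psi_scale [of u u' "-1"] by simp

lemma psi_add_right: "u \<in> US \<Longrightarrow> u' \<in> US \<Longrightarrow> u'' \<in> US \<Longrightarrow> psi u'' (u + u') = psi u'' u + psi u'' u'"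
  using psi_add [of u u' u''] psi_skew [of u'' "u + u'"] psi_skew [of u'' u] psi_skew [of u'' u'] US_simps by simp

lemma psi_nonzero: "u \<in> US \<Longrightarrow> u \<noteq> 0 \<Longrightarrow> \<exists>u'\<in>US. psi u u' \<noteq> 0"
  using psi_nondeg by blast

lemma sym_nonzero: "w \<in> WS \<Longrightarrow> w \<noteq> 0 \<Longrightarrow> \<exists>w'\<in>WS. sym w w' \<noteq> 0"
  using sym_nondeg by blast

lemma sym_zero: "w \<in> WS \<Longrightarrow> sym 0 w = 0" "w \<in> WS \<Longrightarrow> sym w 0 = 0"
  using sym_scale [of 0 w 0] sym_comm [of w 0] WS_simps by auto

lemma sym_scale_right: "w \<in> WS \<Longrightarrow> w' \<in> WS \<Longrightarrow> sym w (sw c w') = c * sym w w'"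
  using sym_scale [of w' w c] sym_comm [of w "sw c w'"] sym_comm [of w w'] WS_simps by simp

lemma cw_zero: "w \<in> WS \<Longrightarrow> cw 0 w = 0"
  using cw_scale [of 0 w 0] by simp

lemma cu_zero: "u \<in> US \<Longrightarrow> cu 0 u = 0"
  using cu_scale [of 0 u 0] by simp

lemma cw_diff: "x \<in> part K True \<Longrightarrow> y \<in> part K True \<Longrightarrow> w \<in> WS \<Longrightarrow> cw (x - y) w = cw x w - cw y w"
  using cw_add [of "x - y" y w] by (simp add: part_diff)

lemma qact_zero: "q \<in> Q \<Longrightarrow> qact q 0 = 0"
  using qact_scale [of q 0 0] US_simps by simp

text \<open>Contractions separate odd elements. The bilinearity of \<open>tens\<close> is recovered
  below by comparing them.\<close>

lemma tens_eqI:
  assumes "x \<in> part K True" "y \<in> part K True" "\<And>w. w \<in> WS \<Longrightarrow> cw x w = cw y w" shows "x = y"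
  using cw_inj [of "x - y"] assms by (simp add: part_diff cw_diff)

lemma tens_scale_left: "w \<in> WS \<Longrightarrow> u \<in> US \<Longrightarrow> tens (sw c w) u = sscale K c (tens w u)"
  by (rule tens_eqI) (simp_all add: tens_part WS_simps part_scale cw_tens cw_scale sym_scale)

lemma tens_scale_right: "w \<in> WS \<Longrightarrow> u \<in> US \<Longrightarrow> tens w (su c u) = sscale K c (tens w u)"
  by (rule tens_eqI) (simp_all add: tens_part US_simps part_scale cw_tens cw_scale mult.commute)

lemma tens_add_right: "w \<in> WS \<Longrightarrow> u \<in> US \<Longrightarrow> u' \<in> US \<Longrightarrow> tens w (u + u') = tens w u + tens w u'"
  by (rule tens_eqI) (simp_all add: tens_part US_simps part_add cw_tens cw_add U.scale_right_distrib)

lemma tens_add_left: "w \<in> WS \<Longrightarrow> w' \<in> WS \<Longrightarrow> u \<in> US \<Longrightarrow> tens (w + w') u = tens w u + tens w' u"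
  by (rule tens_eqI) (simp_all add: tens_part WS_simps part_add cw_tens cw_add sym_add U.scale_left_distrib)

lemma tens_zero: "u \<in> US \<Longrightarrow> tens 0 u = 0" "w \<in> WS \<Longrightarrow> tens w 0 = 0"
  using tens_scale_left [of 0 u 0] tens_scale_right [of w 0 0] WS_simps US_simps by simp_all

lemma tens_eq_zero:
  assumes "w \<in> WS" "u \<in> US" "tens w u = 0" shows "w = 0 \<or> u = 0"
proof (rule ccontr)
  assume *: "\<not> ?thesis"
  then obtain w' where "w' \<in> WS" "sym w w' \<noteq> 0" using sym_nonzero assms by blast
  then show False using cw_tens [of w w' u] assms cw_zero * by simp
qed

lemma odd_induct [consumes 1, case_names subspace tens]:
  assumes "x \<in> part K True" "subspace {x \<in> part K True. P x}"
    and "\<And>w u. w \<in> WS \<Longrightarrow> u \<in> US \<Longrightarrow> P (tens w u)"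
  shows "P x"
proof -
  have "span {tens w u | w u. w \<in> WS \<and> u \<in> US} \<subseteq> {x \<in> part K True. P x}"
    using assms(2,3) tens_part by (intro span_minimal) auto
  then show ?thesis using tens_span assms(1) by blast
qed

lemma WS_nonzero: "\<exists>w\<in>WS. w \<noteq> 0"
proof (rule ccontr)
  assume *: "\<not> ?thesis"
  have "x = 0" if "x \<in> part K True" for x
    using that
  proof (induction rule: odd_induct)
    case subspace
    show ?case by (auto simp: subspace_def)
  next
    case (tens w u)
    then show ?case using * tens_zero by auto
  qed
  then show False using nontrivial part_zero by blast
qed

lemma cw_qact: "x \<in> part K True \<Longrightarrow> q \<in> Q \<Longrightarrow> w \<in> WS \<Longrightarrow> cw (brk K q x) w = qact q (cw x w)"
proof (induction rule: odd_induct)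
  case subspace
  have br: "brk K q x \<in> part K True" if "x \<in> part K True" "q \<in> Q" for x q
    using br_part [OF SQ_part(2) [OF that(2)] that(1)] by simp
  show ?case
    unfolding subspace_def
    by (auto simp: part_add part_scale br_add_right br_scale_right part_space SQ_part cw_add cw_scale br
        qact_add qact_scale cw_in cw_zero qact_zero)
next
  case (tens w' u)
  then show ?case by (simp add: qact_br cw_tens qact_in qact_scale)
qed

lemma cu_cw: "x \<in> part K True \<Longrightarrow> w \<in> WS \<Longrightarrow> u \<in> US \<Longrightarrow> sym (cu x u) w = psi (cw x w) u"
proof (induction rule: odd_induct)
  case subspace
  show ?case
    unfolding subspace_def
    by (auto simp: part_add part_scale cw_add cw_scale cu_add cu_scale cw_zero cu_zero sym_add sym_scale
        psi_add psi_scale cw_in cu_in sym_zero psi_zero)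
next
  case (tens w' u')
  then show ?case by (simp add: cu_tens cw_tens sym_scale psi_scale US_simps WS_simps)
qed

text \<open>The bracket of odd elements is symmetric, \<open>psi\<close> is skew and
  \<open>sym\<close> is symmetric, so comparing the \<open>S\<close>-components of the two orders
  gives the sign. A pair with \<open>psi u u' \<noteq> 0\<close> exists because the odd part is
  non-zero.\<close>

lemma p_skew:
  assumes w: "w \<in> WS" "w' \<in> WS" shows "p w' w = - p w w'"
proof -
  obtain x where x: "x \<in> part K True" "x \<noteq> 0" using nontrivial part_zero by blast
  then obtain w0 where "w0 \<in> WS" "cw x w0 \<noteq> 0" using cw_inj by blast
  then obtain u u' where u: "u \<in> US" "u' \<in> US" "psi u u' \<noteq> 0" using psi_nonzero [of "cw x w0"] cw_in x by blast
  have "brk K (tens w u) (tens w' u') - brk K (tens w' u') (tens w u) = 0"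
    using br_sym_odd [of "tens w u" "tens w' u'"] tens_part w u by simp
  moreover have "brk K (tens w u) (tens w' u') - brk K (tens w' u') (tens w u) =
    sscale K (psi u u') (p w w' + p w' w) + sscale K (sym w w') (quad u u' - quad u' u)"
    using tens_br [OF w u(1,2)] tens_br [OF w(2,1) u(2,1)] psi_skew [OF u(2,1)] sym_comm [OF w(2,1)]
    by (simp add: scale_right_distrib scale_right_diff_distrib)
  moreover have "sscale K (psi u u') (p w w' + p w' w) \<in> S"
    using SQ_scale(1) subspace_add [OF SQ(3)] p_in w by blast
  moreover have "sscale K (sym w w') (quad u u' - quad u' u) \<in> Q"
    using SQ_scale(2) subspace_diff [OF SQ(4)] quad_in u by blast
  ultimately have "sscale K (psi u u') (p w w' + p w' w) = 0" using SQ_unique by metis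
  then have "p w w' + p w' w = 0" using u(3) by simp
  then show ?thesis by (simp add: eq_neg_iff_add_eq_0 add.commute)
qed

text \<open>\<open>quad v v\<close> acts on \<open>U\<close> with image in the line of
  \<open>v\<close>, so it maps an arbitrary odd element to a pure tensor. This is how pure tensors
  enter an ideal.\<close>

lemma quad_cu: "x \<in> part K True \<Longrightarrow> v \<in> US \<Longrightarrow> brk K (quad v v) x = sscale K (- 2) (tens (cu x v) v)"
proof (induction rule: odd_induct)
  case subspace
  have s: "quad v v \<in> space_of K" if "v \<in> US" for v using quad_in that SQ_part by blast
  show ?case
    unfolding subspace_def
    by (auto simp: part_add part_scale br_add_right br_scale_right part_space s cu_add cu_scale cu_zero
        tens_zero scale_right_distrib tens_add_left tens_scale_left cu_in WS_simps mult.commute)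
next
  case (tens w u)
  have "su (psi v u) v + su (psi v u) v = su (2 * psi v u) v"
    by (metis U.scale_left_distrib mult_2)
  then have "brk K (quad v v) (tens w u) = sscale K (2 * psi v u) (tens w v)"
    using tens by (simp add: qact_br quad_in quad_act tens_scale_right)
  moreover have "tens (cu (tens w u) v) v = sscale K (psi u v) (tens w v)"
    using tens by (simp add: cu_tens tens_scale_left)
  moreover have "psi u v = - psi v u" using tens psi_skew by blast
  ultimately show ?case by simp
qed

lemma US_eqI:
  assumes "u \<in> US" "u' \<in> US" "\<And>w. w \<in> WS \<Longrightarrow> tens w u = tens w u'" shows "u = u'"
proof -
  obtain w where w: "w \<in> WS" "w \<noteq> 0" using WS_nonzero by blast
  have "tens w (u - u') + tens w u' = tens w u"
    using tens_add_right [of w "u - u'" u'] w assms(1,2) by (simp add: US_simps)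
  then have "tens w (u - u') = 0" using assms(3) [OF w(1)] by simp
  then show ?thesis using tens_eq_zero [OF w(1), of "u - u'"] w(2) assms(1,2) US_simps by simp
qed

text \<open>The assumptions on \<open>qact\<close> concern linearity in the vector; linearity in the
  operator is read off from the bracket with tensors.\<close>

lemma qact_diff:
  assumes "q \<in> Q" "r \<in> Q" "u \<in> US" shows "qact (q - sscale K c r) u = qact q u - su c (qact r u)"
proof (rule US_eqI)
  have m: "q - sscale K c r \<in> Q" using assms SQ_scale subspace_diff [OF SQ(4)] by blast
  show "qact (q - sscale K c r) u \<in> US" "qact q u - su c (qact r u) \<in> US"
    using m assms qact_in US_simps by auto
  fix w assume w: "w \<in> WS"
  have d: "tens w (qact q u - su c (qact r u)) + tens w (su c (qact r u)) = tens w (qact q u)"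
    using tens_add_right [of w "qact q u - su c (qact r u)" "su c (qact r u)"] w assms qact_in US_simps by simp
  have "tens w (qact (q - sscale K c r) u) = brk K (q - sscale K c r) (tens w u)"
    using qact_br [OF m w assms(3)] by simp
  also have "\<dots> = tens w (qact q u) - sscale K c (tens w (qact r u))"
    using assms w SQ_part tens_space by (simp add: br_diff_left br_scale_left space_scale qact_br)
  also have "\<dots> = tens w (qact q u - su c (qact r u))"
    using d w assms qact_in by (simp add: tens_scale_right algebra_simps)
  finally show "tens w (qact (q - sscale K c r) u) = tens w (qact q u - su c (qact r u))" .
qed

lemma qact_commutator:
  assumes "q \<in> Q" "r \<in> Q" "u \<in> US"
  shows "qact (brk K q r) u = qact q (qact r u) - qact r (qact q u)"
proof -
  obtain w where w: "w \<in> WS" "w \<noteq> 0" using WS_nonzero by blast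
  have s: "q \<in> part K False" "q \<in> space_of K" "r \<in> space_of K" "tens w u \<in> space_of K"
    using assms w SQ_part tens_space by auto
  have "tens w (qact q (qact r u)) = tens w (qact (brk K q r) u) + tens w (qact r (qact q u))"
    using jacobi_even [OF s(1,3,4)] assms w SQ_br(3) [OF assms(1,2)] by (simp add: qact_br qact_in)
  then have "tens w (qact q (qact r u)) = tens w (qact (brk K q r) u + qact r (qact q u))"
    using assms w SQ_br(3) [OF assms(1,2)] by (simp add: tens_add_right qact_in)
  moreover obtain w' where w': "w' \<in> WS" "sym w w' \<noteq> 0" using sym_nonzero w by blast
  ultimately have "su (sym w w') (qact q (qact r u)) = su (sym w w') (qact (brk K q r) u + qact r (qact q u))"
    using cw_tens [of w w'] assms w SQ_br(3) [OF assms(1,2)] by (metis US_simps(2) qact_in)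
  then show ?thesis using w' by simp
qed

text \<open>If \<open>s + q\<close> annihilates all tensors, contraction with a fixed
  \<open>w'\<close> shows that \<open>q\<close> acts on \<open>U\<close> by a scalar
  \<open>k\<close>. A scalar that is skew for \<open>psi\<close> is zero, so \<open>q\<close> and
  then \<open>s\<close> vanish by faithfulness.\<close>

lemma even_kernel:
  assumes z: "z \<in> part K False" "\<And>y. y \<in> part K True \<Longrightarrow> brk K z y = 0"
  shows "z = 0"
proof -
  obtain s q where sq: "s \<in> S" "q \<in> Q" "z = s + q" using SQ(6) z(1) by blast
  obtain w w' where w: "w \<in> WS" "w' \<in> WS" "sym w w' \<noteq> 0" using WS_nonzero sym_nonzero by blast
  define k where "k = - sym (sact s w) w' / sym w w'"
  have zero: "tens (sact s w) u + tens w (qact q u) = 0" if "w \<in> WS" "u \<in> US" for w u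
    using z(2) [OF tens_part [OF that]] sq that SQ_part tens_space by (simp add: br_add_left sact_br qact_br)
  have q_scalar: "qact q u = su k u" if u: "u \<in> US" for u
  proof -
    have "su (sym (sact s w) w') u + su (sym w w') (qact q u) = cw (tens (sact s w) u + tens w (qact q u)) w'"
      using w u sq by (simp add: cw_add cw_tens tens_part sact_in qact_in)
    also have "\<dots> = 0" using zero [OF w(1) u] w(2) cw_zero by simp
    finally have "su (sym w w') (qact q u) = su (- sym (sact s w) w') u"
      by (simp add: eq_neg_iff_add_eq_0 add.commute)
    then have "su (inverse (sym w w')) (su (sym w w') (qact q u)) = su (inverse (sym w w')) (su (- sym (sact s w) w') u)"
      by simp
    then show ?thesis using w(3) by (simp add: k_def divide_inverse mult.commute)
  qed
  have "k = 0 \<or> (\<forall>u\<in>US. \<forall>u'\<in>US. psi u u' = 0)"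
  proof (rule disjCI)
    assume "\<not> (\<forall>u\<in>US. \<forall>u'\<in>US. psi u u' = 0)"
    then obtain u u' where u: "u \<in> US" "u' \<in> US" "psi u u' \<noteq> 0" by blast
    have "k * psi u u' = - (k * psi u u')"
      using qact_psi [OF sq(2) u(1,2)] q_scalar u by (simp add: psi_scale psi_scale_right)
    then show "k = 0" using u by simp
  qed
  then have q0: "q = 0"
    using q_scalar psi_nondeg sq(2) by (intro qact_faithful) auto
  have "sact s w = 0" if "w \<in> WS" for w
  proof (rule ccontr)
    assume *: "sact s w \<noteq> 0"
    have "u = 0" if u: "u \<in> US" for u
      using zero [OF \<open>w \<in> WS\<close> u] tens_eq_zero [of "sact s w" u] q_scalar [OF u] q0 tens_zero \<open>w \<in> WS\<close> u sact_in [OF sq(1)] *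
        qact_faithful
      by (metis add.right_neutral br_zero_left qact_br sq(2) tens_space)
    then have "x = 0" if "x \<in> part K True" for x
      using cw_inj [OF that] cw_in [OF that] by blast
    then show False using nontrivial part_zero by blast
  qed
  then have "s = 0" using sact_faithful sq(1) by blast
  then show ?thesis using q0 sq by simp
qed

text \<open>The even component of a central element annihilates the odd part. The odd component
  \<open>b\<close> commutes with every \<open>quad v v\<close>, which makes
  \<open>2 psi(v, cw b w) v\<close> zero; a suitable \<open>v\<close> contradicts this if
  \<open>cw b w \<noteq> 0\<close>.\<close>

lemma center_trivial: "center K \<subseteq> {0}"
proof
  fix z assume "z \<in> center K"
  then have zs: "z \<in> space_of K" and z: "\<And>y. y \<in> space_of K \<Longrightarrow> brk K z y = 0" by (auto simp: center_def)
  obtain a b where ab: "a \<in> part K False" "b \<in> part K True" "z = a + b" using zs by (rule space_cases)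
  have hom: "brk K a y = 0 \<and> brk K b y = 0" if y: "y \<in> part K r" for y r
  proof -
    have "brk K a y + brk K b y = 0"
      using z [OF part_space [OF y]] ab y by (simp add: br_add_left part_space)
    then show ?thesis using part_sum_zero [of "brk K a y" r "brk K b y"] br_part [OF ab(1) y] br_part [OF ab(2) y] by auto
  qed
  have a0: "a = 0" using even_kernel [OF ab(1)] hom by blast
  have "b = 0"
  proof (rule cw_inj [OF ab(2)])
    fix w assume w: "w \<in> WS"
    show "cw b w = 0"
    proof (rule ccontr)
      assume "cw b w \<noteq> 0"
      then obtain v where v: "v \<in> US" "psi (cw b w) v \<noteq> 0" using psi_nonzero cw_in [OF ab(2) w] by blast
      then have v': "psi v (cw b w) \<noteq> 0" using psi_skew [OF v(1) cw_in [OF ab(2) w]] v(2) by simp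
      have "brk K (quad v v) b = - brk K b (quad v v)"
        using br_skew_even [of "quad v v" b] quad_in SQ_part ab part_space v by simp
      then have "brk K (quad v v) b = 0" using hom [of "quad v v" False] quad_in SQ_part v by simp
      then have "qact (quad v v) (cw b w) = 0"
        using cw_qact [OF ab(2) quad_in [OF v(1) v(1)] w] cw_zero w by simp
      then have "su (psi v (cw b w)) v + su (psi v (cw b w)) v = 0"
        using quad_act [OF v(1) v(1) cw_in [OF ab(2) w]] by simp
      then have "su (psi v (cw b w) + psi v (cw b w)) v = 0" by (simp only: U.scale_left_distrib)
      moreover have "v \<noteq> 0" using v' psi_zero cw_in [OF ab(2) w] by auto
      ultimately show False using v' by simp
    qed
  qed
  then show "z \<in> {0}" using a0 ab by simp
qed

text \<open>A non-central graded ideal contains a non-zero odd element, hence a pure tensor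
  \<open>tens w v\<close>, hence \<open>quad v v\<close>, hence every \<open>tens y v\<close>. From
  these come all \<open>quad u' v\<close>, and with them all tensors.\<close>

lemma graded_ideal_cases:
  assumes I: "graded_ideal K I" shows "part K True \<subseteq> I \<or> I \<subseteq> center K"
proof (rule disjCI)
  assume not: "\<not> I \<subseteq> center K"
  have sub: "subspace I" "I \<subseteq> space_of K"
    and graded: "\<And>a b. a \<in> part K False \<Longrightarrow> b \<in> part K True \<Longrightarrow> a + b \<in> I \<Longrightarrow> a \<in> I \<and> b \<in> I"
    and ideal: "\<And>x y. x \<in> space_of K \<Longrightarrow> y \<in> I \<Longrightarrow> brk K x y \<in> I"
    using I unfolding graded_ideal_def subspace_in_def by blast+
  have I_scale: "x \<in> I" if "sscale K c x \<in> I" "c \<noteq> 0" for c x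
    using subspace_scale [OF sub(1) that(1), of "inverse c"] that(2) by simp
  have "\<exists>x. x \<in> I \<and> x \<in> part K True \<and> x \<noteq> 0"
  proof -
    have "0 \<in> center K" by (simp add: center_def)
    then obtain z where z: "z \<in> I" "z \<noteq> 0" using not by blast
    then obtain a b where ab: "a \<in> part K False" "b \<in> part K True" "z = a + b"
      using sub(2) by (blast elim: space_cases)
    show ?thesis
    proof (cases "b = 0")
      case True
      then have "a \<noteq> 0" "a \<in> I" using z ab by auto
      then obtain y where y: "y \<in> part K True" "brk K a y \<noteq> 0" using even_kernel [OF ab(1)] by blast
      have "brk K y a \<in> I" using ideal y(1) \<open>a \<in> I\<close> part_space by blast
      then have "brk K a y \<in> I"
        using br_skew_even [OF ab(1), of y] y part_space subspace_neg [OF sub(1)] by simp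
      then show ?thesis using y br_part [OF ab(1) y(1)] by auto
    next
      case False
      then show ?thesis using graded [OF ab(1,2)] ab z by auto
    qed
  qed
  then obtain x where x: "x \<in> I" "x \<in> part K True" "x \<noteq> 0" by blast
  then obtain w0 where w0: "w0 \<in> WS" "cw x w0 \<noteq> 0" using cw_inj by blast
  then obtain v where v: "v \<in> US" "psi (cw x w0) v \<noteq> 0" using psi_nonzero cw_in x by blast
  define w where "w = cu x v"
  have w: "w \<in> WS" "w \<noteq> 0"
    using cu_in x v w0 cu_cw [OF x(2) w0(1) v(1)] sym_zero by (auto simp: w_def)
  have "brk K (quad v v) x \<in> I" using ideal x quad_in v SQ_part by blast
  then have wv: "tens w v \<in> I"
    using quad_cu [OF x(2) v(1)] I_scale [of "-2" "tens w v"] by (simp add: w_def)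
  obtain w' where w': "w' \<in> WS" "sym w w' \<noteq> 0" using sym_nonzero w by blast
  have s: "tens y u \<in> space_of K" if "y \<in> WS" "u \<in> US" for y u using tens_space that by blast
  have "brk K (tens w' v) (tens w v) \<in> I" using ideal s w' v wv by blast
  then have "quad v v \<in> I"
    using tens_br [of w' w v v] w w' v psi_self sym_comm I_scale [of "sym w w'" "quad v v"] by simp
  have quad_I: "sscale K (psi u' u) (tens y u'') + sscale K (psi u'' u) (tens y u') \<in> I"
    if "quad u'' u' \<in> I" "y \<in> WS" "u \<in> US" "u' \<in> US" "u'' \<in> US" for y u u' u''
  proof -
    have "brk K (tens y u) (quad u'' u') \<in> I" using ideal s that by blast
    then have "brk K (quad u'' u') (tens y u) \<in> I"
      using br_skew_even [of "quad u'' u'" "tens y u"] quad_in that SQ_part s subspace_neg [OF sub(1)] by simp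
    then show ?thesis
      using that by (simp add: qact_br quad_in quad_act tens_add_right tens_scale_right US_simps)
  qed
  have "psi v (cw x w0) \<noteq> 0" using psi_skew [OF v(1) cw_in [OF x(2) w0(1)]] v(2) by simp
  then obtain u where u: "u \<in> US" "psi v u \<noteq> 0" using cw_in [OF x(2) w0(1)] by blast
  have yv: "tens y v \<in> I" if "y \<in> WS" for y
  proof -
    have "sscale K (psi v u + psi v u) (tens y v) \<in> I"
      using quad_I [OF \<open>quad v v \<in> I\<close> that u(1) v(1) v(1)] by (simp only: scale_left_distrib)
    then show ?thesis using I_scale u(2) by simp
  qed
  have "tens y u' \<in> I" if y: "y \<in> WS" and u': "u' \<in> US" for y u'
  proof -
    \<comment> \<open>Adding the version with \<open>w\<close> and \<open>w'\<close> exchanged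
      cancels the \<open>S\<close>-components, as \<open>p\<close> is skew, and doubles the
      \<open>Q\<close>-component.\<close>
    have "brk K (tens w' u') (tens w v) + brk K (tens w u') (tens w' v) \<in> I"
      using ideal s w w' u' yv subspace_add [OF sub(1)] by blast
    moreover have "brk K (tens w' u') (tens w v) + brk K (tens w u') (tens w' v) = sscale K (sym w w' + sym w w') (quad u' v)"
      unfolding scale_left_distrib using w w' u' v p_skew [of w w'] sym_comm [of w' w] by (simp add: tens_br)
    ultimately have "quad u' v \<in> I" using I_scale [of "sym w w' + sym w w'" "quad u' v"] w' by simp
    then have "sscale K (psi v u) (tens y u') + sscale K (psi u' u) (tens y v) \<in> I"
      using quad_I [of u' v y u] y u u' v by blast
    moreover have "sscale K (psi u' u) (tens y v) \<in> I" using yv [OF y] subspace_scale [OF sub(1)] by blast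
    ultimately have "sscale K (psi v u) (tens y u') \<in> I"
      using subspace_diff [OF sub(1)] by (metis add_diff_cancel_right')
    then show ?thesis using I_scale u by blast
  qed
  then have "span {tens w u | w u. w \<in> WS \<and> u \<in> US} \<subseteq> I" using sub(1) by (intro span_minimal) auto
  then show "part K True \<subseteq> I" using tens_span by blast
qed

section \<open>Weights of a toral subalgebra on the tensor factors\<close>

context
  fixes \<hh> assumes tor: "toral K \<hh>"
begin

lemma h_sub: "\<hh> \<subseteq> part K False" "\<hh> \<subseteq> space_of K" "subspace \<hh>"
  using tor part_space by (auto simp: toral_def)

lemma h_central: "x \<in> part K False \<Longrightarrow> (\<And>y. y \<in> \<hh> \<Longrightarrow> brk K y x = 0) \<Longrightarrow> x \<in> \<hh>"
  using tor by (auto simp: toral_def)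

text \<open>\<open>S\<close> and \<open>Q\<close> commute with each other, so the components of an
  element of \<open>\<hh>\<close> commute with \<open>\<hh>\<close> and belong to it by
  self-centralization.\<close>

lemma h_components:
  assumes "z \<in> \<hh>" "s \<in> S" "q \<in> Q" "z = s + q"
  shows "s \<in> \<hh>" "q \<in> \<hh>"
proof -
  have "brk K y s = 0 \<and> brk K y q = 0" if y: "y \<in> \<hh>" for y
  proof -
    obtain s' q' where y': "s' \<in> S" "q' \<in> Q" "y = s' + q'" using SQ(6) y h_sub by blast
    have "brk K y z = 0" using tor y assms(1) by (simp add: toral_def)
    then have "brk K s' s + brk K q' q = 0"
      using y' assms SQ_part by (simp add: br_add_left br_add_right space_add SQ_br QS_br)
    then have "brk K s' s = 0" "brk K q' q = 0"
      using SQ_unique [OF SQ_br(2,3)] y' assms by blast+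
    then show ?thesis using y' assms SQ_part by (simp add: br_add_left SQ_br QS_br)
  qed
  then show "s \<in> \<hh>" "q \<in> \<hh>" using h_central SQ_part assms by blast+
qed

text \<open>\<open>U\<close> carries the action of \<open>Q\<close> only, so a functional on
  \<open>\<hh>\<close> matters here through its values on \<open>\<hh> \<inter> Q\<close>.\<close>

definition weight_u :: "('k \<Rightarrow> complex) \<Rightarrow> 'u \<Rightarrow> bool" where
  "weight_u a u \<longleftrightarrow> u \<in> US \<and> (\<forall>q\<in>\<hh> \<inter> Q. qact q u = su (a q) u)"

lemma weight_u_psi:
  assumes "weight_u a u" "weight_u b u'" "q \<in> \<hh> \<inter> Q" "a q + b q \<noteq> 0"
  shows "psi u u' = 0"
proof -
  have "a q * psi u u' = - (b q * psi u u')"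
    using qact_psi [of q u u'] assms by (simp add: weight_u_def psi_scale psi_scale_right)
  then have "(a q + b q) * psi u u' = 0" by (simp add: distrib_right)
  then show ?thesis using assms(4) by simp
qed

text \<open>Contracting odd root vectors with a fixed \<open>w'\<close> gives weight vectors of
  \<open>U\<close>, and up to a scalar every \<open>u\<close> is such a contraction of a
  tensor.\<close>

lemma US_weights: "US \<subseteq> U.span {u. \<exists>a. weight_u a u}"
proof
  fix u assume u: "u \<in> US"
  obtain w w' where w: "w \<in> WS" "w' \<in> WS" "sym w w' \<noteq> 0" using WS_nonzero sym_nonzero by blast
  let ?E = "{u. \<exists>a. weight_u a u}"
  have inj: "cw b w' \<in> ?E" if b: "b \<in> part K True" "b \<in> root_space K \<hh> \<beta>" for b \<beta>
  proof -
    have "qact q (cw b w') = su (\<beta> q) (cw b w')" if "q \<in> \<hh> \<inter> Q" for q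
      using cw_qact [OF b(1) _ w(2), of q] that b w by (simp add: root_space_def cw_scale)
    then show ?thesis using cw_in [OF b(1) w(2)] by (auto simp: weight_u_def)
  qed
  have sub: "subspace {x \<in> part K True. cw x w' \<in> U.span ?E}"
    unfolding subspace_def using w
    by (auto simp: part_add part_scale cw_add cw_scale cw_zero U.span_zero U.span_add U.span_scale)
  have "span {x \<in> part K True. \<exists>\<beta>. x \<in> root_space K \<hh> \<beta>} \<subseteq> {x \<in> part K True. cw x w' \<in> U.span ?E}"
    by (rule span_minimal [OF _ sub]) (use inj U.span_base in blast)
  then have "cw (tens w u) w' \<in> U.span ?E" using toral_odd_span [OF tor] tens_part [OF w(1) u] by blast
  then have "su (sym w w') u \<in> U.span ?E" using w u by (simp add: cw_tens)
  then show "u \<in> U.span ?E" using U.span_scale [of "su (sym w w') u" ?E "inverse (sym w w')"] w(3) by simp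
qed

lemma weight_u_dual:
  assumes u: "weight_u a u" "u \<noteq> 0"
  obtains u' where "weight_u (\<lambda>q. - a q) u'" "psi u u' \<noteq> 0"
proof -
  have us: "u \<in> US" using u by (simp add: weight_u_def)
  obtain z where z: "z \<in> US" "psi u z \<noteq> 0" using psi_nonzero us u by blast
  have "\<exists>b z. weight_u b z \<and> psi u z \<noteq> 0"
  proof (rule ccontr)
    assume *: "\<not> ?thesis"
    have "U.subspace {z \<in> US. psi u z = 0}"
      unfolding U.subspace_def using us by (auto simp: US_simps psi_zero psi_add_right psi_scale_right)
    then have "U.span {z. \<exists>b. weight_u b z} \<subseteq> {z \<in> US. psi u z = 0}"
      by (rule U.span_minimal [rotated]) (use * in \<open>auto simp: weight_u_def\<close>)
    then show False using US_weights z by blast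
  qed
  then obtain b u' where u': "weight_u b u'" "psi u u' \<noteq> 0" by blast
  have "b q = - a q" if "q \<in> \<hh> \<inter> Q" for q
    using weight_u_psi [OF u(1) u'(1) that] u'(2) by (metis eq_neg_iff_add_eq_0 add.commute)
  then have "weight_u (\<lambda>q. - a q) u'" using u'(1) by (simp add: weight_u_def)
  then show ?thesis using that u' by blast
qed

text \<open>The operator built from vectors of opposite weights has weight 0, so it commutes with
  \<open>\<hh>\<close>. This is the source of explicit elements of \<open>\<hh>\<close>.\<close>

lemma quad_toral:
  assumes u: "weight_u a u" and u': "weight_u (\<lambda>q. - a q) u'"
  shows "quad u u' \<in> \<hh> \<inter> Q"
proof -
  have us: "u \<in> US" "u' \<in> US" using u u' by (auto simp: weight_u_def)
  have "brk K y (quad u u') = 0" if y: "y \<in> \<hh>" for y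
  proof -
    obtain s q where sq: "s \<in> S" "q \<in> Q" "y = s + q" using SQ(6) y h_sub by blast
    then have q: "q \<in> \<hh> \<inter> Q" using h_components y by blast
    have "brk K q (quad u u') = 0"
    proof (rule qact_faithful)
      show "brk K q (quad u u') \<in> Q" using SQ_br(3) sq quad_in us by blast
      fix z assume z: "z \<in> US"
      have psi_q: "psi u' (qact q z) = a q * psi u' z" "psi u (qact q z) = - a q * psi u z"
        using qact_psi [of q u' z] qact_psi [of q u z] u u' us z q
        by (auto simp: weight_u_def psi_scale psi_minus US_simps)
      have "qact (brk K q (quad u u')) z = qact q (su (psi u' z) u + su (psi u z) u') - (su (psi u' (qact q z)) u + su (psi u (qact q z)) u')"
        using qact_commutator [OF sq(2) quad_in [OF us] z] us z sq qact_in by (simp add: quad_act)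
      also have "\<dots> = 0"
        using us sq u u' q unfolding psi_q
        by (simp add: qact_add qact_scale US_simps weight_u_def mult.commute)
      finally show "qact (brk K q (quad u u')) z = 0" .
    qed
    then show ?thesis using sq SQ_br(1) quad_in us SQ_part by (simp add: br_add_left)
  qed
  then show ?thesis using h_central quad_in us SQ_part by blast
qed

text \<open>If the weight of \<open>u\<close> were 0, then \<open>quad u u\<close> would lie in
  \<open>\<hh>\<close> and act by zero on a dual vector \<open>u'\<close>, but it maps
  \<open>u'\<close> to \<open>2 psi u u'\<close> times \<open>u\<close>.\<close>

lemma weight_u_nonzero:
  assumes u: "weight_u a u" "u \<noteq> 0"
  shows "\<exists>q\<in>\<hh> \<inter> Q. a q \<noteq> 0"
proof (rule ccontr)
  assume *: "\<not> ?thesis"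
  then have w0: "weight_u (\<lambda>q. - a q) u" using u by (auto simp: weight_u_def)
  obtain u' where u': "weight_u (\<lambda>q. - a q) u'" "psi u u' \<noteq> 0" using weight_u_dual u by blast
  have q: "quad u u \<in> \<hh> \<inter> Q" by (rule quad_toral [OF u(1) w0])
  have "qact (quad u u) u' = 0" using u'(1) q * by (auto simp: weight_u_def)
  then have "su (psi u u' + psi u u') u = 0"
    unfolding U.scale_left_distrib using u u' by (simp add: weight_u_def quad_act)
  then show False using u(2) u'(2) by simp
qed

text \<open>With \<open>u'\<close> dual to \<open>u\<close>, the operator \<open>quad v u'\<close>
  lies in \<open>\<hh>\<close> and so acts on \<open>u\<close> by a scalar; since
  \<open>psi v u = 0\<close>, its value at \<open>u\<close> is a non-zero multiple of
  \<open>v\<close>.\<close>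

lemma weight_u_line:
  assumes u: "weight_u a u" "u \<noteq> 0" and v: "weight_u a v"
  shows "\<exists>c. v = su c u"
proof -
  obtain u' where u': "weight_u (\<lambda>q. - a q) u'" "psi u u' \<noteq> 0" using weight_u_dual u by blast
  obtain q where q: "q \<in> \<hh> \<inter> Q" "a q \<noteq> 0" using weight_u_nonzero u by blast
  have us: "u \<in> US" "u' \<in> US" "v \<in> US" using u u' v by (auto simp: weight_u_def)
  have r: "quad v u' \<in> \<hh> \<inter> Q" by (rule quad_toral [OF v u'(1)])
  have "psi v u = 0" using weight_u_psi [OF v u(1) q(1)] q(2) by simp
  then have "su (psi u' u) v = su (a (quad v u')) u"
    using quad_act [of v u' u] us u(1) r by (simp add: weight_u_def)
  then have "su (inverse (psi u' u)) (su (psi u' u) v) = su (inverse (psi u' u)) (su (a (quad v u')) u)" by simp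
  moreover have "psi u' u \<noteq> 0" using psi_skew [OF us(1,2)] u'(2) by simp
  ultimately show ?thesis by auto
qed

text \<open>All contractions \<open>cw e w\<close> have the same weight in \<open>U\<close>, so they
  lie on one line; the tensor \<open>e\<close> has rank one.\<close>

lemma odd_root_vector:
  assumes e: "e \<in> part K True" "e \<in> root_space K \<hh> a" "e \<noteq> 0"
  obtains w u where "w \<in> WS" "u \<in> US" "w \<noteq> 0" "u \<noteq> 0" "e = tens w u" "weight_u a u"
    "\<forall>s\<in>\<hh> \<inter> S. sact s w = sw (a s) w"
proof -
  have wt: "weight_u a (cw e w)" if w: "w \<in> WS" for w
  proof -
    have "qact q (cw e w) = su (a q) (cw e w)" if "q \<in> \<hh> \<inter> Q" for q
      using cw_qact [OF e(1) _ w, of q] that e w by (simp add: root_space_def cw_scale)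
    then show ?thesis using cw_in [OF e(1) w] by (simp add: weight_u_def)
  qed
  obtain w0 where w0: "w0 \<in> WS" "cw e w0 \<noteq> 0" using cw_inj e by blast
  define u where "u = cw e w0"
  have u: "weight_u a u" "u \<noteq> 0" "u \<in> US" using wt w0 by (auto simp: u_def weight_u_def)
  obtain z where z: "z \<in> US" "psi u z \<noteq> 0" using psi_nonzero u by blast
  define w where "w = sw (inverse (psi u z)) (cu e z)"
  have w: "w \<in> WS" unfolding w_def using cu_in e z WS_simps by blast
  have eq: "e = tens w u"
  proof (rule tens_eqI [OF e(1) tens_part [OF w u(3)]])
    fix w' assume w': "w' \<in> WS"
    obtain c where c: "cw e w' = su c u" using weight_u_line [OF u(1,2) wt [OF w']] by blast
    have "sym w w' = inverse (psi u z) * psi (su c u) z"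
      unfolding w_def using cu_cw [OF e(1) w' z(1)] c w' cu_in [OF e(1) z(1)] by (simp add: sym_scale)
    also have "\<dots> = c" using z u by (simp add: psi_scale)
    finally show "cw e w' = cw (tens w u) w'" using c w w' u by (simp add: cw_tens)
  qed
  have "w \<noteq> 0" using eq e(3) tens_zero u by auto
  moreover have "sact s w = sw (a s) w" if s: "s \<in> \<hh> \<inter> S" for s
  proof -
    have "brk K s e = sscale K (a s) e" using e(2) s by (simp add: root_space_def)
    then have "tens (sact s w) u = tens (sw (a s) w) u"
      using s w u by (simp add: eq sact_br tens_scale_left)
    then have "tens (sact s w - sw (a s) w) u = 0"
      using tens_add_left [of "sact s w - sw (a s) w" "sw (a s) w" u] s w u sact_in by (simp add: WS_simps)
    then show ?thesis using tens_eq_zero [of "sact s w - sw (a s) w" u] u s w sact_in WS_simps by auto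
  qed
  ultimately show ?thesis using that w u eq by blast
qed

lemma odd_zero_weight: "root_space K \<hh> (\<lambda>_. 0) \<inter> part K True \<subseteq> {0}"
proof
  fix x assume x: "x \<in> root_space K \<hh> (\<lambda>_. 0) \<inter> part K True"
  show "x \<in> {0}"
  proof (rule ccontr)
    assume "x \<notin> {0}"
    then have x': "x \<in> part K True" "x \<in> root_space K \<hh> (\<lambda>_. 0)" "x \<noteq> 0" using x by auto
    obtain u where "weight_u (\<lambda>_. 0) u" "u \<noteq> 0" by (rule odd_root_vector [OF x'])
    then show False using weight_u_nonzero by blast
  qed
qed

lemma weight_u_pairing:
  assumes u: "weight_u a u" "u \<noteq> 0" and v: "weight_u (- a) v" "v \<noteq> 0"
  shows "psi u v \<noteq> 0"
proof -
  obtain u' where u': "weight_u (\<lambda>q. - a q) u'" "psi u u' \<noteq> 0" using weight_u_dual u by blast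
  have v': "weight_u (\<lambda>q. - a q) v" using v by (simp add: weight_u_def)
  obtain c where c: "u' = su c v" using weight_u_line [OF v' v(2) u'(1)] by blast
  then have "psi u u' = c * psi u v" using u v by (simp add: weight_u_def psi_scale_right)
  then show ?thesis using u'(2) by auto
qed

text \<open>In the Jacobi identity for \<open>s\<close> and two tensors the
  \<open>Q\<close>-component must vanish, because \<open>S\<close> commutes with \<open>Q\<close>;
  its coefficient is the invariance defect of \<open>sym\<close>.\<close>

lemma sact_sym:
  assumes s: "s \<in> S" and w: "w \<in> WS" "w' \<in> WS"
  shows "sym (sact s w) w' = - sym w (sact s w')"
proof -
  obtain u where u: "u \<in> US" "u \<noteq> 0"
  proof -
    obtain x where "x \<in> part K True" "x \<noteq> 0" using nontrivial part_zero by blast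
    then show ?thesis using that cw_inj cw_in by blast
  qed
  then obtain u' where u': "u' \<in> US" "psi u u' \<noteq> 0" using psi_nonzero by blast
  have q: "quad u u' \<noteq> 0"
  proof
    assume "quad u u' = 0"
    then have "tens w0 (qact (quad u u') u) = 0" if "w0 \<in> WS" for w0
      using qact_br [OF quad_in [OF u(1) u'(1)] that u(1)] tens_space [OF that u(1)] by simp
    moreover have "qact (quad u u') u = su (psi u' u) u"
      using u u' by (simp add: quad_act psi_self)
    moreover obtain w0 where "w0 \<in> WS" "w0 \<noteq> 0" using WS_nonzero by blast
    ultimately have "su (psi u' u) u = 0" using tens_eq_zero [of w0 "su (psi u' u) u"] u US_simps by auto
    then show False using u u' psi_skew [OF u(1) u'(1)] by simp
  qed
  have sp: "s \<in> part K False" "s \<in> space_of K" "quad u u' \<in> space_of K" "p w w' \<in> space_of K"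
    using s SQ_part u u' w quad_in p_in by blast+
  have "brk K s (brk K (tens w u) (tens w' u')) =
    brk K (tens (sact s w) u) (tens w' u') + brk K (tens w u) (tens (sact s w') u')"
    using jacobi_even [OF sp(1)] s w u u' tens_space sact_in by (simp add: sact_br)
  moreover have "brk K s (brk K (tens w u) (tens w' u')) = sscale K (psi u u') (brk K s (p w w'))"
    using s w u u' sp SQ_br(1) [OF s quad_in [OF u(1) u'(1)]]
    by (simp add: tens_br br_add_right br_scale_right space_scale)
  ultimately have "sscale K (psi u u') (p (sact s w) w' + p w (sact s w') - brk K s (p w w')) +
     sscale K (sym (sact s w) w' + sym w (sact s w')) (quad u u') = 0"
    using s w u u' sact_in by (simp add: tens_br algebra_simps)
  moreover have "sscale K (psi u u') (p (sact s w) w' + p w (sact s w') - brk K s (p w w')) \<in> S"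
    by (intro SQ_scale(1) subspace_diff [OF SQ(3)] subspace_add [OF SQ(3)] p_in SQ_br(2) sact_in s w)
  ultimately have "sscale K (sym (sact s w) w' + sym w (sact s w')) (quad u u') = 0"
    using SQ_unique SQ_scale(2) [OF quad_in [OF u(1) u'(1)]] by blast
  then show ?thesis using q by (simp add: eq_neg_iff_add_eq_0)
qed

text \<open>Write \<open>e = tens w u\<close> and \<open>f = tens w' u'\<close>. The element
  \<open>r = quad u u'\<close> of \<open>\<hh>\<close> has \<open>a r \<noteq> 0\<close>; the main
  point is to find \<open>s0\<close> in \<open>\<hh> \<inter> S\<close> with
  \<open>a s0 \<noteq> 0\<close>. The latter makes \<open>w\<close> isotropic, and both together
  exclude even root vectors of weight \<open>a\<close> and \<open>a + a\<close>, which would have to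
  lie in \<open>Q\<close> and in \<open>S\<close> at once.\<close>

lemma reflection_root:
  assumes B: "invariant_form K B"
    and e: "e \<in> root_space K \<hh> a \<inter> part K True" and f: "f \<in> root_space K \<hh> (- a) \<inter> part K True"
    and Bef: "B e f \<noteq> 0" and iso: "brk K (brk K e f) e = 0"
  shows "reflection_root K \<hh> a e"
proof -
  have Bp: "B (x + y) z = B x z + B y z" "B (sscale K c x) y = c * B x y" "B x (sscale K c y) = c * B x y"
    "B (brk K x y) z = B x (brk K y z)" if "x \<in> space_of K" "y \<in> space_of K" "z \<in> space_of K" for x y z c
    using B that unfolding invariant_form_def by blast+
  have B0: "B 0 z = 0" "B z 0 = 0" if "z \<in> space_of K" for z
    using Bp(2) [of 0 z z 0] Bp(3) [of z 0 z 0] that by auto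
  have s: "e \<in> space_of K" "f \<in> space_of K" using e f part_space by blast+
  have e': "e \<in> part K True" "e \<in> root_space K \<hh> a" "e \<noteq> 0" using e Bef B0 s by auto
  have f': "f \<in> part K True" "f \<in> root_space K \<hh> (- a)" "f \<noteq> 0" using f Bef B0 s by auto
  obtain w u where wu: "w \<in> WS" "u \<in> US" "w \<noteq> 0" "u \<noteq> 0" "e = tens w u" "weight_u a u"
    "\<forall>s\<in>\<hh> \<inter> S. sact s w = sw (a s) w" by (rule odd_root_vector [OF e'])
  obtain w' u' where wu': "w' \<in> WS" "u' \<in> US" "w' \<noteq> 0" "u' \<noteq> 0" "f = tens w' u'" "weight_u (- a) u'"
    "\<forall>s\<in>\<hh> \<inter> S. sact s w' = sw ((- a) s) w'" by (rule odd_root_vector [OF f'])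
  have psi_uu: "psi u u' \<noteq> 0" by (rule weight_u_pairing [OF wu(6,4) wu'(6,4)])
  have u'w: "weight_u (\<lambda>q. - a q) u'" using wu'(6) by (simp add: weight_u_def)
  define r where "r = quad u u'"
  have r: "r \<in> \<hh>" "r \<in> Q" using quad_toral [OF wu(6) u'w] by (auto simp: r_def)
  have r_act: "qact r z = su (psi u' z) u + su (psi u z) u'" if "z \<in> US" for z
    unfolding r_def by (rule quad_act [OF wu(2) wu'(2) that])
  have "su (a r) u = su (psi u' u) u"
    using r_act [OF wu(2)] wu(6) r psi_self [OF wu(2)] by (simp add: weight_u_def)
  then have "a r = psi u' u" using wu(4) by simp
  then have ar: "a r \<noteq> 0" using psi_uu psi_skew [OF wu(2) wu'(2)] by simp
  have sp: "r \<in> part K False" "r \<in> space_of K" "p w w' \<in> S" "p w w' \<in> space_of K"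
    using r SQ_part p_in wu wu' by blast+
  have ef: "brk K e f = sscale K (psi u u') (p w w') + sscale K (sym w w') r"
    unfolding wu(5) wu'(5) r_def using tens_br wu(1,2) wu'(1,2) by blast
  have t: "brk K e f \<in> \<hh>"
  proof (rule h_central)
    show "brk K e f \<in> part K False" using br_part [OF e'(1) f'(1)] by simp
    have "brk K e f \<in> root_space K \<hh> (a + - a)" by (rule root_space_br [OF h_sub(1) e'(2) f'(2)])
    then show "brk K y (brk K e f) = 0" if "y \<in> \<hh>" for y using that by (simp add: root_space_def)
  qed
  have "sscale K (psi u u') (p w w') \<in> \<hh>"
    by (rule h_components(1) [OF t SQ_scale(1) [OF sp(3)] SQ_scale(2) [OF r(2)] ef])
  then have P: "p w w' \<in> \<hh>"
    using subspace_scale [OF h_sub(3), of "sscale K (psi u u') (p w w')" "inverse (psi u u')"] psi_uu by simp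
  \<comment> \<open>Otherwise \<open>brk K (brk K e f) e = 0\<close> forces
    \<open>sym w w' = 0\<close>, so \<open>brk K e f\<close> lies in \<open>S\<close>. Invariance
    gives \<open>B (brk K e f) r = a r * B e f\<close>, which is not zero, whereas
    \<open>p w w'\<close> is orthogonal to \<open>r\<close>.\<close>
  have "\<exists>s\<in>\<hh> \<inter> S. a s \<noteq> 0"
  proof (rule ccontr)
    assume no: "\<not> ?thesis"
    then have aP: "a (p w w') = 0" using P sp by blast
    have "brk K (p w w') e = 0" "brk K r e = sscale K (a r) e"
      using e'(2) P r aP by (simp_all add: root_space_def)
    then have "sscale K (sym w w' * a r) e = 0"
      using iso sp s unfolding ef by (simp add: br_add_left br_scale_left space_scale)
    then have sym0: "sym w w' = 0" using ar e'(3) by simp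
    have "B (brk K e f) r = B e (brk K f r)" using Bp(4) s sp by blast
    also have "brk K f r = sscale K (a r) f"
    proof -
      have "- brk K f r = sscale K (- a r) f"
        using br_skew_even [OF sp(1) s(2)] f'(2) r by (simp add: root_space_def)
      then show ?thesis by simp
    qed
    finally have "B (brk K e f) r \<noteq> 0" using Bp(3) [of e f e "a r"] s Bef ar by simp
    moreover have "B (p w w') r = 0"
    proof -
      have X: "quad u u \<in> Q" "quad u' u' \<in> Q" "quad u u \<in> space_of K" "quad u' u' \<in> space_of K"
        using quad_in SQ_part wu wu' by blast+
      \<comment> \<open>Up to the factor \<open>4 * psi u u'\<close>, the element \<open>r\<close>
        is a bracket inside \<open>Q\<close>, and such brackets are orthogonal to \<open>S\<close>
        by invariance.\<close>
      have "brk K (quad u u) (quad u' u') - sscale K (4 * psi u u') r = 0"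
      proof (rule qact_faithful)
        have m: "brk K (quad u u) (quad u' u') \<in> Q" "sscale K (4 * psi u u') r \<in> Q"
          using SQ_br(3) X SQ_scale r by blast+
        then show Q: "brk K (quad u u) (quad u' u') - sscale K (4 * psi u u') r \<in> Q"
          by (rule subspace_diff [OF SQ(4)])
        fix z assume z: "z \<in> US"
        have "qact (quad u u) z = su (2 * psi u z) u" "qact (quad u' u') z = su (2 * psi u' z) u'"
          using wu(2) wu'(2) z by (simp_all add: quad_act U.scale_left_distrib [symmetric])
        moreover have "qact (quad u u) (su c u') = su (c * (2 * psi u u')) u" "qact (quad u' u') (su c u) = su (c * (2 * psi u' u)) u'" for c
          using wu(2) wu'(2) quad_in
          by (simp_all add: qact_scale quad_act U.scale_left_distrib [symmetric])
        moreover have "psi u' u = - psi u u'" by (rule psi_skew [OF wu'(2) wu(2)])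
        ultimately show "qact (brk K (quad u u) (quad u' u') - sscale K (4 * psi u u') r) z = 0"
          using qact_commutator [OF X(1,2) z] m(1) r(2) z r_act [OF z]
          by (simp add: qact_diff U.scale_right_distrib mult_ac)
      qed
      then have "sscale K (4 * psi u u') r = brk K (quad u u) (quad u' u')" by simp
      moreover have "B (p w w') (brk K (quad u u) (quad u' u')) = 0"
        using Bp(4) [of "p w w'" "quad u u" "quad u' u'"] sp X SQ_br(1) B0 by simp
      ultimately have "4 * psi u u' * B (p w w') r = 0" using Bp(3) [of "p w w'" r r] sp by metis
      then show ?thesis using psi_uu by simp
    qed
    ultimately show False unfolding ef using sym0 Bp(2) sp by simp
  qed
  then obtain s0 where s0: "s0 \<in> \<hh>" "s0 \<in> S" "a s0 \<noteq> 0" by blast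
  have isotropic: "sym x x = 0" if x: "x \<in> WS" "sact s0 x = sw c x" "c \<noteq> 0" for x c
  proof -
    have "c * sym x x = - (c * sym x x)"
      using sact_sym [OF s0(2) x(1) x(1)] x by (simp add: sym_scale sym_scale_right)
    then show ?thesis using x(3) by simp
  qed
  \<comment> \<open>If \<open>r\<close> and \<open>s0\<close> both act on \<open>z\<close> by
    non-zero scalars, then \<open>z\<close> is a multiple of a bracket with \<open>r\<close>, hence
    in \<open>Q\<close>, and of a bracket with \<open>s0\<close>, hence in \<open>S\<close>.\<close>
  have even: "z = 0" if z: "z \<in> root_space K \<hh> b" "z \<in> part K False" "b r \<noteq> 0" "b s0 \<noteq> 0" for z b
  proof -
    obtain s q where sq: "s \<in> S" "q \<in> Q" "z = s + q" using SQ(6) z(2) by blast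
    have ss: "s0 \<in> space_of K" using s0 SQ_part by blast
    have "brk K r z = sscale K (b r) z" "brk K s0 z = sscale K (b s0) z"
      using z(1) r s0 by (simp_all add: root_space_def)
    moreover have "brk K r z = brk K r q"
      using r sq sp SQ_part QS_br [OF r(2) sq(1)] by (simp add: br_add_right)
    moreover have "brk K s0 z = brk K s0 s"
      using s0 sq ss SQ_part SQ_br(1) [OF s0(2) sq(2)] by (simp add: br_add_right)
    ultimately have "sscale K (b r) z \<in> Q" "sscale K (b s0) z \<in> S"
      using SQ_br(2) [OF s0(2) sq(1)] SQ_br(3) [OF r(2) sq(2)] by simp_all
    then have "sscale K (inverse (b r)) (sscale K (b r) z) \<in> Q" "sscale K (inverse (b s0)) (sscale K (b s0) z) \<in> S"
      using SQ_scale by blast+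
    then show ?thesis using SQ(5) z(3,4) by auto
  qed
  show ?thesis
    unfolding reflection_root_def
  proof (intro conjI ballI impI subsetI)
    have "sym w w = 0" by (rule isotropic [OF wu(1) bspec [OF wu(7)] s0(3)]) (use s0 in simp)
    then show "brk K e e = 0"
      using tens_br [OF wu(1) wu(1) wu(2) wu(2)] psi_self wu(2) by (simp add: wu(5))
    show "z \<in> {0}" if "z \<in> root_space K \<hh> a \<inter> part K False" for z
      using even [of z a] that ar s0 by simp
    show "z \<in> {0}" if z: "z \<in> root_space K \<hh> (a + a)" for z
    proof -
      obtain b c where bc: "b \<in> part K False" "c \<in> part K True" "z = b + c"
        "b \<in> root_space K \<hh> (a + a)" "c \<in> root_space K \<hh> (a + a)"
        using root_space_cases [OF h_sub(1) z] by blast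
      have "b = 0" using even [OF bc(4,1)] ar s0 by simp
      moreover have "c = 0"
      proof (rule ccontr)
        assume "c \<noteq> 0"
        obtain x y where xy: "x \<in> WS" "y \<in> US" "y \<noteq> 0" "weight_u (a + a) y"
          by (rule odd_root_vector [OF bc(2,5) \<open>c \<noteq> 0\<close>])
        have rh: "r \<in> \<hh> \<inter> Q" using r by blast
        \<comment> \<open>At \<open>r\<close> the weights of \<open>u\<close>, \<open>u'\<close> and
          \<open>y\<close> are \<open>a r\<close>, \<open>- a r\<close> and \<open>2 * a r\<close>.
          Neither of the first two cancels the third, so \<open>y\<close> is orthogonal to
          \<open>u\<close> and \<open>u'\<close> and is killed by \<open>r\<close>, contrary to its
          weight.\<close>
        have "psi u y = 0" by (rule weight_u_psi [OF wu(6) xy(4) rh]) (use ar in simp)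
        moreover have "psi u' y = 0" by (rule weight_u_psi [OF wu'(6) xy(4) rh]) (use ar in simp)
        ultimately have "qact r y = 0" using r_act [OF xy(2)] by simp
        then have "su ((a + a) r) y = 0" using xy(4) rh unfolding weight_u_def by simp
        then show False using xy(3) ar by simp
      qed
      ultimately show ?thesis using bc by simp
    qed
    fix x y assume x: "x \<in> root_space K \<hh> a \<inter> part K True" and y: "y \<in> root_space K \<hh> (- a) \<inter> part K True"
      and xy: "brk K x y = 0"
    show "x = 0 \<or> y = 0"
    proof (rule ccontr)
      assume nz: "\<not> (x = 0 \<or> y = 0)"
      then have x': "x \<in> part K True" "x \<in> root_space K \<hh> a" "x \<noteq> 0"
        and y': "y \<in> part K True" "y \<in> root_space K \<hh> (- a)" "y \<noteq> 0" using x y by auto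
      obtain w1 u1 where 1: "w1 \<in> WS" "u1 \<in> US" "w1 \<noteq> 0" "u1 \<noteq> 0" "x = tens w1 u1" "weight_u a u1"
        "\<forall>s\<in>\<hh> \<inter> S. sact s w1 = sw (a s) w1" by (rule odd_root_vector [OF x'])
      obtain w2 u2 where 2: "w2 \<in> WS" "u2 \<in> US" "w2 \<noteq> 0" "u2 \<noteq> 0" "y = tens w2 u2" "weight_u (- a) u2"
        "\<forall>s\<in>\<hh> \<inter> S. sact s w2 = sw ((- a) s) w2" by (rule odd_root_vector [OF y'])
      have psi12: "psi u1 u2 \<noteq> 0" by (rule weight_u_pairing [OF 1(6,4) 2(6,4)])
      have "sscale K (psi u1 u2) (p w1 w2) + sscale K (sym w1 w2) (quad u1 u2) = 0"
        using xy tens_br [OF 1(1) 2(1) 1(2) 2(2)] by (simp add: 1(5) 2(5))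
      then have "sscale K (psi u1 u2) (p w1 w2) = 0 \<and> sscale K (sym w1 w2) (quad u1 u2) = 0"
        by (rule SQ_unique [OF SQ_scale(1) [OF p_in [OF 1(1) 2(1)]] SQ_scale(2) [OF quad_in [OF 1(2) 2(2)]]])
      moreover have "quad u1 u2 \<noteq> 0"
      proof
        assume 0: "quad u1 u2 = 0"
        have "tens w1 (qact (quad u1 u2) u1) = 0"
          using qact_br [OF quad_in [OF 1(2) 2(2)] 1(1,2)] 0 tens_space [OF 1(1,2)] by simp
        then have "qact (quad u1 u2) u1 = 0"
          using tens_eq_zero [OF 1(1) qact_in [OF quad_in [OF 1(2) 2(2)] 1(2)]] 1(3) by blast
        then have "su (psi u2 u1) u1 = 0" using quad_act [OF 1(2) 2(2) 1(2)] psi_self [OF 1(2)] by simp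
        then show False using psi12 psi_skew [OF 1(2) 2(2)] 1(4) by simp
      qed
      ultimately have "p w1 w2 = 0" "sym w1 w2 = 0" using psi12 by auto
      moreover have "sym w1 w1 = 0" by (rule isotropic [OF 1(1) bspec [OF 1(7)] s0(3)]) (use s0 in simp)
      moreover have "sym w2 w2 = 0" by (rule isotropic [OF 2(1) bspec [OF 2(7)]]) (use s0 in simp_all)
      ultimately obtain c where c: "w2 = sw c w1" using p_parallel [OF 1(1) 2(1) 1(3)] by blast
      \<comment> \<open>\<open>w1\<close> and \<open>w2\<close> are proportional but have opposite
        eigenvalues under \<open>s0\<close>. The comparison goes through the invariance of
        \<open>sym\<close>, as linearity of \<open>sact\<close> in the vector is not among the
        assumptions.\<close>
      have "- (a s0 * sym w2 z) = a s0 * sym w2 z" if z: "z \<in> WS" for z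
      proof -
        have "sym (sact s0 w2) z = - (a s0 * sym w2 z)"
          using bspec [OF 2(7), of s0] s0 2(1) z sym_scale [of w2 z "- a s0"] by simp
        moreover have "sym (sact s0 w2) z = a s0 * sym w2 z"
        proof -
          have "sym (sact s0 w2) z = - sym w2 (sact s0 z)" using sact_sym [OF s0(2) 2(1) z] .
          also have "\<dots> = - (c * sym w1 (sact s0 z))"
            using c 1(1) z sact_in [OF s0(2) z] by (simp add: sym_scale)
          also have "\<dots> = c * sym (sact s0 w1) z" using sact_sym [OF s0(2) 1(1) z] by simp
          also have "\<dots> = a s0 * sym w2 z"
            using bspec [OF 1(7), of s0] s0 c 1(1) z by (simp add: sym_scale)
          finally show ?thesis .
        qed
        ultimately show ?thesis by simp
      qed
      then have "w2 = 0" using s0(3) sym_nondeg [OF 2(1)] by simp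
      then show False using 2(3) by simp
    qed
  qed
qed

end

theorem admissible_tensor: "admissible K"
  unfolding admissible_def span_in_eq
proof (intro conjI ballI allI impI)
  show "\<exists>X. finite X \<and> space_of K \<subseteq> span X" by (rule fin)
  show "z \<in> center K" if "z \<in> part K False" "\<forall>y\<in>part K True. brk K z y = 0" for z
  proof -
    have "z = 0" by (rule even_kernel [OF that(1)]) (use that(2) in blast)
    then show ?thesis by (simp add: center_def)
  qed
  show "brk K x y = 0" if "brk K x y \<in> center K" for x y
    using center_trivial that by blast
  show "toral K (part K False) \<or> (\<forall>I. graded_ideal K I \<longrightarrow> I \<subseteq> center K \<or> part K True \<subseteq> I)"
    using graded_ideal_cases by blast
  show "root_space K \<hh> (\<lambda>_. 0) \<inter> part K True \<subseteq> {0}" if "toral K \<hh>" for \<hh>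
    by (rule odd_zero_weight [OF that])
  fix \<hh> B a e f
  assume "toral K \<hh> \<and> invariant_form K B \<and> e \<in> root_space K \<hh> a \<inter> part K True \<and>
        f \<in> root_space K \<hh> (- a) \<inter> part K True \<and> B e f \<noteq> 0 \<and> brk K (brk K e f) e = 0"
  then show "reflection_root K \<hh> a e" by (elim conjE) (rule reflection_root)
qed

end

section \<open>The general and special linear Lie superalgebras\<close>

definition unit_matrix :: "nat \<Rightarrow> nat \<Rightarrow> nat \<Rightarrow> nat \<Rightarrow> complex" where
  "unit_matrix a b i j = (if i = a \<and> j = b then 1 else 0)"

definition one_matrix :: "nat \<Rightarrow> nat \<Rightarrow> nat \<Rightarrow> complex" where
  "one_matrix N i j = (if i = j \<and> i < N then 1 else 0)"

lemma unit_matrix_sums: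
  "(\<Sum>k<N. unit_matrix a b i k * Y k j) = (if i = a \<and> b < N then Y b j else 0)"
  "(\<Sum>k<N. Y i k * unit_matrix a b k j) = (if j = b \<and> a < N then Y i a else 0)"
proof -
  have "(\<Sum>k<N. unit_matrix a b i k * Y k j) = (\<Sum>k<N. if k = b then (if i = a then Y b j else 0) else 0)"
    by (intro sum.cong) (auto simp: unit_matrix_def)
  then show "(\<Sum>k<N. unit_matrix a b i k * Y k j) = (if i = a \<and> b < N then Y b j else 0)" by simp
  have "(\<Sum>k<N. Y i k * unit_matrix a b k j) = (\<Sum>k<N. if k = a then (if j = b then Y i a else 0) else 0)"
    by (intro sum.cong) (auto simp: unit_matrix_def)
  then show "(\<Sum>k<N. Y i k * unit_matrix a b k j) = (if j = b \<and> a < N then Y i a else 0)" by simp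
qed

lemma one_matrix_sums:
  "(\<Sum>k<N. one_matrix N i k * Y k j) = (if i < N then Y i j else 0)"
  "(\<Sum>k<N. Y i k * one_matrix N k j) = (if j < N then Y i j else 0)"
proof -
  have "(\<Sum>k<N. one_matrix N i k * Y k j) = (\<Sum>k<N. if k = i then Y i j else 0)"
    by (intro sum.cong) (auto simp: one_matrix_def)
  then show "(\<Sum>k<N. one_matrix N i k * Y k j) = (if i < N then Y i j else 0)" by simp
  have "(\<Sum>k<N. Y i k * one_matrix N k j) = (\<Sum>k<N. if k = j then Y i j else 0)"
    by (intro sum.cong) (auto simp: one_matrix_def)
  then show "(\<Sum>k<N. Y i k * one_matrix N k j) = (if j < N then Y i j else 0)" by simp
qed

text \<open>Common to gl(m|n) and sl(m|n) with \<open>m\<close> and \<open>n\<close> positive,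
  including sl(n|n): the bracket and the odd part of gl(m|n), together with some subspace of its
  even part.\<close>

locale gl_sub = lie_superalg K for K :: "(nat \<Rightarrow> nat \<Rightarrow> complex) superalgebra" +
  fixes m n :: nat
  assumes scale_K: "sscale K = (\<lambda>c X i j. c * X i j)"
    and brk_K: "brk K = brk (gl m n)"
    and odd_K: "part K True = part (gl m n) True"
    and even_K: "part K False \<subseteq> part (gl m n) False"
    and mn: "0 < m" "0 < n"
begin

abbreviation "N \<equiv> m + n"
abbreviation "par i \<equiv> i \<ge> m"

definition cb :: "(nat \<Rightarrow> nat \<Rightarrow> complex) \<Rightarrow> (nat \<Rightarrow> nat \<Rightarrow> complex) \<Rightarrow> nat \<Rightarrow> nat \<Rightarrow> complex" where
  "cb X Y i j = (\<Sum>k<N. X i k * Y k j) - (\<Sum>k<N. Y i k * X k j)"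

lemma glD: "X \<in> part (gl m n) p \<Longrightarrow> X i j \<noteq> 0 \<Longrightarrow> i < N \<and> j < N \<and> (par i \<noteq> par j) = p"
  by (auto simp: gl_def)

lemma gl_zero: "X \<in> part (gl m n) p \<Longrightarrow> \<not> (i < N \<and> j < N \<and> (par i \<noteq> par j) = p) \<Longrightarrow> X i j = 0"
  using glD by blast

lemma glI: "(\<And>i j. X i j \<noteq> 0 \<Longrightarrow> i < N \<and> j < N \<and> (par i \<noteq> par j) = p) \<Longrightarrow> X \<in> part (gl m n) p"
  by (auto simp: gl_def)

lemma part_gl: "X \<in> part K p \<Longrightarrow> X \<in> part (gl m n) p"
  using odd_K even_K by (cases p) auto

lemma space_support:
  assumes "X \<in> space_of K" "\<not> (i < N \<and> j < N)" shows "X i j = 0"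
proof -
  obtain a b where "a \<in> part K False" "b \<in> part K True" "X = a + b" using assms(1) by (rule space_cases)
  then show ?thesis using gl_zero [OF part_gl, of a False i j] gl_zero [OF part_gl, of b True i j] assms(2) by auto
qed

lemma brk_even: "X \<in> part (gl m n) False \<Longrightarrow> brk K X Y = cb X Y"
proof (intro ext)
  fix i j assume X: "X \<in> part (gl m n) False"
  have "X i k * Y k j - ksign (par i \<noteq> par k) (par k \<noteq> par j) * (Y i k * X k j) = X i k * Y k j - Y i k * X k j" for k
    using glD [OF X, of k j] by (cases "X k j = 0") (auto simp: ksign_def)
  then have "(\<Sum>k<N. X i k * Y k j - ksign (par i \<noteq> par k) (par k \<noteq> par j) * (Y i k * X k j)) = (\<Sum>k<N. X i k * Y k j - Y i k * X k j)"
    by (intro sum.cong refl)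
  then show "brk K X Y i j = cb X Y i j"
    unfolding cb_def sum_subtractf [symmetric] by (simp only: brk_K gl_def superalgebra.simps)
qed

lemma brk_odd:
  assumes X: "X \<in> part K True" and Y: "Y \<in> part K True"
  shows "brk K X Y i j = (\<Sum>k<N. X i k * Y k j) + (\<Sum>k<N. Y i k * X k j)"
proof -
  have "X i k * Y k j - ksign (par i \<noteq> par k) (par k \<noteq> par j) * (Y i k * X k j) = X i k * Y k j + Y i k * X k j" for k
    using glD [OF part_gl [OF X], of k j] glD [OF part_gl [OF Y], of i k]
    by (cases "X k j = 0"; cases "Y i k = 0") (auto simp: ksign_def)
  then have "(\<Sum>k<N. X i k * Y k j - ksign (par i \<noteq> par k) (par k \<noteq> par j) * (Y i k * X k j)) = (\<Sum>k<N. X i k * Y k j + Y i k * X k j)"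
    by (intro sum.cong refl)
  then show ?thesis unfolding sum.distrib [symmetric] by (simp only: brk_K gl_def superalgebra.simps)
qed

lemma cb_shift:
  assumes "\<And>i j. \<not> (i < N \<and> j < N) \<Longrightarrow> Y i j = 0"
  shows "cb (X - sscale K c (one_matrix N)) Y = cb X Y"
proof (intro ext)
  fix i j
  have "(\<Sum>k<N. (X - sscale K c (one_matrix N)) i k * Y k j) = (\<Sum>k<N. X i k * Y k j) - c * (\<Sum>k<N. one_matrix N i k * Y k j)"
    by (simp add: scale_K left_diff_distrib sum_subtractf sum_distrib_left mult.assoc)
  moreover have "(\<Sum>k<N. Y i k * (X - sscale K c (one_matrix N)) k j) = (\<Sum>k<N. Y i k * X k j) - c * (\<Sum>k<N. Y i k * one_matrix N k j)"
    by (simp add: scale_K right_diff_distrib sum_subtractf sum_distrib_left mult.left_commute)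
  ultimately show "cb (X - sscale K c (one_matrix N)) Y i j = cb X Y i j"
    using assms [of i j] by (auto simp: cb_def one_matrix_sums)
qed

text \<open>Scalar matrices commute with everything, so brackets can be computed with an even matrix
  of gl(m|n) of which only the translate by a scalar matrix lies in \<open>K\<close>.\<close>

lemma brk_shift:
  assumes "X - sscale K c (one_matrix N) \<in> part K False" "Y \<in> space_of K"
  shows "brk K (X - sscale K c (one_matrix N)) Y = cb X Y"
  using brk_even [OF part_gl [OF assms(1)]] cb_shift [OF space_support [OF assms(2)]] by simp

lemma unit_odd: "a < N \<Longrightarrow> b < N \<Longrightarrow> par a \<noteq> par b \<Longrightarrow> unit_matrix a b \<in> part K True"
  unfolding odd_K by (rule glI) (auto simp: unit_matrix_def split: if_splits)

lemma unit_even: "a < N \<Longrightarrow> b < N \<Longrightarrow> par a = par b \<Longrightarrow> unit_matrix a b \<in> part (gl m n) False"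
  by (rule glI) (auto simp: unit_matrix_def split: if_splits)

lemma cb_unit:
  "a < N \<Longrightarrow> b < N \<Longrightarrow> cb (unit_matrix a b) Y i j = (if i = a then Y b j else 0) - (if j = b then Y i a else 0)"
  by (simp add: cb_def unit_matrix_sums)

lemma cb_unit_right:
  "a < N \<Longrightarrow> b < N \<Longrightarrow> cb Y (unit_matrix a b) i j = (if j = b then Y i a else 0) - (if i = a then Y b j else 0)"
  by (simp add: cb_def unit_matrix_sums)

lemma other_parity: "\<exists>b<N. par a \<noteq> par b"
  using mn by (cases "par a") (auto intro: exI [of _ 0] exI [of _ m])

text \<open>Commuting with the odd matrix units kills the off-diagonal entries and equates diagonal
  entries of opposite parity; passing through the other parity equates all of them.\<close>

lemma scalar_if_central:
  assumes z: "z \<in> part K False" "\<And>y. y \<in> part K True \<Longrightarrow> brk K z y = 0"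
  shows "\<exists>c. z = sscale K c (one_matrix N)"
proof -
  have eq: "(if j = b then z i a else 0) = (if i = a then z b j else 0)"
    if "a < N" "b < N" "par a \<noteq> par b" for a b i j
    using cb_unit_right [OF that(1,2), of z i j] z(2) [OF unit_odd [OF that]] brk_even [OF part_gl [OF z(1)], of "unit_matrix a b"]
    by (simp add: fun_eq_iff)
  have off: "z i a = 0" if "i \<noteq> a" "a < N" for i a
  proof -
    obtain b where "b < N" "par a \<noteq> par b" using other_parity by blast
    then show ?thesis using eq [of a b b i] that by simp
  qed
  have diag: "z a a = z b b" if "a < N" "b < N" "par a \<noteq> par b" for a b
    using eq [OF that, of b a] that by simp
  have all: "z a a = z 0 0" if "a < N" for a
  proof (cases "par a")
    case True
    then show ?thesis using diag [of a 0] that mn by simp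
  next
    case False
    then show ?thesis using diag [of a m] diag [of m 0] that mn by simp
  qed
  have E: "z i j = z 0 0 * one_matrix N i j" for i j
  proof -
    consider "i = j" "i < N" | "i \<noteq> j" "j < N" | "\<not> (i < N \<and> j < N)" by blast
    then show ?thesis
    proof cases
      case 1
      then show ?thesis using all [of i] by (simp add: one_matrix_def)
    next
      case 2
      then show ?thesis using off [of i j] by (simp add: one_matrix_def)
    next
      case 3
      then show ?thesis using gl_zero [OF part_gl [OF z(1)], of i j] by (auto simp: one_matrix_def)
    qed
  qed
  have "z = sscale K (z 0 0) (one_matrix N)" unfolding scale_K by (intro ext) (rule E)
  then show ?thesis by blast
qed

lemma even_central:
  assumes z: "z \<in> part K False" "\<And>y. y \<in> part K True \<Longrightarrow> brk K z y = 0"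
  shows "z \<in> center K"
proof -
  obtain c where c: "z = sscale K c (one_matrix N)" using scalar_if_central assms by blast
  have "brk K z y = 0" if "y \<in> space_of K" for y
  proof -
    have "z = 0 - sscale K (- c) (one_matrix N)" using c by (simp add: scale_K fun_eq_iff)
    then have "brk K z y = cb 0 y" using brk_shift [of 0 "- c" y] z(1) that by simp
    then show ?thesis by (simp add: cb_def fun_eq_iff)
  qed
  then show ?thesis using z part_space by (simp add: center_def)
qed

lemma matrix_sum:
  assumes "\<And>i j. \<not> (i < N \<and> j < N) \<Longrightarrow> X i j = 0"
  shows "X = (\<Sum>a<N. \<Sum>b<N. sscale K (X a b) (unit_matrix a b))"
proof (intro ext)
  fix i j
  have "(\<Sum>a<N. \<Sum>b<N. sscale K (X a b) (unit_matrix a b)) i j = (\<Sum>a<N. \<Sum>b<N. X a b * unit_matrix a b i j)"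
    by (simp add: sum_fun_apply scale_K)
  also have "\<dots> = (\<Sum>a<N. \<Sum>b<N. if b = j then (if a = i then X i j else 0) else 0)"
    by (intro sum.cong) (auto simp: unit_matrix_def)
  also have "\<dots> = X i j" using assms [of i j] by (cases "j < N") auto
  finally show "X i j = (\<Sum>a<N. \<Sum>b<N. sscale K (X a b) (unit_matrix a b)) i j" by simp
qed


lemma unit_bracket:
  assumes "a < N" "b < N" "par a \<noteq> par b"
  shows "brk K (unit_matrix b a) (unit_matrix a b) = unit_matrix a a + unit_matrix b b"
  using brk_odd [OF unit_odd unit_odd, of b a a b] assms
  by (simp add: fun_eq_iff unit_matrix_sums) (auto simp: unit_matrix_def)

end

text \<open>The even part of \<open>K\<close> represents every even matrix modulo scalar matrices.
  This holds for gl(m|n) and, since the identity has supertrace \<open>m - n\<close>, for sl(m|n)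
  with \<open>m \<noteq> n\<close>.\<close>

locale gl_type = gl_sub +
  assumes shift_K: "\<And>X. X \<in> part (gl m n) False \<Longrightarrow> \<exists>c. X - sscale K c (one_matrix (m + n)) \<in> part K False"
begin

text \<open>The grading element, \<open>1\<close> on the even and \<open>0\<close> on the odd part of the natural module, up to a scalar.\<close>

definition grading :: "nat \<Rightarrow> nat \<Rightarrow> complex" where
  "grading = (SOME J. J \<in> part K False \<and> (\<forall>Y\<in>space_of K. \<forall>i j. brk K J Y i j = ((if par i then 0 else 1) - (if par j then 0 else 1)) * Y i j))"

lemma grading: "grading \<in> part K False"
  "Y \<in> space_of K \<Longrightarrow> brk K grading Y i j = ((if par i then 0 else 1) - (if par j then 0 else 1)) * Y i j"
proof -
  define D :: "nat \<Rightarrow> nat \<Rightarrow> complex" where "D i j = (if i = j \<and> i < m then 1 else 0)" for i j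
  have D: "D \<in> part (gl m n) False" by (rule glI) (auto simp: D_def split: if_splits)
  then obtain c where c: "D - sscale K c (one_matrix N) \<in> part K False" using shift_K by blast
  have "cb D Y i j = ((if par i then 0 else 1) - (if par j then 0 else 1)) * Y i j" for Y i j
  proof -
    have "(\<Sum>k<N. D i k * Y k j) = (\<Sum>k<N. if k = i then (if i < m then Y i j else 0) else 0)"
      by (intro sum.cong) (auto simp: D_def)
    moreover have "(\<Sum>k<N. Y i k * D k j) = (\<Sum>k<N. if k = j then (if j < m then Y i j else 0) else 0)"
      by (intro sum.cong) (auto simp: D_def)
    ultimately show ?thesis by (auto simp: cb_def)
  qed
  then have "\<exists>J. J \<in> part K False \<and> (\<forall>Y\<in>space_of K. \<forall>i j. brk K J Y i j = ((if par i then 0 else 1) - (if par j then 0 else 1)) * Y i j)"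
    using c brk_shift [OF c] by (intro exI [of _ "D - sscale K c (one_matrix N)"]) simp
  from someI_ex [OF this] show "grading \<in> part K False"
    "Y \<in> space_of K \<Longrightarrow> brk K grading Y i j = ((if par i then 0 else 1) - (if par j then 0 else 1)) * Y i j"
    unfolding grading_def by blast+
qed

text \<open>The grading element commutes with the even part, so every toral subalgebra contains it,
  and its eigenvalues 0, 1 and -1 constrain every root space.\<close>

lemma grading_toral:
  assumes "toral K \<hh>" shows "grading \<in> \<hh>"
proof -
  have h: "\<hh> \<subseteq> part K False" using assms by (simp add: toral_def)
  have "brk K y grading = 0" if y: "y \<in> \<hh>" for y
  proof -
    have yp: "y \<in> part K False" "y \<in> space_of K" using y h part_space by auto
    have "brk K grading y = 0"
    proof (intro ext)
      fix i j
      show "brk K grading y i j = 0 i j"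
        using grading(2) [OF yp(2), of i j] glD [OF part_gl [OF yp(1)], of i j] by (cases "y i j = 0") auto
    qed
    then show ?thesis using br_skew_even [OF yp(1)] grading(1) part_space by simp
  qed
  then show ?thesis using assms grading(1) unfolding toral_def by blast
qed

lemma grading_weight:
  assumes tor: "toral K \<hh>" and z: "z \<in> root_space K \<hh> b"
  shows "((if par i then 0 else 1) - (if par j then 0 else 1)) * z i j = b grading * z i j"
proof -
  have "z \<in> space_of K" using z by (simp add: root_space_def)
  moreover have "brk K grading z = (\<lambda>i j. b grading * z i j)"
    using z grading_toral [OF tor] unfolding root_space_def scale_K by blast
  ultimately show ?thesis using grading(2) [of z i j] by (simp only:)
qed

text \<open>A central bracket commutes with the grading element, so it is even and hence a scalar
  matrix. Its trace over the even block is \<open>m\<close> times the scalar, but also zero as the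
  trace of a commutator of blocks.\<close>

lemma bracket_not_central:
  assumes x: "x \<in> part K False" and y: "y \<in> space_of K" and c: "brk K x y \<in> center K"
  shows "brk K x y = 0"
proof -
  have xs: "x \<in> space_of K" using x part_space by blast
  define z where "z = brk K x y"
  have zs: "z \<in> space_of K" using br_space xs y by (simp add: z_def)
  have "brk K grading z = 0"
    using br_skew_even [OF grading(1) zs] c grading(1) part_space unfolding z_def [symmetric] by (simp add: center_def)
  then have z_even: "z i j = 0" if "par i \<noteq> par j" for i j
    using grading(2) [OF zs, of i j] that by (cases "par i") auto
  obtain a b where ab: "a \<in> part K False" "b \<in> part K True" "z = a + b" using zs by (rule space_cases)
  have "b i j = 0" for i j
    using z_even [of i j] ab(3) gl_zero [OF part_gl [OF ab(1)], of i j] gl_zero [OF part_gl [OF ab(2)], of i j]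
    by (cases "par i = par j") auto
  then have "b = 0" by (simp add: fun_eq_iff)
  then have zp: "z \<in> part K False" using ab by simp
  have "\<And>y. y \<in> part K True \<Longrightarrow> brk K z y = 0" using c part_space by (simp add: z_def center_def)
  then obtain k where k: "z = sscale K k (one_matrix N)" using scalar_if_central [OF zp] by blast
  have restrict: "(\<Sum>c<N. x i c * y c i) = (\<Sum>c<m. x i c * y c i)" "(\<Sum>c<N. y i c * x c i) = (\<Sum>c<m. y i c * x c i)" if "i < m" for i
  proof -
    have xz: "x i c = 0" "x c i = 0" if "m \<le> c" for c
      using gl_zero [OF part_gl [OF x], of i c] gl_zero [OF part_gl [OF x], of c i] that \<open>i < m\<close> by auto
    show "(\<Sum>c<N. x i c * y c i) = (\<Sum>c<m. x i c * y c i)" "(\<Sum>c<N. y i c * x c i) = (\<Sum>c<m. y i c * x c i)"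
      by (intro sum.mono_neutral_right; simp add: xz)+
  qed
  have "(\<Sum>i<m. z i i) = (\<Sum>i<m. \<Sum>c<m. x i c * y c i) - (\<Sum>i<m. \<Sum>c<m. y i c * x c i)"
    by (simp add: z_def brk_even [OF part_gl [OF x]] cb_def restrict sum_subtractf)
  also have "(\<Sum>i<m. \<Sum>c<m. y i c * x c i) = (\<Sum>i<m. \<Sum>c<m. x i c * y c i)"
    by (subst sum.swap) (simp add: mult.commute)
  finally have "(\<Sum>i<m. z i i) = 0" by simp
  moreover have "(\<Sum>i<m. z i i) = of_nat m * k" unfolding k by (simp add: scale_K one_matrix_def)
  ultimately have "k = 0" using mn by simp
  then show ?thesis using k by (simp add: z_def scale_K fun_eq_iff)
qed

lemma finite_dimensional: "\<exists>X. finite X \<and> space_of K \<subseteq> span X"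
proof (intro exI conjI)
  let ?X = "(\<lambda>(a, b). unit_matrix a b) ` ({..<N} \<times> {..<N})"
  show "finite ?X" by simp
  show "space_of K \<subseteq> span ?X"
  proof
    fix x assume "x \<in> space_of K"
    then have "x = (\<Sum>a<N. \<Sum>b<N. sscale K (x a b) (unit_matrix a b))" by (intro matrix_sum space_support)
    moreover have "(\<Sum>a<N. \<Sum>b<N. sscale K (x a b) (unit_matrix a b)) \<in> span ?X"
      by (intro span_sum span_scale span_base) auto
    ultimately show "x \<in> span ?X" by simp
  qed
qed

lemma odd_subset:
  assumes "subspace I" "\<And>a b. a < N \<Longrightarrow> b < N \<Longrightarrow> par a \<noteq> par b \<Longrightarrow> unit_matrix a b \<in> I"
  shows "part K True \<subseteq> I"
proof
  fix x assume x: "x \<in> part K True"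
  have "sscale K (x a b) (unit_matrix a b) \<in> I" if "a < N" "b < N" for a b
  proof (cases "x a b = 0")
    case True
    then show ?thesis using subspace_0 [OF assms(1)] by simp
  next
    case False
    then show ?thesis using glD [OF part_gl [OF x] False] assms that by (simp add: subspace_scale)
  qed
  then have "(\<Sum>a<N. \<Sum>b<N. sscale K (x a b) (unit_matrix a b)) \<in> I"
    by (intro subspace_sum [OF assms(1)]) simp
  then show "x \<in> I" using matrix_sum [OF space_support [OF part_space [OF x]]] by simp
qed

text \<open>From a non-zero odd element the grading element isolates one off-diagonal block, and
  even matrix units isolate single entries; so all odd units of that block are in the ideal.
  Brackets with the opposite units yield diagonal matrices that reach the other block, provided
  there is one more index than in gl(1|1).\<close>

lemma graded_ideal_cases:
  assumes I: "graded_ideal K I" and big: "\<not> (m = 1 \<and> n = 1)"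
  shows "part K True \<subseteq> I \<or> I \<subseteq> center K"
proof (rule disjCI)
  assume not: "\<not> I \<subseteq> center K"
  have sub: "subspace I" "I \<subseteq> space_of K"
    and graded: "\<And>a b. a \<in> part K False \<Longrightarrow> b \<in> part K True \<Longrightarrow> a + b \<in> I \<Longrightarrow> a \<in> I \<and> b \<in> I"
    and ideal: "\<And>x y. x \<in> space_of K \<Longrightarrow> y \<in> I \<Longrightarrow> brk K x y \<in> I"
    using I unfolding graded_ideal_def subspace_in_def by blast+
  have I_scale: "x \<in> I" if "sscale K c x \<in> I" "c \<noteq> 0" for c x
    using subspace_scale [OF sub(1) that(1), of "inverse c"] that(2) by simp
  have even_ideal: "brk K x y \<in> I" if "x \<in> I" "x \<in> part K False" "y \<in> space_of K" for x y
    using ideal [OF that(3,1)] br_skew_even [OF that(2,3)] subspace_neg [OF sub(1)] by simp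
  have "\<exists>x. x \<in> I \<and> x \<in> part K True \<and> x \<noteq> 0"
  proof -
    obtain z where z: "z \<in> I" "z \<notin> center K" using not by blast
    have zs: "z \<in> space_of K" using z sub by blast
    obtain a b where ab: "a \<in> part K False" "b \<in> part K True" "z = a + b" using zs by (rule space_cases)
    show ?thesis
    proof (cases "b = 0")
      case True
      then have a: "a \<notin> center K" "a \<in> I" using z ab by auto
      then obtain y where y: "y \<in> part K True" "brk K a y \<noteq> 0" using even_central [OF ab(1)] by blast
      have "brk K a y \<in> I" using even_ideal a ab y part_space by blast
      then show ?thesis using y br_part [OF ab(1) y(1)] by auto
    next
      case False
      then show ?thesis using graded [OF ab(1,2)] ab z by auto
    qed
  qed
  then obtain x where x: "x \<in> I" "x \<in> part K True" "x \<noteq> 0" by blast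
  then obtain p q where pq: "x p q \<noteq> 0" by (auto simp: fun_eq_iff)
  have pq': "p < N" "q < N" "par p \<noteq> par q" using glD [OF part_gl [OF x(2)] pq] by auto
  \<comment> \<open>With this sign, adding \<open>e\<close> times the bracket with the grading
    element doubles the part of \<open>x\<close> in the block of \<open>(p, q)\<close> and cancels
    the part in the other block.\<close>
  define e :: complex where "e = (if par p then - 1 else 1)"
  define y where "y = x + sscale K e (brk K grading x)"
  have y: "y \<in> I" "y \<in> space_of K"
    unfolding y_def using sub x(1) even_ideal ideal grading(1) part_space
    by (auto intro!: subspace_add [OF sub(1)] subspace_scale [OF sub(1)] subsetD [OF sub(2)])
  have y_eq: "y i j = (if par i = par p \<and> par j = par q then 2 * x i j else 0)" for i j
    using grading(2) [OF part_space [OF x(2)], of i j] gl_zero [OF part_gl [OF x(2)], of i j] pq'(3)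
    by (auto simp: y_def scale_K e_def)
  have unit1: "unit_matrix i j \<in> I" if ij: "i < N" "j < N" "par i = par p" "par j = par q" for i j
  proof -
    obtain c where c: "unit_matrix i p - sscale K c (one_matrix N) \<in> part K False"
      using shift_K unit_even [of i p] ij pq' by blast
    obtain d where d: "unit_matrix q j - sscale K d (one_matrix N) \<in> part K False"
      using shift_K unit_even [of q j] ij pq' by blast
    \<comment> \<open>The bracket with the unit at \<open>(i, p)\<close> moves row \<open>p\<close>
      of \<open>y\<close> to row \<open>i\<close> and drops the rest; the next one keeps only the
      entry in column \<open>q\<close>, whose value is \<open>2 * x p q\<close>.\<close>
    define r where "r = cb (unit_matrix i p) y"
    have r: "r \<in> I" using ideal [OF part_space [OF c] y(1)] brk_shift [OF c y(2)] by (simp add: r_def)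
    then have rs: "r \<in> space_of K" using sub by blast
    have r_eq: "r a b = (if a = i then y p b else 0)" for a b
      using cb_unit [of i p y a b] ij pq' by (auto simp: r_def y_eq)
    have s: "cb (unit_matrix q j) r \<in> I" using ideal [OF part_space [OF d] r] brk_shift [OF d rs] by simp
    have "cb (unit_matrix q j) r = sscale K (- 2 * x p q) (unit_matrix i j)"
    proof (intro ext)
      fix a b
      show "cb (unit_matrix q j) r a b = sscale K (- 2 * x p q) (unit_matrix i j) a b"
        using cb_unit [of q j r a b] ij pq' by (auto simp: r_eq y_eq scale_K unit_matrix_def)
    qed
    then show ?thesis using s I_scale [of "- 2 * x p q" "unit_matrix i j"] pq by simp
  qed
  have unit2: "unit_matrix j i \<in> I" if ij: "i < N" "j < N" "par i = par p" "par j = par q" for i j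
  proof -
    have ne: "par i \<noteq> par j" using ij pq' by simp
    have D: "unit_matrix a a + unit_matrix b b \<in> I" "unit_matrix a a + unit_matrix b b \<in> part K False"
      if "a < N" "b < N" "par a = par p" "par b = par q" for a b
    proof -
      have ab: "par a \<noteq> par b" using that pq' by simp
      have "unit_matrix b a \<in> part K True" "unit_matrix a b \<in> part K True" using unit_odd ab that by auto
      then have "brk K (unit_matrix b a) (unit_matrix a b) \<in> I" "brk K (unit_matrix b a) (unit_matrix a b) \<in> part K False"
        using ideal unit1 that part_space br_part [of "unit_matrix b a" True "unit_matrix a b" True] by auto
      then show "unit_matrix a a + unit_matrix b b \<in> I" "unit_matrix a a + unit_matrix b b \<in> part K False"
        using unit_bracket [OF that(1,2) ab] by auto
    qed
    have us: "unit_matrix j i \<in> space_of K" using unit_odd ij ne part_space by auto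
    have brD: "brk K (unit_matrix a a + unit_matrix b b) (unit_matrix j i) r s =
      ((if r = a then 1 else 0) + (if r = b then 1 else 0) - (if s = a then 1 else 0) - (if s = b then 1 else 0)) * unit_matrix j i r s"
      if "a < N" "b < N" "unit_matrix a a + unit_matrix b b \<in> part K False" for a b r s
    proof -
      have "cb (unit_matrix a a + unit_matrix b b) (unit_matrix j i) r s = cb (unit_matrix a a) (unit_matrix j i) r s + cb (unit_matrix b b) (unit_matrix j i) r s"
        by (simp add: cb_def distrib_right distrib_left sum.distrib)
      then show ?thesis
        using that brk_even [OF part_gl [OF that(3)], of "unit_matrix j i"] by (simp add: cb_unit unit_matrix_def)
    qed
    \<comment> \<open>The sum of the diagonal units at \<open>i\<close> and \<open>j\<close>
      commutes with the unit at \<open>(j, i)\<close>. If one of the two indices is replaced by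
      another of the same parity, that unit becomes an eigenvector with eigenvalue 1 or -1.\<close>
    have "(\<exists>a<N. a \<noteq> i \<and> par a = par i) \<or> (\<exists>b<N. b \<noteq> j \<and> par b = par j)"
    proof -
      have "(\<exists>a<N. a \<noteq> k \<and> par a = par k)" if "k < N" "if par k then n > 1 else m > 1" for k
      proof (cases "par k")
        case True
        then show ?thesis using that by (intro exI [of _ "if k = m then m + 1 else m"]) auto
      next
        case False
        then show ?thesis using that by (intro exI [of _ "if k = 0 then 1 else 0"]) auto
      qed
      moreover have "(if par i then n > 1 else m > 1) \<or> (if par j then n > 1 else m > 1)" using ne big mn by auto
      ultimately show ?thesis using ij by blast
    qed
    then show ?thesis
    proof
      assume "\<exists>a<N. a \<noteq> i \<and> par a = par i"
      then obtain a where a: "a < N" "a \<noteq> i" "par a = par i" by blast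
      have d: "unit_matrix a a + unit_matrix j j \<in> I" "unit_matrix a a + unit_matrix j j \<in> part K False"
        using D [of a j] a ij by auto
      have "brk K (unit_matrix a a + unit_matrix j j) (unit_matrix j i) = unit_matrix j i"
        using brD [OF a(1) ij(2) d(2)] a ne by (auto simp: fun_eq_iff unit_matrix_def)
      then show ?thesis using even_ideal [OF d us] by simp
    next
      assume "\<exists>b<N. b \<noteq> j \<and> par b = par j"
      then obtain b where b: "b < N" "b \<noteq> j" "par b = par j" by blast
      have d: "unit_matrix i i + unit_matrix b b \<in> I" "unit_matrix i i + unit_matrix b b \<in> part K False"
        using D [of i b] b ij by auto
      have "brk K (unit_matrix i i + unit_matrix b b) (unit_matrix j i) = - unit_matrix j i"
        using brD [OF ij(1) b(1) d(2)] b ne by (auto simp: fun_eq_iff unit_matrix_def)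
      then have "- unit_matrix j i \<in> I" using even_ideal [OF d us] by simp
      then show ?thesis using subspace_neg [OF sub(1)] by fastforce
    qed
  qed
  show "part K True \<subseteq> I"
  proof (rule odd_subset [OF sub(1)])
    fix a b assume "a < N" "b < N" "par a \<noteq> par b"
    then show "unit_matrix a b \<in> I" using unit1 [of a b] unit2 [of b a] pq'(3) by auto
  qed
qed

lemma toral_gl11:
  assumes "m = 1" "n = 1" shows "toral K (part K False)"
proof -
  have diag: "x i j = 0" if "x \<in> part K False" "i \<noteq> j" for x i j
  proof (rule ccontr)
    assume "x i j \<noteq> 0"
    then have "i < 2" "j < 2" "(1 \<le> i) = (1 \<le> j)" using glD [OF part_gl [OF that(1)], of i j] assms by auto
    then show False using that(2) by linarith
  qed
  have ab: "brk K x y = 0" if "x \<in> part K False" "y \<in> part K False" for x y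
  proof (intro ext)
    fix i j
    have "(\<Sum>k<N. x i k * y k j) = (\<Sum>k<N. y i k * x k j)"
    proof (rule sum.cong [OF refl])
      fix k
      show "x i k * y k j = y i k * x k j"
        using diag [OF that(1), of i k] diag [OF that(2), of k j] diag [OF that(2), of i k] diag [OF that(1), of k j]
        by (cases "i = k"; cases "k = j") auto
    qed
    then show "brk K x y i j = 0 i j" using brk_even [OF part_gl [OF that(1)], of y] by (simp add: cb_def)
  qed
  let ?E = "{x \<in> space_of K. \<forall>k\<in>part K False. \<exists>c. brk K k x = sscale K c x}"
  have "part K False \<subseteq> ?E"
    using ab part_space by (auto intro!: exI [of _ 0])
  then have even: "part K False \<subseteq> span ?E" using span_base by blast
  have odd: "part K True \<subseteq> span ?E"
  proof (rule odd_subset [OF subspace_span])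
    fix a b assume *: "a < N" "b < N" "par a \<noteq> par b"
    have "brk K k (unit_matrix a b) = sscale K (k a a - k b b) (unit_matrix a b)" if k: "k \<in> part K False" for k
    proof (intro ext)
      fix i j
      show "brk K k (unit_matrix a b) i j = sscale K (k a a - k b b) (unit_matrix a b) i j"
        using brk_even [OF part_gl [OF k], of "unit_matrix a b"] cb_unit_right [OF *(1,2), of k i j]
          diag [OF k, of i a] diag [OF k, of b j]
        by (auto simp: scale_K unit_matrix_def)
    qed
    then show "unit_matrix a b \<in> span ?E" using unit_odd [OF *] part_space by (intro span_base) blast
  qed
  have "space_of K \<subseteq> span ?E"
  proof
    fix x assume "x \<in> space_of K"
    then obtain a b where "a \<in> part K False" "b \<in> part K True" "x = a + b" by (rule space_cases)
    then show "x \<in> span ?E" using even odd span_add by blast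
  qed
  then show ?thesis unfolding toral_def span_in_eq using part_subspace [of False] ab by blast
qed

lemma odd_zero_weight:
  assumes "toral K \<hh>" shows "root_space K \<hh> (\<lambda>_. 0) \<inter> part K True \<subseteq> {0}"
proof
  fix x assume x: "x \<in> root_space K \<hh> (\<lambda>_. 0) \<inter> part K True"
  then have "brk K grading x = 0" using grading_toral [OF assms] by (simp add: root_space_def)
  then have "x i j = 0" for i j
    using grading(2) [of x i j] x part_space gl_zero [OF part_gl, of x True i j]
    by (cases "par i = par j") (auto split: if_splits)
  then show "x \<in> {0}" by (simp add: fun_eq_iff)
qed

text \<open>If \<open>[x, y] = 0\<close>, a column of \<open>x\<close> times a row of \<open>y\<close> is a nilpotent matrix in the
  diagonalizable algebra \<open>\<hh>\<close> (up to scalars), hence zero.\<close>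

lemma opposite_root_vectors:
  assumes tor: "toral K \<hh>" and x: "x \<in> root_space K \<hh> a" "x \<in> part K True"
    and y: "y \<in> root_space K \<hh> (- a)" "y \<in> part K True" and xy: "brk K x y = 0"
  shows "x = 0 \<or> y = 0"
proof (rule ccontr)
  assume "\<not> ?thesis"
  then obtain p q r s where pq: "x p q \<noteq> 0" and rs: "y r s \<noteq> 0" by (auto simp: fun_eq_iff)
  have h: "\<hh> \<subseteq> part K False" "\<hh> \<subseteq> space_of K" using tor part_space by (auto simp: toral_def)
  have abelian: "\<And>k k'. k \<in> \<hh> \<Longrightarrow> k' \<in> \<hh> \<Longrightarrow> brk K k k' = 0" using tor by (simp add: toral_def)
  have central: "z \<in> \<hh>" if "z \<in> part K False" "\<And>k. k \<in> \<hh> \<Longrightarrow> brk K k z = 0" for z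
    using tor that by (simp add: toral_def)
  have xs: "x \<in> space_of K" "y \<in> space_of K" using x y part_space by auto
  have pq': "p < N" "q < N" "par p \<noteq> par q" using glD [OF part_gl [OF x(2)] pq] by auto
  have rs': "r < N" "s < N" "par r \<noteq> par s" using glD [OF part_gl [OF y(2)] rs] by auto
  let ?g = "\<lambda>i::nat. if par i then 0 else 1 :: complex"
  have xg: "(?g i - ?g j) * x i j = a grading * x i j" for i j
    by (rule grading_weight [OF tor x(1)])
  have yg: "(?g i - ?g j) * y i j = (- a) grading * y i j" for i j
    by (rule grading_weight [OF tor y(1)])
  have ag: "a grading = ?g p - ?g q" using xg [of p q] pq by simp
  have x_zero: "x i j = 0" if "\<not> (i < N \<and> j < N \<and> par i = par p \<and> par j = par q)" for i j
    using xg [of i j] gl_zero [OF part_gl [OF x(2)], of i j] that pq'(3) ag by (auto split: if_splits)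
  have y_zero: "y i j = 0" if "\<not> (i < N \<and> j < N \<and> par i = par q \<and> par j = par p)" for i j
    using yg [of i j] gl_zero [OF part_gl [OF y(2)], of i j] that pq'(3) ag by (auto split: if_splits)
  have rs_par: "par r = par q" "par s = par p" using rs y_zero [of r s] by blast+
  define Z where "Z i j = x i q * y r j" for i j
  have Z_zero: "Z i j = 0" if "\<not> (i < N \<and> j < N \<and> par i = par p \<and> par j = par p)" for i j
    using x_zero [of i q] y_zero [of r j] that by (auto simp: Z_def)
  have Z_even: "Z \<in> part (gl m n) False" by (rule glI) (use Z_zero in blast)
  have k_zero: "k i j = 0" if "k \<in> \<hh>" "par i \<noteq> par j" for k i j
    using gl_zero [OF part_gl, of k False i j] that h by blast
  \<comment> \<open>Column \<open>q\<close> of \<open>x\<close> and row \<open>r\<close> of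
    \<open>y\<close> are eigenvectors of \<open>k\<close> with the same eigenvalue. For this
    \<open>k\<close> is cut down to the block \<open>k'\<close> of the parity of \<open>p\<close>,
    which stays in \<open>\<hh>\<close> up to a scalar matrix because \<open>\<hh>\<close> is block
    diagonal; its weights on \<open>x\<close> and \<open>y\<close> are opposite.\<close>
  have eig: "\<exists>A. (\<forall>i. (\<Sum>c<N. k i c * x c q) = A * x i q) \<and> (\<forall>j. (\<Sum>c<N. y r c * k c j) = A * y r j)"
    if k: "k \<in> \<hh>" for k
  proof -
    define k' where "k' i j = (if par i = par p \<and> par j = par p then k i j else 0)" for i j
    have kp: "k \<in> part (gl m n) False" using k h part_gl by blast
    have "k' \<in> part (gl m n) False"
      by (rule glI) (use glD [OF kp] in \<open>auto simp: k'_def split: if_splits\<close>)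
    then obtain c where c: "k' - sscale K c (one_matrix N) \<in> part K False" using shift_K by blast
    let ?k = "k' - sscale K c (one_matrix N)"
    have "?k \<in> \<hh>"
    proof (rule central [OF c])
      fix u assume u: "u \<in> \<hh>"
      have "cb k' u i j = 0" for i j
      proof (cases "par i = par p \<and> par j = par p")
        case True
        have E: "k' i c * u c j = k i c * u c j" "u i c * k' c j = u i c * k c j" for c
          using k_zero [OF u, of c j] k_zero [OF u, of i c] True by (auto simp: k'_def)
        have "cb k' u i j = cb k u i j" by (simp only: cb_def E)
        also have "\<dots> = brk K k u i j" using brk_even [OF kp] by simp
        also have "\<dots> = 0" using abelian [OF k u] by simp
        finally show ?thesis .
      next
        case False
        have E: "k' i c * u c j = 0" "u i c * k' c j = 0" for c
          using k_zero [OF u, of c j] k_zero [OF u, of i c] False by (auto simp: k'_def)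
        show ?thesis by (simp only: cb_def E sum.neutral_const diff_zero)
      qed
      then have "brk K ?k u = 0" using brk_shift [OF c, of u] u h by (auto simp: fun_eq_iff)
      then show "brk K u ?k = 0" using br_skew_even [of u ?k] u h c part_space by auto
    qed
    then have "brk K ?k x = sscale K (a ?k) x" "brk K ?k y = sscale K ((- a) ?k) y"
      using x(1) y(1) unfolding root_space_def by blast+
    then have "cb k' x = sscale K (a ?k) x" "cb k' y = sscale K ((- a) ?k) y"
      using brk_shift [OF c xs(1)] brk_shift [OF c xs(2)] by simp_all
    then have kx: "cb k' x i j = a ?k * x i j" "cb k' y i j = - (a ?k * y i j)" for i j
      by (simp_all only: scale_K uminus_apply mult_minus_left)
    have "(\<Sum>c<N. k i c * x c q) = a ?k * x i q" for i
    proof -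
      have E: "x i c * k' c q = 0" "k' i c * x c q = k i c * x c q" for c
        using pq'(3) x_zero [of c q] k_zero [OF k, of i c] by (auto simp: k'_def)
      have "cb k' x i q = (\<Sum>c<N. k i c * x c q)" by (simp only: cb_def E sum.neutral_const diff_zero)
      then show ?thesis using kx(1) [of i q] by simp
    qed
    moreover have "(\<Sum>c<N. y r c * k c j) = a ?k * y r j" for j
    proof -
      have E: "k' r c * y c j = 0" "y r c * k' c j = y r c * k c j" for c
        using rs_par pq'(3) y_zero [of r c] k_zero [OF k, of c j] by (auto simp: k'_def)
      have "cb k' y r j = - (\<Sum>c<N. y r c * k c j)" by (simp only: cb_def E sum.neutral_const diff_0)
      then show ?thesis using kx(2) [of r j] by simp
    qed
    ultimately show ?thesis by blast
  qed
  obtain d where d: "Z - sscale K d (one_matrix N) \<in> part K False" using shift_K Z_even by blast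
  let ?Z = "Z - sscale K d (one_matrix N)"
  have Zh: "?Z \<in> \<hh>"
  proof (rule central [OF d])
    fix k assume k: "k \<in> \<hh>"
    obtain A where A: "\<And>i. (\<Sum>c<N. k i c * x c q) = A * x i q" "\<And>j. (\<Sum>c<N. y r c * k c j) = A * y r j"
      using eig [OF k] by blast
    have "cb Z k i j = 0" for i j
    proof -
      have "(\<Sum>c<N. Z i c * k c j) = x i q * (\<Sum>c<N. y r c * k c j)"
        by (simp add: Z_def sum_distrib_left mult.assoc)
      moreover have "(\<Sum>c<N. k i c * Z c j) = (\<Sum>c<N. k i c * x c q) * y r j"
        by (simp add: Z_def sum_distrib_right mult.assoc)
      ultimately show ?thesis by (simp add: cb_def A)
    qed
    then have "brk K ?Z k = 0" using brk_shift [OF d, of k] k h by (auto simp: fun_eq_iff)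
    then show "brk K k ?Z = 0" using br_skew_even [of k ?Z] k h d part_space by auto
  qed
  \<comment> \<open>The entry \<open>(r, q)\<close> of the product \<open>x y\<close> vanishes for
    block reasons, so that of \<open>y x\<close> vanishes by \<open>brk K x y = 0\<close>. Hence
    \<open>Z\<close> squares to zero.\<close>
  have yx: "(\<Sum>c<N. y r c * x c q) = 0"
  proof -
    have "(\<Sum>c<N. x r c * y c q) = 0" using x_zero rs_par pq'(3) by (intro sum.neutral) auto
    then show ?thesis using brk_odd [OF x(2) y(2), of r q] xy by simp
  qed
  have ZZ: "(\<Sum>c<N. Z i c * Z c j) = 0" for i j
  proof -
    have "(\<Sum>c<N. Z i c * Z c j) = x i q * (\<Sum>c<N. y r c * x c q) * y r j"
      by (simp add: Z_def sum_distrib_left sum_distrib_right mult_ac)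
    then show ?thesis using yx by simp
  qed
  \<comment> \<open>In the double commutator two terms contain the square of \<open>Z\<close>, and
    \<open>Z z Z\<close> vanishes because \<open>Z\<close> lives in one diagonal block and
    \<open>z\<close> in the off-diagonal ones.\<close>
  have nil: "brk K ?Z (brk K ?Z z) = 0" if z: "z \<in> part K True" for z
  proof (intro ext)
    fix i j
    have zs: "z \<in> space_of K" using z part_space by blast
    have "brk K ?Z (brk K ?Z z) = cb Z (cb Z z)"
      using brk_shift [OF d zs] brk_shift [OF d, of "cb Z z"] br_space [OF part_space [OF d] zs] by simp
    moreover have "cb Z (cb Z z) i j = (\<Sum>c<N. \<Sum>b<N. Z i c * (Z c b * z b j)) - (\<Sum>c<N. \<Sum>b<N. Z i c * (z c b * Z b j))
        - ((\<Sum>c<N. \<Sum>b<N. Z i b * z b c * Z c j) - (\<Sum>c<N. \<Sum>b<N. z i b * Z b c * Z c j))"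
      by (simp add: cb_def sum_distrib_left sum_distrib_right sum_subtractf right_diff_distrib left_diff_distrib)
    moreover have "(\<Sum>c<N. \<Sum>b<N. Z i c * (Z c b * z b j)) = 0"
    proof -
      have "(\<Sum>c<N. \<Sum>b<N. Z i c * (Z c b * z b j)) = (\<Sum>b<N. (\<Sum>c<N. Z i c * Z c b) * z b j)"
        by (subst sum.swap) (simp add: sum_distrib_right mult.assoc)
      then show ?thesis using ZZ by simp
    qed
    moreover have "(\<Sum>c<N. \<Sum>b<N. z i b * Z b c * Z c j) = 0"
    proof -
      have "(\<Sum>c<N. \<Sum>b<N. z i b * Z b c * Z c j) = (\<Sum>b<N. z i b * (\<Sum>c<N. Z b c * Z c j))"
        by (subst sum.swap) (simp add: sum_distrib_left mult.assoc)
      then show ?thesis using ZZ by simp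
    qed
    moreover have zz: "Z i c * (z c b * Z b j) = 0" "Z i b * z b c * Z c j = 0" for b c
      using Z_zero [of i c] Z_zero [of b j] Z_zero [of i b] Z_zero [of c j]
        gl_zero [OF part_gl [OF z], of c b] gl_zero [OF part_gl [OF z], of b c] by auto
    ultimately have "brk K ?Z (brk K ?Z z) i j = 0" by (simp only: zz sum.neutral_const diff_zero)
    then show "brk K ?Z (brk K ?Z z) i j = 0 i j" by simp
  qed
  have "brk K ?Z z = 0" if z: "z \<in> part K True" for z
  proof -
    have zp: "?Z \<in> space_of K" using d part_space by blast
    let ?E = "{x \<in> part K True. \<exists>\<beta>. x \<in> root_space K \<hh> \<beta>}"
    have "subspace {z \<in> space_of K. brk K ?Z z = 0}"
      unfolding subspace_def using zp by (auto simp: space_add space_scale br_add_right br_scale_right)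
    moreover have "?E \<subseteq> {z \<in> space_of K. brk K ?Z z = 0}"
    proof clarify
      fix u \<beta> assume u: "u \<in> part K True" "u \<in> root_space K \<hh> \<beta>"
      have us: "u \<in> space_of K" using u part_space by blast
      have eq: "brk K ?Z u = sscale K (\<beta> ?Z) u" using u(2) Zh unfolding root_space_def by blast
      then have "sscale K (\<beta> ?Z) (sscale K (\<beta> ?Z) u) = 0" using nil [OF u(1)] zp us by (simp add: br_scale_right)
      then have "brk K ?Z u = 0" using eq by auto
      then show "u \<in> space_of K \<and> brk K ?Z u = 0" using us by simp
    qed
    ultimately have "span ?E \<subseteq> {z \<in> space_of K. brk K ?Z z = 0}" by (rule span_minimal [rotated])
    then show ?thesis using toral_odd_span [OF tor] z by blast
  qed
  \<comment> \<open>So \<open>Z\<close> is a scalar matrix. Its entry at \<open>(q, q)\<close> lies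
    outside its block, which makes the scalar 0, while its entry at \<open>(p, s)\<close> is
    \<open>x p q * y r s\<close>.\<close>
  then obtain g where g: "?Z = sscale K g (one_matrix N)" using scalar_if_central [OF d] by blast
  have Z_eq: "Z i j = (g + d) * one_matrix N i j" for i j
  proof -
    have "?Z i j = g * one_matrix N i j" using g by (metis scale_K)
    then show ?thesis by (simp add: scale_K algebra_simps)
  qed
  have "g + d = 0" using Z_eq [of q q] Z_zero [of q q] pq' by (simp add: one_matrix_def)
  then have "Z p s = 0" using Z_eq by simp
  then show False using pq rs by (simp add: Z_def)
qed

text \<open>The grading element acts on \<open>e\<close> by 1 or -1, so \<open>e\<close> is
  supported in a single off-diagonal block and squares to zero. Even matrices have degree 0 for the
  grading, and degrees 2 and -2 do not occur.\<close>

lemma reflection_root: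
  assumes tor: "toral K \<hh>" and e: "e \<in> root_space K \<hh> a \<inter> part K True" "e \<noteq> 0"
  shows "reflection_root K \<hh> a e"
proof -
  have es: "e \<in> space_of K" "e \<in> part K True" using e part_space by auto
  obtain p q where pq: "e p q \<noteq> 0" using e(2) by (auto simp: fun_eq_iff)
  have pq': "p < N" "q < N" "par p \<noteq> par q" using glD [OF part_gl [OF es(2)] pq] by auto
  let ?g = "\<lambda>i::nat. if par i then 0 else 1 :: complex"
  have wt: "(?g i - ?g j) * z i j = b grading * z i j" if "z \<in> root_space K \<hh> b" for z b i j
    by (rule grading_weight [OF tor that])
  have ag: "a grading = ?g p - ?g q" using wt [of e a p q] e pq by simp
  have e_zero: "e i j = 0" if "\<not> (par i = par p \<and> par j = par q)" for i j
    using wt [of e a i j] e that ag gl_zero [OF part_gl [OF es(2)], of i j] pq'(3) by (auto split: if_splits)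
  show ?thesis
    unfolding reflection_root_def
  proof (intro conjI ballI impI subsetI)
    have "(\<Sum>k<N. e i k * e k j) = 0" for i j
      using e_zero [of i] e_zero [of _ j] pq'(3) by (intro sum.neutral) auto
    then show "brk K e e = 0" using brk_odd [OF es(2) es(2)] by (simp add: fun_eq_iff)
    show "z \<in> {0}" if "z \<in> root_space K \<hh> a \<inter> part K False" for z
    proof -
      have "z i j = 0" for i j
        using wt [of z a i j] that ag pq'(3) gl_zero [OF part_gl, of z False i j] by (auto split: if_splits)
      then show ?thesis by (simp add: fun_eq_iff)
    qed
    show "z \<in> {0}" if "z \<in> root_space K \<hh> (a + a)" for z
    proof -
      have "z i j = 0" for i j
        using wt [OF that, of i j] ag pq'(3) by (auto split: if_splits)
      then show ?thesis by (simp add: fun_eq_iff)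
    qed
    show "x = 0 \<or> y = 0" if "x \<in> root_space K \<hh> a \<inter> part K True" "y \<in> root_space K \<hh> (- a) \<inter> part K True"
      "brk K x y = 0" for x y
      using opposite_root_vectors [OF tor] that by blast
  qed
qed

theorem admissible_gl: "admissible K"
  unfolding admissible_def span_in_eq
proof (intro conjI ballI allI impI)
  show "\<exists>X. finite X \<and> space_of K \<subseteq> span X" by (rule finite_dimensional)
  show "z \<in> center K" if "z \<in> part K False" "\<forall>y\<in>part K True. brk K z y = 0" for z
    using even_central that by blast
  show "brk K x y = 0" if "x \<in> part K False" "y \<in> space_of K" "brk K x y \<in> center K" for x y
    by (rule bracket_not_central [OF that])
  show "toral K (part K False) \<or> (\<forall>I. graded_ideal K I \<longrightarrow> I \<subseteq> center K \<or> part K True \<subseteq> I)"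
    using graded_ideal_cases toral_gl11 by blast
  show "root_space K \<hh> (\<lambda>_. 0) \<inter> part K True \<subseteq> {0}" if "toral K \<hh>" for \<hh>
    by (rule odd_zero_weight [OF that])
  fix \<hh> B a e f
  assume *: "toral K \<hh> \<and> invariant_form K B \<and> e \<in> root_space K \<hh> a \<inter> part K True \<and>
        f \<in> root_space K \<hh> (- a) \<inter> part K True \<and> B e f \<noteq> 0 \<and> brk K (brk K e f) e = 0"
  have "e \<noteq> 0"
  proof
    assume "e = 0"
    have "\<forall>c. \<forall>x\<in>space_of K. \<forall>y\<in>space_of K. B (sscale K c x) y = c * B x y"
      using * by (simp add: invariant_form_def)
    then have "B (sscale K 0 0) f = 0 * B 0 f" using * part_space space_zero by blast
    then show False using * \<open>e = 0\<close> by simp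
  qed
  then show "reflection_root K \<hh> a e" using * reflection_root by blast
qed

end

lemma vector_space_gl: "vector_space (sscale (gl m n))"
  by unfold_locales (auto simp: gl_def fun_eq_iff algebra_simps)

lemma odd_gl_trivial:
  assumes "m = 0 \<or> n = 0" shows "part (gl m n) True = {0}"
proof -
  have "X i j = 0" if "X \<in> part (gl m n) True" for X i j
  proof (rule ccontr)
    assume "X i j \<noteq> 0"
    then have "i < m + n \<and> j < m + n \<and> (i \<ge> m) \<noteq> (j \<ge> m)" using that by (auto simp: gl_def)
    then show False using assms by auto
  qed
  then have "X = 0" if "X \<in> part (gl m n) True" for X using that by (intro ext) simp
  moreover have "0 \<in> part (gl m n) True" by (simp add: gl_def)
  ultimately show ?thesis by blast
qed

lemma admissible_gl_mn:
  assumes "lie_superalgebra (gl m n)" "part (gl m n) True \<noteq> {0}"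
  shows "admissible (gl m n)"
proof -
  interpret lie_superalg "gl m n" by unfold_locales (rule assms(1))
  interpret gl_type "gl m n" m n
  proof
    show "sscale (gl m n) = (\<lambda>c X i j. c * X i j)" by (simp add: gl_def)
    show "0 < m" "0 < n" using odd_gl_trivial [of m n] assms(2) by (cases "m = 0"; cases "n = 0"; simp)+
    show "\<exists>c. X - sscale (gl m n) c (one_matrix (m + n)) \<in> part (gl m n) False" if "X \<in> part (gl m n) False" for X
      using that by (intro exI [of _ 0]) simp
  qed auto
  show ?thesis by (rule admissible_gl)
qed

lemma sl_simps: "sscale (sl m n) = sscale (gl m n)" "brk (sl m n) = brk (gl m n)"
  "part (sl m n) p = {X \<in> part (gl m n) p. supertrace m n X = 0}"
  by (simp_all add: sl_def gl_def)

lemma supertrace_shift: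
  "supertrace m n (X - sscale (gl m n) c (one_matrix (m + n))) = supertrace m n X - c * (of_nat m - of_nat n)"
proof -
  have A: "(\<Sum>i<m. (X - sscale (gl m n) c (one_matrix (m + n))) i i) = (\<Sum>i<m. X i i) - of_nat m * c"
    by (simp add: gl_def one_matrix_def sum_subtractf)
  have B: "(\<Sum>i=m..<m+n. (X - sscale (gl m n) c (one_matrix (m + n))) i i) = (\<Sum>i=m..<m+n. X i i) - of_nat n * c"
    by (simp add: gl_def one_matrix_def sum_subtractf)
  show ?thesis unfolding supertrace_def A B by (simp add: algebra_simps)
qed

lemma odd_sl: "part (sl m n) True = part (gl m n) True"
proof -
  have "supertrace m n X = 0" if "X \<in> part (gl m n) True" for X
  proof -
    have "X i i = 0" for i using that unfolding gl_def by auto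
    then show ?thesis by (simp add: supertrace_def)
  qed
  then show ?thesis by (auto simp: sl_simps)
qed

text \<open>The identity matrix is orthogonal to all of \<open>sl(n|n)\<close>, as \<open>sl(n|n)\<close> is spanned by brackets.\<close>

lemma sl_nn_degenerate:
  assumes lie: "lie_superalgebra (sl n n)" and n: "0 < n"
    and form: "invariant_form (sl n n) B" "nondegenerate_form (sl n n) B"
  shows False
proof -
  interpret lie_superalg_form "sl n n" B by unfold_locales (fact lie form)+
  interpret gl_sub "sl n n" n n
  proof
    show "sscale (sl n n) = (\<lambda>c X i j. c * X i j)" by (simp add: sl_simps gl_def)
    show "0 < n" by (fact n)
    show "part (sl n n) True = part (gl n n) True" by (rule odd_sl)
    show "brk (sl n n) = brk (gl n n)" "part (sl n n) False \<subseteq> part (gl n n) False" by (auto simp: sl_simps)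
  qed
  let ?one = "one_matrix (n + n)"
  have one: "?one \<in> part (sl n n) False"
    by (auto simp: sl_simps gl_def one_matrix_def supertrace_def split: if_splits)
  have os: "?one \<in> space_of (sl n n)" using one part_space by blast
  have one_br: "brk (sl n n) ?one Y = 0" if "Y \<in> space_of (sl n n)" for Y
    using brk_even [OF part_gl [OF one], of Y] space_support [OF that]
    by (auto simp: cb_def one_matrix_sums fun_eq_iff)
  define D where "D = {X \<in> space_of (sl n n). B ?one X = 0}"
  have D: "subspace D"
    unfolding D_def subspace_def using os
    by (auto simp: space_add space_scale B_add_right B_scale_right B_zero_right)
  have br_D: "brk (sl n n) X Y \<in> D" if "X \<in> space_of (sl n n)" "Y \<in> space_of (sl n n)" for X Y
    using B_inv [OF os that] one_br [OF that(1)] B_zero_left that br_space by (simp add: D_def)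
  \<comment> \<open>Matrix units corrected by a multiple of the odd diagonal unit at
    \<open>n\<close> so as to have supertrace zero; in the expansion of \<open>X\<close> the
    corrections add up to the supertrace of \<open>X\<close>.\<close>
  define Pm where "Pm a b = unit_matrix a b + sscale (sl n n) (if a = b then (if a < n then 1 else - 1) else 0) (unit_matrix n n)" for a b
  have diag: "unit_matrix a a + unit_matrix b b \<in> D" if "a < n + n" "b < n + n" "par a \<noteq> par b" for a b
    using br_D unit_bracket [OF that] unit_odd that part_space by metis
  have Pm: "Pm a b \<in> D" if ab: "a < n + n" "b < n + n" "par a = par b" for a b
  proof (cases "a = b")
    case True
    show ?thesis
    proof (cases "a < n")
      case True
      then show ?thesis using diag [of a n] \<open>a = b\<close> n ab by (simp add: Pm_def)
    next
      case False
      have "unit_matrix a a + unit_matrix 0 0 - (unit_matrix n n + unit_matrix 0 0) \<in> D"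
        using diag [of a 0] diag [of n 0] n ab False by (intro subspace_diff [OF D]) auto
      then show ?thesis using \<open>a = b\<close> False by (simp add: Pm_def)
    qed
  next
    case False
    obtain c where c: "c < n + n" "par a \<noteq> par c" using other_parity by blast
    have u: "unit_matrix a c \<in> part (sl n n) True" "unit_matrix c b \<in> part (sl n n) True"
      using unit_odd c ab by auto
    \<comment> \<open>An off-diagonal even unit is the bracket of two odd units through an index
      \<open>c\<close> of the other parity.\<close>
    have "brk (sl n n) (unit_matrix a c) (unit_matrix c b) = unit_matrix a b"
      using brk_odd [OF u] ab c False
      by (simp add: fun_eq_iff unit_matrix_sums) (auto simp: unit_matrix_def)
    then have "unit_matrix a b \<in> D" using br_D u part_space by metis
    then show ?thesis using False by (simp add: Pm_def)
  qed
  have "X \<in> D" if X: "X \<in> part (sl n n) False" for X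
  proof -
    have str: "supertrace n n X = 0" using X by (simp add: sl_simps)
    have "(\<Sum>a<n+n. \<Sum>b<n+n. X a b * (if a = b then (if a < n then 1 else - 1) else 0)) = (\<Sum>a<n+n. if a < n then X a a else - X a a)"
    proof (rule sum.cong [OF refl])
      fix a assume "a \<in> {..<n+n}"
      moreover have "(\<Sum>b<n+n. X a b * (if a = b then (if a < n then 1 else - 1) else 0)) = (\<Sum>b<n+n. if b = a then (if a < n then X a a else - X a a) else 0)"
        by (intro sum.cong) auto
      ultimately show "(\<Sum>b<n+n. X a b * (if a = b then (if a < n then 1 else - 1) else 0)) = (if a < n then X a a else - X a a)"
        by simp
    qed
    also have "\<dots> = (\<Sum>a<n. X a a) + (\<Sum>a=n..<n+n. - X a a)"
    proof -
      have "{..<n+n} = {..<n} \<union> {n..<n+n}" by auto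
      then show ?thesis by (simp add: sum.union_disjoint disjoint_iff)
    qed
    also have "\<dots> = 0" using str by (simp add: supertrace_def sum_negf)
    finally have zero: "(\<Sum>a<n+n. \<Sum>b<n+n. X a b * (if a = b then (if a < n then 1 else - 1) else 0)) = 0" .
    have "(\<Sum>a<n+n. \<Sum>b<n+n. sscale (sl n n) (X a b) (Pm a b)) =
      (\<Sum>a<n+n. \<Sum>b<n+n. sscale (sl n n) (X a b) (unit_matrix a b)) +
      sscale (sl n n) (\<Sum>a<n+n. \<Sum>b<n+n. X a b * (if a = b then (if a < n then 1 else - 1) else 0)) (unit_matrix n n)"
      by (simp only: Pm_def scale_right_distrib scale_scale sum.distrib scale_sum_left)
    also have "\<dots> = X" using zero matrix_sum [OF space_support [OF part_space [OF X]]] by simp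
    finally have eq: "X = (\<Sum>a<n+n. \<Sum>b<n+n. sscale (sl n n) (X a b) (Pm a b))" by simp
    have "sscale (sl n n) (X a b) (Pm a b) \<in> D" if "a < n + n" "b < n + n" for a b
    proof (cases "X a b = 0")
      case True
      then show ?thesis using subspace_0 [OF D] by simp
    next
      case False
      then show ?thesis using glD [OF part_gl [OF X] False] Pm that subspace_scale [OF D] by blast
    qed
    then have "(\<Sum>a<n+n. \<Sum>b<n+n. sscale (sl n n) (X a b) (Pm a b)) \<in> D"
      by (intro subspace_sum [OF D]) simp
    then show ?thesis using eq by simp
  qed
  then have "?one = 0" using B_nondeg_part [OF one] by (simp add: D_def)
  then have "?one 0 0 = 0" by simp
  then show False using n by (simp add: one_matrix_def)
qed

text \<open>A non-degenerate form excludes \<open>m = n\<close>, so an even matrix can be made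
  supertraceless by subtracting a scalar matrix.\<close>

lemma admissible_sl_mn:
  assumes lie: "lie_superalgebra (sl m n)" and odd: "part (sl m n) True \<noteq> {0}"
    and form: "invariant_form (sl m n) B" "nondegenerate_form (sl m n) B"
  shows "admissible (sl m n)"
proof -
  have mn: "0 < m" "0 < n"
    using odd_gl_trivial [of m n] odd unfolding odd_sl by (cases "m = 0"; cases "n = 0"; simp)+
  have "m \<noteq> n" using sl_nn_degenerate [of n B] lie mn form by blast
  then have ne: "of_nat m - of_nat n \<noteq> (0 :: complex)" by simp
  interpret lie_superalg "sl m n" by unfold_locales (rule lie)
  interpret gl_type "sl m n" m n
  proof
    show "sscale (sl m n) = (\<lambda>c X i j. c * X i j)" by (simp add: sl_simps gl_def)
    show "0 < m" "0 < n" by (fact mn)+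
    show "part (sl m n) True = part (gl m n) True" by (rule odd_sl)
    show "brk (sl m n) = brk (gl m n)" "part (sl m n) False \<subseteq> part (gl m n) False" by (auto simp: sl_simps)
    show "\<exists>c. X - sscale (sl m n) c (one_matrix (m + n)) \<in> part (sl m n) False" if X: "X \<in> part (gl m n) False" for X
    proof -
      define c where "c = supertrace m n X / (of_nat m - of_nat n)"
      have "supertrace m n (X - sscale (gl m n) c (one_matrix (m + n))) = 0"
        using ne by (simp add: supertrace_shift c_def)
      moreover have "X - sscale (gl m n) c (one_matrix (m + n)) \<in> part (gl m n) False"
        using X by (auto simp: gl_def one_matrix_def split: if_splits)
      ultimately show ?thesis by (auto simp: sl_simps)
    qed
  qed
  show ?thesis by (rule admissible_gl)
qed

section \<open>The exceptional Lie superalgebras\<close>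

lemma UNIV_7: "(UNIV::7 set) = {0,1,2,3,4,5,6}"
proof -
  have "x \<in> {0,1,2,3,4,5,6}" for x :: 7
  proof (cases x rule: bit1_cases)
    fix z :: int assume "x = of_int z" "0 \<le> z" "z < int CARD(7)"
    moreover from this have "z = 0 \<or> z = 1 \<or> z = 2 \<or> z = 3 \<or> z = 4 \<or> z = 5 \<or> z = 6" by (simp, presburger)
    ultimately show ?thesis by auto
  qed
  then show ?thesis by auto
qed

lemma sum_7': "sum f (UNIV::7 set) = f 0 + f 1 + f 2 + f 3 + f 4 + f 5 + f 6"
proof -
  have "distinct [0,1,2,3,4,5,6::7]" by simp
  moreover have "(UNIV::7 set) = set [0,1,2,3,4,5,6]" using UNIV_7 by simp
  ultimately have "sum f (UNIV::7 set) = sum_list (map f [0,1,2,3,4,5,6])"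
    using sum.distinct_set_conv_list by metis
  then show ?thesis by (simp add: add.assoc)
qed

lemma all_7: "(\<forall>i::7. P i) \<longleftrightarrow> P 0 \<and> P 1 \<and> P 2 \<and> P 3 \<and> P 4 \<and> P 5 \<and> P 6"
proof -
  have "(\<forall>i::7. P i) \<longleftrightarrow> (\<forall>i\<in>UNIV. P i)" by simp
  then show ?thesis unfolding UNIV_7 by simp
qed

lemma UNIV_2': "(UNIV::2 set) = {0, 1}"
  using UNIV_2 by auto

lemma sum_2': "sum f (UNIV::2 set) = f 0 + f 1"
  by (simp add: UNIV_2')

lemma all_2: "(\<forall>i::2. P i) \<longleftrightarrow> P 0 \<and> P 1"
proof -
  have "(\<forall>i::2. P i) \<longleftrightarrow> (\<forall>i\<in>UNIV. P i)" by simp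
  then show ?thesis unfolding UNIV_2' by simp
qed

lemma eps_simps [simp]: "eps 0 0 = 0" "eps 0 1 = 1" "eps 1 0 = - 1" "eps 1 1 = 0"
  by (simp_all add: eps_def)

text \<open>A real orthonormal basis spans over the complex numbers as well; this gives finite
  dimension without writing down a complex basis.\<close>

lemma span_Basis_complex:
  fixes s :: "complex \<Rightarrow> 'a::euclidean_space \<Rightarrow> 'a"
  assumes "vector_space s" "\<And>r x. s (complex_of_real r) x = r *\<^sub>R x"
  shows "x \<in> module.span s Basis"
proof -
  interpret vector_space s by (rule assms(1))
  have "(\<Sum>b\<in>Basis. s (complex_of_real (x \<bullet> b)) b) \<in> span Basis"
    by (intro span_sum span_scale span_base)
  then show ?thesis by (simp add: assms(2) euclidean_representation)
qed

lemma vector_space_mscale: "vector_space (mscale :: complex \<Rightarrow> complex^'n^'m \<Rightarrow> complex^'n^'m)"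
  by unfold_locales (auto simp: mscale_def vec_eq_iff algebra_simps)

lemma vector_space_vec: "vector_space ((*s) :: complex \<Rightarrow> complex^'n \<Rightarrow> complex^'n)"
  by unfold_locales (auto simp: vec_eq_iff algebra_simps)

definition psi2 :: "complex^2 \<Rightarrow> complex^2 \<Rightarrow> complex" where
  "psi2 u v = u $ 0 * v $ 1 - u $ 1 * v $ 0"

lemma sl2_pair_act: "sl2_pair u v *v z = psi2 v z *s u + psi2 u z *s v"
  by (simp add: vec_eq_iff all_2 sl2_pair_def matrix_vector_mult_def sum_2' psi2_def algebra_simps)

lemma trace_2: "trace (A :: complex^2^2) = A $ 0 $ 0 + A $ 1 $ 1"
  by (simp add: trace_def sum_2')

lemma sl2_pair_sl2: "sl2_pair u v \<in> sl2"
  by (simp add: sl2_def trace_2 sl2_pair_def sum_2' algebra_simps)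

lemma comm_sl2: "comm A B \<in> sl2"
  by (simp add: sl2_def trace_2 comm_def matrix_matrix_mult_def sum_2' algebra_simps)

lemma psi2_sl2: "A \<in> sl2 \<Longrightarrow> psi2 (A *v u) v = - psi2 u (A *v v)"
proof -
  assume "A \<in> sl2"
  then have "A $ 1 $ 1 = - A $ 0 $ 0" by (simp add: sl2_def trace_2 eq_neg_iff_add_eq_0 add.commute)
  then show ?thesis by (simp add: psi2_def matrix_vector_mult_def sum_2' algebra_simps)
qed

lemma matrix_eq_0_if: "(\<And>u. A *v u = 0) \<Longrightarrow> A = (0 :: complex^'n^'m)"
  using matrix_eq [of A 0] by simp

subsection \<open>\<open>D(2,1;\<alpha>)\<close>\<close>

lemma vector_space_D21: "vector_space (sscale (D21 \<alpha>))"
  by unfold_locales (auto simp: D21_def mscale_def vec_eq_iff algebra_simps)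

lemma D21_scaleR: "sscale (D21 \<alpha>) (complex_of_real r) x = r *\<^sub>R x"
  by (cases x) (simp add: D21_def mscale_def vec_eq_iff scaleR_conv_of_real [where 'a = complex])

lemma part_D21: "part (D21 \<alpha>) True = {(0, 0, 0, T) | T. True}"
  "part (D21 \<alpha>) False = {(A, B, C, 0) | A B C. A \<in> sl2 \<and> B \<in> sl2 \<and> C \<in> sl2}"
  by (auto simp: D21_def)

text \<open>The first two tensor factors are taken together as \<open>W\<close>, realized by 2 by 2
  matrices, and the third is the symplectic factor \<open>U\<close>.\<close>

definition D21_tens :: "complex^2^2 \<Rightarrow> complex^2 \<Rightarrow> d21" where
  "D21_tens w u = (0, 0, 0, \<chi> i j k. w $ i $ j * u $ k)"

text \<open>The product of the symplectic forms of the first two factors, which is the polarized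
  determinant, times the third structure constant.\<close>

definition D21_sym :: "complex \<Rightarrow> complex^2^2 \<Rightarrow> complex^2^2 \<Rightarrow> complex" where
  "D21_sym \<alpha> w v = (- 1 - \<alpha>) * (w $ 0 $ 0 * v $ 1 $ 1 - w $ 0 $ 1 * v $ 1 $ 0 - w $ 1 $ 0 * v $ 0 $ 1 + w $ 1 $ 1 * v $ 0 $ 0)"

definition D21_cw :: "complex \<Rightarrow> d21 \<Rightarrow> complex^2^2 \<Rightarrow> complex^2" where
  "D21_cw \<alpha> x w = (\<chi> k. D21_sym \<alpha> (\<chi> i j. snd (snd (snd x)) $ i $ j $ k) w)"

definition D21_cu :: "d21 \<Rightarrow> complex^2 \<Rightarrow> complex^2^2" where
  "D21_cu x u = (\<chi> i j. psi2 (snd (snd (snd x)) $ i $ j) u)"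

text \<open>The components of the odd bracket in the first two copies of \<open>sl2\<close>, with
  the structure constants 1 and \<alpha>.\<close>

definition D21_pair :: "complex \<Rightarrow> complex^2^2 \<Rightarrow> complex^2^2 \<Rightarrow> d21" where
  "D21_pair \<alpha> w v =
    (\<chi> a b. \<Sum>c\<in>UNIV. \<Sum>j\<in>UNIV. \<Sum>j'\<in>UNIV. (w $ a $ j * v $ c $ j' + v $ a $ j' * w $ c $ j) * eps c b * eps j j',
     mscale \<alpha> (\<chi> a b. \<Sum>c\<in>UNIV. \<Sum>j\<in>UNIV. \<Sum>j'\<in>UNIV. (w $ j $ a * v $ j' $ c + v $ j' $ a * w $ j $ c) * eps c b * eps j j'),
     0, 0)"

lemma D21_bracket:
  "brk (D21 \<alpha>) (D21_tens w u) (D21_tens w' u') =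
    sscale (D21 \<alpha>) (psi2 u u') (D21_pair \<alpha> w w') + sscale (D21 \<alpha>) (D21_sym \<alpha> w w') (0, 0, sl2_pair u u', 0)"
  by (simp add: D21_def D21_tens_def D21_pair_def D21_sym_def tensor_pair_def tensor_act_def comm_def mscale_def
      matrix_matrix_mult_def psi2_def sl2_pair_def vec_eq_iff all_2 sum_2' zero_prod_def algebra_simps)

text \<open>The second exterior power of the tensor product of two planes is the sum of two copies
  of \<open>sl2\<close>, so the two components of the pairing together amount to all minors of
  \<open>w\<close> and \<open>v\<close>. The second one is visible since \<alpha> is not 0.\<close>

lemma D21_parallel:
  assumes \<alpha>: "\<alpha> \<noteq> 0" and w: "w \<noteq> 0" and p: "D21_pair \<alpha> w v = 0"
  shows "\<exists>c. v = mscale c w"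
proof -
  have p1: "(\<Sum>c\<in>UNIV. \<Sum>j\<in>UNIV. \<Sum>j'\<in>UNIV. (w $ a $ j * v $ c $ j' + v $ a $ j' * w $ c $ j) * eps c b * eps j j') = 0"
    and p2: "(\<Sum>c\<in>UNIV. \<Sum>j\<in>UNIV. \<Sum>j'\<in>UNIV. (w $ j $ a * v $ j' $ c + v $ j' $ a * w $ j $ c) * eps c b * eps j j') = 0" for a b
    using p \<alpha> by (simp_all add: D21_pair_def zero_prod_def mscale_def vec_eq_iff)
  have e: "w $ 0 $ 0 * v $ 0 $ 1 = w $ 0 $ 1 * v $ 0 $ 0" "w $ 1 $ 0 * v $ 1 $ 1 = w $ 1 $ 1 * v $ 1 $ 0"
    "w $ 0 $ 0 * v $ 1 $ 0 = w $ 1 $ 0 * v $ 0 $ 0" "w $ 0 $ 1 * v $ 1 $ 1 = w $ 1 $ 1 * v $ 0 $ 1"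
    "w $ 0 $ 0 * v $ 1 $ 1 = w $ 1 $ 1 * v $ 0 $ 0" "w $ 0 $ 1 * v $ 1 $ 0 = w $ 1 $ 0 * v $ 0 $ 1"
    using p1 [of 0 1] p1 [of 1 0] p1 [of 0 0] p2 [of 0 1] p2 [of 1 0] p2 [of 0 0]
    by (simp_all add: sum_2') (algebra+)
  have "\<exists>i j. w $ i $ j \<noteq> 0" using w by (auto simp: vec_eq_iff)
  then obtain i j where ij: "w $ i $ j \<noteq> 0" by blast
  have "\<forall>i j k l. w $ i $ j * v $ k $ l = w $ k $ l * v $ i $ j"
    using e by (simp add: all_2 mult.commute)
  then have "v $ k $ l = v $ i $ j / w $ i $ j * w $ k $ l" for k l
    using ij by (simp add: field_simps)
  then have "\<forall>k l. v $ k $ l = mscale (v $ i $ j / w $ i $ j) w $ k $ l"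
    unfolding mscale_def vec_lambda_beta by blast
  then have "v = mscale (v $ i $ j / w $ i $ j) w" unfolding vec_eq_iff .
  then show ?thesis by blast
qed

lemma D21_brk_even:
  "brk (D21 \<alpha>) (A, B, C, 0) (A', B', C', T) = (comm A A', comm B B', comm C C', tensor_act A B C T)"
  by (simp add: D21_def tensor_pair_def tensor_act_def comm_def mscale_def vec_eq_iff)

lemma D21_tens_act:
  "tensor_act A B 0 (\<chi> i j k. w $ i $ j * u $ k) = (\<chi> i j k. (A ** w + w ** transpose B) $ i $ j * u $ k)"
  by (simp add: tensor_act_def matrix_matrix_mult_def transpose_def vec_eq_iff sum.distrib sum_distrib_left sum_distrib_right mult_ac)
    (simp add: sum_2' algebra_simps)

lemma D21_tens_act':
  "tensor_act 0 0 C (\<chi> i j k. w $ i $ j * u $ k) = (\<chi> i j k. w $ i $ j * (C *v u) $ k)"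
  by (simp add: tensor_act_def matrix_vector_mult_def vec_eq_iff sum_distrib_left mult_ac)

lemma D21_faithful:
  assumes AB: "A \<in> sl2" "B \<in> sl2" and 0: "\<And>w. A ** w + w ** transpose B = 0"
  shows "A = 0" "B = 0"
proof -
  have "(A ** w + w ** transpose B) $ i $ j = 0" for w i j using 0 [of w] by simp
  note e = this [unfolded matrix_matrix_mult_def transpose_def]
  have "A $ 1 $ 1 = - A $ 0 $ 0" "B $ 1 $ 1 = - B $ 0 $ 0"
    using AB by (simp_all add: sl2_def trace_2 eq_neg_iff_add_eq_0 add.commute)
  moreover have "A $ 1 $ 0 = 0" "B $ 1 $ 0 = 0" "A $ 0 $ 0 + B $ 0 $ 0 = 0"
    using e [of "\<chi> i j. if i = 0 \<and> j = 0 then 1 else 0" 1 0] e [of "\<chi> i j. if i = 0 \<and> j = 0 then 1 else 0" 0 1]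
      e [of "\<chi> i j. if i = 0 \<and> j = 0 then 1 else 0" 0 0] by (simp_all add: sum_2')
  moreover have "A $ 0 $ 1 = 0" "B $ 0 $ 1 = 0"
    using e [of "\<chi> i j. if i = 1 \<and> j = 1 then 1 else 0" 0 1] e [of "\<chi> i j. if i = 1 \<and> j = 1 then 1 else 0" 1 0]
    by (simp_all add: sum_2')
  moreover have "A $ 0 $ 0 + B $ 1 $ 1 = 0"
    using e [of "\<chi> i j. if i = 0 \<and> j = 1 then 1 else 0" 0 1] by (simp add: sum_2')
  ultimately show "A = 0" "B = 0" by (simp_all add: vec_eq_iff all_2)
qed

lemma sl2_simps: "0 \<in> sl2" "A \<in> sl2 \<Longrightarrow> B \<in> sl2 \<Longrightarrow> A + B \<in> sl2" "A \<in> sl2 \<Longrightarrow> mscale c A \<in> sl2"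
  by (auto simp: sl2_def trace_2 mscale_def)
    (metis (no_types, lifting) add.assoc add.commute add_0, metis distrib_left mult_zero_right)

lemma D21_pair_in: "D21_pair \<alpha> w v \<in> {(A, B, 0, 0) | A B. A \<in> sl2 \<and> B \<in> sl2}"
  by (simp add: D21_pair_def sl2_def trace_2 mscale_def sum_2' algebra_simps)

text \<open>Here \<alpha> \<noteq> -1 makes the form on \<open>W\<close> non-degenerate and \<alpha>
  \<noteq> 0 makes the pairing detect proportionality; the third copy of \<open>sl2\<close> is
  sp(U).\<close>

lemma admissible_D21:
  assumes \<alpha>: "\<alpha> \<noteq> 0" "\<alpha> \<noteq> - 1" and lie: "lie_superalgebra (D21 \<alpha>)" and odd: "part (D21 \<alpha>) True \<noteq> {0}"
  shows "admissible (D21 \<alpha>)"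
proof -
  interpret lie_superalg "D21 \<alpha>" by unfold_locales (rule lie)
  interpret W: complex_vs "mscale :: complex \<Rightarrow> complex^2^2 \<Rightarrow> complex^2^2"
    unfolding complex_vs_def by (rule vector_space_mscale)
  interpret U: complex_vs "(*s) :: complex \<Rightarrow> complex^2 \<Rightarrow> complex^2"
    unfolding complex_vs_def by (rule vector_space_vec)
  have \<alpha>1: "- 1 - \<alpha> \<noteq> 0" using \<alpha>(2) by (metis diff_eq_eq add_0)
  note S = D21_def part_D21 D21_tens_def D21_sym_def D21_cw_def D21_cu_def psi2_def mscale_def vec_eq_iff all_2 sum_2' zero_prod_def
  have tensI: "(0, 0, 0, T) = D21_tens (\<chi> i j. T $ i $ j $ 0) (axis 0 1) + D21_tens (\<chi> i j. T $ i $ j $ 1) (axis 1 1)" for T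
    by (simp add: S axis_def)
  let ?S = "{(A, B, 0, 0) | A B. A \<in> sl2 \<and> B \<in> sl2} :: d21 set" and ?Q = "{(0, 0, C, 0) | C. C \<in> sl2} :: d21 set"
  interpret tensor_superalg "D21 \<alpha>" mscale "(*s)" UNIV UNIV
    ?S ?Q
    D21_tens "D21_cw \<alpha>" D21_cu
    "\<lambda>s w. fst s ** w + w ** transpose (fst (snd s))" "\<lambda>q u. fst (snd (snd q)) *v u"
    "\<lambda>u v. (0, 0, sl2_pair u v, 0)" "D21_pair \<alpha>" "D21_sym \<alpha>" psi2
  proof
    show "\<exists>X. finite X \<and> space_of (D21 \<alpha>) \<subseteq> span X"
      using span_Basis_complex [OF vector_space_D21 D21_scaleR] by (intro exI [of _ Basis]) auto
    show "part (D21 \<alpha>) True \<subseteq> span {D21_tens w u | w u. w \<in> UNIV \<and> u \<in> UNIV}"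
    proof
      fix x assume "x \<in> part (D21 \<alpha>) True"
      then obtain T where "x = (0, 0, 0, T)" by (auto simp: part_D21)
      then show "x \<in> span {D21_tens w u | w u. w \<in> UNIV \<and> u \<in> UNIV}"
        unfolding tensI [of T] by (simp only:) (intro span_add span_base; blast)
    qed
    show "x = 0" if "x \<in> part (D21 \<alpha>) True" "\<And>w. w \<in> UNIV \<Longrightarrow> D21_cw \<alpha> x w = 0" for x
      using that(1) \<alpha>1 that(2) [of "\<chi> i j. if i = 0 \<and> j = 0 then 1 else 0"] that(2) [of "\<chi> i j. if i = 0 \<and> j = 1 then 1 else 0"]
        that(2) [of "\<chi> i j. if i = 1 \<and> j = 0 then 1 else 0"] that(2) [of "\<chi> i j. if i = 1 \<and> j = 1 then 1 else 0"]
      by (auto simp: S)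
    show "w = 0" if "\<And>w'. w' \<in> UNIV \<Longrightarrow> D21_sym \<alpha> w w' = 0" for w
      using \<alpha>1 that [of "\<chi> i j. if i = 0 \<and> j = 0 then 1 else 0"] that [of "\<chi> i j. if i = 0 \<and> j = 1 then 1 else 0"]
        that [of "\<chi> i j. if i = 1 \<and> j = 0 then 1 else 0"] that [of "\<chi> i j. if i = 1 \<and> j = 1 then 1 else 0"]
      by (auto simp: S)
    show "u = 0" if "\<And>u'. u' \<in> UNIV \<Longrightarrow> psi2 u u' = 0" for u
      using that [of "axis 0 1"] that [of "axis 1 1"] by (auto simp: S axis_def)
    have sc: "sscale (D21 \<alpha>) c (A, B, C, T) = (mscale c A, mscale c B, mscale c C, \<chi> i j k. c * T $ i $ j $ k)" for c A B C T
      by (simp add: D21_def)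
    have m0: "mscale c 0 = (0 :: complex^2^2)" for c by (simp add: mscale_def vec_eq_iff)
    have v0: "(\<chi> i j k. 0) = (0 :: complex^2^2^2)" by (simp add: vec_eq_iff)
    have c0: "comm 0 0 = (0 :: complex^2^2)" "comm A 0 = 0" "comm 0 A = 0" for A :: "complex^2^2" by (simp_all add: comm_def vec_eq_iff matrix_matrix_mult_def)
    have t0: "tensor_act A B C 0 = 0" for A B C by (simp add: tensor_act_def vec_eq_iff)
    show "part (D21 \<alpha>) True \<noteq> {0}" by (rule odd)
    show "D21_tens w u \<in> part (D21 \<alpha>) True" for w u by (simp add: part_D21 D21_tens_def)
    show "D21_cw \<alpha> (x + y) w = D21_cw \<alpha> x w + D21_cw \<alpha> y w" for x y w
      by (simp add: D21_cw_def D21_sym_def vec_eq_iff algebra_simps)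
    show "D21_cw \<alpha> (sscale (D21 \<alpha>) c x) w = c *s D21_cw \<alpha> x w" for c x w
      by (cases x) (simp add: sc D21_cw_def D21_sym_def vec_eq_iff algebra_simps)
    show "D21_cw \<alpha> (D21_tens w u) w' = D21_sym \<alpha> w w' *s u" for w u w'
      by (simp add: D21_tens_def D21_cw_def D21_sym_def vec_eq_iff algebra_simps)
    show "D21_cu (x + y) u = D21_cu x u + D21_cu y u" for x y u
      by (simp add: D21_cu_def psi2_def vec_eq_iff algebra_simps)
    show "D21_cu (sscale (D21 \<alpha>) c x) u = mscale c (D21_cu x u)" for c x u
      by (cases x) (simp add: sc D21_cu_def psi2_def mscale_def vec_eq_iff algebra_simps)
    show "D21_cu (D21_tens w u) u' = mscale (psi2 u u') w" for w u u'
      by (simp add: D21_tens_def D21_cu_def psi2_def mscale_def vec_eq_iff algebra_simps)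
    show "D21_sym \<alpha> (w + w') w'' = D21_sym \<alpha> w w'' + D21_sym \<alpha> w' w''" "D21_sym \<alpha> (mscale c w) w' = c * D21_sym \<alpha> w w'"
      "D21_sym \<alpha> w w' = D21_sym \<alpha> w' w" for w w' w'' c
      by (simp_all add: D21_sym_def mscale_def algebra_simps)
    show "psi2 (u + u') u'' = psi2 u u'' + psi2 u' u''" "psi2 (c *s u) u' = c * psi2 u u'" "psi2 u u' = - psi2 u' u" for u u' u'' c
      by (simp_all add: psi2_def algebra_simps)
    show "?S \<subseteq> part (D21 \<alpha>) False" "?Q \<subseteq> part (D21 \<alpha>) False" using sl2_simps(1) by (auto simp: part_D21)
    show "subspace ?S" "subspace ?Q"
      unfolding subspace_def using sl2_simps by (auto simp: sc m0 v0 zero_prod_def)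
    show "?S \<inter> ?Q = {0}" using sl2_simps(1) by (auto simp: zero_prod_def)
    show "\<exists>s\<in>?S. \<exists>q\<in>?Q. z = s + q" if zp: "z \<in> part (D21 \<alpha>) False" for z
    proof -
      obtain A B C where z: "z = (A, B, C, 0)" "A \<in> sl2" "B \<in> sl2" "C \<in> sl2" using zp by (auto simp: part_D21)
      have "z = (A, B, 0, 0) + (0, 0, C, 0)" using z by simp
      then show ?thesis using z(2-4) by blast
    qed
    show "brk (D21 \<alpha>) s q = 0" if "s \<in> ?S" "q \<in> ?Q" for s q
      using that by (auto simp: D21_brk_even c0 t0 zero_prod_def)
    show "brk (D21 \<alpha>) s s' \<in> ?S" if "s \<in> ?S" "s' \<in> ?S" for s s'
      using that by (auto simp: D21_brk_even c0 t0 comm_sl2)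
    show "brk (D21 \<alpha>) q q' \<in> ?Q" if "q \<in> ?Q" "q' \<in> ?Q" for q q'
      using that by (auto simp: D21_brk_even c0 t0 comm_sl2)
    show "brk (D21 \<alpha>) s (D21_tens w u) = D21_tens (fst s ** w + w ** transpose (fst (snd s))) u"
      if "s \<in> ?S" for s w u
      using that by (auto simp only: D21_tens_def D21_brk_even c0 D21_tens_act prod.case fst_conv snd_conv mem_Collect_eq)
    show "s = 0" if "s \<in> ?S" "\<And>w. w \<in> UNIV \<Longrightarrow> (fst s ** w + w ** transpose (fst (snd s))) = 0" for s
      using that D21_faithful by (auto simp: zero_prod_def)
    show "(fst (snd (snd q)) *v (u + u')) = (fst (snd (snd q)) *v u) + (fst (snd (snd q)) *v u')" for q :: d21 and u u'
      by (cases q) (simp add: matrix_vector_right_distrib)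
    show "(fst (snd (snd q)) *v (c *s u)) = c *s (fst (snd (snd q)) *v u)" for q :: d21 and u c
      by (cases q) (simp add: vector_scalar_commute)
    show "brk (D21 \<alpha>) q (D21_tens w u) = D21_tens w (fst (snd (snd q)) *v u)" if "q \<in> ?Q" for q w u
      using that by (auto simp only: D21_tens_def D21_brk_even c0 D21_tens_act' prod.case fst_conv snd_conv mem_Collect_eq)
    show "q = 0" if "q \<in> ?Q" "\<And>u. u \<in> UNIV \<Longrightarrow> (fst (snd (snd q)) *v u) = 0" for q
      using that by (auto simp: zero_prod_def intro: matrix_eq_0_if)
    show "psi2 (fst (snd (snd q)) *v u) u' = - psi2 u (fst (snd (snd q)) *v u')" if "q \<in> ?Q" for q u u'
      using that psi2_sl2 by auto
    show "(0, 0, sl2_pair u u', 0) \<in> ?Q" for u u' using sl2_pair_sl2 by blast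
    show "fst (snd (snd (0 :: complex^2^2, 0 :: complex^2^2, sl2_pair u u', 0 :: complex^2^2^2))) *v z = psi2 u' z *s u + psi2 u z *s u'" for u u' z
      by (simp add: sl2_pair_act)
    show "D21_pair \<alpha> w w' \<in> ?S" for w w' by (rule D21_pair_in)
    show "brk (D21 \<alpha>) (D21_tens w u) (D21_tens w' u') =
      sscale (D21 \<alpha>) (psi2 u u') (D21_pair \<alpha> w w') + sscale (D21 \<alpha>) (D21_sym \<alpha> w w') (0, 0, sl2_pair u u', 0)" for w u w' u'
      by (rule D21_bracket)
    show "\<exists>c. w' = mscale c w" if "w \<noteq> 0" "D21_pair \<alpha> w w' = 0" for w w'
      by (rule D21_parallel [OF \<alpha>(1) that])
  qed simp_all
  show ?thesis by (rule admissible_tensor)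
qed

subsection \<open>\<open>G(3)\<close> and \<open>F(4)\<close>\<close>

text \<open>The common shape of the last two exceptional algebras: \<open>g2\<close> on its
  7-dimensional module with \<open>k = - 2\<close>, and \<open>so7\<close> on its spin module with
  \<open>k = - 3\<close>.\<close>

definition bi_superalgebra ::
  "(complex^'m^'m) set \<Rightarrow> (complex^'m^'m \<Rightarrow> complex^'n^'n) \<Rightarrow> (complex^'n \<Rightarrow> complex^'n \<Rightarrow> complex^'m^'m) \<Rightarrow>
   complex \<Rightarrow> ((complex^'m^'m) \<times> (complex^2^2) \<times> (complex^2^'n)) superalgebra" where
  "bi_superalgebra E \<rho> \<pi> k = \<lparr>
     sscale = (\<lambda>c (M, A, S). (mscale c M, mscale c A, mscale c S)),
     part = (\<lambda>p. if p then {(M, A, S). M = 0 \<and> A = 0}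
                  else {(M, A, S). M \<in> E \<and> A \<in> sl2 \<and> S = 0}),
     brk = (\<lambda>(M, A, S) (N, B, T).
       (comm M N + (\<Sum>a\<in>UNIV. \<Sum>b\<in>UNIV. mscale (eps a b) (\<pi> (column a S) (column b T))),
        comm A B + mscale k (\<Sum>i\<in>UNIV. sl2_pair (S $ i) (T $ i)),
        bi_act (\<rho> M) A T - bi_act (\<rho> N) B S)) \<rparr>"

definition bi_tens :: "complex^'n \<Rightarrow> complex^2 \<Rightarrow> (complex^'m^'m) \<times> (complex^2^2) \<times> (complex^2^'n)" where
  "bi_tens w u = (0, 0, \<chi> i a. w $ i * u $ a)"

lemma mscale_simps: "mscale 0 A = 0" "mscale c 0 = 0" "mscale 1 A = A" "mscale (- 1) A = - A"
  "mscale a (mscale b A) = mscale (a * b) A" "mscale (a + b) A = mscale a A + mscale b A"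
  "mscale a (A + B) = mscale a A + mscale a B"
  by (simp_all add: mscale_def vec_eq_iff algebra_simps)

lemma mscale_sum: "mscale c (sum f X) = (\<Sum>x\<in>X. mscale c (f x))"
  by (induction X rule: infinite_finite_induct) (simp_all add: mscale_simps)

lemma mscale_sum_left: "mscale (sum f X) A = (\<Sum>x\<in>X. mscale (f x) A)"
  by (induction X rule: infinite_finite_induct) (simp_all add: mscale_simps)

lemma comm_zero: "comm A 0 = 0" "comm 0 A = 0"
  by (simp_all add: comm_def vec_eq_iff matrix_matrix_mult_def)

lemma sl2_pair_scale: "sl2_pair (a *s u) (b *s v) = mscale (a * b) (sl2_pair u v)"
  by (simp add: sl2_pair_def mscale_def vec_eq_iff sum_2' algebra_simps)

lemma sl2_pair_zero: "sl2_pair 0 u = 0" "sl2_pair u 0 = 0"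
  by (simp_all add: sl2_pair_def vec_eq_iff)

lemma bi_act_zero: "bi_act X A 0 = 0" "bi_act 0 0 S = 0"
  by (simp_all add: bi_act_def vec_eq_iff matrix_matrix_mult_def transpose_def)

lemma bi_act_left: "bi_act X 0 (\<chi> i a. w $ i * u $ a) = (\<chi> i a. (X *v w) $ i * u $ a)"
  by (simp add: bi_act_def matrix_matrix_mult_def matrix_vector_mult_def transpose_def vec_eq_iff sum_distrib_left sum_distrib_right mult_ac)

lemma bi_act_right: "bi_act 0 A (\<chi> i a. w $ i * u $ a) = (\<chi> i a. w $ i * (A *v u) $ a)"
  by (simp add: bi_act_def matrix_matrix_mult_def matrix_vector_mult_def transpose_def vec_eq_iff sum_distrib_left mult_ac)

lemma vector_space_bi: "vector_space (sscale (bi_superalgebra E \<rho> \<pi> k))"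
  by unfold_locales (auto simp: bi_superalgebra_def mscale_def vec_eq_iff algebra_simps)

lemma bi_scaleR: "sscale (bi_superalgebra E \<rho> \<pi> k) (complex_of_real r) x = r *\<^sub>R x"
  by (cases x) (simp add: bi_superalgebra_def mscale_def vec_eq_iff scaleR_conv_of_real [where 'a = complex])

lemma part_bi: "part (bi_superalgebra E \<rho> \<pi> k) True = {(0, 0, S) | S. True}"
  "part (bi_superalgebra E \<rho> \<pi> k) False = {(M, A, 0) | M A. M \<in> E \<and> A \<in> sl2}"
  by (auto simp: bi_superalgebra_def)

text \<open>That \<open>\<pi>\<close> takes values in \<open>E\<close> and that \<open>E\<close> is
  closed under sums, scalars and commutators is extracted from the axioms for \<open>K\<close>. The
  hypothesis \<open>faithful\<close> may use that \<open>M\<close> commutes with the values of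
  \<open>\<pi>\<close>, which follows from \<open>\<rho> M = 0\<close> by the Jacobi identity; for
  \<open>so7\<close> this takes the place of injectivity of the spin representation.\<close>

lemma admissible_bi:
  fixes E :: "(complex^'m^'m) set" and \<rho> :: "complex^'m^'m \<Rightarrow> complex^'n^'n"
    and \<pi> :: "complex^'n \<Rightarrow> complex^'n \<Rightarrow> complex^'m^'m" and k :: complex
  defines "K \<equiv> bi_superalgebra E \<rho> \<pi> k"
  assumes lie: "lie_superalgebra K" and k: "k \<noteq> 0" and \<rho>0: "\<rho> 0 = 0"
    and \<pi>_scale: "\<And>a b w v. \<pi> (a *s w) (b *s v) = mscale (a * b) (\<pi> w v)"
    and faithful: "\<And>M. M \<in> E \<Longrightarrow> \<rho> M = 0 \<Longrightarrow> (\<And>w v. comm M (\<pi> w v) = 0) \<Longrightarrow> M = 0"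
    and parallel: "\<And>w v. w \<noteq> 0 \<Longrightarrow> (\<Sum>i\<in>UNIV. w $ i * w $ i) = 0 \<Longrightarrow> (\<Sum>i\<in>UNIV. v $ i * v $ i) = 0 \<Longrightarrow>
      (\<Sum>i\<in>UNIV. w $ i * v $ i) = 0 \<Longrightarrow> \<pi> w v = 0 \<Longrightarrow> \<exists>c. v = c *s w"
  shows "admissible K"
proof -
  interpret lie_superalg K by unfold_locales (rule lie)
  interpret W: complex_vs "(*s) :: complex \<Rightarrow> complex^'n \<Rightarrow> complex^'n"
    unfolding complex_vs_def by (rule vector_space_vec)
  interpret U: complex_vs "(*s) :: complex \<Rightarrow> complex^2 \<Rightarrow> complex^2"
    unfolding complex_vs_def by (rule vector_space_vec)
  note part_K = part_bi [of E \<rho> \<pi> k, folded K_def]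
  have sc: "sscale K c (M, A, S) = (mscale c M, mscale c A, mscale c S)" for c M A S
    by (simp add: K_def bi_superalgebra_def)
  have \<pi>0: "\<pi> 0 w = 0" "\<pi> w 0 = 0" for w
    using \<pi>_scale [of 0 w 1 w] \<pi>_scale [of 1 w 0 w] by (simp_all add: mscale_simps)
  have brk_even: "brk K (M, A, 0) (N, B, T) = (comm M N, comm A B, bi_act (\<rho> M) A T)" for M A N B T
    using \<pi>0 by (simp add: K_def bi_superalgebra_def bi_act_zero sl2_pair_zero mscale_simps column_def zero_vec_def [symmetric])
  define sym where "sym w v = k * (\<Sum>i\<in>UNIV. w $ i * v $ i)" for w v :: "complex^'n"
  have brk_odd: "brk K (bi_tens w u) (bi_tens w' u') =
      sscale K (psi2 u u') (\<pi> w w', 0, 0) + sscale K (sym w w') (0, sl2_pair u u', 0)" for w w' u u'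
  proof -
    have "column a (\<chi> i a. w $ i * u $ a) = u $ a *s w" for a and w :: "complex^'n" and u :: "complex^2"
      by (simp add: column_def vec_eq_iff)
    moreover have "(\<chi> i a. w $ i * u $ a) $ i = w $ i *s u" for i and w :: "complex^'n" and u :: "complex^2"
      by (simp add: vec_eq_iff)
    moreover have "mscale (u $ 0 * u' $ 1) X - mscale (u $ 1 * u' $ 0) X = mscale (psi2 u u') X" for X :: "complex^'m^'m"
      by (simp add: psi2_def mscale_def vec_eq_iff algebra_simps)
    ultimately show ?thesis
      by (simp add: K_def bi_superalgebra_def bi_tens_def \<rho>0 bi_act_zero comm_zero \<pi>_scale mscale_simps(1-5) sum_2'
          sl2_pair_scale mscale_sum_left [symmetric] sym_def)
  qed
  have fin: "\<exists>X. finite X \<and> space_of K \<subseteq> span X"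
    unfolding K_def using span_Basis_complex [OF vector_space_bi bi_scaleR] by (intro exI [of _ Basis]) auto
  \<comment> \<open>The standard basis vectors of \<open>U\<close> pair to 1, so the first component
    of this bracket is exactly \<open>\<pi> w v\<close>; evenness of the bracket puts it in
    \<open>E\<close>.\<close>
  have \<pi>_in: "\<pi> w v \<in> E" for w v
  proof -
    have "bi_tens w (axis 0 1) \<in> part K True" "bi_tens v (axis 1 1) \<in> part K True"
      by (simp_all add: part_K bi_tens_def)
    then have "brk K (bi_tens w (axis 0 1)) (bi_tens v (axis 1 1)) \<in> part K False"
      using br_part by fastforce
    moreover have "psi2 (axis 0 1) (axis 1 1) = 1" by (simp add: psi2_def axis_def)
    ultimately show ?thesis unfolding brk_odd by (auto simp: part_K sc mscale_simps)
  qed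
  have jac: "comm M (\<pi> w v) = 0" if M: "M \<in> E" "\<rho> M = 0" for M w v
  proof -
    let ?x = "(M, 0, 0)" and ?y = "bi_tens w (axis 0 1)" and ?z = "bi_tens v (axis 1 1)"
    have s: "?x \<in> part K False" "?y \<in> part K True" "?z \<in> part K True"
      using M sl2_simps(1) by (simp_all add: part_K bi_tens_def)
    have "brk K ?x ?y = 0" "brk K ?x ?z = 0"
      using M by (simp_all add: bi_tens_def brk_even comm_zero bi_act_zero zero_prod_def)
    then have "brk K ?x (brk K ?y ?z) = 0"
      using jacobi [OF s(1,2), of ?z] s part_space by simp
    moreover have "psi2 (axis 0 1) (axis 1 1) = 1" by (simp add: psi2_def axis_def)
    ultimately show ?thesis unfolding brk_odd by (simp add: sc mscale_simps brk_even zero_prod_def)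
  qed
  let ?S = "{(M, 0, 0) | M. M \<in> E} :: ((complex^'m^'m) \<times> (complex^2^2) \<times> (complex^2^'n)) set"
    and ?Q = "{(0, A, 0) | A. A \<in> sl2} :: ((complex^'m^'m) \<times> (complex^2^2) \<times> (complex^2^'n)) set"
  have E: "0 \<in> E" "M \<in> E \<Longrightarrow> N \<in> E \<Longrightarrow> M + N \<in> E" "M \<in> E \<Longrightarrow> mscale c M \<in> E" "M \<in> E \<Longrightarrow> N \<in> E \<Longrightarrow> comm M N \<in> E" for M N c
  proof -
    have m: "M \<in> E \<longleftrightarrow> (M, 0, 0) \<in> part K False" for M using sl2_simps(1) by (simp add: part_K)
    show "0 \<in> E" using m [of 0] part_zero [of False] by (simp add: zero_prod_def)
    show "M + N \<in> E" if "M \<in> E" "N \<in> E" using part_add [of "(M, 0, 0)" False "(N, 0, 0)"] that m by simp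
    show "mscale c M \<in> E" if "M \<in> E" using part_scale [of "(M, 0, 0)" False c] that m by (simp add: sc mscale_simps)
    show "comm M N \<in> E" if "M \<in> E" "N \<in> E"
      using br_part [of "(M, 0, 0)" False "(N, 0, 0)" False] that m by (simp add: brk_even comm_zero bi_act_zero)
  qed
  have tensI: "(0, 0, T) = bi_tens (\<chi> i. T $ i $ 0) (axis 0 1) + bi_tens (\<chi> i. T $ i $ 1) (axis 1 1)" for T
    by (simp add: bi_tens_def vec_eq_iff all_2 axis_def)
  have ax: "(\<Sum>i\<in>UNIV. f i * axis j 1 $ i) = f j" for f :: "'n \<Rightarrow> complex" and j
    by (simp add: axis_def if_distrib cong: if_cong)
  interpret tensor_superalg K "(*s)" "(*s)" UNIV UNIV ?S ?Q bi_tens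
    "\<lambda>x w. \<chi> a. k * (\<Sum>i\<in>UNIV. snd (snd x) $ i $ a * w $ i)" "\<lambda>x u. \<chi> i. psi2 (snd (snd x) $ i) u"
    "\<lambda>s w. \<rho> (fst s) *v w" "\<lambda>q u. fst (snd q) *v u" "\<lambda>u v. (0, sl2_pair u v, 0)" "\<lambda>w v. (\<pi> w v, 0, 0)" sym psi2
  proof
    show "\<exists>X. finite X \<and> space_of K \<subseteq> span X" by (rule fin)
    have "(0, 0, \<chi> i a. 1) \<in> part K True" by (simp add: part_K)
    then show "part K True \<noteq> {0}" by (auto simp: zero_prod_def vec_eq_iff)
    show "bi_tens w u \<in> part K True" for w u by (simp add: part_K bi_tens_def)
    show "part K True \<subseteq> span {bi_tens w u | w u. w \<in> UNIV \<and> u \<in> UNIV}"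
    proof
      fix x assume "x \<in> part K True"
      then obtain T where "x = (0, 0, T)" by (auto simp: part_K)
      then show "x \<in> span {bi_tens w u | w u. w \<in> UNIV \<and> u \<in> UNIV}"
        unfolding tensI [of T] by (simp only:) (intro span_add span_base; blast)
    qed
    show "(\<chi> a. k * (\<Sum>i\<in>UNIV. snd (snd (x + y)) $ i $ a * w $ i)) =
        (\<chi> a. k * (\<Sum>i\<in>UNIV. snd (snd x) $ i $ a * w $ i)) + (\<chi> a. k * (\<Sum>i\<in>UNIV. snd (snd y) $ i $ a * w $ i))" for x y w
      by (simp add: vec_eq_iff sum.distrib algebra_simps)
    show "(\<chi> a. k * (\<Sum>i\<in>UNIV. snd (snd (sscale K c x)) $ i $ a * w $ i)) =
        c *s (\<chi> a. k * (\<Sum>i\<in>UNIV. snd (snd x) $ i $ a * w $ i))" for c x w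
      by (cases x) (simp add: sc mscale_def vec_eq_iff sum_distrib_left algebra_simps)
    show "(\<chi> a. k * (\<Sum>i\<in>UNIV. snd (snd (bi_tens w u)) $ i $ a * w' $ i)) = sym w w' *s u" for w u w'
      by (simp add: bi_tens_def sym_def vec_eq_iff sum_distrib_left sum_distrib_right algebra_simps)
    show "x = 0" if "x \<in> part K True" "\<And>w. w \<in> UNIV \<Longrightarrow> (\<chi> a. k * (\<Sum>i\<in>UNIV. snd (snd x) $ i $ a * w $ i)) = 0" for x
    proof -
      have "snd (snd x) $ j $ a = 0" for j a
        using that(2) [of "axis j 1"] k by (simp add: vec_eq_iff ax)
      then show ?thesis using that(1) by (auto simp: part_K vec_eq_iff zero_prod_def)
    qed
    show "(\<chi> i. psi2 (snd (snd (x + y)) $ i) u) = (\<chi> i. psi2 (snd (snd x) $ i) u) + (\<chi> i. psi2 (snd (snd y) $ i) u)" for x y u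
      by (simp add: psi2_def vec_eq_iff algebra_simps)
    show "(\<chi> i. psi2 (snd (snd (sscale K c x)) $ i) u) = c *s (\<chi> i. psi2 (snd (snd x) $ i) u)" for c x u
      by (cases x) (simp add: sc mscale_def psi2_def vec_eq_iff algebra_simps)
    show "(\<chi> i. psi2 (snd (snd (bi_tens w u)) $ i) u') = psi2 u u' *s w" for w u u'
      by (simp add: bi_tens_def psi2_def vec_eq_iff algebra_simps)
    show "sym (w + w') w'' = sym w w'' + sym w' w''" "sym (c *s w) w' = c * sym w w'" "sym w w' = sym w' w" for w w' w'' c
      by (simp_all add: sym_def sum.distrib sum_distrib_left algebra_simps)
    show "w = 0" if "\<And>w'. w' \<in> UNIV \<Longrightarrow> sym w w' = 0" for w
      using that [of "axis _ 1"] k by (simp add: sym_def ax vec_eq_iff)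
    show "psi2 (u + u') u'' = psi2 u u'' + psi2 u' u''" "psi2 (c *s u) u' = c * psi2 u u'" "psi2 u u' = - psi2 u' u" for u u' u'' c
      by (simp_all add: psi2_def algebra_simps)
    show "u = 0" if "\<And>u'. u' \<in> UNIV \<Longrightarrow> psi2 u u' = 0" for u
      using that [of "axis 0 1"] that [of "axis 1 1"] by (auto simp: psi2_def vec_eq_iff all_2 axis_def)
    show "?S \<subseteq> part K False" "?Q \<subseteq> part K False" using sl2_simps(1) E(1) by (auto simp: part_K)
    show "subspace ?S" "subspace ?Q"
      unfolding subspace_def using sl2_simps E by (auto simp: sc mscale_simps zero_prod_def)
    show "?S \<inter> ?Q = {0}" using sl2_simps(1) E(1) by (auto simp: zero_prod_def)
    show "\<exists>s\<in>?S. \<exists>q\<in>?Q. z = s + q" if zp: "z \<in> part K False" for z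
    proof -
      obtain M A where z: "z = (M, A, 0)" "M \<in> E" "A \<in> sl2" using zp by (auto simp: part_K)
      have "z = (M, 0, 0) + (0, A, 0)" using z by simp
      then show ?thesis using z(2,3) by blast
    qed
    show "brk K s q = 0" if "s \<in> ?S" "q \<in> ?Q" for s q
      using that by (auto simp: brk_even comm_zero bi_act_zero zero_prod_def)
    show "brk K s s' \<in> ?S" if "s \<in> ?S" "s' \<in> ?S" for s s'
      using that E by (auto simp: brk_even comm_zero bi_act_zero)
    show "brk K q q' \<in> ?Q" if "q \<in> ?Q" "q' \<in> ?Q" for q q'
      using that by (auto simp: brk_even comm_zero bi_act_zero comm_sl2)
    show "brk K s (bi_tens w u) = bi_tens (\<rho> (fst s) *v w) u" if "s \<in> ?S" for s w u
      using that by (auto simp only: bi_tens_def brk_even comm_zero bi_act_left fst_conv mem_Collect_eq)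
    show "s = 0" if s: "s \<in> ?S" "\<And>w. w \<in> UNIV \<Longrightarrow> \<rho> (fst s) *v w = 0" for s
    proof -
      obtain M where M: "s = (M, 0, 0)" "M \<in> E" using s(1) by blast
      have "\<rho> M = 0" using s(2) M(1) by (intro matrix_eq_0_if) simp
      then show ?thesis using faithful M jac by (simp add: zero_prod_def)
    qed
    show "fst (snd q) *v (u + u') = fst (snd q) *v u + fst (snd q) *v u'"
      "fst (snd q) *v (c *s u) = c *s (fst (snd q) *v u)" for q :: "(complex^'m^'m) \<times> (complex^2^2) \<times> (complex^2^'n)" and u u' c
      by (simp_all add: matrix_vector_right_distrib vector_scalar_commute)
    show "brk K q (bi_tens w u) = bi_tens w (fst (snd q) *v u)" if "q \<in> ?Q" for q w u
      using that by (auto simp only: bi_tens_def brk_even \<rho>0 comm_zero bi_act_right fst_conv snd_conv mem_Collect_eq)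
    show "q = 0" if "q \<in> ?Q" "\<And>u. u \<in> UNIV \<Longrightarrow> fst (snd q) *v u = 0" for q
      using that by (auto simp: zero_prod_def intro: matrix_eq_0_if)
    show "psi2 (fst (snd q) *v u) u' = - psi2 u (fst (snd q) *v u')" if "q \<in> ?Q" for q u u'
      using that psi2_sl2 by auto
    show "(0, sl2_pair u u', 0) \<in> ?Q" for u u' using sl2_pair_sl2 by blast
    show "fst (snd (0 :: complex^'m^'m, sl2_pair u u', 0 :: complex^2^'n)) *v z = psi2 u' z *s u + psi2 u z *s u'" for u u' z
      by (simp add: sl2_pair_act)
    show "(\<pi> w v, 0, 0) \<in> ?S" for w v using \<pi>_in by blast
    show "brk K (bi_tens w u) (bi_tens w' u') =
      sscale K (psi2 u u') (\<pi> w w', 0, 0) + sscale K (sym w w') (0, sl2_pair u u', 0)" for w w' u u' by (rule brk_odd)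
    show "\<exists>c. w' = c *s w" if "w \<noteq> 0" "sym w w = 0" "sym w' w' = 0" "sym w w' = 0" "(\<pi> w w', 0, 0) = (0 :: (complex^'m^'m) \<times> (complex^2^2) \<times> (complex^2^'n))" for w w'
      using that k by (intro parallel) (auto simp: sym_def zero_prod_def)
  qed simp_all
  show ?thesis by (rule admissible_tensor)
qed

section \<open>The cross product of imaginary octonions\<close>

lemma sum_124: "(\<Sum>d\<in>{1, 2, 4 :: 7}. f d) = f 1 + f 2 + (f 4 :: 'a::comm_monoid_add)"
  by (simp add: add.assoc)

lemma minus_7: "- 1 = (6 :: 7)" "- 2 = (5 :: 7)" "- 3 = (4 :: 7)" "- 4 = (3 :: 7)" "- 5 = (2 :: 7)" "- 6 = (1 :: 7)"
  "7 = (0 :: 7)" "8 = (1 :: 7)" "9 = (2 :: 7)" "10 = (3 :: 7)" "11 = (4 :: 7)" "12 = (5 :: 7)" "13 = (6 :: 7)"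
  by simp_all

text \<open>The three products belong to the lines of the Fano plane through \<open>k\<close>, one
  for each non-zero square modulo 7.\<close>

lemma oct_cross_nth: "oct_cross x y $ k =
    x $ (k - 3) * y $ (k - 2) - y $ (k - 3) * x $ (k - 2) + (x $ (k - 6) * y $ (k - 4) - y $ (k - 6) * x $ (k - 4)) +
    (x $ (k - 5) * y $ (k - 1) - y $ (k - 5) * x $ (k - 1))"
proof -
  have "3 * 4 = (5 :: 7)" "2 * 4 = (1 :: 7)" "3 * 2 = (6 :: 7)" "2 * 2 = (4 :: 7)" by simp_all
  then show ?thesis unfolding oct_cross_def sum_124 by (simp only: vec_lambda_beta mult_1_right)
qed

lemma oct_cross_table:
  "oct_cross x y $ 0 = x $ 4 * y $ 5 - y $ 4 * x $ 5 + (x $ 1 * y $ 3 - y $ 1 * x $ 3) + (x $ 2 * y $ 6 - y $ 2 * x $ 6)"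
  "oct_cross x y $ 1 = x $ 5 * y $ 6 - y $ 5 * x $ 6 + (x $ 2 * y $ 4 - y $ 2 * x $ 4) + (x $ 3 * y $ 0 - y $ 3 * x $ 0)"
  "oct_cross x y $ 2 = x $ 6 * y $ 0 - y $ 6 * x $ 0 + (x $ 3 * y $ 5 - y $ 3 * x $ 5) + (x $ 4 * y $ 1 - y $ 4 * x $ 1)"
  "oct_cross x y $ 3 = x $ 0 * y $ 1 - y $ 0 * x $ 1 + (x $ 4 * y $ 6 - y $ 4 * x $ 6) + (x $ 5 * y $ 2 - y $ 5 * x $ 2)"
  "oct_cross x y $ 4 = x $ 1 * y $ 2 - y $ 1 * x $ 2 + (x $ 5 * y $ 0 - y $ 5 * x $ 0) + (x $ 6 * y $ 3 - y $ 6 * x $ 3)"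
  "oct_cross x y $ 5 = x $ 2 * y $ 3 - y $ 2 * x $ 3 + (x $ 6 * y $ 1 - y $ 6 * x $ 1) + (x $ 0 * y $ 4 - y $ 0 * x $ 4)"
  "oct_cross x y $ 6 = x $ 3 * y $ 4 - y $ 3 * x $ 4 + (x $ 0 * y $ 2 - y $ 0 * x $ 2) + (x $ 1 * y $ 5 - y $ 1 * x $ 5)"
  by (simp_all add: oct_cross_nth minus_7)

lemma oct_cross_scale: "oct_cross (a *s x) (b *s y) = (a * b) *s oct_cross x y"
  by (simp add: vec_eq_iff oct_cross_nth algebra_simps)

lemma oct_cross_zero: "oct_cross 0 x = 0" "oct_cross x 0 = 0"
  by (simp_all add: vec_eq_iff oct_cross_nth)

lemma oct_cross_linear: "oct_cross z (a *s x - b *s y) = a *s oct_cross z x - b *s oct_cross z y"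
  by (simp add: vec_eq_iff oct_cross_nth algebra_simps)

lemma oct_cross_self: "oct_cross x x = 0"
  by (simp add: vec_eq_iff oct_cross_nth)

lemma axis_sum: "(\<Sum>j\<in>UNIV. axis j 1 $ a * f j) = (f a :: complex)"
proof -
  have "axis j 1 $ a * f j = (if j = a then f a else 0)" for j by (auto simp: axis_def)
  then show ?thesis by simp
qed

lemma oct_cross_axis_right: "(\<Sum>j\<in>UNIV. oct_cross x (axis j 1) $ i * y $ j) = oct_cross x y $ i"
proof -
  have "oct_cross x (axis j 1) $ i * y $ j =
      x $ (i - 3) * (axis j 1 $ (i - 2) * y $ j) - x $ (i - 2) * (axis j 1 $ (i - 3) * y $ j)
      + (x $ (i - 6) * (axis j 1 $ (i - 4) * y $ j) - x $ (i - 4) * (axis j 1 $ (i - 6) * y $ j))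
      + (x $ (i - 5) * (axis j 1 $ (i - 1) * y $ j) - x $ (i - 1) * (axis j 1 $ (i - 5) * y $ j))" for j
    unfolding oct_cross_nth by (simp only: algebra_simps)
  then show ?thesis
    unfolding oct_cross_nth by (simp only: sum.distrib sum_subtractf sum_distrib_left [symmetric] axis_sum) (simp add: algebra_simps)
qed

lemma oct_cross_skew: "oct_cross x y = - oct_cross y x"
  by (simp add: vec_eq_iff oct_cross_nth)

lemma oct_cross_axis_left: "(\<Sum>j\<in>UNIV. oct_cross (axis j 1) x $ i * y $ j) = oct_cross y x $ i"
  using oct_cross_axis_right [of x i y] oct_cross_skew [of y x]
  by (simp add: oct_cross_skew [of "axis _ 1" x] sum_negf)

text \<open>The double cross product identity, which in dimension 7 is confined to a repeated
  factor; it is checked in coordinates.\<close>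

lemma oct_cross_cross:
  "oct_cross x (oct_cross x y) = (\<Sum>i\<in>UNIV. x $ i * y $ i) *s x - (\<Sum>i\<in>UNIV. x $ i * x $ i) *s y"
  by (simp add: vec_eq_iff all_7 sum_7' oct_cross_table algebra_simps)

lemma g2_pair_mult:
  "g2_pair u v *v z = (3 * (\<Sum>j\<in>UNIV. u $ j * z $ j)) *s v - (3 * (\<Sum>j\<in>UNIV. v $ j * z $ j)) *s u - oct_cross (oct_cross u v) z"
proof -
  have "(g2_pair u v *v z) $ i = 3 * (\<Sum>j\<in>UNIV. u $ j * z $ j) * v $ i - 3 * (\<Sum>j\<in>UNIV. v $ j * z $ j) * u $ i - oct_cross (oct_cross u v) z $ i" for i
  proof -
    have "g2_pair u v $ i $ j * z $ j = 3 * v $ i * (u $ j * z $ j) - 3 * u $ i * (v $ j * z $ j)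
        - oct_cross (oct_cross u v) (axis j 1) $ i * z $ j" for j
      by (simp add: g2_pair_def algebra_simps)
    then show ?thesis
      by (simp add: matrix_vector_mult_def sum_subtractf sum_distrib_left [symmetric] oct_cross_axis_right)
  qed
  then show ?thesis by (simp add: vec_eq_iff)
qed

lemma g2_pair_scale: "g2_pair (a *s u) (b *s v) = mscale (a * b) (g2_pair u v)"
proof -
  have "oct_cross (c *s x) y = c *s oct_cross x y" for c x y using oct_cross_scale [of c x 1 y] by simp
  then show ?thesis by (simp add: g2_pair_def mscale_def vec_eq_iff oct_cross_scale algebra_simps)
qed

lemma parallelI:
  fixes u v :: "complex^'n"
  assumes u: "u \<noteq> 0" and uv: "\<And>i j. u $ i * v $ j = u $ j * v $ i"
  shows "\<exists>c. v = c *s u"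
proof -
  obtain i where i: "u $ i \<noteq> 0" using u by (auto simp: vec_eq_iff)
  have "v $ j = v $ i / u $ i * u $ j" for j using uv [of i j] i by (simp add: field_simps)
  then show ?thesis unfolding vec_eq_iff vector_smult_component by blast
qed

text \<open>For isotropic \<open>u\<close> and \<open>v\<close>, the double cross product formula shows that \<open>z = u \<times> v\<close>
  annihilates \<open>u\<close>, \<open>v\<close> and hence \<open>z \<times> y\<close> for all \<open>y\<close>; then \<open>z = 0\<close>.\<close>

lemma g2_pair_parallel:
  assumes u: "u \<noteq> 0" and iso: "(\<Sum>i\<in>UNIV. u $ i * u $ i) = 0" "(\<Sum>i\<in>UNIV. v $ i * v $ i) = 0" "(\<Sum>i\<in>UNIV. u $ i * v $ i) = 0"
    and p: "g2_pair u v = 0"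
  shows "\<exists>c. v = c *s u"
proof -
  define z where "z = oct_cross u v"
  have cross: "oct_cross z y = (3 * (\<Sum>j\<in>UNIV. u $ j * y $ j)) *s v - (3 * (\<Sum>j\<in>UNIV. v $ j * y $ j)) *s u" for y
    using g2_pair_mult [of u v y] p by (simp add: z_def)
  have "oct_cross z u = 0" "oct_cross z v = 0" using iso by (simp_all add: cross mult.commute)
  then have zz: "oct_cross z (oct_cross z y) = 0" for y
    unfolding cross [of y] oct_cross_linear by simp
  \<comment> \<open>By the double cross product formula, crossing the \<open>i\<close>-th basis
    vector twice with \<open>z\<close> gives \<open>z $ i\<close> times \<open>z\<close> minus
    \<open>z . z\<close> times that vector, and this is zero.\<close>
  have e: "z $ i * z $ k = (if i = k then \<Sum>j\<in>UNIV. z $ j * z $ j else 0)" for i k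
  proof -
    have "(\<Sum>j\<in>UNIV. z $ j * axis i 1 $ j) = z $ i" by (simp add: axis_def if_distrib cong: if_cong)
    then have "(z $ i *s z - (\<Sum>j\<in>UNIV. z $ j * z $ j) *s axis i 1) $ k = 0"
      using zz [of "axis i 1"] unfolding oct_cross_cross by simp
    then show ?thesis by (auto simp: axis_def split: if_splits)
  qed
  \<comment> \<open>The squares of \<open>z $ 0\<close> and \<open>z $ 1\<close> both equal
    \<open>z . z\<close> while their product is 0, so \<open>z . z = 0\<close>.\<close>
  have "z $ 0 * z $ 1 = 0" using e [of 0 1] by simp
  then have c: "(\<Sum>j\<in>UNIV. z $ j * z $ j) = 0" using e [of 0 0] e [of 1 1] by auto
  have "z $ i * z $ i = 0" for i using e [of i i] unfolding c by simp
  then have "z = 0" by (simp add: vec_eq_iff)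
  have "u $ j * v $ i = v $ j * u $ i" for i j
  proof -
    \<comment> \<open>With \<open>z = 0\<close>, what remains of \<open>g2_pair\<close> is the
      matrix of minors of \<open>u\<close> and \<open>v\<close>, times 3.\<close>
    have "g2_pair u v $ i $ j = 0" using p by simp
    then show ?thesis using \<open>z = 0\<close> by (simp add: g2_pair_def z_def oct_cross_zero)
  qed
  then show ?thesis using parallelI [OF u, of v] by (simp add: mult.commute)
qed

lemma G3_eq: "G3 = bi_superalgebra g2 (\<lambda>M. M) g2_pair (- 2)"
  by (simp add: G3_def bi_superalgebra_def)

lemma admissible_G3:
  assumes "lie_superalgebra G3" shows "admissible G3"
  using assms unfolding G3_eq by (rule admissible_bi) (simp_all add: g2_pair_scale g2_pair_parallel)

section \<open>The spin module of so(7)\<close>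

lemma sum_option: "sum f (UNIV :: 'n::finite option set) = f None + (\<Sum>i\<in>UNIV. f (Some i))"
  by (simp add: UNIV_option_conv sum.reindex)

lemma oct_left_mult: "oct_left i *v t = (\<chi> p. case p of None \<Rightarrow> - t $ Some i
    | Some k \<Rightarrow> (if k = i then t $ None else 0) + oct_cross (axis i 1) (\<chi> j. t $ Some j) $ k)"
proof -
  have "(\<Sum>j\<in>UNIV. oct_cross (axis i 1) (axis j 1) $ k * t $ Some j) = oct_cross (axis i 1) (\<chi> j. t $ Some j) $ k" for k
    using oct_cross_axis_right [of "axis i 1" k "\<chi> j. t $ Some j"] by simp
  then show ?thesis
    by (simp add: vec_eq_iff matrix_vector_mult_def sum_option oct_left_def if_distrib [where f = "\<lambda>x. x * _"]
        split: option.split cong: if_cong)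
qed

lemma spin_pair_nth: "i \<noteq> j \<Longrightarrow> spin_pair s t $ i $ j = (\<Sum>p\<in>UNIV. s $ p * (oct_left i *v (oct_left j *v t)) $ p)"
  by (simp add: spin_pair_def matrix_vector_mul_assoc)

lemma spin_pair_scale: "spin_pair (a *s s) (b *s t) = mscale (a * b) (spin_pair s t)"
  by (simp add: spin_pair_def mscale_def vec_eq_iff vector_scalar_commute sum_distrib_left mult_ac)

text \<open>Pairing the unit octonion with an imaginary unit gives the cross product by that unit.
  These are the elements against which faithfulness is tested.\<close>

lemma spin_pair_unit: "spin_pair (axis None 1) (axis (Some k) 1) *v y = oct_cross (axis k 1) y"
proof -
  have z: "oct_cross (axis i 1) x $ i = 0" for i x
    by (simp add: oct_cross_nth axis_def)
  have o: "oct_left j *v axis (Some k) 1 = (\<chi> p. case p of None \<Rightarrow> - (if k = j then 1 else 0) | Some i \<Rightarrow> oct_cross (axis j 1) (axis k 1) $ i)" for j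
    unfolding oct_left_mult by (auto simp: vec_eq_iff axis_def oct_cross_nth split: option.split)
  have "spin_pair (axis None 1) (axis (Some k) 1) $ i $ j = - oct_cross (axis j 1) (axis k 1) $ i" for i j
  proof (cases "i = j")
    case True
    then show ?thesis by (simp add: spin_pair_def z)
  next
    case False
    then show ?thesis
      unfolding spin_pair_nth [OF False] o sum_option unfolding oct_left_mult [of i]
      by (simp add: axis_def [of None])
  qed
  then show ?thesis
    using oct_cross_axis_left [of "axis k 1" _ y] oct_cross_skew [of y "axis k 1"]
    by (simp add: vec_eq_iff matrix_vector_mult_def sum_negf)
qed

lemma mult_axis: "(M *v axis k 1) $ i = M $ i $ (k :: 'n::finite)" for M :: "complex^'n^'m"
proof -
  have "M $ i $ j * axis k 1 $ j = (if j = k then M $ i $ k else 0)" for j by (simp add: axis_def)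
  then show ?thesis by (simp add: matrix_vector_mult_def)
qed

text \<open>For a basis vector \<open>e\<close>, commuting with the cross product by
  \<open>e\<close> makes the cross product of \<open>e\<close> and \<open>M e\<close> equal to
  \<open>M\<close> applied to that of \<open>e\<close> with itself, which is 0. By skew symmetry
  \<open>M e\<close> is orthogonal to \<open>e\<close>, so the double cross product formula yields
  \<open>M e = 0\<close>.\<close>

lemma so7_faithful:
  assumes M: "M \<in> so7" and c: "\<And>s t. comm M (spin_pair s t) = 0"
  shows "M = 0"
proof -
  have "M *v axis k 1 = 0" for k
  proof -
    let ?e = "axis k 1 :: complex^7" and ?P = "spin_pair (axis None 1) (axis (Some k) 1)"
    have "?P *v (M *v ?e) = M *v (?P *v ?e)"
      using c [of "axis None 1" "axis (Some k) 1"] by (simp add: comm_def matrix_vector_mul_assoc)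
    then have "oct_cross ?e (oct_cross ?e (M *v ?e)) = oct_cross ?e 0"
      by (simp add: spin_pair_unit oct_cross_self)
    moreover have "oct_cross ?e 0 = 0" by (rule oct_cross_zero)
    moreover have "transpose M $ k $ k = - M $ k $ k" using M by (simp add: so7_def)
    then have "M $ k $ k = 0" by (simp add: transpose_def)
    then have "(M *v ?e) $ k = 0" by (simp add: mult_axis)
    moreover have "(\<Sum>i\<in>UNIV. ?e $ i * y $ i) = y $ k" for y
    proof -
      have "?e $ i * y $ i = (if i = k then y $ k else 0)" for i by (simp add: axis_def)
      then show ?thesis by simp
    qed
    ultimately show ?thesis unfolding oct_cross_cross by simp
  qed
  then have "(M *v axis k 1) $ i = 0" for i k by simp
  then show ?thesis by (simp add: mult_axis vec_eq_iff)
qed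

text \<open>The hypotheses identify complementary Pluecker coordinates of \<open>s\<close> and
  \<open>t\<close> in four-space, up to sign; the quadratic Pluecker relation then becomes a sum of
  three squares.\<close>

lemma plucker:
  fixes s0 s1 s2 s3 t0 t1 t2 t3 :: complex
  assumes "s2 * t1 - s1 * t2 = s3 * t0 - s0 * t3" "s3 * t2 - s2 * t3 = s1 * t0 - s0 * t1" "s1 * t3 - s3 * t1 = s2 * t0 - s0 * t2"
  shows "(s1 * t0 - s0 * t1)^2 + (s2 * t0 - s0 * t2)^2 + (s3 * t0 - s0 * t3)^2 = 0"
  using assms by algebra

text \<open>At the three pairs collinear with \<open>k\<close>, the entries of
  \<open>spin_pair\<close> are signed sums of four minors: that of \<open>k\<close> with the unit
  and those of the three pairs. Their vanishing is a linear system that makes all four minors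
  equal.\<close>

lemma spin_pair_lines:
  "spin_pair s t $ (k - 3) $ (k - 2) = 0 \<and> spin_pair s t $ (k - 6) $ (k - 4) = 0 \<and> spin_pair s t $ (k - 5) $ (k - 1) = 0 \<longrightarrow>
   s $ Some (k - 2) * t $ Some (k - 3) - s $ Some (k - 3) * t $ Some (k - 2) = s $ Some k * t $ None - s $ None * t $ Some k \<and>
   s $ Some (k - 4) * t $ Some (k - 6) - s $ Some (k - 6) * t $ Some (k - 4) = s $ Some k * t $ None - s $ None * t $ Some k \<and>
   s $ Some (k - 1) * t $ Some (k - 5) - s $ Some (k - 5) * t $ Some (k - 1) = s $ Some k * t $ None - s $ None * t $ Some k"
proof -
  have solve: "y1 = a \<and> y2 = a \<and> y3 = a" if "a + y1 - y2 - y3 = 0" "a + y2 - y1 - y3 = 0" "a + y3 - y1 - y2 = 0" for a y1 y2 y3 :: complex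
    using that by (intro conjI) (algebra+)
  have "\<forall>k. spin_pair s t $ (k - 3) $ (k - 2) = (s $ Some k * t $ None - s $ None * t $ Some k)
      + (s $ Some (k - 2) * t $ Some (k - 3) - s $ Some (k - 3) * t $ Some (k - 2))
      - (s $ Some (k - 4) * t $ Some (k - 6) - s $ Some (k - 6) * t $ Some (k - 4))
      - (s $ Some (k - 1) * t $ Some (k - 5) - s $ Some (k - 5) * t $ Some (k - 1))"
    by (simp add: all_7 spin_pair_nth sum_option sum_7' oct_left_mult oct_cross_table minus_7 axis_def algebra_simps)
  moreover have "\<forall>k. spin_pair s t $ (k - 6) $ (k - 4) = (s $ Some k * t $ None - s $ None * t $ Some k)
      + (s $ Some (k - 4) * t $ Some (k - 6) - s $ Some (k - 6) * t $ Some (k - 4))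
      - (s $ Some (k - 2) * t $ Some (k - 3) - s $ Some (k - 3) * t $ Some (k - 2))
      - (s $ Some (k - 1) * t $ Some (k - 5) - s $ Some (k - 5) * t $ Some (k - 1))"
    by (simp add: all_7 spin_pair_nth sum_option sum_7' oct_left_mult oct_cross_table minus_7 axis_def algebra_simps)
  moreover have "\<forall>k. spin_pair s t $ (k - 5) $ (k - 1) = (s $ Some k * t $ None - s $ None * t $ Some k)
      + (s $ Some (k - 1) * t $ Some (k - 5) - s $ Some (k - 5) * t $ Some (k - 1))
      - (s $ Some (k - 2) * t $ Some (k - 3) - s $ Some (k - 3) * t $ Some (k - 2))
      - (s $ Some (k - 4) * t $ Some (k - 6) - s $ Some (k - 6) * t $ Some (k - 4))"
    by (simp add: all_7 spin_pair_nth sum_option sum_7' oct_left_mult oct_cross_table minus_7 axis_def algebra_simps)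
  ultimately show ?thesis using solve by metis
qed

text \<open>The incidence matrix of the Fano plane is invertible, since its transpose times itself
  is \<open>2 I + J\<close> with \<open>J\<close> the all-ones matrix; hence numbers that sum to
  zero on every line vanish.\<close>

lemma fano_squares:
  fixes x :: "7 \<Rightarrow> complex"
  assumes "\<And>k. x (k - 3) + x (k - 2) + x k = 0"
  shows "x k = 0"
proof -
  have e: "x (m + k - 3) + x (m + k - 2) + x (m + k) = 0" for m using assms [of "m + k"] .
  have "\<forall>k. x k = 0"
  proof -
    have "x 4 + x 5 + x 0 = 0" "x 5 + x 6 + x 1 = 0" "x 6 + x 0 + x 2 = 0" "x 0 + x 1 + x 3 = 0"
      "x 1 + x 2 + x 4 = 0" "x 2 + x 3 + x 5 = 0" "x 3 + x 4 + x 6 = 0"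
      using assms [of 0] assms [of 1] assms [of 2] assms [of 3] assms [of 4] assms [of 5] assms [of 6] by (simp_all add: minus_7)
    then show ?thesis unfolding all_7 by (intro conjI) (algebra+)
  qed
  then show ?thesis by blast
qed

text \<open>On each line \<open>{i, j, k}\<close> of the Fano plane the Pluecker relation of the bivector \<open>s \<and> t\<close>
  turns the vanishing of \<open>spin_pair s t\<close> into a relation between three squares.\<close>

lemma spin_pair_parallel:
  assumes s: "s \<noteq> 0" and p: "spin_pair s t = 0"
  shows "\<exists>c. t = c *s s"
proof -
  define a where "a k = s $ Some k * t $ None - s $ None * t $ Some k" for k
  have L: "\<forall>k. s $ Some (k - 2) * t $ Some (k - 3) - s $ Some (k - 3) * t $ Some (k - 2) = a k \<and>
     s $ Some (k - 4) * t $ Some (k - 6) - s $ Some (k - 6) * t $ Some (k - 4) = a k \<and>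
     s $ Some (k - 1) * t $ Some (k - 5) - s $ Some (k - 5) * t $ Some (k - 1) = a k"
    using spin_pair_lines [of s t] p by (simp add: a_def)
  have "\<forall>k. (a (k - 3))^2 + (a (k - 2))^2 + (a k)^2 = 0"
    unfolding all_7 a_def
    by (intro conjI; rule plucker; insert L [unfolded all_7 a_def]; simp add: minus_7)
  then have "(a k)^2 = 0" for k using fano_squares [of "\<lambda>k. (a k)^2" k] by blast
  then have a0: "a k = 0" for k by simp
  \<comment> \<open>Any two points of the Fano plane lie on a line, so the minors in
    \<open>L\<close>, now zero, are up to sign all minors with two imaginary indices.\<close>
  have "\<forall>p q. s $ Some p * t $ Some q = s $ Some q * t $ Some p"
    using L [unfolded a0 all_7] by (simp add: all_7 minus_7)
  moreover have "s $ Some k * t $ None = s $ None * t $ Some k" for k using a0 [of k] by (simp add: a_def)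
  ultimately have "s $ i * t $ j = s $ j * t $ i" for i j by (cases i; cases j) auto
  then show ?thesis by (rule parallelI [OF s])
qed

text \<open>The factor 2 of the even component is absorbed into the pairing.\<close>

lemma F4_eq: "F4 = bi_superalgebra so7 spin (\<lambda>s t. mscale 2 (spin_pair s t)) (- 3)"
  by (simp add: F4_def bi_superalgebra_def mscale_sum mscale_simps mult.commute)

lemma admissible_F4:
  assumes "lie_superalgebra F4" shows "admissible F4"
  using assms unfolding F4_eq
proof (rule admissible_bi)
  show "spin 0 = 0" by (simp add: spin_def mscale_simps)
  show "mscale 2 (spin_pair (a *s s) (b *s t)) = mscale (a * b) (mscale 2 (spin_pair s t))" for a b s t
    by (simp add: spin_pair_scale mscale_simps mult.commute)
  have half: "mscale (1 / 2) (mscale 2 X) = X" for X :: "complex^7^7" by (simp add: mscale_simps)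
  show "M = 0" if "M \<in> so7" "\<And>s t. comm M (mscale 2 (spin_pair s t)) = 0" for M
  proof (rule so7_faithful [OF that(1)])
    have "comm M (mscale c X) = mscale c (comm M X)" for c X
      by (simp add: comm_def mscale_def vec_eq_iff matrix_matrix_mult_def sum_distrib_left right_diff_distrib mult_ac)
    then show "comm M (spin_pair s t) = 0" for s t
      using that(2) [of s t] half [of "comm M (spin_pair s t)"] by (simp add: mscale_simps)
  qed
  show "\<exists>c. v = c *s w" if "w \<noteq> 0" "mscale 2 (spin_pair w v) = 0" for w v
    using spin_pair_parallel [OF that(1)] that(2) half [of "spin_pair w v"] by (simp add: mscale_simps)
qed simp

section \<open>The orthosymplectic Lie superalgebras\<close>

lemma gl_brk_even:
  assumes X: "X \<in> part (gl m n) False"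
  shows "brk (gl m n) X Y = (\<lambda>i j. (\<Sum>k<m+n. X i k * Y k j) - (\<Sum>k<m+n. Y i k * X k j))"
proof (intro ext)
  fix i j
  have "X i k * Y k j - ksign ((m \<le> i) \<noteq> (m \<le> k)) ((m \<le> k) \<noteq> (m \<le> j)) * (Y i k * X k j) = X i k * Y k j - Y i k * X k j" for k
    using X by (cases "X k j = 0") (auto simp: ksign_def gl_def)
  then have "(\<Sum>k<m+n. X i k * Y k j - ksign ((m \<le> i) \<noteq> (m \<le> k)) ((m \<le> k) \<noteq> (m \<le> j)) * (Y i k * X k j)) = (\<Sum>k<m+n. X i k * Y k j - Y i k * X k j)"
    by (intro sum.cong refl)
  then show "brk (gl m n) X Y i j = (\<Sum>k<m+n. X i k * Y k j) - (\<Sum>k<m+n. Y i k * X k j)"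
    unfolding sum_subtractf [symmetric] by (simp only: gl_def superalgebra.simps)
qed

lemma gl_brk_odd:
  assumes X: "X \<in> part (gl m n) True" and Y: "Y \<in> part (gl m n) True"
  shows "brk (gl m n) X Y = (\<lambda>i j. (\<Sum>k<m+n. X i k * Y k j) + (\<Sum>k<m+n. Y i k * X k j))"
proof (intro ext)
  fix i j
  have "X i k * Y k j - ksign ((m \<le> i) \<noteq> (m \<le> k)) ((m \<le> k) \<noteq> (m \<le> j)) * (Y i k * X k j) = X i k * Y k j + Y i k * X k j" for k
    using X Y by (cases "X k j = 0"; cases "Y i k = 0") (auto simp: ksign_def gl_def)
  then have "(\<Sum>k<m+n. X i k * Y k j - ksign ((m \<le> i) \<noteq> (m \<le> k)) ((m \<le> k) \<noteq> (m \<le> j)) * (Y i k * X k j)) = (\<Sum>k<m+n. X i k * Y k j + Y i k * X k j)"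
    by (intro sum.cong refl)
  then show "brk (gl m n) X Y i j = (\<Sum>k<m+n. X i k * Y k j) + (\<Sum>k<m+n. Y i k * X k j)"
    unfolding sum.distrib [symmetric] by (simp only: gl_def superalgebra.simps)
qed

lemma vector_space_seq: "vector_space (\<lambda>c (f :: nat \<Rightarrow> complex) i. c * f i)"
  by unfold_locales (auto simp: fun_eq_iff algebra_simps)

locale osp_lie = lie_superalg "osp m n" for m n :: nat +
  assumes odd_nontrivial: "part (osp m n) True \<noteq> {0}"
begin

abbreviation "N \<equiv> m + 2 * n"

text \<open>Together with \<open>gs\<close> this describes the Gram matrix as a signed permutation
  matrix: row \<open>j\<close> has the single entry \<open>gs j\<close>, in column
  \<open>dual_index j\<close>. On odd indices the permutation reverses the sign.\<close>

definition dual_index :: "nat \<Rightarrow> nat" where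
  "dual_index j = (if j < m then j else if j < m + n then j + n else j - n)"

definition gs :: "nat \<Rightarrow> complex" where
  "gs j = (if j < m + n then 1 else - 1)"

lemma dual_index: "j < N \<Longrightarrow> dual_index j < N" "j < m \<Longrightarrow> dual_index j = j" "m \<le> j \<Longrightarrow> j < N \<Longrightarrow> m \<le> dual_index j"
  "j < N \<Longrightarrow> dual_index (dual_index j) = j"
  by (auto simp: dual_index_def)

lemma gs: "gs j * gs j = 1" "gs j * (gs j * c) = c" "j < m \<Longrightarrow> gs j = 1"
  "m \<le> j \<Longrightarrow> j < N \<Longrightarrow> gs (dual_index j) = - gs j"
  by (auto simp: gs_def dual_index_def)

lemma gram:
  assumes ij: "i < N" "j < N"
  shows "osp_gram m n i j = (if j = dual_index i then gs i else 0)"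
    "osp_gram m n i j = (if i = dual_index j then gs (dual_index j) else 0)"
proof -
  consider "i < m" | "m \<le> i" "i < m + n" | "m + n \<le> i" by linarith
  then show 1: "osp_gram m n i j = (if j = dual_index i then gs i else 0)"
  proof cases
    case 1
    then have "dual_index i = i" "gs i = 1" by (simp_all add: dual_index_def gs_def)
    then show ?thesis using 1 by (simp add: osp_gram_def)
  next
    case 2
    then have "dual_index i = i + n" "gs i = 1" by (simp_all add: dual_index_def gs_def)
    then show ?thesis using 2 by (simp add: osp_gram_def)
  next
    case 3
    then have d: "dual_index i = i - n" "gs i = - 1" by (simp_all add: dual_index_def gs_def)
    have e: "j \<noteq> i + n" "\<not> i < m" "m \<le> j \<and> i = j + n \<longleftrightarrow> j = i - n" using 3 ij by arith+
    show ?thesis unfolding osp_gram_def d e(3) using e(1,2) by simp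
  qed
  have "j = dual_index i \<longleftrightarrow> i = dual_index j" using dual_index(4) ij by metis
  then show "osp_gram m n i j = (if i = dual_index j then gs (dual_index j) else 0)" using 1 by simp
qed

lemma part_osp: "X \<in> part (osp m n) p \<longleftrightarrow> X \<in> part (gl m (2 * n)) p \<and>
  (\<forall>i<N. \<forall>j<N. gs (dual_index j) * X (dual_index j) i + ksign p (m \<le> i) * (gs i * X (dual_index i) j) = 0)"
proof -
  have a: "(\<Sum>k<N. X k i * osp_gram m n k j) = gs (dual_index j) * X (dual_index j) i" if "j < N" for i j
  proof -
    have "(\<Sum>k<N. X k i * osp_gram m n k j) = (\<Sum>k<N. if k = dual_index j then gs (dual_index j) * X (dual_index j) i else 0)"
      using that by (intro sum.cong) (auto simp: gram(2))
    then show ?thesis using dual_index(1) [OF that] by simp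
  qed
  have b: "(\<Sum>k<N. osp_gram m n i k * X k j) = gs i * X (dual_index i) j" if "i < N" for i j
  proof -
    have "(\<Sum>k<N. osp_gram m n i k * X k j) = (\<Sum>k<N. if k = dual_index i then gs i * X (dual_index i) j else 0)"
      using that by (intro sum.cong) (auto simp: gram(1))
    then show ?thesis using dual_index(1) [OF that] by simp
  qed
  show ?thesis by (simp add: osp_def gl_def a b)
qed

lemma osp_simps: "sscale (osp m n) = (\<lambda>c X i j. c * X i j)" "brk (osp m n) = brk (gl m (2 * n))"
  by (simp_all add: osp_def gl_def)

lemma part_gl_iff: "X \<in> part (gl m (2 * n)) p \<longleftrightarrow> (\<forall>i j. X i j \<noteq> 0 \<longrightarrow> i < N \<and> j < N \<and> ((m \<le> i) \<noteq> (m \<le> j)) = p)"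
  by (simp add: gl_def)

lemma evenD:
  assumes "X \<in> part (osp m n) False"
  shows "X i j \<noteq> 0 \<Longrightarrow> i < N \<and> j < N \<and> (m \<le> i) = (m \<le> j)" "i < m \<Longrightarrow> j < m \<Longrightarrow> X j i = - X i j"
    "m \<le> i \<Longrightarrow> i < N \<Longrightarrow> m \<le> j \<Longrightarrow> j < N \<Longrightarrow> gs i * X (dual_index i) j = gs j * X (dual_index j) i"
proof -
  have X: "X \<in> part (gl m (2 * n)) False"
    and c: "gs (dual_index j) * X (dual_index j) i + gs i * X (dual_index i) j = 0" if "i < N" "j < N" for i j
    using assms that by (auto simp: part_osp ksign_def)
  show "X i j \<noteq> 0 \<Longrightarrow> i < N \<and> j < N \<and> (m \<le> i) = (m \<le> j)" using assms by (auto simp: part_osp part_gl_iff)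
  show "X j i = - X i j" if "i < m" "j < m"
    using c [of i j] that by (simp add: dual_index gs eq_neg_iff_add_eq_0)
  show "gs i * X (dual_index i) j = gs j * X (dual_index j) i" if "m \<le> i" "i < N" "m \<le> j" "j < N"
    using c [of i j] that by (simp add: gs)
qed

lemma evenI:
  assumes X: "\<And>i j. X i j \<noteq> 0 \<Longrightarrow> i < N \<and> j < N \<and> (m \<le> i) = (m \<le> j)"
    and 0: "\<And>i j. i < m \<Longrightarrow> j < m \<Longrightarrow> X j i = - X i j"
    and 1: "\<And>i j. m \<le> i \<Longrightarrow> i < N \<Longrightarrow> m \<le> j \<Longrightarrow> j < N \<Longrightarrow> gs i * X (dual_index i) j = gs j * X (dual_index j) i"
  shows "X \<in> part (osp m n) False"
  unfolding part_osp
proof (intro conjI allI impI)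
  show "X \<in> part (gl m (2 * n)) False" unfolding part_gl_iff using X by blast
  fix i j assume ij: "i < N" "j < N"
  consider "i < m" "j < m" | "m \<le> i" "m \<le> j" | "(m \<le> i) \<noteq> (m \<le> j)" by linarith
  then show "gs (dual_index j) * X (dual_index j) i + ksign False (m \<le> i) * (gs i * X (dual_index i) j) = 0"
  proof cases
    case 1
    then show ?thesis using 0 [of i j] by (simp add: dual_index gs ksign_def)
  next
    case 2
    then show ?thesis using 1 [of i j] ij by (simp add: gs ksign_def)
  next
    case 3
    have "(m \<le> dual_index k) = (m \<le> k)" if "k < N" for k using that dual_index(2,3) [of k] by (cases "k < m") auto
    then have "X (dual_index j) i = 0" "X (dual_index i) j = 0" using X [of "dual_index j" i] X [of "dual_index i" j] 3 ij by auto
    then show ?thesis by simp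
  qed
qed

text \<open>The upper right block of an odd element is determined by the lower left one; this is
  what identifies the odd part with \<open>W\<close> tensor \<open>U\<close>.\<close>

lemma oddD:
  assumes "X \<in> part (osp m n) True"
  shows "X i j \<noteq> 0 \<Longrightarrow> i < N \<and> j < N \<and> (m \<le> i) \<noteq> (m \<le> j)"
    "i < m \<Longrightarrow> m \<le> j \<Longrightarrow> j < N \<Longrightarrow> X i j = gs j * X (dual_index j) i"
proof -
  show "X i j \<noteq> 0 \<Longrightarrow> i < N \<and> j < N \<and> (m \<le> i) \<noteq> (m \<le> j)" using assms by (auto simp: part_osp part_gl_iff)
  show "X i j = gs j * X (dual_index j) i" if ij: "i < m" "m \<le> j" "j < N"
  proof -
    have "i < N" using ij by simp
    then have "gs (dual_index j) * X (dual_index j) i + ksign True (m \<le> i) * (gs i * X (dual_index i) j) = 0"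
      using assms ij(3) unfolding part_osp by blast
    then show ?thesis using ij by (simp add: dual_index gs ksign_def)
  qed
qed

lemma oddI:
  assumes X: "\<And>i j. X i j \<noteq> 0 \<Longrightarrow> i < N \<and> j < N \<and> (m \<le> i) \<noteq> (m \<le> j)"
    and 0: "\<And>i j. i < m \<Longrightarrow> m \<le> j \<Longrightarrow> j < N \<Longrightarrow> X i j = gs j * X (dual_index j) i"
  shows "X \<in> part (osp m n) True"
  unfolding part_osp
proof (intro conjI allI impI)
  show "X \<in> part (gl m (2 * n)) True" unfolding part_gl_iff using X by blast
  fix i j assume ij: "i < N" "j < N"
  consider "i < m" "m \<le> j" | "m \<le> i" "j < m" | "(m \<le> i) = (m \<le> j)" by linarith
  then show "gs (dual_index j) * X (dual_index j) i + ksign True (m \<le> i) * (gs i * X (dual_index i) j) = 0"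
  proof cases
    case 1
    then show ?thesis using 0 [of i j] ij by (simp add: dual_index gs ksign_def)
  next
    case 2
    then show ?thesis using 0 [of j i] ij by (simp add: dual_index gs ksign_def)
  next
    case 3
    have "(m \<le> dual_index k) = (m \<le> k)" if "k < N" for k using that dual_index(2,3) [of k] by (cases "k < m") auto
    then have "X (dual_index j) i = 0" "X (dual_index i) j = 0" using X [of "dual_index j" i] X [of "dual_index i" j] 3 ij by auto
    then show ?thesis by simp
  qed
qed

definition WS :: "(nat \<Rightarrow> complex) set" where "WS = {w. \<forall>i. w i \<noteq> 0 \<longrightarrow> i < m}"
definition US :: "(nat \<Rightarrow> complex) set" where "US = {u. \<forall>i. u i \<noteq> 0 \<longrightarrow> m \<le> i \<and> i < N}"

lemma WS_0: "w \<in> WS \<Longrightarrow> m \<le> i \<Longrightarrow> w i = 0"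
  by (auto simp: WS_def)

lemma US_0: "u \<in> US \<Longrightarrow> \<not> (m \<le> i \<and> i < N) \<Longrightarrow> u i = 0"
  by (auto simp: US_def)

definition mv :: "(nat \<Rightarrow> nat \<Rightarrow> complex) \<Rightarrow> (nat \<Rightarrow> complex) \<Rightarrow> nat \<Rightarrow> complex" where
  "mv X v a = (\<Sum>b<N. X a b * v b)"

text \<open>The covector of \<open>u\<close> for the symplectic form, whose sign is opposite to that
  of the odd block of \<open>osp_gram\<close>. It is the sign that the orthosymplectic condition
  imposes on the upper right block of odd matrices.\<close>

definition adj :: "(nat \<Rightarrow> complex) \<Rightarrow> nat \<Rightarrow> complex" where
  "adj u b = (if m \<le> b \<and> b < N then gs b * u (dual_index b) else 0)"

definition dot :: "(nat \<Rightarrow> complex) \<Rightarrow> (nat \<Rightarrow> complex) \<Rightarrow> complex" where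
  "dot w v = (\<Sum>b<N. w b * v b)"

abbreviation "psi u v \<equiv> dot (adj u) v"

text \<open>The lower left block is the column \<open>u\<close> times the row \<open>w\<close>; the
  upper right block is then forced.\<close>

definition tens :: "(nat \<Rightarrow> complex) \<Rightarrow> (nat \<Rightarrow> complex) \<Rightarrow> nat \<Rightarrow> nat \<Rightarrow> complex" where
  "tens w u a b = u a * w b + w a * adj u b"

definition quad :: "(nat \<Rightarrow> complex) \<Rightarrow> (nat \<Rightarrow> complex) \<Rightarrow> nat \<Rightarrow> nat \<Rightarrow> complex" where
  "quad u u' a b = u a * adj u' b + u' a * adj u b"

definition wedge :: "(nat \<Rightarrow> complex) \<Rightarrow> (nat \<Rightarrow> complex) \<Rightarrow> nat \<Rightarrow> nat \<Rightarrow> complex" where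
  "wedge w w' a b = w a * w' b - w' a * w b"

lemma adj_US: "adj u \<in> US"
  by (simp add: US_def adj_def)

lemma dot_comm: "dot u v = dot v u"
  by (simp add: dot_def mult.commute)

lemma dot_WS_US: "w \<in> WS \<Longrightarrow> u \<in> US \<Longrightarrow> dot w u = 0" "w \<in> WS \<Longrightarrow> u \<in> US \<Longrightarrow> dot u w = 0"
proof -
  assume "w \<in> WS" "u \<in> US"
  then have "w b = 0 \<or> u b = 0" for b using WS_0 [of w b] US_0 [of u b] by (cases "m \<le> b") auto
  then have 0: "w b * u b = 0" "u b * w b = 0" for b by (metis mult_eq_0_iff)+
  show "dot w u = 0" "dot u w = 0" by (simp_all only: dot_def 0 sum.neutral_const)
qed

lemma dot_linear: "dot (\<lambda>b. x b + y b) v = dot x v + dot y v" "dot (\<lambda>b. c * x b) v = c * dot x v"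
  "dot v (\<lambda>b. x b + y b) = dot v x + dot v y" "dot v (\<lambda>b. c * x b) = c * dot v x" "dot v (\<lambda>b. x b * c) = c * dot v x"
  "dot v (\<lambda>b. x b - y b) = dot v x - dot v y"
  by (simp_all add: dot_def sum.distrib sum_subtractf sum_distrib_left algebra_simps)

lemma adj_linear: "adj (\<lambda>i. u i + v i) = (\<lambda>b. adj u b + adj v b)" "adj (\<lambda>i. c * u i) = (\<lambda>b. c * adj u b)"
  by (auto simp: adj_def algebra_simps)

lemma mv_dot: "mv X v a = dot (X a) v"
  by (simp add: mv_def dot_def)

lemma mv_rank_two:
  "mv (tens w u) v = (\<lambda>a. dot w v * u a + psi u v * w a)"
  "mv (quad u u') v = (\<lambda>a. psi u' v * u a + psi u v * u' a)"
proof -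
  have "tens w u a = (\<lambda>b. u a * w b + w a * adj u b)" "quad u u' a = (\<lambda>b. u a * adj u' b + u' a * adj u b)" for a
    by (simp_all add: tens_def quad_def fun_eq_iff)
  then show "mv (tens w u) v = (\<lambda>a. dot w v * u a + psi u v * w a)"
    "mv (quad u u') v = (\<lambda>a. psi u' v * u a + psi u v * u' a)"
    unfolding mv_dot [abs_def] by (simp_all only: dot_linear mult.commute)
qed

lemma sum_dual: "(\<Sum>b\<in>{m..<N}. f (dual_index b)) = (\<Sum>b\<in>{m..<N}. f b)"
  by (rule sum.reindex_bij_witness [where i = dual_index and j = dual_index]) (auto simp: dual_index)

lemma dot_US: "u \<in> US \<Longrightarrow> dot u v = (\<Sum>b\<in>{m..<N}. u b * v b)"
  unfolding dot_def by (rule sum.mono_neutral_right) (auto simp: US_def not_le)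

lemma psi_eq: "psi u v = (\<Sum>b\<in>{m..<N}. gs b * (u (dual_index b) * v b))"
  unfolding dot_US [OF adj_US] by (rule sum.cong) (auto simp: adj_def)

text \<open>Reindexing by \<open>dual_index\<close> reverses the sign \<open>gs\<close>; the skew
  symmetry of the form comes from here.\<close>

lemma psi_flip: "psi u v = - (\<Sum>b\<in>{m..<N}. gs b * (u b * v (dual_index b)))"
proof -
  have "psi u v = (\<Sum>b\<in>{m..<N}. gs (dual_index b) * (u (dual_index (dual_index b)) * v (dual_index b)))"
    unfolding psi_eq by (rule sum_dual [of "\<lambda>b. gs b * (u (dual_index b) * v b)", symmetric])
  also have "\<dots> = (\<Sum>b\<in>{m..<N}. - (gs b * (u b * v (dual_index b))))"
    by (rule sum.cong) (auto simp: dual_index gs)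
  finally show ?thesis by (simp add: sum_negf)
qed

definition unit :: "nat \<Rightarrow> nat \<Rightarrow> complex" where
  "unit a b = (if b = a then 1 else 0)"

lemma dot_unit: "a < N \<Longrightarrow> dot x (unit a) = x a"
proof -
  assume a: "a < N"
  have "dot x (unit a) = (\<Sum>b<N. if b = a then x a else 0)" unfolding dot_def unit_def by (intro sum.cong) auto
  then show ?thesis using a by simp
qed

lemma unit_in: "a < m \<Longrightarrow> unit a \<in> WS" "m \<le> a \<Longrightarrow> a < N \<Longrightarrow> unit a \<in> US"
  by (auto simp: unit_def WS_def US_def)

lemma psi_nondeg: "u \<in> US \<Longrightarrow> (\<And>v. v \<in> US \<Longrightarrow> psi u v = 0) \<Longrightarrow> u = 0"
proof
  fix i assume u: "u \<in> US" "\<And>v. v \<in> US \<Longrightarrow> psi u v = 0"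
  show "u i = 0 i"
  proof (cases "m \<le> i \<and> i < N")
    case True
    then have j: "m \<le> dual_index i" "dual_index i < N" "dual_index (dual_index i) = i" using dual_index by auto
    then have "gs (dual_index i) * u i = 0"
      using u(2) [OF unit_in(2) [OF j(1,2)]] dot_unit [OF j(2), of "adj u"] by (simp add: adj_def)
    then show ?thesis by (simp add: gs_def split: if_splits)
  qed (use US_0 u in simp)
qed

lemma tens_odd:
  assumes "w \<in> WS" "u \<in> US" shows "tens w u \<in> part (osp m n) True"
proof (rule oddI)
  have w: "w i \<noteq> 0 \<Longrightarrow> i < m" and u: "u i \<noteq> 0 \<Longrightarrow> m \<le> i \<and> i < N" "adj u i \<noteq> 0 \<Longrightarrow> m \<le> i \<and> i < N" for i
    using assms adj_US [of u] by (auto simp: WS_def US_def)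
  show "i < N \<and> j < N \<and> (m \<le> i) \<noteq> (m \<le> j)" if "tens w u i j \<noteq> 0" for i j
  proof -
    have "u i \<noteq> 0 \<and> w j \<noteq> 0 \<or> w i \<noteq> 0 \<and> adj u j \<noteq> 0" using that by (auto simp: tens_def)
    then show ?thesis using w [of i] w [of j] u(1) [of i] u(2) [of j] by auto
  qed
  show "tens w u i j = gs j * tens w u (dual_index j) i" if "i < m" "m \<le> j" "j < N" for i j
    using that assms dual_index(3) [of j] by (simp add: tens_def adj_def WS_0 US_0)
qed

text \<open>Column \<open>i\<close> of the lower left block is the \<open>U\<close>-factor belonging
  to the \<open>i\<close>-th basis vector of \<open>W\<close>, and the other block follows from
  it.\<close>

lemma odd_expand:
  assumes X: "X \<in> part (osp m n) True"
  shows "X = (\<Sum>i<m. tens (unit i) (\<lambda>k. if m \<le> k then X k i else 0))"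
proof (intro ext)
  fix a b
  have eq: "(\<Sum>i<m. tens (unit i) (\<lambda>k. if m \<le> k then X k i else 0)) a b =
      (\<Sum>i<m. (if m \<le> a then X a i else 0) * unit i b) + (\<Sum>i<m. unit i a * adj (\<lambda>k. if m \<le> k then X k i else 0) b)"
    by (simp add: sum_fun_apply tens_def sum.distrib)
  have s1: "(\<Sum>i<m. (if m \<le> a then X a i else 0) * unit i b) = (\<Sum>i<m. if i = b then (if m \<le> a then X a b else 0) else 0)"
    by (intro sum.cong) (auto simp: unit_def)
  have s2: "(\<Sum>i<m. unit i a * adj (\<lambda>k. if m \<le> k then X k i else 0) b) =
      (\<Sum>i<m. if i = a then adj (\<lambda>k. if m \<le> k then X k a else 0) b else 0)"
    by (intro sum.cong) (auto simp: unit_def)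
  show "X a b = (\<Sum>i<m. tens (unit i) (\<lambda>k. if m \<le> k then X k i else 0)) a b"
  proof -
    have 0: "X a b = 0" if "\<not> (a < N \<and> b < N \<and> (m \<le> a) \<noteq> (m \<le> b))" using oddD(1) [OF X, of a b] that by blast
    consider "m \<le> a" "b < m" | "a < m" "m \<le> b" "b < N" | "(m \<le> a) = (m \<le> b)" | "a < m" "N \<le> b" by linarith
    then show ?thesis
    proof cases
      case 2
      then have "adj (\<lambda>k. if m \<le> k then X k a else 0) b = X a b"
        using oddD(2) [OF X 2] dual_index(3) [OF 2(2,3)] by (simp add: adj_def)
      then show ?thesis unfolding eq s1 s2 using 2 by simp
    next
      case 3
      then show ?thesis unfolding eq s1 s2 using 0 by (auto simp: adj_def)
    next
      case 4
      then show ?thesis unfolding eq s1 s2 using 0 by (simp add: adj_def)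
    qed (unfold eq s1 s2, simp)
  qed
qed

lemma even_gl: "X \<in> part (osp m n) False \<Longrightarrow> X \<in> part (gl m (2 * n)) False"
  by (simp add: part_osp)

lemma odd_gl: "X \<in> part (osp m n) True \<Longrightarrow> X \<in> part (gl m (2 * n)) True"
  by (simp add: part_osp)

lemma brk_even: "X \<in> part (osp m n) False \<Longrightarrow>
    brk (osp m n) X Y = (\<lambda>i j. dot (X i) (\<lambda>k. Y k j) - dot (Y i) (\<lambda>k. X k j))"
  unfolding osp_simps by (simp only: gl_brk_even [OF even_gl] dot_def)

lemma dot_tens: "dot (tens w u i) v = u i * dot w v + w i * psi u v"
  using fun_cong [OF mv_rank_two(1), of w u v i] by (simp add: mv_dot mult.commute)

lemma tens_column: "(\<lambda>k. tens w u k j) = (\<lambda>k. u k * w j + w k * adj u j)"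
  by (simp add: tens_def)

text \<open>A product of two such matrices has four terms. Those that pair \<open>W\<close> with
  \<open>U\<close> vanish, and the others assemble to the components in so(m) and sp(2n).\<close>

lemma brk_tens:
  assumes "w \<in> WS" "w' \<in> WS" "u \<in> US" "u' \<in> US" and skew: "psi u' u = - psi u u'"
  shows "brk (osp m n) (tens w u) (tens w' u') =
    sscale (osp m n) (psi u u') (wedge w w') + sscale (osp m n) (dot w w') (quad u u')"
proof -
  have "brk (osp m n) (tens w u) (tens w' u') i j = dot (tens w u i) (\<lambda>k. tens w' u' k j) + dot (tens w' u' i) (\<lambda>k. tens w u k j)" for i j
    unfolding osp_simps using assms by (simp only: gl_brk_odd [OF odd_gl odd_gl] tens_odd dot_def)
  then show ?thesis
    using assms adj_US unfolding tens_column dot_tens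
    by (intro ext) (simp add: osp_simps dot_linear dot_WS_US wedge_def quad_def dot_comm [of w' w] algebra_simps)
qed

definition SO :: "(nat \<Rightarrow> nat \<Rightarrow> complex) set" where
  "SO = {X \<in> part (osp m n) False. \<forall>i j. X i j \<noteq> 0 \<longrightarrow> i < m \<and> j < m}"
definition SP :: "(nat \<Rightarrow> nat \<Rightarrow> complex) set" where
  "SP = {X \<in> part (osp m n) False. \<forall>i j. X i j \<noteq> 0 \<longrightarrow> m \<le> i \<and> m \<le> j}"

lemma SO_0: "s \<in> SO \<Longrightarrow> \<not> (i < m \<and> j < m) \<Longrightarrow> s i j = 0"
  unfolding SO_def by blast

lemma SP_0: "s \<in> SP \<Longrightarrow> \<not> (m \<le> i \<and> i < N \<and> m \<le> j \<and> j < N) \<Longrightarrow> s i j = 0"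
  using evenD(1) [of s i j] unfolding SP_def by blast

lemma SO_skew: "s \<in> SO \<Longrightarrow> s j i = - s i j"
  using evenD(2) [of s i j] SO_0 [of s i j] SO_0 [of s j i] by (cases "i < m \<and> j < m") (auto simp: SO_def)

end

context osp_lie
begin

lemma SO_brk:
  assumes s: "s \<in> SO" and wu: "w \<in> WS" "u \<in> US"
  shows "brk (osp m n) s (tens w u) = tens (mv s w) u"
proof (intro ext)
  fix i j
  have row: "s i \<in> WS" for i using s by (auto simp: SO_def WS_def)
  have col: "(\<lambda>k. s k j) \<in> WS" using s by (auto simp: SO_def WS_def)
  have "s k j = - 1 * s j k" for k using SO_skew [OF s, of k j] by simp
  then have "(\<lambda>k. s k j) = (\<lambda>k. - 1 * s j k)" by blast
  then have "dot w (\<lambda>k. s k j) = - dot (s j) w" using dot_linear(4) [of w "- 1" "s j"] dot_comm [of w "s j"] by simp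
  then show "brk (osp m n) s (tens w u) i j = tens (mv s w) u i j"
    using s wu row col adj_US unfolding SO_def
    by (simp add: brk_even tens_column dot_tens dot_linear dot_WS_US mv_dot) (simp add: tens_def mv_dot mult.commute)
qed

text \<open>For an element of sp(2n) the composite with the Gram matrix is symmetric, which moves
  \<open>q\<close> across the form with a sign.\<close>

lemma SP_adj:
  assumes q: "q \<in> SP" and u: "u \<in> US" shows "adj (mv q u) b = - psi u (\<lambda>k. q k b)"
proof (cases "m \<le> b \<and> b < N")
  case True
  have qe: "q \<in> part (osp m n) False" using q by (simp add: SP_def)
  have "adj (mv q u) b = gs b * dot u (q (dual_index b))"
    using True by (simp add: adj_def mv_dot dot_comm)
  also have "\<dots> = (\<Sum>k\<in>{m..<N}. gs b * (u k * q (dual_index b) k))"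
    unfolding dot_US [OF u] by (rule sum_distrib_left)
  also have "\<dots> = (\<Sum>k\<in>{m..<N}. gs k * (u k * q (dual_index k) b))"
  proof (rule sum.cong [OF refl])
    fix k assume "k \<in> {m..<N}"
    then have "gs b * q (dual_index b) k = gs k * q (dual_index k) b" using evenD(3) [OF qe, of b k] True by auto
    then have "u k * (gs b * q (dual_index b) k) = u k * (gs k * q (dual_index k) b)" by (simp only:)
    then show "gs b * (u k * q (dual_index b) k) = gs k * (u k * q (dual_index k) b)" by (simp only: mult.left_commute)
  qed
  finally show ?thesis using psi_flip [of u "\<lambda>k. q k b"] by simp
next
  case False
  then have "(\<lambda>k. q k b) = (\<lambda>k. 0 * q k b)" using q evenD(1) [of q _ b] by (auto simp: SP_def fun_eq_iff)
  then have "psi u (\<lambda>k. q k b) = 0" using dot_linear(4) [of "adj u" 0 "\<lambda>k. q k b"] by simp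
  then show ?thesis using False by (auto simp: adj_def)
qed

lemma SP_rows: "q \<in> SP \<Longrightarrow> q i \<in> US" "q \<in> SP \<Longrightarrow> (\<lambda>k. q k j) \<in> US"
  using evenD(1) [of q] by (auto simp: SP_def US_def)

lemma SP_brk:
  assumes q: "q \<in> SP" and wu: "w \<in> WS" "u \<in> US"
  shows "brk (osp m n) q (tens w u) = tens w (mv q u)"
proof (intro ext)
  fix i j
  show "brk (osp m n) q (tens w u) i j = tens w (mv q u) i j"
    using q wu SP_rows [OF q] adj_US unfolding SP_def
    by (simp add: brk_even tens_column dot_tens dot_linear dot_WS_US) (simp add: tens_def mv_dot SP_adj [OF q wu(2)] mult.commute)
qed

lemma SP_psi:
  assumes q: "q \<in> SP" and u: "u \<in> US" shows "psi (mv q u) v = - psi u (mv q v)"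
proof -
  have "psi (mv q u) v = (\<Sum>b<N. - (\<Sum>k<N. adj u k * q k b * v b))"
    unfolding dot_def [of "adj (mv q u)"] SP_adj [OF q u] by (simp add: dot_def sum_distrib_right)
  also have "\<dots> = - (\<Sum>k<N. \<Sum>b<N. adj u k * q k b * v b)"
    unfolding sum_negf by (subst sum.swap) simp
  also have "\<dots> = - psi u (mv q v)"
    by (simp add: dot_def mv_def sum_distrib_left mult.assoc)
  finally show ?thesis .
qed

lemma even_split:
  assumes z: "z \<in> part (osp m n) False"
  shows "(\<lambda>i j. if i < m \<and> j < m then z i j else 0) \<in> SO" "(\<lambda>i j. if m \<le> i \<and> m \<le> j then z i j else 0) \<in> SP"
    "z = (\<lambda>i j. if i < m \<and> j < m then z i j else 0) + (\<lambda>i j. if m \<le> i \<and> m \<le> j then z i j else 0)"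
proof -
  have "(\<lambda>i j. if i < m \<and> j < m then z i j else 0) \<in> part (osp m n) False"
  proof (rule evenI)
    show "i < N \<and> j < N \<and> (m \<le> i) = (m \<le> j)" if "(if i < m \<and> j < m then z i j else 0) \<noteq> 0" for i j
      using that by (auto split: if_splits)
    show "(if j < m \<and> i < m then z j i else 0) = - (if i < m \<and> j < m then z i j else 0)" if "i < m" "j < m" for i j
      using evenD(2) [OF z that] that by simp
  qed simp
  then show "(\<lambda>i j. if i < m \<and> j < m then z i j else 0) \<in> SO" by (auto simp: SO_def)
  have "(\<lambda>i j. if m \<le> i \<and> m \<le> j then z i j else 0) \<in> part (osp m n) False"
  proof (rule evenI)
    show "i < N \<and> j < N \<and> (m \<le> i) = (m \<le> j)" if "(if m \<le> i \<and> m \<le> j then z i j else 0) \<noteq> 0" for i j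
      using that evenD(1) [OF z, of i j] by (auto split: if_splits)
    show "gs i * (if m \<le> dual_index i \<and> m \<le> j then z (dual_index i) j else 0) =
        gs j * (if m \<le> dual_index j \<and> m \<le> i then z (dual_index j) i else 0)" if "m \<le> i" "i < N" "m \<le> j" "j < N" for i j
      using evenD(3) [OF z that] dual_index(3) [OF that(1,2)] dual_index(3) [OF that(3,4)] that by simp
  qed simp
  then show "(\<lambda>i j. if m \<le> i \<and> m \<le> j then z i j else 0) \<in> SP" by (auto simp: SP_def)
  show "z = (\<lambda>i j. if i < m \<and> j < m then z i j else 0) + (\<lambda>i j. if m \<le> i \<and> m \<le> j then z i j else 0)"
  proof (intro ext)
    fix i j
    show "z i j = ((\<lambda>i j. if i < m \<and> j < m then z i j else 0) + (\<lambda>i j. if m \<le> i \<and> m \<le> j then z i j else 0)) i j"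
    proof (cases "(m \<le> i) = (m \<le> j)")
      case True
      then show ?thesis by (cases "m \<le> i") auto
    next
      case False
      then have "z i j = 0" using evenD(1) [OF z, of i j] by blast
      then show ?thesis by simp
    qed
  qed
qed

lemma wedge_SO: "w \<in> WS \<Longrightarrow> w' \<in> WS \<Longrightarrow> wedge w w' \<in> SO"
proof -
  assume w: "w \<in> WS" "w' \<in> WS"
  have s: "i < m \<and> j < m" if "wedge w w' i j \<noteq> 0" for i j
  proof (rule ccontr)
    assume "\<not> (i < m \<and> j < m)"
    then have "w i = 0 \<and> w' i = 0 \<or> w j = 0 \<and> w' j = 0"
      using WS_0 [OF w(1)] WS_0 [OF w(2)] by (metis not_less)
    then have "wedge w w' i j = 0" by (auto simp: wedge_def)
    then show False using that by simp
  qed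
  then have "wedge w w' \<in> part (osp m n) False"
  proof (intro evenI)
    show "i < N \<and> j < N \<and> (m \<le> i) = (m \<le> j)" if "wedge w w' i j \<noteq> 0" for i j using s [OF that] by simp
    show "gs i * wedge w w' (dual_index i) j = gs j * wedge w w' (dual_index j) i" if "m \<le> i" "i < N" "m \<le> j" "j < N" for i j
    proof -
      have "wedge w w' (dual_index i) j = 0" "wedge w w' (dual_index j) i = 0"
        using s [of "dual_index i" j] s [of "dual_index j" i] that(1,3) by (meson not_le)+
      then show ?thesis by simp
    qed
  qed (simp add: wedge_def)
  then show ?thesis using s by (simp add: SO_def)
qed

lemma quad_SP: "u \<in> US \<Longrightarrow> u' \<in> US \<Longrightarrow> quad u u' \<in> SP"
proof -
  assume u: "u \<in> US" "u' \<in> US"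
  have s: "m \<le> i \<and> i < N \<and> m \<le> j \<and> j < N" if "quad u u' i j \<noteq> 0" for i j
  proof (rule ccontr)
    assume "\<not> ?thesis"
    then have "quad u u' i j = 0" using US_0 [OF u(1), of i] US_0 [OF u(2), of i] US_0 [OF adj_US, of j] by (auto simp: quad_def)
    then show False using that by simp
  qed
  have "quad u u' \<in> part (osp m n) False"
  proof (rule evenI)
    show "i < N \<and> j < N \<and> (m \<le> i) = (m \<le> j)" if "quad u u' i j \<noteq> 0" for i j using s [OF that] by simp
    show "quad u u' j i = - quad u u' i j" if "i < m" "j < m" for i j
    proof -
      have "quad u u' i j = 0" "quad u u' j i = 0" using s [of i j] s [of j i] that by (meson not_le)+
      then show ?thesis by simp
    qed
    show "gs i * quad u u' (dual_index i) j = gs j * quad u u' (dual_index j) i" if "m \<le> i" "i < N" "m \<le> j" "j < N" for i j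
      using that by (simp add: quad_def adj_def algebra_simps)
  qed
  then show ?thesis using s by (auto simp: SP_def)
qed

lemma osp_span: "space_of (osp m n) \<subseteq> span {unit_matrix a b | a b. a < N \<and> b < N}"
proof
  fix X assume X: "X \<in> space_of (osp m n)"
  have 0: "X i j = 0" if "\<not> (i < N \<and> j < N)" for i j
  proof -
    obtain a b where ab: "a \<in> part (osp m n) False" "b \<in> part (osp m n) True" "X = a + b" using X by (rule space_cases)
    have "a i j = 0" "b i j = 0" using evenD(1) [OF ab(1), of i j] oddD(1) [OF ab(2), of i j] that by blast+
    then show ?thesis using ab(3) by simp
  qed
  have "X = (\<Sum>a<N. \<Sum>b<N. sscale (osp m n) (X a b) (unit_matrix a b))"
  proof (intro ext)
    fix i j
    have "(\<Sum>a<N. \<Sum>b<N. sscale (osp m n) (X a b) (unit_matrix a b)) i j = (\<Sum>a<N. \<Sum>b<N. X a b * unit_matrix a b i j)"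
      by (simp add: sum_fun_apply osp_simps)
    also have "\<dots> = (\<Sum>a<N. \<Sum>b<N. if b = j then (if a = i then X i j else 0) else 0)"
      by (intro sum.cong) (auto simp: unit_matrix_def)
    also have "\<dots> = X i j" using 0 [of i j] by (cases "j < N") auto
    finally show "X i j = (\<Sum>a<N. \<Sum>b<N. sscale (osp m n) (X a b) (unit_matrix a b)) i j" by simp
  qed
  also have "\<dots> \<in> span {unit_matrix a b | a b. a < N \<and> b < N}"
    by (intro span_sum span_scale span_base) auto
  finally show "X \<in> span {unit_matrix a b | a b. a < N \<and> b < N}" .
qed


lemma mv_zero: "(\<And>b. X a b = 0 \<or> v b = 0) \<Longrightarrow> mv X v a = 0"
  unfolding mv_def by (intro sum.neutral) (metis mult_eq_0_iff)

lemma mv_in: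
  "X \<in> part (osp m n) True \<Longrightarrow> w \<in> WS \<Longrightarrow> mv X w \<in> US" "X \<in> part (osp m n) True \<Longrightarrow> u \<in> US \<Longrightarrow> mv X u \<in> WS"
  "X \<in> SO \<Longrightarrow> mv X v \<in> WS" "X \<in> SP \<Longrightarrow> mv X v \<in> US"
proof -
  show "mv X w \<in> US" if X: "X \<in> part (osp m n) True" and w: "w \<in> WS"
  proof -
    have "mv X w a = 0" if "\<not> (m \<le> a \<and> a < N)" for a
    proof (rule mv_zero)
      show "X a b = 0 \<or> w b = 0" for b using oddD(1) [OF X, of a b] WS_0 [OF w, of b] that by fastforce
    qed
    then show ?thesis unfolding US_def by blast
  qed
  show "mv X u \<in> WS" if X: "X \<in> part (osp m n) True" and u: "u \<in> US"
  proof -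
    have "mv X u a = 0" if "\<not> a < m" for a
    proof (rule mv_zero)
      show "X a b = 0 \<or> u b = 0" for b using oddD(1) [OF X, of a b] US_0 [OF u, of b] that by fastforce
    qed
    then show ?thesis unfolding WS_def by blast
  qed
  show "mv X v \<in> WS" if "X \<in> SO"
  proof -
    have "mv X v a = 0" if "\<not> a < m" for a using SO_0 [OF \<open>X \<in> SO\<close>] that by (intro mv_zero) blast
    then show ?thesis unfolding WS_def by blast
  qed
  show "mv X v \<in> US" if "X \<in> SP"
  proof -
    have "mv X v a = 0" if "\<not> (m \<le> a \<and> a < N)" for a using SP_0 [OF \<open>X \<in> SP\<close>] that by (intro mv_zero) blast
    then show ?thesis unfolding US_def by blast
  qed
qed

lemma mv_linear: "mv (X + Y) v = mv X v + mv Y v" "mv (\<lambda>i j. c * X i j) v = (\<lambda>a. c * mv X v a)"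
  "mv X (v + v') = mv X v + mv X v'" "mv X (\<lambda>i. c * v i) = (\<lambda>a. c * mv X v a)"
  by (auto simp: mv_def fun_eq_iff sum.distrib sum_distrib_left algebra_simps)

lemma mv_unit: "b < N \<Longrightarrow> mv X (unit b) a = X a b"
  by (simp add: mv_dot dot_unit)

lemma psi_skew: "psi u v = - psi v u"
  unfolding psi_flip [of u v] psi_eq [of v u] by (simp only: mult.commute)

lemma subspace_SO: "subspace SO" and subspace_SP: "subspace SP"
proof -
  note P = part_subspace [of False]
  show "subspace SO"
    unfolding subspace_def
  proof (intro conjI ballI allI)
    show "0 \<in> SO" using subspace_0 [OF P] by (simp add: SO_def)
    show "x + y \<in> SO" if xy: "x \<in> SO" "y \<in> SO" for x y
    proof -
      have "x + y \<in> part (osp m n) False" using subspace_add [OF P] xy by (simp add: SO_def)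
      moreover have "(x + y) i j = 0" if "\<not> (i < m \<and> j < m)" for i j using SO_0 [OF xy(1) that] SO_0 [OF xy(2) that] by simp
      ultimately show ?thesis unfolding SO_def by blast
    qed
    show "sscale (osp m n) c x \<in> SO" if x: "x \<in> SO" for c x
    proof -
      have "sscale (osp m n) c x \<in> part (osp m n) False" using subspace_scale [OF P] x by (simp add: SO_def)
      moreover have "sscale (osp m n) c x i j = 0" if "\<not> (i < m \<and> j < m)" for i j using SO_0 [OF x that] by (simp add: osp_simps)
      ultimately show ?thesis unfolding SO_def by blast
    qed
  qed
  show "subspace SP"
    unfolding subspace_def
  proof (intro conjI ballI allI)
    show "0 \<in> SP" using subspace_0 [OF P] by (simp add: SP_def)
    show "x + y \<in> SP" if xy: "x \<in> SP" "y \<in> SP" for x y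
    proof -
      have "x + y \<in> part (osp m n) False" using subspace_add [OF P] xy by (simp add: SP_def)
      moreover have "(x + y) i j = 0" if "\<not> (m \<le> i \<and> m \<le> j)" for i j using SP_0 [OF xy(1), of i j] SP_0 [OF xy(2), of i j] that by auto
      ultimately show ?thesis unfolding SP_def by blast
    qed
    show "sscale (osp m n) c x \<in> SP" if x: "x \<in> SP" for c x
    proof -
      have "sscale (osp m n) c x \<in> part (osp m n) False" using subspace_scale [OF P] x by (simp add: SP_def)
      moreover have "sscale (osp m n) c x i j = 0" if "\<not> (m \<le> i \<and> m \<le> j)" for i j using SP_0 [OF x, of i j] that by (auto simp: osp_simps)
      ultimately show ?thesis unfolding SP_def by blast
    qed
  qed
qed

lemma dot_zero_if: "(\<And>k. x k = 0 \<or> y k = 0) \<Longrightarrow> dot x y = 0"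
  unfolding dot_def by (intro sum.neutral) (metis mult_eq_0_iff)

lemma SO_SP_brk: "s \<in> SO \<Longrightarrow> q \<in> SP \<Longrightarrow> brk (osp m n) s q = 0" "s \<in> SO \<Longrightarrow> s' \<in> SO \<Longrightarrow> brk (osp m n) s s' \<in> SO"
  "q \<in> SP \<Longrightarrow> q' \<in> SP \<Longrightarrow> brk (osp m n) q q' \<in> SP"
proof -
  show "brk (osp m n) s q = 0" if sq: "s \<in> SO" "q \<in> SP"
  proof (intro ext)
    fix i j
    have "dot (s i) (\<lambda>k. q k j) = 0" "dot (q i) (\<lambda>k. s k j) = 0"
      using SO_0 [OF sq(1)] SP_0 [OF sq(2)] by (intro dot_zero_if; meson not_le)+
    then show "brk (osp m n) s q i j = 0 i j" using sq by (simp add: brk_even SO_def)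
  qed
  show "brk (osp m n) s s' \<in> SO" if ss: "s \<in> SO" "s' \<in> SO"
  proof -
    have p: "s \<in> part (osp m n) False" "s' \<in> part (osp m n) False" using ss by (simp_all add: SO_def)
    have "brk (osp m n) s s' i j = 0" if "\<not> (i < m \<and> j < m)" for i j
    proof -
      have "dot (s i) (\<lambda>k. s' k j) = 0" "dot (s' i) (\<lambda>k. s k j) = 0"
        using SO_0 [OF ss(1)] SO_0 [OF ss(2)] that by (intro dot_zero_if; meson)+
      then show ?thesis using p by (simp add: brk_even)
    qed
    moreover have "brk (osp m n) s s' \<in> part (osp m n) False" using br_part [OF p] by simp
    ultimately show ?thesis unfolding SO_def by blast
  qed
  show "brk (osp m n) q q' \<in> SP" if qq: "q \<in> SP" "q' \<in> SP"
  proof -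
    have p: "q \<in> part (osp m n) False" "q' \<in> part (osp m n) False" using qq by (simp_all add: SP_def)
    have "brk (osp m n) q q' i j = 0" if "\<not> (m \<le> i \<and> m \<le> j)" for i j
    proof -
      have "dot (q i) (\<lambda>k. q' k j) = 0" "dot (q' i) (\<lambda>k. q k j) = 0"
        using SP_0 [OF qq(1)] SP_0 [OF qq(2)] that by (intro dot_zero_if; meson)+
      then show ?thesis using p by (simp add: brk_even)
    qed
    moreover have "brk (osp m n) q q' \<in> part (osp m n) False" using br_part [OF p] by simp
    ultimately show ?thesis unfolding SP_def by blast
  qed
qed

lemma wedge_parallel:
  assumes w: "w \<noteq> 0" and p: "wedge w w' = 0"
  shows "\<exists>c. w' = (\<lambda>i. c * w i)"
proof -
  obtain i where i: "w i \<noteq> 0" using w by (auto simp: fun_eq_iff)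
  have "w' j = w' i / w i * w j" for j
  proof -
    have "wedge w w' i j = 0" using p by simp
    then show ?thesis using i by (simp add: wedge_def field_simps)
  qed
  then have "w' = (\<lambda>j. w' i / w i * w j)" by blast
  then show ?thesis by blast
qed

text \<open>\<open>W\<close> is the orthogonal space of dimension \<open>m\<close>, \<open>U\<close>
  the symplectic space of dimension \<open>2n\<close>, and the pairing is the wedge product. Odd
  matrices exchange the two spaces and even ones preserve them, so both contractions and both
  actions are given by the matrix-vector product \<open>mv\<close>.\<close>

theorem admissible_osp: "admissible (osp m n)"
proof -
  interpret W: complex_vs "\<lambda>c (f :: nat \<Rightarrow> complex) i. c * f i"
    unfolding complex_vs_def by (rule vector_space_seq)
  interpret tensor_superalg "osp m n" "\<lambda>c f i. c * f i" "\<lambda>c f i. c * f i" WS US SO SP tens mv mv mv mv quad wedge dot "\<lambda>u v. psi u v"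
  proof
    show "\<exists>X. finite X \<and> space_of (osp m n) \<subseteq> span X"
    proof (intro exI conjI)
      have "{unit_matrix a b | a b. a < N \<and> b < N} = (\<lambda>(a, b). unit_matrix a b) ` ({..<N} \<times> {..<N})" by auto
      then show "finite {unit_matrix a b | a b. a < N \<and> b < N}" by simp
    qed (rule osp_span)
    show "W.subspace WS" "W.subspace US"
      unfolding W.subspace_def by (auto simp: WS_def US_def) (metis add_0)+
    show "part (osp m n) True \<noteq> {0}" by (rule odd_nontrivial)
    show "tens w u \<in> part (osp m n) True" if "w \<in> WS" "u \<in> US" for w u by (rule tens_odd [OF that])
    show "part (osp m n) True \<subseteq> span {tens w u | w u. w \<in> WS \<and> u \<in> US}"
    proof
      fix X assume X: "X \<in> part (osp m n) True"
      have "(\<lambda>k. if m \<le> k then X k i else 0) \<in> US" for i using oddD(1) [OF X] by (auto simp: US_def)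
      then have "(\<Sum>i<m. tens (unit i) (\<lambda>k. if m \<le> k then X k i else 0)) \<in> span {tens w u | w u. w \<in> WS \<and> u \<in> US}"
        using unit_in(1) by (intro span_sum span_base) blast
      then show "X \<in> span {tens w u | w u. w \<in> WS \<and> u \<in> US}" using odd_expand [OF X] by simp
    qed
    show "mv X w \<in> US" if "X \<in> part (osp m n) True" "w \<in> WS" for X w by (rule mv_in(1) [OF that])
    show "mv (X + Y) w = mv X w + mv Y w" for X Y w by (rule mv_linear)
    show "mv (sscale (osp m n) c X) w = (\<lambda>i. c * mv X w i)" for c X w unfolding osp_simps by (rule mv_linear)
    show "mv (tens w u) w' = (\<lambda>i. dot w w' * u i)" if "w' \<in> WS" for w u w'
      using that adj_US dot_WS_US(2) by (simp add: mv_rank_two)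
    show "X = 0" if X: "X \<in> part (osp m n) True" and 0: "\<And>w. w \<in> WS \<Longrightarrow> mv X w = 0" for X
    proof (intro ext)
      fix a b
      have z: "X a b = 0" if "b < m" for a b
        using 0 [OF unit_in(1) [OF that]] mv_unit [of b X a] that by simp
      show "X a b = 0 a b"
      proof (rule ccontr)
        assume "X a b \<noteq> 0 a b"
        then have "X a b \<noteq> 0" by simp
        then have ab: "a < m" "m \<le> b" "b < N" using oddD(1) [OF X, of a b] z [of b a] by (auto simp: not_le)
        then show False using oddD(2) [OF X ab] z [of a "dual_index b"] \<open>X a b \<noteq> 0\<close> by simp
      qed
    qed
    show "mv X u \<in> WS" if "X \<in> part (osp m n) True" "u \<in> US" for X u by (rule mv_in(2) [OF that])
    show "mv (tens w u) u' = (\<lambda>i. psi u u' * w i)" if "w \<in> WS" "u' \<in> US" for w u u'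
      using that dot_WS_US(1) by (simp add: mv_rank_two)
    show "dot (w + w') w'' = dot w w'' + dot w' w''" for w w' w'' unfolding plus_fun_def by (rule dot_linear)
    show "dot (\<lambda>i. c * w i) w' = c * dot w w'" for c w w' by (rule dot_linear)
    show "dot w w' = dot w' w" for w w' by (rule dot_comm)
    show "w = 0" if w: "w \<in> WS" and 0: "\<And>w'. w' \<in> WS \<Longrightarrow> dot w w' = 0" for w
    proof
      fix i show "w i = 0 i"
        using 0 [OF unit_in(1), of i] dot_unit [of i w] WS_0 [OF w, of i] by (cases "i < m") auto
    qed
    show "psi (u + u') u'' = psi u u'' + psi u' u''" for u u' u'' unfolding plus_fun_def adj_linear by (rule dot_linear)
    show "psi (\<lambda>i. c * u i) u' = c * psi u u'" for c u u' unfolding adj_linear by (rule dot_linear)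
    show "psi u u' = - psi u' u" for u u' by (rule psi_skew)
    show "u = 0" if "u \<in> US" "\<And>u'. u' \<in> US \<Longrightarrow> psi u u' = 0" for u by (rule psi_nondeg [OF that])
    show "SO \<subseteq> part (osp m n) False" "SP \<subseteq> part (osp m n) False" by (auto simp: SO_def SP_def)
    show "subspace SO" "subspace SP" by (rule subspace_SO subspace_SP)+
    show "SO \<inter> SP = {0}"
    proof -
      have "x = 0" if "x \<in> SO" "x \<in> SP" for x
        using SO_0 [OF that(1)] SP_0 [OF that(2)] by (intro ext) (metis not_le zero_fun_apply)
      then show ?thesis using subspace_0 [OF subspace_SO] subspace_0 [OF subspace_SP] by blast
    qed
    show "\<exists>s\<in>SO. \<exists>q\<in>SP. z = s + q" if "z \<in> part (osp m n) False" for z using even_split [OF that] by blast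
    show "brk (osp m n) s q = 0" if "s \<in> SO" "q \<in> SP" for s q by (rule SO_SP_brk(1) [OF that])
    show "brk (osp m n) s q \<in> SO" if "s \<in> SO" "q \<in> SO" for s q by (rule SO_SP_brk(2) [OF that])
    show "brk (osp m n) s q \<in> SP" if "s \<in> SP" "q \<in> SP" for s q by (rule SO_SP_brk(3) [OF that])
    show "mv s w \<in> WS" if "s \<in> SO" for s w by (rule mv_in(3) [OF that])
    show "brk (osp m n) s (tens w u) = tens (mv s w) u" if "s \<in> SO" "w \<in> WS" "u \<in> US" for s w u by (rule SO_brk [OF that])
    show "s = 0" if s: "s \<in> SO" and 0: "\<And>w. w \<in> WS \<Longrightarrow> mv s w = 0" for s
    proof (intro ext)
      fix a b show "s a b = 0 a b"
        using 0 [OF unit_in(1), of b] mv_unit [of b s a] SO_0 [OF s, of a b] by (cases "b < m") auto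
    qed
    show "mv q u \<in> US" if "q \<in> SP" for q u by (rule mv_in(4) [OF that])
    show "mv q (u + u') = mv q u + mv q u'" for q u u' by (rule mv_linear)
    show "mv q (\<lambda>i. c * u i) = (\<lambda>i. c * mv q u i)" for q u c by (rule mv_linear)
    show "brk (osp m n) q (tens w u) = tens w (mv q u)" if "q \<in> SP" "w \<in> WS" "u \<in> US" for q w u by (rule SP_brk [OF that])
    show "q = 0" if q: "q \<in> SP" and 0: "\<And>u. u \<in> US \<Longrightarrow> mv q u = 0" for q
    proof (intro ext)
      fix a b show "q a b = 0 a b"
        using 0 [OF unit_in(2), of b] mv_unit [of b q a] SP_0 [OF q, of a b] by (cases "m \<le> b \<and> b < N") auto
    qed
    show "psi (mv q u) u' = - psi u (mv q u')" if "q \<in> SP" "u \<in> US" for q u u' by (rule SP_psi [OF that])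
    show "quad u u' \<in> SP" if "u \<in> US" "u' \<in> US" for u u' by (rule quad_SP [OF that])
    show "mv (quad u u') z = (\<lambda>i. psi u' z * u i) + (\<lambda>i. psi u z * u' i)" for u u' z
      unfolding mv_rank_two plus_fun_def by (rule refl)
    show "wedge w w' \<in> SO" if "w \<in> WS" "w' \<in> WS" for w w' by (rule wedge_SO [OF that])
    show "brk (osp m n) (tens w u) (tens w' u') =
      sscale (osp m n) (psi u u') (wedge w w') + sscale (osp m n) (dot w w') (quad u u')"
      if "w \<in> WS" "w' \<in> WS" "u \<in> US" "u' \<in> US" for w w' u u' by (rule brk_tens [OF that psi_skew])
    show "\<exists>c. w' = (\<lambda>i. c * w i)" if "w \<noteq> 0" "wedge w w' = 0" for w w' by (rule wedge_parallel [OF that])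
  qed (simp_all add: mv_linear osp_simps)
  show ?thesis by (rule admissible_tensor)
qed

end

lemma vector_space_osp: "vector_space (sscale (osp m n))"
proof -
  have "sscale (osp m n) = sscale (gl m n)" by (simp add: osp_def gl_def)
  then show ?thesis using vector_space_gl by simp
qed

theorem admissible_basic_classical:
  assumes lie: "lie_superalgebra G" and bc: "basic_classical G"
    and form: "invariant_form G B" "nondegenerate_form G B" and odd: "part G True \<noteq> {0}"
  shows "admissible G"
proof -
  note iso = admissible_iso [OF _ lie _ form odd]
  have vsl: "vector_space (sscale (sl m n))" for m n unfolding sl_simps by (rule vector_space_gl)
  consider (gl) m n where "superalgebra_iso G (gl m n)" | (sl) m n where "superalgebra_iso G (sl m n)"
    | (osp) m n where "superalgebra_iso G (osp m n)"
    | (D21) \<alpha> where "\<alpha> \<noteq> 0" "\<alpha> \<noteq> - 1" "superalgebra_iso G (D21 \<alpha>)"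
    | (G3) "superalgebra_iso G G3" | (F4) "superalgebra_iso G F4"
    using bc unfolding basic_classical_def by blast
  then show ?thesis
  proof cases
    case gl
    show ?thesis by (rule iso [OF gl vector_space_gl]) (rule admissible_gl_mn)
  next
    case sl
    show ?thesis by (rule iso [OF sl vsl]) (rule admissible_sl_mn)
  next
    case osp
    show ?thesis
    proof (rule iso [OF osp vector_space_osp])
      assume "lie_superalgebra (osp m n)" "part (osp m n) True \<noteq> {0}"
      then interpret osp_lie m n by unfold_locales
      show "admissible (osp m n)" by (rule admissible_osp)
    qed
  next
    case D21
    show ?thesis by (rule iso [OF D21(3) vector_space_D21]) (rule admissible_D21 [OF D21(1,2)])
  next
    case G3
    show ?thesis by (rule iso [OF G3]) (simp_all add: G3_eq vector_space_bi admissible_G3 [unfolded G3_eq])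
  next
    case F4
    show ?thesis by (rule iso [OF F4]) (simp_all add: F4_eq vector_space_bi admissible_F4 [unfolded F4_eq])
  qed
qed

theorem proposition11:
  fixes G :: "('a::ab_group_add) superalgebra"
    and B :: "'a \<Rightarrow> 'a \<Rightarrow> complex"
    and \<hh> :: "'a set"
    and P :: "('a \<Rightarrow> complex) set"
    and l :: nat
    and L :: "(nat \<Rightarrow> 'a, 'b::ab_group_add) supermodule"
    and \<Lambda> :: "(nat \<Rightarrow> 'a) \<Rightarrow> complex"
    and v :: 'b
    and \<alpha> :: "'a \<Rightarrow> complex"
    and e f :: 'a
  assumes "lie_superalgebra G" and "basic_classical G"
    and "invariant_form G B" and "nondegenerate_form G B"
    and "l \<ge> 1"
    and "cartan_subalgebra G \<hh>" and "positive_system G \<hh> P"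
    and "category_O G \<hh> P l L" and "simple_module (current l G) L"
    and "highest_weight_vector G \<hh> P l L \<Lambda> v"
    and "simple_root P \<alpha>" and "odd_root G \<hh> \<alpha>" and "dual_form B \<hh> \<alpha> \<alpha> = 0"
    and "e \<in> root_space G \<hh> \<alpha>" and "e \<noteq> 0"
    and "f \<in> root_space G \<hh> (- \<alpha>)" and "f \<noteq> 0"
    and "brk G e f \<in> \<hh>" and "\<forall>\<nu>\<in>dual G \<hh>. \<nu> (brk G e f) = dual_form B \<hh> \<nu> \<alpha>"
  shows "(\<forall>k\<le>l. dual_form B \<hh> (weight_component l \<hh> \<Lambda> k) \<alpha> \<noteq> 0 \<and>
            (\<forall>j. k < j \<and> j \<le> l \<longrightarrow> dual_form B \<hh> (weight_component l \<hh> \<Lambda> j) \<alpha> = 0) \<longrightarrow>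
            (\<exists>\<mu>. highest_weight_vector G \<hh> (odd_reflection P \<alpha>) l L \<mu>
                    (foldr (\<lambda>i. act L (cur l f i)) [0..<Suc k] v)))
       \<and> ((\<forall>k\<le>l. dual_form B \<hh> (weight_component l \<hh> \<Lambda> k) \<alpha> = 0) \<longrightarrow>
            (\<exists>\<mu>. highest_weight_vector G \<hh> (odd_reflection P \<alpha>) l L \<mu> v))"
proof -
  \<comment> \<open>The families have purely even members, such as gl(m|0); the presence of an odd
    root excludes them.\<close>
  have O: "part G True \<noteq> {0}"
  proof
    assume 0: "part G True = {0}"
    interpret lie_superalg G by unfold_locales (rule assms(1))
    have "\<hh> \<subseteq> space_of G" using assms(6) by (simp add: cartan_subalgebra_def subspace_in_def)
    then have "0 \<in> root_space G \<hh> \<alpha>" using subspace_0 [OF root_space_subspace] by blast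
    then have "root_space G \<hh> \<alpha> \<inter> part G True = {0}" using 0 by blast
    then show False using assms(12) by (simp add: odd_root_def)
  qed
  have "admissible G" by (rule admissible_basic_classical [OF assms(1-4) O])
  then show ?thesis by (rule odd_reflection_of_admissible [OF assms(1) _ assms(3,4,6-19)])
qed

end
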